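(* Let $\mathbb{K}$ be a commutative superring and $\mathfrak{g}$ a Lie $\mathbb{K}$-superalgebra. Assume that $\frac12\in\mathbb{K}$, or that $\mathbb{K}=\mathbb{K}_0$ and $\mathfrak{g}=\mathfrak{g}_0$. Assume moreover that either $\mathbb{K}\supseteq\mathbb{Q}$, or $\mathfrak{g}$ is $N$-nilpotent for some $N\ge2$ with $\frac12,\dots,\frac1N\in\mathbb{K}$. Let $\beta=\sigma^{-1}:S(\mathfrak{g})\to U(\mathfrak{g})$ be the symmetrization map and let $a\in\mathfrak{g}$. Then (i) $\beta^{-1}\circ\mathrm{ad}\,j(a)\circ\beta=\Phi_0^a$; (ii) $\beta^{-1}\circ j(a)^L\circ\beta=\Phi_1^a$; (iii) $\beta^{-1}\circ j(a)^R\circ\beta=-\Phi_{-1}^a$.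
   Context: Conventions. A commutative superring $\mathbb{K}=\mathbb{K}_0\oplus\mathbb{K}_1$ is a unital $\mathbb{Z}/2$-graded ring with $ab=(-1)^{p(a)p(b)}ba$ and $a^2=0$ for $a\in\mathbb{K}_1$; $p$ denotes parity, and formulas containing $p(\cdot)$ are written for nonzero homogeneous elements and extended by linearity. A $\mathbb{K}$-module $M=M_0\oplus M_1$ is a graded right module with $p(m\alpha)=p(m)+p(\alpha)$, and $\alpha m:=(-1)^{p(\alpha)p(m)}m\alpha$. $Hom(M,N)$ is the graded group of right $\mathbb{K}$-linear maps; $(F\otimes G)(v\otimes w)=(-1)^{p(G)p(v)}F(v)\otimes G(w)$. $\mathbb{K}\supseteq\mathbb{Q}$ means all positive integers are invertible in $\mathbb{K}$. A Lie $\mathbb{K}$-superalgebra is a $\mathbb{K}$-module $\mathfrak{g}$ with an even $\mathbb{K}$-bilinear bracket satisfying $[X,Y]=-(-1)^{p(X)p(Y)}[Y,X]$; $[X,X]=0$ for $X\in\mathfrak{g}_0$; $[[X,Y],Z]=[X,[Y,Z]]-(-1)^{p(X)p(Y)}[Y,[X,Z]]$; $[Y,[Y,Y]]=0$ for $Y\in\mathfrak{g}_1$. $\mathfrak{g}$ is $N$-nilpotent if $\mathrm{ad}X_1\circ\cdots\circ\mathrm{ad}X_N=0$ for all $X_i\in\mathfrak{g}$, where $\mathrm{ad}X=[X,\cdot]$. $S(\mathfrak{g})$ is the quotient of $T(\mathfrak{g})$ by the ideal generated by $v\otimes w-(-1)^{p(v)p(w)}w\otimes v$ and $u\otimes u$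 ($u\in\mathfrak{g}_1$); $\Delta:S(\mathfrak{g})\to S(\mathfrak{g})\otimes S(\mathfrak{g})$ is the superalgebra morphism with $\Delta(X)=X\otimes1+1\otimes X$, $X\in\mathfrak{g}$. $U(\mathfrak{g})$ is the quotient of $T(\mathfrak{g})$ by the ideal generated by $a\otimes b-(-1)^{p(a)p(b)}b\otimes a-[a,b]$, with canonical map $j:\mathfrak{g}\to U(\mathfrak{g})$. For $w\in U(\mathfrak{g})$: $w^L$ is left multiplication by $w$; $w^R(v)=(-1)^{p(w)p(v)}vw$; $\mathrm{ad}\,w=w^L-w^R$. Let $\varphi_0(t)=-t$ and, for an invertible $c\in\mathbb{K}_0$, $\varphi_c(t)=\frac{t}{e^{t/c}-1}$ (in the $N$-nilpotent case, truncated modulo $t^N$; the rational numbers occurring lie in $\mathbb{Z}[\frac1{N!}]$). For $\varphi_c=\sum_nc_nt^n$ and $a\in\mathfrak{g}$ let $\varphi_c^a\in Hom(S(\mathfrak{g}),\mathfrak{g})$ be given by $\varphi_c^a(1)=c_0a$ and $$\varphi_c^a(X_1\cdots X_n)=(-1)^{p(a)(p(X_1)+\cdots+p(X_n))}c_n\sum_{s\in\Sigma_n}\alpha(X_{s(1)},\dots,X_{s(n)})\,\mathrm{ad}X_{s(1)}\circ\cdots\circ\mathrm{ad}X_{s(n)}(a)$$ (zero for $n\ge N$ in the nilpotent case), with $\alpha=\pm1$ the Koszul sign such that $\alpha(X_{s(1)},\dots,X_{s(n)})X_{s(1)}\cdots X_{s(n)}=X_1\cdots X_n$ in $S(\mathfrak{g})$;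 put $\Phi_c^a=\mathrm{Mult}\circ(id\otimes\varphi_c^a)\circ\Delta$, $\mathrm{Mult}$ being the multiplication of $S(\mathfrak g)$. The map $a\mapsto\Phi_1^a$ is a representation of $\mathfrak{g}$ in $S(\mathfrak{g})$, so it extends to an algebra morphism $\Phi:U(\mathfrak{g})\to Hom(S(\mathfrak{g}),S(\mathfrak{g}))$ with $\Phi(j(a))=\Phi_1^a$; the symbol map is $\sigma:U(\mathfrak{g})\to S(\mathfrak{g})$, $\sigma(u):=\Phi(u)(1)$. Under the stated assumptions $\sigma$ is invertible, and $\beta:=\sigma^{-1}$. *)

theory Defs
  imports
    "HOL-Algebra.QuotRing"
    "HOL-Algebra.Generated_Groups"
    "HOL-Algebra.Free_Abelian_Groups"
    "HOL-Library.Z2"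
    "HOL-Library.Extended_Nat"
    "HOL-Combinatorics.Permutations"
    "HOL-Computational_Algebra.Formal_Power_Series"
begin

text \<open>
  Parities are elements of \<^typ>\<open>bit\<close>, the field with two elements, so that the sign
  $(-1)^{p(a)p(b)}$ is determined by the product of the parities.  The field \<open>grade\<close> gives the
  homogeneous submodules and \<open>act\<close> the right action of the ground superring.  As for
  \<^locale>\<open>module\<close> in the library, the fields \<open>mult\<close> and \<open>one\<close> of a
  structure that is only used as a module are ignored.
\<close>

record 'm superring = "'m ring" +
  grade :: "bit \<Rightarrow> 'm set"

record ('k, 'm) supermodule = "'m superring" +
  act :: "'m \<Rightarrow> 'k \<Rightarrow> 'm"

record ('k, 'm) lie_superalgebra = "('k, 'm) supermodule" +
  bracket :: "'m \<Rightarrow> 'm \<Rightarrow> 'm"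

definition ksign :: "('m, 'x) ring_scheme \<Rightarrow> bit \<Rightarrow> 'm \<Rightarrow> 'm" where
  "ksign A p x = (if p = 0 then x else \<ominus>\<^bsub>A\<^esub> x)"

definition hcomp :: "('m, 'x) superring_scheme \<Rightarrow> bit \<Rightarrow> 'm \<Rightarrow> 'm" where
  "hcomp A p x = (THE y. y \<in> grade A p \<and> (\<exists>z \<in> grade A (p + 1). x = y \<oplus>\<^bsub>A\<^esub> z))"

text \<open>
  A formula $(-1)^{p(v)p(w)} f(v,w)$ is extended by linearity from homogeneous arguments as
  \<open>koszul_sum A (\<lambda>p q. f v\<^sub>p w\<^sub>q)\<close>, where the subscripts denote homogeneous components.
\<close>

definition koszul_sum :: "('m, 'x) ring_scheme \<Rightarrow> (bit \<Rightarrow> bit \<Rightarrow> 'm) \<Rightarrow> 'm" where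
  "koszul_sum A f = (\<Oplus>\<^bsub>A\<^esub>p \<in> {0, 1}. \<Oplus>\<^bsub>A\<^esub>q \<in> {0, 1}. ksign A (p * q) (f p q))"


section \<open>Superrings, supermodules and Lie superalgebras\<close>

locale super_group = abelian_group A for A :: "('m, 'x) superring_scheme" (structure) +
  assumes grade_subgroup: "additive_subgroup (grade A p) A"
    and grade_sum: "grade A 0 <+> grade A 1 = carrier A"
    and grade_inter: "grade A 0 \<inter> grade A 1 = {\<zero>}"

locale comm_superring = ring K + super_group K for K :: "('k, 'x) superring_scheme" (structure) +
  assumes grade_mult:
      "\<lbrakk>a \<in> grade K p; b \<in> grade K q\<rbrakk> \<Longrightarrow> a \<otimes> b \<in> grade K (p + q)"
    and super_comm:
      "\<lbrakk>a \<in> grade K p; b \<in> grade K q\<rbrakk> \<Longrightarrow> a \<otimes> b = ksign K (p * q) (b \<otimes> a)"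
    and odd_square: "a \<in> grade K 1 \<Longrightarrow> a \<otimes> a = \<zero>"

locale supermodule = K: comm_superring K + M: super_group M
  for K :: "('k, 'x) superring_scheme" and M :: "('k, 'm, 'y) supermodule_scheme" +
  assumes act_closed: "\<lbrakk>m \<in> carrier M; \<alpha> \<in> carrier K\<rbrakk> \<Longrightarrow> act M m \<alpha> \<in> carrier M"
    and act_add_left: "\<lbrakk>m \<in> carrier M; n \<in> carrier M; \<alpha> \<in> carrier K\<rbrakk>
      \<Longrightarrow> act M (m \<oplus>\<^bsub>M\<^esub> n) \<alpha> = act M m \<alpha> \<oplus>\<^bsub>M\<^esub> act M n \<alpha>"
    and act_add_right: "\<lbrakk>m \<in> carrier M; \<alpha> \<in> carrier K; \<beta> \<in> carrier K\<rbrakk>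
      \<Longrightarrow> act M m (\<alpha> \<oplus>\<^bsub>K\<^esub> \<beta>) = act M m \<alpha> \<oplus>\<^bsub>M\<^esub> act M m \<beta>"
    and act_act: "\<lbrakk>m \<in> carrier M; \<alpha> \<in> carrier K; \<beta> \<in> carrier K\<rbrakk>
      \<Longrightarrow> act M (act M m \<alpha>) \<beta> = act M m (\<alpha> \<otimes>\<^bsub>K\<^esub> \<beta>)"
    and act_one: "m \<in> carrier M \<Longrightarrow> act M m \<one>\<^bsub>K\<^esub> = m"
    and grade_act:
      "\<lbrakk>m \<in> grade M p; \<alpha> \<in> grade K q\<rbrakk> \<Longrightarrow> act M m \<alpha> \<in> grade M (p + q)"

definition lact ::
  "('k, 'x) superring_scheme \<Rightarrow> ('k, 'm, 'y) supermodule_scheme \<Rightarrow> 'k \<Rightarrow> 'm \<Rightarrow> 'm" where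
  "lact K M \<alpha> m = koszul_sum M (\<lambda>p q. act M (hcomp M q m) (hcomp K p \<alpha>))"

locale lie_superalgebra = supermodule K \<gg>
  for K :: "('k, 'x) superring_scheme" and \<gg> :: "('k, 'g, 'y) lie_superalgebra_scheme" +
  assumes bracket_closed:
      "\<lbrakk>X \<in> carrier \<gg>; Y \<in> carrier \<gg>\<rbrakk> \<Longrightarrow> bracket \<gg> X Y \<in> carrier \<gg>"
    and bracket_add_left: "\<lbrakk>X \<in> carrier \<gg>; Y \<in> carrier \<gg>; Z \<in> carrier \<gg>\<rbrakk>
      \<Longrightarrow> bracket \<gg> (X \<oplus>\<^bsub>\<gg>\<^esub> Y) Z = bracket \<gg> X Z \<oplus>\<^bsub>\<gg>\<^esub> bracket \<gg> Y Z"
    and bracket_add_right: "\<lbrakk>X \<in> carrier \<gg>; Y \<in> carrier \<gg>; Z \<in> carrier \<gg>\<rbrakk>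
      \<Longrightarrow> bracket \<gg> X (Y \<oplus>\<^bsub>\<gg>\<^esub> Z) = bracket \<gg> X Y \<oplus>\<^bsub>\<gg>\<^esub> bracket \<gg> X Z"
    and bracket_balanced: "\<lbrakk>X \<in> carrier \<gg>; Y \<in> carrier \<gg>; \<alpha> \<in> carrier K\<rbrakk>
      \<Longrightarrow> bracket \<gg> (act \<gg> X \<alpha>) Y = bracket \<gg> X (lact K \<gg> \<alpha> Y)"
    and bracket_act: "\<lbrakk>X \<in> carrier \<gg>; Y \<in> carrier \<gg>; \<alpha> \<in> carrier K\<rbrakk>
      \<Longrightarrow> bracket \<gg> X (act \<gg> Y \<alpha>) = act \<gg> (bracket \<gg> X Y) \<alpha>"
    and grade_bracket:
      "\<lbrakk>X \<in> grade \<gg> p; Y \<in> grade \<gg> q\<rbrakk> \<Longrightarrow> bracket \<gg> X Y \<in> grade \<gg> (p + q)"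
    and bracket_skew: "\<lbrakk>X \<in> grade \<gg> p; Y \<in> grade \<gg> q\<rbrakk>
      \<Longrightarrow> bracket \<gg> X Y = \<ominus>\<^bsub>\<gg>\<^esub> ksign \<gg> (p * q) (bracket \<gg> Y X)"
    and bracket_even: "X \<in> grade \<gg> 0 \<Longrightarrow> bracket \<gg> X X = \<zero>\<^bsub>\<gg>\<^esub>"
    and bracket_jacobi: "\<lbrakk>X \<in> grade \<gg> p; Y \<in> grade \<gg> q; Z \<in> carrier \<gg>\<rbrakk>
      \<Longrightarrow> bracket \<gg> (bracket \<gg> X Y) Z =
        bracket \<gg> X (bracket \<gg> Y Z) \<ominus>\<^bsub>\<gg>\<^esub> ksign \<gg> (p * q) (bracket \<gg> Y (bracket \<gg> X Z))"
    and bracket_odd: "Y \<in> grade \<gg> 1 \<Longrightarrow> bracket \<gg> Y (bracket \<gg> Y Y) = \<zero>\<^bsub>\<gg>\<^esub>"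

definition nilpotent_lie :: "('k, 'g, 'y) lie_superalgebra_scheme \<Rightarrow> nat \<Rightarrow> bool" where
  "nilpotent_lie \<gg> N \<longleftrightarrow>
    (\<forall>Xs. set Xs \<subseteq> carrier \<gg> \<and> length Xs = N \<longrightarrow>
      (\<forall>a \<in> carrier \<gg>. foldr (bracket \<gg>) Xs a = \<zero>\<^bsub>\<gg>\<^esub>))"

definition nat_unit :: "('k, 'x) ring_scheme \<Rightarrow> nat \<Rightarrow> bool" where
  "nat_unit K n \<longleftrightarrow> [n] \<cdot>\<^bsub>K\<^esub> \<one>\<^bsub>K\<^esub> \<in> Units K"


section \<open>Linear maps and superalgebra morphisms\<close>

text \<open>
  Maps are extensional on the carrier of the source, so that a map determined by its values on
  generators is unique as a HOL function.
\<close>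

definition Hom ::
  "('k, 'x) superring_scheme \<Rightarrow> ('k, 'm, 'y) supermodule_scheme \<Rightarrow>
    ('k, 'n, 'z) supermodule_scheme \<Rightarrow> ('m \<Rightarrow> 'n) set" where
  "Hom K M N = {f \<in> carrier M \<rightarrow>\<^sub>E carrier N.
    (\<forall>x \<in> carrier M. \<forall>y \<in> carrier M. f (x \<oplus>\<^bsub>M\<^esub> y) = f x \<oplus>\<^bsub>N\<^esub> f y) \<and>
    (\<forall>x \<in> carrier M. \<forall>\<alpha> \<in> carrier K. f (act M x \<alpha>) = act N (f x) \<alpha>)}"

definition hom_comp ::
  "('m, 'y) superring_scheme \<Rightarrow> ('n, 'z) superring_scheme \<Rightarrow> bit \<Rightarrow> ('m \<Rightarrow> 'n) \<Rightarrow> 'm \<Rightarrow> 'n" where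
  "hom_comp M N p f =
    (\<lambda>x \<in> carrier M. \<Oplus>\<^bsub>N\<^esub>q \<in> {0, 1}. hcomp N (p + q) (f (hcomp M q x)))"

definition superalg_hom ::
  "('k, 'x) superring_scheme \<Rightarrow> ('k, 'm, 'y) supermodule_scheme \<Rightarrow>
    ('k, 'n, 'z) supermodule_scheme \<Rightarrow> ('m \<Rightarrow> 'n) set" where
  "superalg_hom K A B = {f \<in> Hom K A B.
    f \<one>\<^bsub>A\<^esub> = \<one>\<^bsub>B\<^esub> \<and>
    (\<forall>x \<in> carrier A. \<forall>y \<in> carrier A. f (x \<otimes>\<^bsub>A\<^esub> y) = f x \<otimes>\<^bsub>B\<^esub> f y) \<and>
    (\<forall>p. f ` grade A p \<subseteq> grade B p)}"

text \<open>The superalgebra of right linear endomorphisms, with $(f\alpha)(x) = f(\alpha x)$.\<close>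

definition End_alg ::
  "('k, 'x) superring_scheme \<Rightarrow> ('k, 'm, 'y) supermodule_scheme \<Rightarrow> ('k, 'm \<Rightarrow> 'm) supermodule" where
  "End_alg K M =
    \<lparr>carrier = Hom K M M,
     monoid.mult = (\<lambda>f g. compose (carrier M) f g),
     one = (\<lambda>x \<in> carrier M. x),
     ring.zero = (\<lambda>x \<in> carrier M. \<zero>\<^bsub>M\<^esub>),
     ring.add = (\<lambda>f g. \<lambda>x \<in> carrier M. f x \<oplus>\<^bsub>M\<^esub> g x),
     grade = (\<lambda>p. {f \<in> Hom K M M. \<forall>q. f ` grade M q \<subseteq> grade M (p + q)}),
     act = (\<lambda>f \<alpha>. \<lambda>x \<in> carrier M. f (lact K M \<alpha> x))\<rparr>"


section \<open>Quotients and tensor products\<close>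

text \<open>
  The action on a coset is that of any of its representatives; compare \<^const>\<open>rcoset_mult\<close>.
\<close>

definition quot_alg :: "('k, 'm, 'y) supermodule_scheme \<Rightarrow> 'm set \<Rightarrow> ('k, 'm set) supermodule" where
  "quot_alg A I =
    \<lparr>carrier = carrier (A Quot I),
     monoid.mult = monoid.mult (A Quot I),
     one = one (A Quot I),
     ring.zero = ring.zero (A Quot I),
     ring.add = ring.add (A Quot I),
     grade = (\<lambda>p. (\<lambda>x. I +>\<^bsub>A\<^esub> x) ` grade A p),
     act = (\<lambda>C \<alpha>. \<Union>x \<in> C. I +>\<^bsub>A\<^esub> act A x \<alpha>)\<rparr>"

text \<open>
  Formal integer combinations of pairs \<open>(a, b)\<close>, to be divided by the relations of the tensor
  product $A \otimes_K B$.  The product encodes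
  $(a \otimes b)(c \otimes d) = (-1)^{p(b)p(c)} ac \otimes bd$.
\<close>

definition pair_alg ::
  "('k, 'm, 'y) supermodule_scheme \<Rightarrow> ('k, 'n, 'z) supermodule_scheme \<Rightarrow>
    ('k, ('m \<times> 'n) \<Rightarrow>\<^sub>0 int) supermodule" where
  "pair_alg A B =
    \<lparr>carrier = carrier (free_Abelian_group (carrier A \<times> carrier B)),
     monoid.mult = (\<lambda>x y. frag_extend (\<lambda>(a, b). frag_extend (\<lambda>(c, d).
       \<Sum>p \<in> {0, 1}. \<Sum>q \<in> {0, 1}. frag_cmul (if p * q = (0::bit) then 1 else -1)
         (frag_of (a \<otimes>\<^bsub>A\<^esub> hcomp A q c, hcomp B p b \<otimes>\<^bsub>B\<^esub> d))) y) x),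
     one = frag_of (\<one>\<^bsub>A\<^esub>, \<one>\<^bsub>B\<^esub>),
     ring.zero = 0,
     ring.add = (+),
     grade = (\<lambda>r. generate (free_Abelian_group (carrier A \<times> carrier B))
       {frag_of (a, b) | a b p q. a \<in> grade A p \<and> b \<in> grade B q \<and> p + q = r}),
     act = (\<lambda>x \<alpha>. frag_extend (\<lambda>(a, b). frag_of (a, act B b \<alpha>)) x)\<rparr>"

definition tensor_rels ::
  "('k, 'x) superring_scheme \<Rightarrow> ('k, 'm, 'y) supermodule_scheme \<Rightarrow>
    ('k, 'n, 'z) supermodule_scheme \<Rightarrow> (('m \<times> 'n) \<Rightarrow>\<^sub>0 int) set" where
  "tensor_rels K A B = generate (free_Abelian_group (carrier A \<times> carrier B))
    ({frag_of (a \<oplus>\<^bsub>A\<^esub> a', b) - frag_of (a, b) - frag_of (a', b) | a a' b.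
        a \<in> carrier A \<and> a' \<in> carrier A \<and> b \<in> carrier B} \<union>
     {frag_of (a, b \<oplus>\<^bsub>B\<^esub> b') - frag_of (a, b) - frag_of (a, b') | a b b'.
        a \<in> carrier A \<and> b \<in> carrier B \<and> b' \<in> carrier B} \<union>
     {frag_of (act A a \<alpha>, b) - frag_of (a, lact K B \<alpha> b) | a b \<alpha>.
        a \<in> carrier A \<and> b \<in> carrier B \<and> \<alpha> \<in> carrier K})"

definition tensor_prod ::
  "('k, 'x) superring_scheme \<Rightarrow> ('k, 'm, 'y) supermodule_scheme \<Rightarrow>
    ('k, 'n, 'z) supermodule_scheme \<Rightarrow> ('k, (('m \<times> 'n) \<Rightarrow>\<^sub>0 int) set) supermodule" where
  "tensor_prod K A B = quot_alg (pair_alg A B) (tensor_rels K A B)"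

definition pure_tensor ::
  "('k, 'x) superring_scheme \<Rightarrow> ('k, 'm, 'y) supermodule_scheme \<Rightarrow>
    ('k, 'n, 'z) supermodule_scheme \<Rightarrow> 'm \<Rightarrow> 'n \<Rightarrow> (('m \<times> 'n) \<Rightarrow>\<^sub>0 int) set" where
  "pure_tensor K A B a b = tensor_rels K A B +>\<^bsub>pair_alg A B\<^esub> frag_of (a, b)"

definition tensor_map ::
  "('k, 'x) superring_scheme \<Rightarrow> ('k, 'm, 'y) supermodule_scheme \<Rightarrow>
    ('k, 'n, 'z) supermodule_scheme \<Rightarrow> ('m \<Rightarrow> 'm) \<Rightarrow> ('n \<Rightarrow> 'n) \<Rightarrow>
    (('m \<times> 'n) \<Rightarrow>\<^sub>0 int) set \<Rightarrow> (('m \<times> 'n) \<Rightarrow>\<^sub>0 int) set" where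
  "tensor_map K A B F G = (THE H. H \<in> Hom K (tensor_prod K A B) (tensor_prod K A B) \<and>
    (\<forall>v \<in> carrier A. \<forall>w \<in> carrier B. H (pure_tensor K A B v w) =
      koszul_sum (tensor_prod K A B)
        (\<lambda>p q. pure_tensor K A B (F (hcomp A q v)) (hom_comp B B p G w))))"

definition Mult ::
  "('k, 'x) superring_scheme \<Rightarrow> ('k, 'm, 'y) supermodule_scheme \<Rightarrow>
    (('m \<times> 'm) \<Rightarrow>\<^sub>0 int) set \<Rightarrow> 'm" where
  "Mult K A = (THE H. H \<in> Hom K (tensor_prod K A A) A \<and>
    (\<forall>v \<in> carrier A. \<forall>w \<in> carrier A. H (pure_tensor K A A v w) = v \<otimes>\<^bsub>A\<^esub> w))"


section \<open>The tensor, symmetric and enveloping algebras\<close>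

text \<open>
  The tensor algebra is the direct sum of all $M^{\otimes n} \otimes_K K = M^{\otimes n}$: a word
  \<open>([X\<^sub>1, \<dots>, X\<^sub>n], \<alpha>)\<close> stands for $(X_1 \otimes \cdots \otimes X_n)\alpha$, and formal integer
  combinations of words are divided by the relations of the tensor product.  In a product of words
  the scalar of the left factor is moved into the first letter of the right factor.
\<close>

type_synonym ('k, 'm) tens = "(('m list \<times> 'k) \<Rightarrow>\<^sub>0 int) set"

fun word_mult ::
  "('k, 'x) superring_scheme \<Rightarrow> ('k, 'm, 'y) supermodule_scheme \<Rightarrow>
    'm list \<times> 'k \<Rightarrow> 'm list \<times> 'k \<Rightarrow> 'm list \<times> 'k" where
  "word_mult K M (u, \<alpha>) ([], \<beta>) = (u, \<alpha> \<otimes>\<^bsub>K\<^esub> \<beta>)"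
| "word_mult K M (u, \<alpha>) (X # v, \<beta>) = (u @ lact K M \<alpha> X # v, \<beta>)"

definition words ::
  "('k, 'x) superring_scheme \<Rightarrow> ('k, 'm, 'y) supermodule_scheme \<Rightarrow> ('m list \<times> 'k) set" where
  "words K M = lists (carrier M) \<times> carrier K"

definition word_alg ::
  "('k, 'x) superring_scheme \<Rightarrow> ('k, 'm, 'y) supermodule_scheme \<Rightarrow>
    ('k, ('m list \<times> 'k) \<Rightarrow>\<^sub>0 int) supermodule" where
  "word_alg K M =
    \<lparr>carrier = carrier (free_Abelian_group (words K M)),
     monoid.mult = (\<lambda>x y. frag_extend (\<lambda>u. frag_extend (\<lambda>v. frag_of (word_mult K M u v)) y) x),
     one = frag_of ([], \<one>\<^bsub>K\<^esub>),
     ring.zero = 0,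
     ring.add = (+),
     grade = (\<lambda>r. generate (free_Abelian_group (words K M))
       {frag_of (u, \<alpha>) | u \<alpha> ps q. list_all2 (\<lambda>X p. X \<in> grade M p) u ps \<and>
          \<alpha> \<in> grade K q \<and> sum_list ps + q = r}),
     act = (\<lambda>x \<beta>. frag_extend (\<lambda>(u, \<alpha>). frag_of (u, \<alpha> \<otimes>\<^bsub>K\<^esub> \<beta>)) x)\<rparr>"

definition word_rels ::
  "('k, 'x) superring_scheme \<Rightarrow> ('k, 'm, 'y) supermodule_scheme \<Rightarrow> ('k, 'm) tens" where
  "word_rels K M = generate (free_Abelian_group (words K M))
    ({frag_of (u @ (X \<oplus>\<^bsub>M\<^esub> Y) # v, \<alpha>) - frag_of (u @ X # v, \<alpha>) - frag_of (u @ Y # v, \<alpha>)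
        | u X Y v \<alpha>. u \<in> lists (carrier M) \<and> v \<in> lists (carrier M) \<and>
          X \<in> carrier M \<and> Y \<in> carrier M \<and> \<alpha> \<in> carrier K} \<union>
     {frag_of (u, \<alpha> \<oplus>\<^bsub>K\<^esub> \<beta>) - frag_of (u, \<alpha>) - frag_of (u, \<beta>)
        | u \<alpha> \<beta>. u \<in> lists (carrier M) \<and> \<alpha> \<in> carrier K \<and> \<beta> \<in> carrier K} \<union>
     {frag_of (u @ act M X \<beta> # Y # v, \<alpha>) - frag_of (u @ X # lact K M \<beta> Y # v, \<alpha>)
        | u X Y v \<alpha> \<beta>. u \<in> lists (carrier M) \<and> v \<in> lists (carrier M) \<and>
          X \<in> carrier M \<and> Y \<in> carrier M \<and> \<alpha> \<in> carrier K \<and> \<beta> \<in> carrier K} \<union>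
     {frag_of (u @ [act M X \<beta>], \<alpha>) - frag_of (u @ [X], \<beta> \<otimes>\<^bsub>K\<^esub> \<alpha>)
        | u X \<alpha> \<beta>. u \<in> lists (carrier M) \<and> X \<in> carrier M \<and> \<alpha> \<in> carrier K \<and> \<beta> \<in> carrier K})"

definition tensor_alg ::
  "('k, 'x) superring_scheme \<Rightarrow> ('k, 'm, 'y) supermodule_scheme \<Rightarrow>
    ('k, ('k, 'm) tens) supermodule" where
  "tensor_alg K M = quot_alg (word_alg K M) (word_rels K M)"

definition tensor_inc ::
  "('k, 'x) superring_scheme \<Rightarrow> ('k, 'm, 'y) supermodule_scheme \<Rightarrow> 'm \<Rightarrow> ('k, 'm) tens" where
  "tensor_inc K M X = word_rels K M +>\<^bsub>word_alg K M\<^esub> frag_of ([X], \<one>\<^bsub>K\<^esub>)"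

definition sym_ideal ::
  "('k, 'x) superring_scheme \<Rightarrow> ('k, 'm, 'y) supermodule_scheme \<Rightarrow> ('k, 'm) tens set" where
  "sym_ideal K M = (let T = tensor_alg K M; \<iota> = tensor_inc K M in
    Idl\<^bsub>T\<^esub>
      ({(\<iota> v \<otimes>\<^bsub>T\<^esub> \<iota> w) \<ominus>\<^bsub>T\<^esub> ksign T (p * q) (\<iota> w \<otimes>\<^bsub>T\<^esub> \<iota> v)
          | v w p q. v \<in> grade M p \<and> w \<in> grade M q} \<union>
       {\<iota> u \<otimes>\<^bsub>T\<^esub> \<iota> u | u. u \<in> grade M 1}))"

definition sym_alg ::
  "('k, 'x) superring_scheme \<Rightarrow> ('k, 'm, 'y) supermodule_scheme \<Rightarrow>
    ('k, ('k, 'm) tens set) supermodule" where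
  "sym_alg K M = quot_alg (tensor_alg K M) (sym_ideal K M)"

definition sym_inc ::
  "('k, 'x) superring_scheme \<Rightarrow> ('k, 'm, 'y) supermodule_scheme \<Rightarrow> 'm \<Rightarrow> ('k, 'm) tens set" where
  "sym_inc K M X = sym_ideal K M +>\<^bsub>tensor_alg K M\<^esub> tensor_inc K M X"

definition sym_prod ::
  "('k, 'x) superring_scheme \<Rightarrow> ('k, 'm, 'y) supermodule_scheme \<Rightarrow>
    'm list \<Rightarrow> ('k, 'm) tens set" where
  "sym_prod K M Xs = foldr (\<otimes>\<^bsub>sym_alg K M\<^esub>) (map (sym_inc K M) Xs) \<one>\<^bsub>sym_alg K M\<^esub>"

definition env_ideal ::
  "('k, 'x) superring_scheme \<Rightarrow> ('k, 'g, 'y) lie_superalgebra_scheme \<Rightarrow> ('k, 'g) tens set" where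
  "env_ideal K \<gg> = (let T = tensor_alg K \<gg>; \<iota> = tensor_inc K \<gg> in
    Idl\<^bsub>T\<^esub>
      {(\<iota> a \<otimes>\<^bsub>T\<^esub> \<iota> b) \<ominus>\<^bsub>T\<^esub> ksign T (p * q) (\<iota> b \<otimes>\<^bsub>T\<^esub> \<iota> a) \<ominus>\<^bsub>T\<^esub> \<iota> (bracket \<gg> a b)
        | a b p q. a \<in> grade \<gg> p \<and> b \<in> grade \<gg> q})"

definition env_alg ::
  "('k, 'x) superring_scheme \<Rightarrow> ('k, 'g, 'y) lie_superalgebra_scheme \<Rightarrow>
    ('k, ('k, 'g) tens set) supermodule" where
  "env_alg K \<gg> = quot_alg (tensor_alg K \<gg>) (env_ideal K \<gg>)"

definition env_inc ::
  "('k, 'x) superring_scheme \<Rightarrow> ('k, 'g, 'y) lie_superalgebra_scheme \<Rightarrow>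
    'g \<Rightarrow> ('k, 'g) tens set" where
  "env_inc K \<gg> X = env_ideal K \<gg> +>\<^bsub>tensor_alg K \<gg>\<^esub> tensor_inc K \<gg> X"

definition coproduct ::
  "('k, 'x) superring_scheme \<Rightarrow> ('k, 'm, 'y) supermodule_scheme \<Rightarrow>
    ('k, 'm) tens set \<Rightarrow> ((('k, 'm) tens set \<times> ('k, 'm) tens set) \<Rightarrow>\<^sub>0 int) set" where
  "coproduct K M = (let S = sym_alg K M; \<iota> = sym_inc K M in
    THE D. D \<in> superalg_hom K S (tensor_prod K S S) \<and>
      (\<forall>X \<in> carrier M. D (\<iota> X) =
        pure_tensor K S S (\<iota> X) \<one>\<^bsub>S\<^esub> \<oplus>\<^bsub>tensor_prod K S S\<^esub> pure_tensor K S S \<one>\<^bsub>S\<^esub> (\<iota> X)))"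


section \<open>Left and right multiplications\<close>

definition mult_left :: "('m, 'x) superring_scheme \<Rightarrow> 'm \<Rightarrow> 'm \<Rightarrow> 'm" where
  "mult_left U w v = w \<otimes>\<^bsub>U\<^esub> v"

definition mult_right :: "('m, 'x) superring_scheme \<Rightarrow> 'm \<Rightarrow> 'm \<Rightarrow> 'm" where
  "mult_right U w v = koszul_sum U (\<lambda>p q. hcomp U q v \<otimes>\<^bsub>U\<^esub> hcomp U p w)"

definition ad_alg :: "('m, 'x) superring_scheme \<Rightarrow> 'm \<Rightarrow> 'm \<Rightarrow> 'm" where
  "ad_alg U w v = mult_left U w v \<ominus>\<^bsub>U\<^esub> mult_right U w v"


section \<open>The operators on the symmetric algebra\<close>

text \<open>
  Meaningful only if the denominator of \<open>q\<close> is invertible in \<open>K\<close>.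
\<close>

definition rat_in :: "('k, 'x) ring_scheme \<Rightarrow> rat \<Rightarrow> 'k" where
  "rat_in K q = [fst (quotient_of q)] \<cdot>\<^bsub>K\<^esub> \<one>\<^bsub>K\<^esub> \<otimes>\<^bsub>K\<^esub>
    inv\<^bsub>K\<^esub> ([snd (quotient_of q)] \<cdot>\<^bsub>K\<^esub> \<one>\<^bsub>K\<^esub>)"

text \<open>
  The coefficients of $\varphi_0(t) = -t$ and of $\varphi_c(t) = t/(e^{t/c}-1) = c\, f(t/c)$ with
  $f(t) = t/(e^t-1)$, modulo $t^N$; there is no truncation for \<open>N = \<infinity>\<close>.
\<close>

definition phi_coeff :: "('k, 'x) ring_scheme \<Rightarrow> enat \<Rightarrow> 'k \<Rightarrow> nat \<Rightarrow> 'k" where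
  "phi_coeff K N c n =
    (if N \<le> enat n then \<zero>\<^bsub>K\<^esub>
     else if c = \<zero>\<^bsub>K\<^esub> then (if n = 1 then \<ominus>\<^bsub>K\<^esub> \<one>\<^bsub>K\<^esub> else \<zero>\<^bsub>K\<^esub>)
     else rat_in K (fps_nth (fps_X / (fps_exp 1 - 1)) n) \<otimes>\<^bsub>K\<^esub> (c \<otimes>\<^bsub>K\<^esub> (inv\<^bsub>K\<^esub> c) [^]\<^bsub>K\<^esub> n))"

text \<open>
  The total parity of the inversions of \<open>s\<close>; for \<open>X\<^sub>i\<close> of parity \<open>ps ! i\<close> it determines the sign
  by which $X_{s(1)} \cdots X_{s(n)}$ and $X_1 \cdots X_n$ differ.
\<close>

definition koszul_parity :: "bit list \<Rightarrow> (nat \<Rightarrow> nat) \<Rightarrow> bit" where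
  "koszul_parity ps s = (\<Sum>l < length ps. \<Sum>k < l. if s l < s k then ps ! s k * ps ! s l else 0)"

definition sym_ad ::
  "('k, 'g, 'y) lie_superalgebra_scheme \<Rightarrow> bit list \<Rightarrow> 'g list \<Rightarrow> 'g \<Rightarrow> 'g" where
  "sym_ad \<gg> ps Xs a = (\<Oplus>\<^bsub>\<gg>\<^esub>s \<in> {s. s permutes {..<length Xs}}.
    ksign \<gg> (koszul_parity ps s)
      (foldr (bracket \<gg>) (map (\<lambda>k. Xs ! s k) [0..<length Xs]) a))"

text \<open>The case of the empty list says $\varphi_c^a(1) = c_0 a$.\<close>

definition phi_map ::
  "('k, 'x) superring_scheme \<Rightarrow> ('k, 'g, 'y) lie_superalgebra_scheme \<Rightarrow> enat \<Rightarrow> 'k \<Rightarrow> 'g \<Rightarrow>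
    ('k, 'g) tens set \<Rightarrow> 'g" where
  "phi_map K \<gg> N c a = (THE f. f \<in> Hom K (sym_alg K \<gg>) \<gg> \<and>
    (\<forall>Xs ps. list_all2 (\<lambda>X p. X \<in> grade \<gg> p) Xs ps \<longrightarrow>
      f (sym_prod K \<gg> Xs) =
        act \<gg> (\<Oplus>\<^bsub>\<gg>\<^esub>q \<in> {0, 1}. ksign \<gg> (q * sum_list ps) (sym_ad \<gg> ps Xs (hcomp \<gg> q a)))
          (phi_coeff K N c (length Xs))))"

definition Phi_op ::
  "('k, 'x) superring_scheme \<Rightarrow> ('k, 'g, 'y) lie_superalgebra_scheme \<Rightarrow> enat \<Rightarrow> 'k \<Rightarrow> 'g \<Rightarrow>
    ('k, 'g) tens set \<Rightarrow> ('k, 'g) tens set" where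
  "Phi_op K \<gg> N c a = (let S = sym_alg K \<gg> in
    compose (carrier S) (Mult K S)
      (compose (carrier S)
        (tensor_map K S S (\<lambda>x \<in> carrier S. x)
          (compose (carrier S) (sym_inc K \<gg>) (phi_map K \<gg> N c a)))
        (coproduct K \<gg>)))"


section \<open>The symbol map and the symmetrization map\<close>

definition env_rep ::
  "('k, 'x) superring_scheme \<Rightarrow> ('k, 'g, 'y) lie_superalgebra_scheme \<Rightarrow> enat \<Rightarrow>
    ('k, 'g) tens set \<Rightarrow> ('k, 'g) tens set \<Rightarrow> ('k, 'g) tens set" where
  "env_rep K \<gg> N = (THE F. F \<in> superalg_hom K (env_alg K \<gg>) (End_alg K (sym_alg K \<gg>)) \<and>
    (\<forall>a \<in> carrier \<gg>. F (env_inc K \<gg> a) = Phi_op K \<gg> N \<one>\<^bsub>K\<^esub> a))"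

definition symbol_map ::
  "('k, 'x) superring_scheme \<Rightarrow> ('k, 'g, 'y) lie_superalgebra_scheme \<Rightarrow> enat \<Rightarrow>
    ('k, 'g) tens set \<Rightarrow> ('k, 'g) tens set" where
  "symbol_map K \<gg> N u = env_rep K \<gg> N u \<one>\<^bsub>sym_alg K \<gg>\<^esub>"

definition symmetrization ::
  "('k, 'x) superring_scheme \<Rightarrow> ('k, 'g, 'y) lie_superalgebra_scheme \<Rightarrow> enat \<Rightarrow>
    ('k, 'g) tens set \<Rightarrow> ('k, 'g) tens set" where
  "symmetrization K \<gg> N = inv_into (carrier (env_alg K \<gg>)) (symbol_map K \<gg> N)"

end

(* The universal property of U(g) reduces everything to commutators of the operators Phi: all of them
   are convolution operators on S(g) whose symbols are power series in the generic element x of g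
   (x being the degree-one projection of S(g)) applied to ad x, so commutators of operators become
   identities between iterated brackets {(ad x)^i a, (ad x)^j b}. The functional equation of
   t/(e^t - 1) then says that a -> Phi_1^a is a representation, and that Phi_0^a - Phi_1^a
   supercommutes with all Phi_1^b. As the symbol map turns j(b)^L into Phi_1^b and sends 1 to 1, this
   forces it to turn j(a)^R into Phi_1^a - Phi_0^a = -Phi_{-1}^a. Bijectivity of the symbol map follows
   from the leading term X s of Phi_1^X(s) and from the fact that the relations of S(g) hold in U(g)
   up to shorter words. *)

theory Submission
  imports Defs "HOL-Computational_Algebra.Polynomial"
begin

\<comment> \<open>Neither S(gg) nor U(gg) comes with a basis, as \<open>gg\<close> may be any
  module. Linear maps are compared on products of homogeneous elements; but each map has to be
  produced by a universal property or as a convolution before the definite descriptions in the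
  definitions denote anything. The computations take place on functions of words, lists of letters
  with recorded parities: the recursions \<open>br\<close> and \<open>cmp\<close> imitate what the
  coproduct does to a product, and the Jacobi identity and the derivation rule become inductions on
  the word in which only signs are matched.

  Coefficients are rationals, and \<open>rok\<close> says that the denominator is a unit of
  \<open>K\<close>. On a word of length L the commutator of two operators uses coefficients up to
  index L + 1, one more than its result. Truncation may remove that index; in this case all brackets
  involved vanish (\<open>bra_nilpotent\<close>).

  A unit 2 serves the odd part: even and odd elements of T(gg) are separated by an involution, and
  the square of an odd generator of U(gg) is half a bracket.\<close>
syntax "_index_sub" :: "logic => index" ("\<^sub>_" [1000])
translations "_index_sub R" => "_index R"

abbreviation (input) carrier_element (infix "el" 50) where "x el R \<equiv> x \<in> carrier R"

lemmas (in abelian_group) ag = abelian_group_axioms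

section \<open>Superrings and supermodules\<close>

text \<open>Parities stay ring terms over the two-element field, so that
  \<open>algebra_simps\<close> can normalise the exponents of Koszul signs; rewriting them into xor
  and conjunction would prevent this.\<close>

declare add_bit_eq_xor [simp del] mult_bit_eq_and [simp del]

lemma bit_add_self [simp]: "p + p = (0::bit)" "p + (p + q) = (q::bit)" by (cases p; simp flip: add.assoc)+

lemma bit_mult_self [simp]: "p * p = (p::bit)" "p * (p * q) = (p * q::bit)" by (cases p; simp)+

text \<open>Additivity alone carries most of the linear algebra below. Unlike \<open>Hom\<close>,
  the values off the carrier are left open, so compositions and sums of such maps need no
  restriction.\<close>

definition addmap ::
 "('a, 'x) ring_scheme => ('b, 'y) ring_scheme => ('a => 'b) => bool" where
 "addmap A B f \<longleftrightarrow> f : carrier A \<rightarrow> carrier B &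
  (ALL x:carrier A. ALL y:carrier A. f (x \<oplus>\<^sub>A y) = f x \<oplus>\<^sub>B f y)"

lemma addmapI:
 assumes "!!x. x el A ==> f x el B"
  and "!!x y. [|x el A; y el A|] ==> f (x \<oplus>\<^sub>A y) = f x \<oplus>\<^sub>B f y"
 shows "addmap A B f" using assms by (auto simp: addmap_def)

lemma addmap_closed: "[|addmap A B f; x el A|] ==> f x el B"
 by (auto simp: addmap_def)

lemma addmap_add:
 "[|addmap A B f; x el A; y el A|] ==> f (x \<oplus>\<^sub>A y) = f x \<oplus>\<^sub>B f y"
 by (auto simp: addmap_def)

lemma addmap_zero:
 assumes "abelian_group A" "abelian_group B" "addmap A B f"
 shows "f \<zero>\<^sub>A = \<zero>\<^sub>B"
proof -
 interpret A: abelian_group A by fact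
 interpret B: abelian_group B by fact
 have "f \<zero>\<^sub>A \<oplus>\<^sub>B f \<zero>\<^sub>A = f \<zero>\<^sub>A"
  using addmap_add[OF assms(3), of "\<zero>\<^sub>A" "\<zero>\<^sub>A"] addmap_closed[OF assms(3)] by simp
 then show ?thesis using addmap_closed[OF assms(3)] by simp
qed

lemma addmap_minus:
 assumes "abelian_group A" "abelian_group B" "addmap A B f" "x el A"
 shows "f (\<ominus>\<^sub>A x) = \<ominus>\<^sub>B f x"
proof -
 interpret A: abelian_group A by fact
 interpret B: abelian_group B by fact
 have "f (\<ominus>\<^sub>A x) \<oplus>\<^sub>B f x = \<zero>\<^sub>B"
  using addmap_add[OF assms(3), of "\<ominus>\<^sub>A x" x] addmap_zero[OF assms(1-3)] assms(4)
  by (simp add: A.l_neg)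
 then show ?thesis using addmap_closed[OF assms(3)] assms(4) by (metis A.a_inv_closed B.minus_equality)
qed

lemma addmap_compose:
 "[|addmap A B f; addmap B C g|] ==> addmap A C (%x. g (f x))"
 by (auto simp: addmap_def Pi_iff)

lemma addmap_ksign:
 assumes "abelian_group A" "abelian_group B" "addmap A B f" "x el A"
 shows "f (ksign A p x) = ksign B p (f x)" using addmap_minus[OF assms] by (simp add: ksign_def)

section \<open>Koszul signs in abelian groups\<close>

context abelian_group
begin

lemma ksign_closed [simp, intro]: "x el G ==> ksign G p x el G" by (simp add: ksign_def)

lemma ksign_0 [simp]: "ksign G 0 x = x" by (simp add: ksign_def)

lemma ksign_1: "ksign G 1 x = \<ominus> x" by (simp add: ksign_def)

lemma ksign_zero [simp]: "ksign G p \<zero> = \<zero>" by (simp add: ksign_def)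

lemma ksign_ksign [simp]: "x el G ==> ksign G p (ksign G q x) = ksign G (p + q) x"
 by (cases p; cases q) (simp_all add: ksign_def)

lemma ksign_add:
 "[|x el G; y el G|] ==> ksign G p (x \<oplus> y) = ksign G p x \<oplus> ksign G p y"
 by (simp add: ksign_def minus_add)

lemma ksign_uminus: "x el G ==> ksign G p (\<ominus> x) = \<ominus> ksign G p x"
 by (simp add: ksign_def)

lemma uminus_ksign: "x el G ==> \<ominus> x = ksign G 1 x" by (simp add: ksign_def)

lemma a_inv_zero [simp]: "\<ominus> \<zero> = \<zero>" by (rule minus_equality) simp_all

lemma additive_subgroupI':
 assumes "H \<subseteq> carrier G" "\<zero> : H" "!!x y. [|x : H; y : H|] ==> x \<oplus> y : H"
  "!!x. x : H ==> \<ominus> x : H"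
 shows "additive_subgroup H G" by (rule additive_subgroup.intro, rule add.subgroupI) (use assms in auto)

lemma minus_eq_zero_iff:
 assumes "x el G" "y el G"
 shows "x \<ominus> y = \<zero> \<longleftrightarrow> x = y"
 using assms by (metis a_minus_def add.inv_closed add.inv_inv minus_equality r_neg)

lemma add_4_swap:
 "[|a el G; b el G; c el G; d el G|] ==>
  (a \<oplus> b) \<oplus> (c \<oplus> d) = (a \<oplus> c) \<oplus> (b \<oplus> d)" by (simp add: a_ac)

lemma koszul_sum_eq:
 assumes "!!p q. f p q el G"
 shows "koszul_sum G f = (f 0 0 \<oplus> f 0 1) \<oplus> (f 1 0 \<oplus> \<ominus> f 1 1)"
 unfolding koszul_sum_def using assms by (simp add: ksign_1 a_ac)

lemma koszul_sum_closed:
 assumes "!!p q. f p q el G"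
 shows "koszul_sum G f el G" by (subst koszul_sum_eq) (simp_all add: assms)

lemma koszul_sum_add:
 assumes "!!p q. f p q el G" "!!p q. g p q el G"
 shows "koszul_sum G (%p q. f p q \<oplus> g p q) = koszul_sum G f \<oplus> koszul_sum G g"
 using assms by (simp add: koszul_sum_eq minus_add a_ac)

text \<open>For homogeneous arguments only one of the four summands survives. This brings the linear
  extension of a sign rule back to the rule itself.\<close>

lemma koszul_sum_single:
 assumes "f p q el G" "!!r s. r \<noteq> p \<or> s \<noteq> q ==> f r s = \<zero>"
 shows "koszul_sum G f = ksign G (p * q) (f p q)"
proof -
 have c: "f r s el G" for r s using assms by (cases "r = p & s = q") auto
 have z: "r \<noteq> p \<or> s \<noteq> q \<longrightarrow> f r s = \<zero>" for r s using assms(2) by blast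
 have *: "koszul_sum G f = (f 0 0 \<oplus> f 0 1) \<oplus> (f 1 0 \<oplus> \<ominus> f 1 1)"
  using koszul_sum_eq[of f] c by blast
 show ?thesis
 proof (cases p; cases q)
  assume "p = 0" "q = 0"
  then show ?thesis using * z[of 0 1] z[of 1 0] z[of 1 1] c[of 0 0] by simp
 next
  assume "p = 0" "q = 1"
  then show ?thesis using * z[of 0 0] z[of 1 0] z[of 1 1] c[of 0 1] by simp
 next
  assume "p = 1" "q = 0"
  then show ?thesis using * z[of 0 0] z[of 0 1] z[of 1 1] c[of 1 0] by simp
 next
  assume "p = 1" "q = 1"
  then show ?thesis using * z[of 0 0] z[of 0 1] z[of 1 0] c[of 1 1] by (simp add: ksign_1)
 qed
qed

lemma addmap_koszul_sum:
 assumes "abelian_group H" "addmap G H h" "!!p q. f p q el G"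
 shows "h (koszul_sum G f) = koszul_sum H (%p q. h (f p q))"
proof -
 interpret H: abelian_group H by fact
 have c: "!!p q. h (f p q) el H" using assms by (simp add: addmap_closed)
 have "koszul_sum G f = (f 0 0 \<oplus> f 0 1) \<oplus> (f 1 0 \<oplus> \<ominus> f 1 1)"
  using koszul_sum_eq[of f] assms(3) by blast
 moreover have "koszul_sum H (%p q. h (f p q)) =
   (h (f 0 0) \<oplus>\<^sub>H h (f 0 1)) \<oplus>\<^sub>H (h (f 1 0) \<oplus>\<^sub>H \<ominus>\<^sub>H h (f 1 1))"
  using H.koszul_sum_eq[of "%p q. h (f p q)"] c by blast
 ultimately show ?thesis by (simp add: assms(3) addmap_add[OF assms(2)]
    addmap_minus[OF abelian_group_axioms assms(1,2)])
qed

end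

section \<open>Homogeneous components\<close>

context super_group
begin

lemma grade_carrier [simp]: "x : grade A p ==> x el A"
 by (rule additive_subgroup.a_Hcarr[OF grade_subgroup])

lemma grade_add [simp]: "[|x : grade A p; y : grade A p|] ==> x \<oplus> y : grade A p"
 by (rule additive_subgroup.a_closed[OF grade_subgroup])

lemma grade_zero [simp]: "\<zero> : grade A p" by (rule additive_subgroup.zero_closed[OF grade_subgroup])

lemma grade_uminus [simp]: "x : grade A p ==> \<ominus> x : grade A p"
 by (rule additive_subgroup.a_inv_closed[OF grade_subgroup])

lemma grade_minus [simp]: "[|x : grade A p; y : grade A p|] ==> x \<ominus> y : grade A p"
 by (simp add: minus_eq)

lemma grade_ksign [simp]: "x : grade A p ==> ksign A q x : grade A p" by (simp add: ksign_def)

lemma grade_inter_zero: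
 assumes "x : grade A p" "x : grade A (p + 1)"
 shows "x = \<zero>" using assms grade_inter by (cases p) auto

text \<open>The difference of two decompositions, \<open>y - y' = z' - z\<close>, lies in both
  grades and is therefore zero.\<close>

lemma hcomp_unique:
 assumes "y : grade A p" "z : grade A (p + 1)"
 shows "hcomp A p (y \<oplus> z) = y" unfolding hcomp_def
proof (rule the_equality)
 show "y : grade A p & (EX za:grade A (p + 1). y \<oplus> z = y \<oplus> za)" using assms by auto
next
 fix y' assume "y' : grade A p & (EX za:grade A (p + 1). y \<oplus> z = y' \<oplus> za)"
 then obtain z' where y': "y' : grade A p" and z': "z' : grade A (p + 1)"
  and eq: "y \<oplus> z = y' \<oplus> z'" by auto
 have c: "y el A" "z el A" "y' el A" "z' el A" using assms y' z' by auto
 have "y \<ominus> y' = (y \<ominus> y') \<oplus> (z \<ominus> z)" using c by (simp add: minus_eq r_neg)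
 also have "... = (y \<oplus> z) \<oplus> (\<ominus> y' \<oplus> \<ominus> z)"
  using c by (simp add: minus_eq add_4_swap)
 also have "... = (y' \<oplus> z') \<oplus> (\<ominus> y' \<oplus> \<ominus> z)" by (simp only: eq)
 also have "... = (y' \<ominus> y') \<oplus> (z' \<ominus> z)" using c by (simp add: minus_eq add_4_swap)
 also have "... = z' \<ominus> z" using c by (simp add: minus_eq r_neg)
 finally have "y \<ominus> y' = z' \<ominus> z" .
 then have "y \<ominus> y' = \<zero>" using assms y' z' grade_inter_zero by (metis grade_minus)
 then show "y' = y" using assms(1) y' by (simp add: minus_eq_zero_iff)
qed

lemma grade_decomp:
 assumes "x el A"
 obtains y z where "y : grade A p" "z : grade A (p + 1)" "x = y \<oplus> z"
proof -
 obtain y z where yz: "y : grade A 0" "z : grade A 1" "x = y \<oplus> z"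
  using assms unfolding grade_sum[symmetric] set_add_def' by auto
 show ?thesis
 proof (cases p)
  assume "p = 0"
  then show ?thesis using yz that by auto
 next
  assume "p = 1"
  then show ?thesis using yz that[of z y] by (simp add: a_comm)
 qed
qed

lemma hcomp_grade [simp]: "x el A ==> hcomp A p x : grade A p"
 by (metis grade_decomp hcomp_unique)

lemma hcomp_closed [simp]: "x el A ==> hcomp A p x el A"
 by (rule grade_carrier[OF hcomp_grade])

lemma hcomp_sum':
 assumes "x el A"
 shows "hcomp A p x \<oplus> hcomp A (p + 1) x = x"
proof -
 obtain y z where yz: "y : grade A p" "z : grade A (p + 1)" "x = y \<oplus> z" by (rule grade_decomp[OF assms])
 moreover have "hcomp A (p + 1) (z \<oplus> y) = z" using yz by (intro hcomp_unique) (auto simp: add.assoc)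
 ultimately show ?thesis by (simp add: hcomp_unique a_comm)
qed

lemma hcomp_sum: "x el A ==> hcomp A 0 x \<oplus> hcomp A 1 x = x" using hcomp_sum'[of x 0] by simp

lemma hcomp_homogeneous: "x : grade A q ==> hcomp A p x = (if p = q then x else \<zero>)"
 using hcomp_unique[of x p \<zero>] hcomp_unique[of \<zero> p x] by (cases p; cases q) auto

lemma hcomp_zero [simp]: "hcomp A p \<zero> = \<zero>" using hcomp_homogeneous[of \<zero> p p] by simp

lemma hcomp_add:
 assumes "x el A" "y el A"
 shows "hcomp A p (x \<oplus> y) = hcomp A p x \<oplus> hcomp A p y"
proof -
 have "x \<oplus> y = (hcomp A p x \<oplus> hcomp A p y) \<oplus> (hcomp A (p + 1) x \<oplus> hcomp A (p + 1) y)"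
  using assms by (subst add_4_swap) (simp_all add: hcomp_sum')
 then show ?thesis using assms by (simp add: hcomp_unique)
qed

lemma grade_induct [consumes 1, case_names homogeneous add]:
 assumes "x el A"
  and "!!p x. x : grade A p ==> P x"
  and "!!x y. [|x el A; y el A; P x; P y|] ==> P (x \<oplus> y)"
 shows "P x" using assms by (metis hcomp_closed hcomp_grade hcomp_sum)

lemma addmap_hcomp: "addmap A A (hcomp A p)" by (rule addmapI) (auto simp: hcomp_add)

end

context comm_superring
begin

text \<open>The even part e0 of 1 is already a left unit for homogeneous elements: compare
  components in x = e0 x + e1 x. Applied to e0 and e1 this gives e0 = e0 (e0 + e1) = e0 + e1 =
  1.\<close>

lemma one_even: "\<one> : grade K 0"
proof -
 define e0 e1 where "e0 = hcomp K 0 \<one>" "e1 = hcomp K 1 \<one>"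
 have e: "e0 : grade K 0" "e1 : grade K 1" "\<one> = e0 \<oplus> e1" by (simp_all add: e0_e1_def hcomp_sum)
 have h: "e0 \<otimes> x = x" if "x : grade K q" for x q
 proof -
  have "x = e0 \<otimes> x \<oplus> e1 \<otimes> x" using e that by (metis grade_carrier l_distr l_one)
  moreover have "e0 \<otimes> x : grade K q" "e1 \<otimes> x : grade K (q + 1)"
   using grade_mult[OF e(1) that] grade_mult[OF e(2) that] by (simp_all add: add.commute)
  ultimately have "hcomp K q x = e0 \<otimes> x" using hcomp_unique by metis
  then show ?thesis using hcomp_homogeneous[OF that, of q] by simp
 qed
 have "e0 = e0 \<otimes> \<one>" using e(1) by simp
 also have "e0 \<otimes> \<one> = e0 \<otimes> (e0 \<oplus> e1)" by (simp only: e(3))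
 also have "... = e0 \<otimes> e0 \<oplus> e0 \<otimes> e1" using e by (simp add: r_distr)
 also have "... = \<one>" using h e by simp
 finally show ?thesis using e by simp
qed

end

lemma (in ring) ring_ksign_l:
 "[|x el R; y el R|] ==> ksign R p x \<otimes> y = ksign R p (x \<otimes> y)"
 by (simp add: ksign_def l_minus)

lemma (in ring) ring_ksign_r:
 "[|x el R; y el R|] ==> x \<otimes> ksign R p y = ksign R p (x \<otimes> y)"
 by (simp add: ksign_def r_minus)

section \<open>The left action of scalars on a right module\<close>

context supermodule
begin

lemma addmap_act: "ka el K ==> addmap M M (%m. act M m ka)"
 by (rule addmapI) (auto simp: act_closed act_add_left)

lemma addmap_act_scalar: "m el M ==> addmap K M (%ka. act M m ka)"
 by (rule addmapI) (auto simp: act_closed act_add_right)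

lemma act_zero_left [simp]: "ka el K ==> act M \<zero>\<^sub>M ka = \<zero>\<^sub>M"
 by (rule addmap_zero[OF M.ag M.ag addmap_act])

lemma act_zero_right [simp]: "m el M ==> act M m \<zero>\<^sub>K = \<zero>\<^sub>M"
 by (rule addmap_zero[OF K.ag M.ag addmap_act_scalar])

lemma act_ksign:
 "[|m el M; ka el K|] ==> act M (ksign M p m) ka = ksign M p (act M m ka)"
 using addmap_ksign[OF M.ag M.ag addmap_act] .

lemma act_ksign_right:
 "[|m el M; ka el K|] ==> act M m (ksign K p ka) = ksign M p (act M m ka)"
 using addmap_ksign[OF K.ag M.ag addmap_act_scalar] .

lemma lact_closed [simp]:
 "[|m el M; ka el K|] ==> lact K M ka m el M"
 unfolding lact_def by (rule M.koszul_sum_closed) (simp add: act_closed)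

lemma lact_homogeneous:
 assumes "m : grade M q" "ka : grade K p"
 shows "lact K M ka m = ksign M (p * q) (act M m ka)" unfolding lact_def
 by (subst M.koszul_sum_single[where p = p and q = q])
  (use assms in \<open>auto simp: M.hcomp_homogeneous K.hcomp_homogeneous act_closed\<close>)

lemma lact_add_left:
 assumes "m el M" "ka el K" "kb el K"
 shows "lact K M (ka \<oplus>\<^sub>K kb) m = lact K M ka m \<oplus>\<^sub>M lact K M kb m"
 unfolding lact_def by (subst M.koszul_sum_add[symmetric])
  (use assms in \<open>auto simp: K.hcomp_add act_add_right act_closed\<close>)

lemma lact_add_right:
 assumes "m el M" "n el M" "ka el K"
 shows "lact K M ka (m \<oplus>\<^sub>M n) = lact K M ka m \<oplus>\<^sub>M lact K M ka n"
 unfolding lact_def by (subst M.koszul_sum_add[symmetric])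
  (use assms in \<open>auto simp: M.hcomp_add act_add_left act_closed\<close>)

lemma addmap_lact: "ka el K ==> addmap M M (lact K M ka)"
 by (rule addmapI) (auto simp: lact_add_right)

lemma addmap_lact_scalar: "m el M ==> addmap K M (%ka. lact K M ka m)"
 by (rule addmapI) (auto simp: lact_add_left)

lemma lact_grade:
 "[|m : grade M q; ka : grade K p|] ==> lact K M ka m : grade M (p + q)"
 using grade_act[of m q ka p] by (simp add: lact_homogeneous add.commute[of p])

lemma lact_one [simp]: "m el M ==> lact K M \<one>\<^sub>K m = m"
 by (induction rule: M.grade_induct)
  (use K.one_even in \<open>auto simp: lact_add_right lact_homogeneous act_one\<close>)

text \<open>The two actions commute. Letting \<open>ka\<close> pass \<open>m kb\<close> costs the
  extra exponent p*r, and supercommutativity of \<open>K\<close> returns it when \<open>ka\<close>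
  and \<open>kb\<close> are exchanged.\<close>

lemma lact_act:
 assumes "m el M" "ka el K" "kb el K"
 shows "lact K M ka (act M m kb) = act M (lact K M ka m) kb" using assms(2)
proof (induction rule: K.grade_induct)
 case (homogeneous p ka)
 show ?case using assms(1)
 proof (induction rule: M.grade_induct)
  case (homogeneous q m)
  show ?case using assms(3)
  proof (induction rule: K.grade_induct)
   case (homogeneous r kb)
   have "lact K M ka (act M m kb) = ksign M (p * (q + r)) (act M (act M m kb) ka)"
    using homogeneous \<open>ka : _\<close> \<open>m : _\<close> by (simp add: lact_homogeneous grade_act)
   also have "act M (act M m kb) ka = act M m (ksign K (r * p) (ka \<otimes>\<^sub>K kb))"
    using homogeneous \<open>ka : _\<close> \<open>m : _\<close>
    by (simp add: act_act) (metis K.super_comm)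
   also have "... = ksign M (r * p) (act M (act M m ka) kb)"
    using homogeneous \<open>ka : _\<close> \<open>m : _\<close> by (simp add: act_ksign_right act_act)
   finally show ?case using homogeneous \<open>ka : _\<close> \<open>m : _\<close>
    by (simp add: lact_homogeneous act_ksign act_closed)
     (cases p; cases q; cases r; simp)
  next
   case (add x y)
   then show ?case
    using \<open>ka : _\<close> \<open>m : _\<close> by (simp add: act_add_right lact_add_right act_closed)
  qed
 next
  case (add x y)
  then show ?case using \<open>ka : _\<close> assms by (simp add: act_add_left lact_add_right act_closed)
 qed
next
 case (add x y)
 then show ?case using assms by (simp add: lact_add_left act_add_left act_closed)
qed

text \<open>Two successive left actions have exponent r*q + p*(q + r), the action of the product has
  (p + r)*q. They differ by p*r, the sign for exchanging the two scalars.\<close>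

lemma lact_lact:
 assumes "m el M" "ka el K" "kb el K"
 shows "lact K M ka (lact K M kb m) = lact K M (ka \<otimes>\<^sub>K kb) m" using assms(1)
proof (induction rule: M.grade_induct)
 case (homogeneous q m)
 show ?case using assms(3)
 proof (induction rule: K.grade_induct)
  case (homogeneous r kb)
  show ?case using assms(2)
  proof (induction rule: K.grade_induct)
   case (homogeneous p ka)
   note h = homogeneous \<open>kb : _\<close> \<open>m : _\<close>
   have "lact K M ka (lact K M kb m) = ksign M (r * q + p * (q + r)) (act M (act M m kb) ka)"
    using h lact_homogeneous[OF grade_act[OF h(3,2)] h(1)]
    by (simp add: lact_homogeneous[OF h(3,2)] act_closed act_ksign addmap_ksign[OF
       M.ag M.ag addmap_lact])
   also have "act M (act M m kb) ka = act M m (ksign K (r * p) (ka \<otimes>\<^sub>K kb))"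
    using h by (simp add: act_act) (metis K.super_comm)
   finally show ?case using h lact_homogeneous[OF h(3) K.grade_mult[OF h(1,2)]] by (simp add: act_ksign_right act_closed)
     (cases p; cases q; cases r; simp)
  next
   case (add x y)
   then show ?case using \<open>m : _\<close> \<open>kb : _\<close> by (simp add: lact_add_left K.l_distr)
  qed
 next
  case (add x y)
  then show ?case using \<open>m : _\<close> assms by (simp add: lact_add_left lact_add_right K.r_distr)
 qed
next
 case (add x y)
 then show ?case using assms by (simp add: lact_add_right)
qed

end

section \<open>Quotients\<close>

text \<open>The map induced by \<open>h\<close> on cosets, through an arbitrary representative. It
  is meaningful when \<open>h\<close> is additive and vanishes on \<open>I\<close>; then the choice
  is immaterial by \<open>qlift_cls\<close>.\<close>

definition qlift :: "('a, 'y) ring_scheme => 'a set => ('a => 'b) => 'a set => 'b" where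
 "qlift A I h C = h (SOME x. x el A & C = I +>\<^sub>A x)"

locale alg_quotient = A: abelian_group A + I: additive_subgroup I A
 for A :: "('k, 'm, 'y) supermodule_scheme" (structure) and I
begin

abbreviation Q where "Q \<equiv> quot_alg A I"
abbreviation cls where "cls x \<equiv> I +> x"

lemma abelian_subgroup: "abelian_subgroup I A" by (rule abelian_subgroupI3) unfold_locales

lemma carrier_Q: "carrier Q = cls ` carrier A" by (auto simp: quot_alg_def FactRing_def A_RCOSETS_def')

lemma cls_closed [simp, intro]: "x el A ==> cls x el Q" by (simp add: carrier_Q)

lemma cls_cases [consumes 1]:
 assumes "c el Q" obtains x where "x el A" "c = cls x" using assms by (auto simp: carrier_Q)

lemma cls_add: "[|x el A; y el A|] ==> cls x \<oplus>\<^sub>Q cls y = cls (x \<oplus> y)"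
 by (simp add: quot_alg_def FactRing_def abelian_subgroup.a_rcos_sum[OF abelian_subgroup])

lemma zero_Q: "\<zero>\<^sub>Q = I" by (simp add: quot_alg_def FactRing_def)

lemma cls_zero: "cls \<zero> = \<zero>\<^sub>Q" unfolding zero_Q by (simp add: A.a_coset_add_zero[OF I.a_subset])

lemma cls_eq_iff:
 assumes "x el A" "y el A"
 shows "cls x = cls y \<longleftrightarrow> x \<ominus> y : I"
 using abelian_subgroup.a_rcos_module[OF abelian_subgroup assms(2,1)]
  abelian_subgroup.a_repr_independence'[OF abelian_subgroup, of x y]
  abelian_subgroup.a_rcos_self[OF abelian_subgroup, of x] assms by (auto simp: A.minus_eq)

lemma cls_zero_iff: "x el A ==> cls x = \<zero>\<^sub>Q \<longleftrightarrow> x : I"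
 using cls_eq_iff[of x \<zero>] by (simp add: cls_zero A.minus_eq)

lemma abelian_group_Q: "abelian_group Q"
proof (rule abelian_groupI)
 fix c assume "c el Q"
 then obtain x where "x el A" "c = cls x" by (rule cls_cases)
 then show "EX d:carrier Q. d \<oplus>\<^sub>Q c = \<zero>\<^sub>Q"
  by (intro bexI[of _ "cls (\<ominus> x)"]) (auto simp: cls_add A.l_neg cls_zero)
qed (auto elim!: cls_cases simp: cls_add cls_zero[symmetric] A.a_ac)

lemma addmap_cls: "addmap A Q cls" by (rule addmapI) (auto simp: cls_add)

lemma cls_uminus: "x el A ==> cls (\<ominus> x) = \<ominus>\<^sub>Q cls x"
 by (rule addmap_minus[OF A.ag abelian_group_Q addmap_cls])

lemma cls_ksign: "x el A ==> cls (ksign A p x) = ksign Q p (cls x)"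
 by (rule addmap_ksign[OF A.ag abelian_group_Q addmap_cls])

lemma qlift_cls:
 assumes "abelian_group B" "addmap A B h" "!!x. x : I ==> h x = \<zero>\<^sub>B" "x el A"
 shows "qlift A I h (cls x) = h x"
proof -
 interpret B: abelian_group B by fact
 define y where "y = (SOME y. y el A & cls x = cls y)"
 have y: "y el A" "cls x = cls y"
  using someI[of "%y. y el A & cls x = cls y" x] assms(4) by (auto simp: y_def)
 then have "h (x \<ominus> y) = \<zero>\<^sub>B" using assms cls_eq_iff by blast
 then have "h x \<ominus>\<^sub>B h y = \<zero>\<^sub>B"
  using y assms(2,4) addmap_minus[OF A.ag assms(1,2)] by (simp add: A.minus_eq B.minus_eq addmap_add)
 then have "h x = h y" using y assms(2,4) B.minus_eq_zero_iff by (simp add: addmap_closed)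
 then show ?thesis by (simp add: qlift_def y_def)
qed

lemma addmap_qlift:
 assumes "abelian_group B" "addmap A B h" "!!x. x : I ==> h x = \<zero>\<^sub>B"
 shows "addmap Q B (qlift A I h)"
proof (rule addmapI)
 fix c d assume "c el Q" "d el Q"
 then obtain x y where "x el A" "c = cls x" "y el A" "d = cls y" by (metis cls_cases)
 then show "qlift A I h (c \<oplus>\<^sub>Q d) = qlift A I h c \<oplus>\<^sub>B qlift A I h d"
  using assms by (simp add: cls_add qlift_cls addmap_add)
qed (use assms in \<open>auto elim!: cls_cases simp: qlift_cls addmap_closed\<close>)

lemma grade_Q: "grade Q p = cls ` grade A p" by (simp add: quot_alg_def)

text \<open>The union that defines the action on a coset has only equal members, because the action
  maps \<open>I\<close> into itself.\<close>

lemma act_cls: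
 assumes "addmap A A (%x. act A x ka)" "!!x. x : I ==> act A x ka : I" "x el A"
 shows "act Q (cls x) ka = cls (act A x ka)"
proof -
 have "cls (act A y ka) = cls (act A x ka)" if "y : cls x" for y
 proof -
  have y: "y el A" using that assms(3) A.a_r_coset_subset_G[OF I.a_subset] by blast
  have "cls y = cls x" using that assms(3) abelian_subgroup.a_repr_independence'[OF abelian_subgroup] by metis
  then have "act A (y \<ominus> x) ka : I" using assms y cls_eq_iff by blast
  then have "act A y ka \<ominus> act A x ka : I"
   using y assms addmap_minus[OF A.ag A.ag assms(1)]
   by (simp add: A.minus_eq addmap_add[OF assms(1)])
  then show ?thesis using y assms addmap_closed[OF assms(1)] by (simp add: cls_eq_iff)
 qed
 moreover have "x : cls x" using assms(3) abelian_subgroup.a_rcos_self[OF abelian_subgroup] by blast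
 ultimately have "(\<Union>y\<in>cls x. cls (act A y ka)) = cls (act A x ka)" by blast
 then show ?thesis by (simp add: quot_alg_def)
qed

text \<open>Associativity and units are not required of \<open>A\<close> itself: the algebra of formal
 combinations of pairs has no unit before passing to the tensor product.\<close>

lemma cls_mult:
 assumes "!!x. x el A ==> addmap A A (%y. x \<otimes> y)"
  and "!!x. x el A ==> addmap A A (%y. y \<otimes> x)"
  and "!!x i. [|x el A; i : I|] ==> x \<otimes> i : I"
  and "!!x i. [|x el A; i : I|] ==> i \<otimes> x : I"
  and "x el A" "y el A"
 shows "cls x \<otimes>\<^sub>Q cls y = cls (x \<otimes> y)"
proof -
 note cl = addmap_closed[OF assms(1)]
 have *: "cls (a \<otimes> b) = cls (x \<otimes> y)" if ab: "a : cls x" "b : cls y" for a b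
 proof -
  have c: "a el A" "b el A" using ab assms(5,6) A.a_r_coset_subset_G[OF I.a_subset] by blast+
  have "a \<ominus> x : I" "b \<ominus> y : I"
   using ab assms(5,6) c cls_eq_iff abelian_subgroup.a_repr_independence'[OF abelian_subgroup] by metis+
  then have "cls ((a \<ominus> x) \<otimes> b) = \<zero>\<^sub>Q" "cls (x \<otimes> (b \<ominus> y)) = \<zero>\<^sub>Q"
   using assms c cl cls_zero_iff by (meson A.minus_closed)+
  moreover have "(a \<ominus> x) \<otimes> b = a \<otimes> b \<ominus> x \<otimes> b" "x \<otimes> (b \<ominus> y) = x \<otimes> b \<ominus> x \<otimes> y"
   using c assms(5,6) addmap_minus[OF A.ag A.ag assms(1)]
    addmap_minus[OF A.ag A.ag assms(2)]
   by (simp_all add: A.minus_eq addmap_add[OF assms(1)] addmap_add[OF assms(2)])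
  ultimately have "a \<otimes> b \<ominus> x \<otimes> b : I" "x \<otimes> b \<ominus> x \<otimes> y : I"
   using c assms(5,6) cl by (simp_all add: cls_zero_iff)
  then show ?thesis using c assms(5,6) cl cls_eq_iff by metis
 qed
 have "x : cls x" "y : cls y" using assms(5,6) abelian_subgroup.a_rcos_self[OF abelian_subgroup] by blast+
 then have "(\<Union>a\<in>cls x. \<Union>b\<in>cls y. cls (a \<otimes> b)) = cls (x \<otimes> y)" using * by blast
 then show ?thesis by (simp add: quot_alg_def FactRing_def rcoset_mult_def)
qed

lemma ring_Q:
 assumes m: "!!x. x el A ==> addmap A A (%y. x \<otimes> y)"
   "!!x. x el A ==> addmap A A (%y. y \<otimes> x)"
   "!!x i. [|x el A; i : I|] ==> x \<otimes> i : I"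
   "!!x i. [|x el A; i : I|] ==> i \<otimes> x : I"
  and "!!x y z. [|x el A; y el A; z el A|] ==> (x \<otimes> y) \<otimes> z = x \<otimes> (y \<otimes> z)"
  and "\<one> el A" "!!x. x el A ==> cls (\<one> \<otimes> x) = cls x"
   "!!x. x el A ==> cls (x \<otimes> \<one>) = cls x"
 shows "ring Q"
proof -
 have one: "\<one>\<^sub>Q = cls \<one>" by (simp add: quot_alg_def FactRing_def)
 note c = addmap_closed[OF m(1)]
 show ?thesis
 proof (rule ringI[OF abelian_group_Q])
  show "Group.monoid Q"
   by (rule monoidI) (use assms(5-) c in \<open>auto elim!: cls_cases simp: cls_mult[OF m] one\<close>)
 qed (use c in \<open>auto elim!: cls_cases
   simp: cls_mult[OF m] cls_add addmap_add[OF m(1)] addmap_add[OF m(2)]\<close>)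
qed

lemma one_Q: "\<one>\<^sub>Q = cls \<one>" by (simp add: quot_alg_def FactRing_def)

end

section \<open>Superalgebras\<close>

text \<open>Both actions of \<open>K\<close> are multiplications by the image of a scalar in the
  algebra, from the right and from the left. Every compatibility of products with scalars thus
  becomes an instance of associativity.\<close>

locale superalg = supermodule K A + A: ring A
 for K :: "('k, 'x) superring_scheme" and A :: "('k, 'm, 'y) supermodule_scheme" +
 assumes act_eq_mult: "[|x el A; ka el K|] ==> act A x ka = x \<otimes>\<^sub>A act A \<one>\<^sub>A ka"
  and lact_eq_mult: "[|x el A; ka el K|] ==> lact K A ka x = act A \<one>\<^sub>A ka \<otimes>\<^sub>A x"
  and grade_mult: "[|x : grade A p; y : grade A q|] ==> x \<otimes>\<^sub>A y : grade A (p + q)"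
  and one_even: "\<one>\<^sub>A : grade A 0"
begin

definition kap where "kap ka = act A \<one>\<^sub>A ka"

lemma kap_closed [simp]: "ka el K ==> kap ka el A"
 by (simp add: kap_def act_closed)

lemma kap_mult: "[|ka el K; kb el K|] ==> kap ka \<otimes>\<^sub>A kap kb = kap (ka \<otimes>\<^sub>K kb)"
 unfolding kap_def by (subst act_eq_mult[symmetric]) (auto simp: act_closed act_act)

lemma kap_add: "[|ka el K; kb el K|] ==> kap (ka \<oplus>\<^sub>K kb) = kap ka \<oplus>\<^sub>A kap kb"
 by (simp add: kap_def act_add_right)

lemma kap_one: "kap \<one>\<^sub>K = \<one>\<^sub>A" by (simp add: kap_def act_one)

lemma act_kap: "[|x el A; ka el K|] ==> act A x ka = x \<otimes>\<^sub>A kap ka"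
 unfolding kap_def by (rule act_eq_mult)

lemma lact_kap: "[|x el A; ka el K|] ==> lact K A ka x = kap ka \<otimes>\<^sub>A x"
 unfolding kap_def by (rule lact_eq_mult)

lemma mult_act: "[|x el A; y el A; ka el K|] ==>
  x \<otimes>\<^sub>A act A y ka = act A (x \<otimes>\<^sub>A y) ka"
 by (simp add: act_kap A.m_assoc)

lemma act_mult: "[|x el A; y el A; ka el K|] ==>
  act A x ka \<otimes>\<^sub>A y = x \<otimes>\<^sub>A lact K A ka y"
 by (simp add: act_kap lact_kap A.m_assoc)

lemma lact_mult: "[|x el A; y el A; ka el K|] ==>
  lact K A ka x \<otimes>\<^sub>A y = lact K A ka (x \<otimes>\<^sub>A y)"
 by (simp add: lact_kap A.m_assoc)

lemma addmap_mult_l: "x el A ==> addmap A A (%y. x \<otimes>\<^sub>A y)"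
 by (rule addmapI) (auto simp: A.r_distr)

lemma addmap_mult_r: "x el A ==> addmap A A (%y. y \<otimes>\<^sub>A x)"
 by (rule addmapI) (auto simp: A.l_distr)

lemma hcomp_mult_homogeneous:
 assumes "x : grade A q" "y el A"
 shows "hcomp A p (x \<otimes>\<^sub>A y) = x \<otimes>\<^sub>A hcomp A (p + q) y"
proof -
 have "x \<otimes>\<^sub>A y = x \<otimes>\<^sub>A hcomp A (p + q) y \<oplus>\<^sub>A x \<otimes>\<^sub>A hcomp A (p + q + 1) y"
  using assms by (simp add: A.r_distr[symmetric] M.hcomp_sum')
 moreover have "x \<otimes>\<^sub>A hcomp A (p + q) y : grade A p" "x \<otimes>\<^sub>A hcomp A (p + q + 1) y : grade A (p + 1)"
  using grade_mult[OF assms(1) M.hcomp_grade[OF assms(2), of "p + q"]]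
   grade_mult[OF assms(1) M.hcomp_grade[OF assms(2), of "p + q + 1"]] by (cases p; cases q; simp)+
 ultimately show ?thesis using M.hcomp_unique by metis
qed

lemma hcomp_mult_homogeneous_r:
 assumes "x : grade A q" "y el A"
 shows "hcomp A p (y \<otimes>\<^sub>A x) = hcomp A (p + q) y \<otimes>\<^sub>A x"
proof -
 have "y \<otimes>\<^sub>A x = hcomp A (p + q) y \<otimes>\<^sub>A x \<oplus>\<^sub>A hcomp A (p + q + 1) y \<otimes>\<^sub>A x"
  using assms by (simp add: A.l_distr[symmetric] M.hcomp_sum')
 moreover have "hcomp A (p + q) y \<otimes>\<^sub>A x : grade A p" "hcomp A (p + q + 1) y \<otimes>\<^sub>A x : grade A (p + 1)"
  using grade_mult[OF M.hcomp_grade[OF assms(2), of "p + q"] assms(1)]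
   grade_mult[OF M.hcomp_grade[OF assms(2), of "p + q + 1"] assms(1)] by (cases p; cases q; simp)+
 ultimately show ?thesis using M.hcomp_unique by metis
qed

text \<open>The elements all of whose components lie in the generated ideal form an ideal again: a
  homogeneous multiplier only permutes the components. Containing the generators, this ideal
  contains everything generated.\<close>

lemma graded_idealI:
 assumes "G \<subseteq> carrier A" "!!x p. x : G ==> hcomp A p x : Idl\<^bsub>A\<^esub> G" "x : Idl\<^bsub>A\<^esub> G"
 shows "hcomp A p x : Idl\<^bsub>A\<^esub> G"
proof -
 interpret I: ideal "Idl\<^bsub>A\<^esub> G" A by (rule A.genideal_ideal[OF assms(1)])
 let ?J = "{x : carrier A. ALL p. hcomp A p x : Idl\<^bsub>A\<^esub> G}"
 have "ideal ?J A"
 proof (rule idealI[OF A.ring_axioms])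
  show "subgroup ?J (add_monoid A)" by (rule additive_subgroup.a_subgroup, rule M.additive_subgroupI')
    (auto simp: M.hcomp_add addmap_minus[OF M.ag M.ag M.addmap_hcomp])
 next
  fix a x assume a: "a : ?J" and x: "x el A"
  then have ac: "a el A" by simp
  show "x \<otimes>\<^sub>A a : ?J" using x
  proof (induction rule: M.grade_induct)
   case (homogeneous q x)
   then show ?case using a by (auto simp: hcomp_mult_homogeneous I.I_l_closed)
  next
   case (add x y)
   then show ?case using ac by (auto simp: A.l_distr M.hcomp_add)
  qed
  show "a \<otimes>\<^sub>A x : ?J" using x
  proof (induction rule: M.grade_induct)
   case (homogeneous q x)
   then show ?case using a by (auto simp: hcomp_mult_homogeneous_r I.I_r_closed)
  next
   case (add x y)
   then show ?case using ac by (auto simp: A.r_distr M.hcomp_add)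
  qed
 qed
 moreover have "G \<subseteq> ?J" using assms(1,2) by auto
 ultimately have "Idl\<^bsub>A\<^esub> G \<subseteq> ?J" by (rule A.genideal_minimal)
 then show ?thesis using assms(3) by blast
qed

end

locale superalg_quotient = superalg K A + I: ideal I A
 for K :: "('k, 'x) superring_scheme" and A :: "('k, 'm, 'y) supermodule_scheme" and I +
 assumes graded: "x : I ==> hcomp A p x : I"
begin

sublocale quo: alg_quotient A I ..

abbreviation Q where "Q \<equiv> quot_alg A I"

lemma cls_mult:
 "[|x el A; y el A|] ==> quo.cls x \<otimes>\<^sub>Q quo.cls y = quo.cls (x \<otimes>\<^sub>A y)"
 by (rule quo.cls_mult) (auto simp: addmap_mult_l addmap_mult_r I.I_l_closed I.I_r_closed)

lemma act_cls: "[|x el A; ka el K|] ==> act Q (quo.cls x) ka = quo.cls (act A x ka)"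
 by (rule quo.act_cls) (auto simp: addmap_act act_kap I.I_r_closed)

lemma ring_Q: "ring Q" by (rule quo.ring_Q)
  (auto simp: addmap_mult_l addmap_mult_r I.I_l_closed I.I_r_closed A.m_assoc)

lemma super_group_Q: "super_group Q"
proof -
 interpret Q: ring Q by (rule ring_Q)
 show ?thesis
 proof (intro super_group.intro super_group_axioms.intro Q.ag)
  fix p
  show "additive_subgroup (grade Q p) Q" by (rule Q.additive_subgroupI')
    (auto simp: quo.grade_Q quo.cls_uminus[symmetric] quo.cls_add quo.cls_zero[symmetric])
 next
  show "grade Q 0 <+>\<^sub>Q grade Q 1 = carrier Q" unfolding set_add_def' quo.grade_Q
  proof (safe)
   fix c assume "c el Q"
   then obtain x where x: "x el A" "c = quo.cls x" by (rule quo.cls_cases)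
   have "c = quo.cls (hcomp A 0 x) \<oplus>\<^sub>Q quo.cls (hcomp A 1 x)"
    using x by (simp add: quo.cls_add M.hcomp_sum)
   then show "c : (\<Union>h\<in>(+>\<^sub>A) I ` grade A 0. \<Union>k\<in>(+>\<^sub>A) I ` grade A 1. {h \<oplus>\<^sub>Q k})"
    using x(1) by (intro UN_I[of "quo.cls (hcomp A 0 x)"] UN_I[of "quo.cls (hcomp A 1 x)"]) auto
  qed (auto simp: quo.cls_add)
 next
  have "quo.cls y = \<zero>\<^sub>Q" if yz: "y : grade A 0" "z : grade A 1" "quo.cls y = quo.cls z" for y z
  proof -
   \<comment> \<open>If an even and an odd element have the same class, the even component of their
     difference lies in the ideal; that component is y itself.\<close>
   have "y \<ominus>\<^sub>A z : I" using yz by (simp add: quo.cls_eq_iff)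
   then have "hcomp A 0 (y \<oplus>\<^sub>A \<ominus>\<^sub>A z) : I"
    using graded by (simp add: M.minus_eq)
   then have "y : I" using yz M.hcomp_unique[of y 0 "\<ominus>\<^sub>A z"] by simp
   then show ?thesis using yz(1) quo.cls_zero_iff[of y] by simp
  qed
  then show "grade Q 0 \<inter> grade Q 1 = {\<zero>\<^sub>Q}"
   unfolding quo.grade_Q by (auto simp: quo.cls_zero[symmetric])
 qed
qed

lemma hcomp_cls: "x el A ==> hcomp Q p (quo.cls x) = quo.cls (hcomp A p x)"
proof -
 interpret Q: super_group Q by (rule super_group_Q)
 assume x: "x el A"
 have "quo.cls x = quo.cls (hcomp A p x) \<oplus>\<^sub>Q quo.cls (hcomp A (p + 1) x)"
  using x by (simp add: quo.cls_add M.hcomp_sum')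
 then show ?thesis using x Q.hcomp_unique[of "quo.cls (hcomp A p x)" p "quo.cls (hcomp A (p + 1) x)"]
  by (simp add: quo.grade_Q)
qed

lemma lact_cls:
 assumes "x el A" "ka el K"
 shows "lact K Q ka (quo.cls x) = quo.cls (lact K A ka x)" unfolding lact_def
 by (subst M.addmap_koszul_sum[OF quo.abelian_group_Q quo.addmap_cls])
  (use assms in \<open>auto simp: hcomp_cls act_cls act_closed\<close>)

theorem superalg_Q: "superalg K Q"
proof -
 interpret Q: super_group Q by (rule super_group_Q)
 interpret QR: ring Q by (rule ring_Q)
 interpret S: supermodule K Q by unfold_locales
   (auto elim!: quo.cls_cases simp: quo.grade_Q act_cls act_closed quo.cls_add act_add_left
    act_add_right act_act act_one grade_act)
 show ?thesis by unfold_locales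
   (auto elim!: quo.cls_cases simp: quo.one_Q act_cls lact_cls cls_mult act_closed quo.grade_Q
    act_eq_mult[symmetric] lact_eq_mult[symmetric] grade_mult one_even)
qed

end

section \<open>The tensor algebra\<close>

lemma frag_extend_add_fun: "frag_extend (%x. f x + g x) c = frag_extend f c + frag_extend g c"
 by (induction c rule: frag_induction[OF subset_UNIV]) (auto simp: frag_extend_diff)

lemma frag_extend_diff_fun: "frag_extend (%x. f x - g x) c = frag_extend f c - frag_extend g c"
 by (induction c rule: frag_induction[OF subset_UNIV]) (auto simp: frag_extend_diff)

lemma frag_extend_zero_fun: "frag_extend (%x. 0) c = 0"
 by (induction c rule: frag_induction[OF subset_UNIV]) (auto simp: frag_extend_diff)

lemma generate_frag_subgroup:
 assumes "G \<subseteq> carrier (free_Abelian_group S)"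
 shows "subgroup (generate (free_Abelian_group S) G) (free_Abelian_group S)"
 by (rule group.generate_is_subgroup[OF group_free_Abelian_group assms])

lemma generate_frag_diff:
 assumes "G \<subseteq> carrier (free_Abelian_group S)"
  and "x : generate (free_Abelian_group S) G" "y : generate (free_Abelian_group S) G"
 shows "x - y : generate (free_Abelian_group S) G"
proof -
 interpret subgroup "generate (free_Abelian_group S) G" "free_Abelian_group S" by (rule generate_frag_subgroup[OF assms(1)])
 have "inv\<^bsub>free_Abelian_group S\<^esub> y = - y" using mem_carrier[OF assms(3)] by simp
 then show ?thesis using m_closed[OF assms(2) m_inv_closed[OF assms(3)]] by simp
qed

lemma generate_frag_zero: "0 : generate (free_Abelian_group S) G" using generate.one[of "free_Abelian_group S" G] by simp

lemma generate_frag_uminus: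
 assumes "G \<subseteq> carrier (free_Abelian_group S)" "y : generate (free_Abelian_group S) G"
 shows "- y : generate (free_Abelian_group S) G"
 using generate_frag_diff[OF assms(1) generate_frag_zero assms(2)] by simp

lemma generate_frag_add:
 assumes "G \<subseteq> carrier (free_Abelian_group S)"
  and "x : generate (free_Abelian_group S) G" "y : generate (free_Abelian_group S) G"
 shows "x + y : generate (free_Abelian_group S) G"
 using generate_frag_diff[OF assms(1,2) generate_frag_uminus[OF assms(1,3)]] by simp

text \<open>Closure under differences covers the group operations: an inverse is
  \<open>0 - h\<close>, and a sum is \<open>h1 - (0 - h2)\<close>.\<close>

lemma generate_frag_induct [consumes 2, case_names zero gen diff]:
 assumes "x : generate (free_Abelian_group S) G" "G \<subseteq> carrier (free_Abelian_group S)"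
  and "P 0" "!!g. g : G ==> P g"
  and "!!x y. [|x : generate (free_Abelian_group S) G; y : generate (free_Abelian_group S) G;
   P x; P y|] ==> P (x - y)"
 shows "P x" using assms(1)
proof (induction rule: generate.induct)
 case one
 then show ?case using assms(3) by simp
next
 case (incl h)
 then show ?case using assms(4) by simp
next
 case (inv h)
 then have "inv\<^bsub>free_Abelian_group S\<^esub> h = 0 - h" using assms(2) by auto
 then show ?case using assms(3) assms(4)[OF inv] assms(5) generate_frag_zero generate.incl[OF inv] by metis
next
 case (eng h1 h2)
 have "P (h1 - (0 - h2))" using assms eng generate_frag_zero generate_frag_diff by metis
 then show ?case by simp
qed

lemma abelian_group_frag:
 fixes A :: "('a \<Rightarrow>\<^sub>0 int, 'x) ring_scheme"
 assumes "carrier A = carrier (free_Abelian_group S)" "ring.add A = (+)" "ring.zero A = 0"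
 shows "abelian_group A"
proof (rule abelian_groupI)
 fix x y assume "x el A" "y el A"
 then show "x \<oplus>\<^sub>A y el A" using keys_add[of x y] by (auto simp: assms)
next
 fix x assume "x el A"
 then show "EX y:carrier A. y \<oplus>\<^sub>A x = \<zero>\<^sub>A"
  by (intro bexI[of _ "- x"]) (simp_all add: assms)
qed (auto simp: assms)

lemma frag_a_inv:
 fixes A :: "('a \<Rightarrow>\<^sub>0 int, 'x) ring_scheme"
 assumes "abelian_group A" "ring.add A = (+)" "ring.zero A = 0" "y el A"
 shows "\<ominus>\<^sub>A y = - y"
 using abelian_group.l_neg[OF assms(1,4)] assms(2,3) by (simp add: eq_neg_iff_add_eq_0)

lemma additive_subgroup_generate:
 assumes "carrier A = carrier (free_Abelian_group S)" "ring.add A = (+)" "ring.zero A = 0"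
  and "G \<subseteq> carrier (free_Abelian_group S)"
 shows "additive_subgroup (generate (free_Abelian_group S) G) A"
proof -
 interpret A: abelian_group A by (rule abelian_group_frag[OF assms(1-3)])
 have sub: "generate (free_Abelian_group S) G \<subseteq> carrier A"
  using subgroup.subset[OF generate_frag_subgroup[OF assms(4)]] assms(1) by simp
 show ?thesis
 proof (rule A.additive_subgroupI')
  fix x assume "x : generate (free_Abelian_group S) G"
  then show "\<ominus>\<^sub>A x : generate (free_Abelian_group S) G"
   using frag_a_inv[OF A.ag assms(2,3)] sub generate_frag_uminus[OF assms(4)] by auto
 qed (use sub assms generate_frag_zero generate_frag_add[OF assms(4)] in auto)
qed

text \<open>Freeness, with values in a group that is not given by a type class.\<close>

lemma frag_lift:
 fixes A :: "('a \<Rightarrow>\<^sub>0 int, 'x) ring_scheme"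
 assumes "abelian_group B" "carrier A = carrier (free_Abelian_group S)" "ring.add A = (+)"
  and "!!s. s : S ==> f s el B"
 shows "EX h. addmap A B h & (ALL s:S. h (frag_of s) = f s)"
proof -
 interpret B: abelian_group B by fact
 obtain h where "h : hom (free_Abelian_group S) (add_monoid B)" "!!s. s : S ==> h (frag_of s) = f s"
  using comm_group.free_Abelian_group_universal[OF B.a_comm_group, of f S] assms(4) by auto
 then have "addmap A B h & (ALL s:S. h (frag_of s) = f s)"
  using assms(2,3) by (auto simp: addmap_def hom_def Pi_iff)
 then show ?thesis by blast
qed

lemma addmap_frag_diff:
 fixes A :: "('a \<Rightarrow>\<^sub>0 int, 'x) ring_scheme"
 assumes "abelian_group A" "abelian_group B" "addmap A B h"
  and "ring.add A = (+)" "ring.zero A = 0" "x el A" "y el A"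
 shows "h (x - y) = h x \<ominus>\<^sub>B h y"
proof -
 interpret A: abelian_group A by fact
 interpret B: abelian_group B by fact
 have "x - y = x \<oplus>\<^sub>A \<ominus>\<^sub>A y"
  using assms(4) by (simp add: frag_a_inv[OF assms(1,4,5,7)])
 moreover have "h (x \<oplus>\<^sub>A \<ominus>\<^sub>A y) = h x \<oplus>\<^sub>B h (\<ominus>\<^sub>A y)"
  using assms(6,7) by (intro addmap_add[OF assms(3)]) auto
 moreover have "h (\<ominus>\<^sub>A y) = \<ominus>\<^sub>B h y" by (rule addmap_minus[OF assms(1-3,7)])
 ultimately show ?thesis by (simp add: B.minus_eq)
qed

text \<open>The parity involution, which multiplies elements of parity p by (-1)^p. It respects
  products and both actions of scalars, so it extends to the tensor algebra letter by
  letter.\<close>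

definition pinv :: "('m, 'x) superring_scheme => 'm => 'm" where
 "pinv A x = hcomp A 0 x \<ominus>\<^sub>A hcomp A 1 x"

context super_group
begin

lemma pinv_closed [simp]: "x el A ==> pinv A x el A" by (simp add: pinv_def)

lemma pinv_homogeneous: "x : grade A p ==> pinv A x = ksign A p x"
 by (cases p) (simp_all add: pinv_def hcomp_homogeneous ksign_1 minus_eq)

lemma pinv_add: "[|x el A; y el A|] ==> pinv A (x \<oplus> y) = pinv A x \<oplus> pinv A y"
 by (simp add: pinv_def hcomp_add minus_eq minus_add a_ac)

end

context comm_superring
begin

lemma grade_mult_ksign: "[|ka : grade K p; kb : grade K q|] ==> pinv K (ka \<otimes> kb) = pinv K ka \<otimes> pinv K kb"
 by (simp add: pinv_homogeneous[OF grade_mult] pinv_homogeneous ring_ksign_l ring_ksign_r add.commute)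

lemma pinv_mult:
 assumes "ka el K" "kb el K"
 shows "pinv K (ka \<otimes> kb) = pinv K ka \<otimes> pinv K kb" using assms(1)
proof (induction rule: grade_induct)
 case (homogeneous p ka)
 show ?case using assms(2)
  by (induction rule: grade_induct) (use homogeneous in \<open>auto simp: grade_mult_ksign pinv_add r_distr\<close>)
qed (use assms in \<open>auto simp: pinv_add l_distr\<close>)

end

section \<open>Words, their product and their relations\<close>

context supermodule
begin

lemma pinv_act:
 assumes "m el M" "ka el K"
 shows "pinv M (act M m ka) = act M (pinv M m) (pinv K ka)" using assms(1)
proof (induction rule: M.grade_induct)
 case (homogeneous p m)
 show ?case using assms(2)
 proof (induction rule: K.grade_induct)
  case (homogeneous q ka)
  then show ?case
   using \<open>m : _\<close> M.pinv_homogeneous[OF grade_act[OF \<open>m : _\<close> \<open>ka : _\<close>]]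
   by (simp add: M.pinv_homogeneous K.pinv_homogeneous act_ksign act_ksign_right act_closed
     add.commute[of p])
 qed (use homogeneous in \<open>auto simp: M.pinv_add K.pinv_add act_add_right act_closed\<close>)
qed (use assms in \<open>auto simp: M.pinv_add act_add_left act_closed\<close>)

lemma pinv_lact:
 assumes "m el M" "ka el K"
 shows "pinv M (lact K M ka m) = lact K M (pinv K ka) (pinv M m)" using assms(1)
proof (induction rule: M.grade_induct)
 case (homogeneous p m)
 show ?case using assms(2)
 proof (induction rule: K.grade_induct)
  case (homogeneous q ka)
  then show ?case
   using \<open>m : _\<close> M.pinv_homogeneous[OF lact_grade[OF \<open>m : _\<close> \<open>ka : _\<close>]]
   by (simp add: M.pinv_homogeneous K.pinv_homogeneous lact_homogeneous[of _ p _ q]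
    act_ksign act_ksign_right act_closed ac_simps)
 qed (use homogeneous in \<open>auto simp: M.pinv_add K.pinv_add lact_add_left\<close>)
qed (use assms in \<open>auto simp: M.pinv_add lact_add_right\<close>)

abbreviation "W \<equiv> word_alg K M"
abbreviation "R \<equiv> word_rels K M"
abbreviation "T \<equiv> tensor_alg K M"

text \<open>The generators in \<open>word_rels\<close> as a set of their own: stability under
  products, under the parity involution and under evaluation is checked one relation at a
  time.\<close>

definition word_gens where "word_gens =
  {frag_of (u @ (X \<oplus>\<^sub>M Y) # v, ka) - frag_of (u @ X # v, ka) - frag_of (u @ Y # v, ka)
    | u X Y v ka. u : lists (carrier M) & v : lists (carrier M) &
     X el M & Y el M & ka el K} \<union>
   {frag_of (u, ka \<oplus>\<^sub>K kb) - frag_of (u, ka) - frag_of (u, kb)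
    | u ka kb. u : lists (carrier M) & ka el K & kb el K} \<union>
   {frag_of (u @ act M X kb # Y # v, ka) - frag_of (u @ X # lact K M kb Y # v, ka)
    | u X Y v ka kb. u : lists (carrier M) & v : lists (carrier M) &
     X el M & Y el M & ka el K & kb el K} \<union>
   {frag_of (u @ [act M X kb], ka) - frag_of (u @ [X], kb \<otimes>\<^sub>K ka)
    | u X ka kb. u : lists (carrier M) & X el M & ka el K & kb el K}"

lemma R_eq: "R = generate (free_Abelian_group (words K M)) word_gens" by (simp add: word_rels_def word_gens_def)

lemma word_gens_cases [consumes 1, case_names add scalar balanced last]:
 assumes "g : word_gens"
 obtains u X Y v ka where "g = frag_of (u @ (X \<oplus>\<^sub>M Y) # v, ka) - frag_of (u @ X # v, ka) - frag_of (u @ Y # v, ka)"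
   "u : lists (carrier M)" "v : lists (carrier M)" "X el M" "Y el M" "ka el K"
 | u ka kb where "g = frag_of (u, ka \<oplus>\<^sub>K kb) - frag_of (u, ka) - frag_of (u, kb)"
   "u : lists (carrier M)" "ka el K" "kb el K"
 | u X Y v ka kb where "g = frag_of (u @ act M X kb # Y # v, ka) - frag_of (u @ X # lact K M kb Y # v, ka)"
   "u : lists (carrier M)" "v : lists (carrier M)" "X el M" "Y el M"
   "ka el K" "kb el K"
 | u X ka kb where "g = frag_of (u @ [act M X kb], ka) - frag_of (u @ [X], kb \<otimes>\<^sub>K ka)"
   "u : lists (carrier M)" "X el M" "ka el K" "kb el K"
 using assms unfolding word_gens_def by blast

lemma word_gensI:
 "[|u : lists (carrier M); v : lists (carrier M); X el M; Y el M; ka el K|] ==>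
  frag_of (u @ (X \<oplus>\<^sub>M Y) # v, ka) - frag_of (u @ X # v, ka) - frag_of (u @ Y # v, ka) : word_gens"
 "[|u : lists (carrier M); ka el K; kb el K|] ==>
  frag_of (u, ka \<oplus>\<^sub>K kb) - frag_of (u, ka) - frag_of (u, kb) : word_gens"
 "[|u : lists (carrier M); v : lists (carrier M); X el M; Y el M; ka el K; kb el K|] ==>
  frag_of (u @ act M X kb # Y # v, ka) - frag_of (u @ X # lact K M kb Y # v, ka) : word_gens"
 "[|u : lists (carrier M); X el M; ka el K; kb el K|] ==>
  frag_of (u @ [act M X kb], ka) - frag_of (u @ [X], kb \<otimes>\<^sub>K ka) : word_gens"
 unfolding word_gens_def by blast+

lemma frag_diff_closed: "[|x el (free_Abelian_group S); y el (free_Abelian_group S)|] ==>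
  x - y el (free_Abelian_group S)" using keys_diff[of x y] by auto

lemma word_gens_carrier: "word_gens \<subseteq> carrier (free_Abelian_group (words K M))"
proof
 fix g assume "g : word_gens"
 then show "g el (free_Abelian_group (words K M))" by (cases rule: word_gens_cases)
   (auto intro!: frag_diff_closed simp del: carrier_free_Abelian_group_iff
    simp: frag_of_in_free_Abelian_group words_def act_closed)
qed

lemma W_simps: "carrier W = carrier (free_Abelian_group (words K M))" "ring.add W = (+)"
 "ring.zero W = 0" "\<one>\<^sub>W = frag_of ([], \<one>\<^sub>K)"
 "x \<otimes>\<^sub>W y = frag_extend (%u. frag_extend (%v. frag_of (word_mult K M u v)) y) x"
 "act W x kb = frag_extend (%(u, ka). frag_of (u, ka \<otimes>\<^sub>K kb)) x"
 by (simp_all add: word_alg_def)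

lemma word_mult_closed: "[|u : words K M; v : words K M|] ==> word_mult K M u v : words K M"
 by (cases u; cases v; cases "fst v") (auto simp: words_def)

lemma word_mult_assoc:
 assumes "u : words K M" "v : words K M" "w : words K M"
 shows "word_mult K M (word_mult K M u v) w = word_mult K M u (word_mult K M v w)" using assms
 by (cases u; cases v; cases w; cases "fst v"; cases "fst w")
  (auto simp: words_def K.m_assoc lact_lact)

lemma word_mult_one:
 assumes "u : words K M"
 shows "word_mult K M u ([], \<one>\<^sub>K) = u" "word_mult K M ([], \<one>\<^sub>K) u = u"
 using assms by (cases u; cases "fst u"; auto simp: words_def)+

lemma W_mult_diff: "(x - y) \<otimes>\<^sub>W z = x \<otimes>\<^sub>W z - y \<otimes>\<^sub>W z" "z \<otimes>\<^sub>W (x - y) = z \<otimes>\<^sub>W x - z \<otimes>\<^sub>W y"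
 by (simp_all add: W_simps frag_extend_diff frag_extend_diff_fun)

lemma W_mult_add: "(x + y) \<otimes>\<^sub>W z = x \<otimes>\<^sub>W z + y \<otimes>\<^sub>W z" "z \<otimes>\<^sub>W (x + y) = z \<otimes>\<^sub>W x + z \<otimes>\<^sub>W y"
 by (simp_all add: W_simps frag_extend_add frag_extend_add_fun)

lemma W_mult_zero: "0 \<otimes>\<^sub>W z = 0" "z \<otimes>\<^sub>W 0 = 0"
 by (simp_all add: W_simps frag_extend_zero_fun)

lemma W_mult_of: "frag_of u \<otimes>\<^sub>W frag_of v = frag_of (word_mult K M u v)" by (simp add: W_simps)

lemma W_zero_closed: "0 el W" by (simp add: W_simps)

lemma W_diff_closed: "[|x el W; y el W|] ==> x - y el W"
 unfolding W_simps(1) by (rule frag_diff_closed)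

lemma W_mult_closed:
 assumes "x el W" "y el W"
 shows "x \<otimes>\<^sub>W y el W"
proof -
 have "Poly_Mapping.keys x \<subseteq> words K M" "Poly_Mapping.keys y \<subseteq> words K M"
  using assms by (simp_all add: W_simps)
 from this(1) show ?thesis
 proof (induction rule: frag_induction)
  case (one u)
  from \<open>Poly_Mapping.keys y \<subseteq> words K M\<close> show ?case
  proof (induction rule: frag_induction)
   case (one v)
   then show ?case using \<open>u : _\<close> word_mult_closed by (simp add: W_mult_of) (simp add: W_simps)
  qed (auto simp: W_mult_zero W_mult_diff W_zero_closed W_diff_closed)
 qed (auto simp: W_mult_zero W_mult_diff W_zero_closed W_diff_closed)
qed

lemma W_mult_assoc:
 assumes "x el W" "y el W" "z el W"
 shows "(x \<otimes>\<^sub>W y) \<otimes>\<^sub>W z = x \<otimes>\<^sub>W (y \<otimes>\<^sub>W z)"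
proof -
 have k: "Poly_Mapping.keys x \<subseteq> words K M" "Poly_Mapping.keys y \<subseteq> words K M" "Poly_Mapping.keys z \<subseteq> words K M"
  using assms by (simp_all add: W_simps)
 from k(1) show ?thesis
 proof (induction rule: frag_induction)
  case (one u)
  from k(2) show ?case
  proof (induction rule: frag_induction)
   case (one v)
   from k(3) show ?case
   proof (induction rule: frag_induction)
    case (one w)
    then show ?case using \<open>u : _\<close> \<open>v : _\<close> by (simp add: W_mult_of word_mult_assoc)
   qed (auto simp: W_mult_zero W_mult_diff)
  qed (auto simp: W_mult_zero W_mult_diff)
 qed (auto simp: W_mult_zero W_mult_diff)
qed

lemma abelian_group_W: "abelian_group W" by (rule abelian_group_frag) (simp_all add: W_simps)

lemma additive_subgroup_R: "additive_subgroup R W"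
 unfolding R_eq by (rule additive_subgroup_generate) (simp_all add: W_simps word_gens_carrier)

sublocale W: alg_quotient W R using abelian_group_W additive_subgroup_R by (rule alg_quotient.intro)

lemma R_gen: "g : word_gens ==> g : R" by (simp add: R_eq generate.incl)

lemma R_diff: "[|x : R; y : R|] ==> x - y : R"
 unfolding R_eq by (rule generate_frag_diff[OF word_gens_carrier])

lemma R_zero: "0 : R" unfolding R_eq by (rule generate_frag_zero)

text \<open>A word times a generator is a single generator again. If the first letter is not the one
  concerned, it merely absorbs the scalar \<open>ka'\<close> of the word; otherwise
  \<open>ka'\<close> is distributed over the relation by additivity of \<open>lact\<close> or moved
  through it by \<open>lact_act\<close>.\<close>

lemma word_mult_gen_l:
 assumes "u' : lists (carrier M)" "ka' el K" "g : word_gens"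
 shows "frag_of (u', ka') \<otimes>\<^sub>W g : word_gens" using assms(3)
proof (cases rule: word_gens_cases)
 case (add u X Y v ka)
 then show ?thesis using assms word_gensI(1)[of u' v "lact K M ka' X" "lact K M ka' Y" ka]
   word_gensI(1)[of "u' @ lact K M ka' (hd u) # tl u" v X Y ka]
  by (cases u) (auto simp: W_mult_diff W_mult_of lact_add_right)
next
 case (scalar u ka kb)
 then show ?thesis
  using assms word_gensI(2)[of u' "ka' \<otimes>\<^sub>K ka" "ka' \<otimes>\<^sub>K kb"]
   word_gensI(2)[of "u' @ lact K M ka' (hd u) # tl u" ka kb]
  by (cases u) (auto simp: W_mult_diff W_mult_of K.r_distr)
next
 case (balanced u X Y v ka kb)
 then show ?thesis using assms word_gensI(3)[of u' v "lact K M ka' X" Y ka kb]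
   word_gensI(3)[of "u' @ lact K M ka' (hd u) # tl u" v X Y ka kb]
  by (cases u) (auto simp: W_mult_diff W_mult_of lact_act)
next
 case (last u X ka kb)
 then show ?thesis using assms word_gensI(4)[of u' "lact K M ka' X" ka kb]
   word_gensI(4)[of "u' @ lact K M ka' (hd u) # tl u" X ka kb]
  by (cases u) (auto simp: W_mult_diff W_mult_of lact_act)
qed

text \<open>In front of a nonempty word a relation may change its kind: additivity in the scalar
  becomes additivity in the letter that receives the scalar, and the relation for a last letter
  becomes the balancing relation for two neighbours.\<close>

lemma word_mult_gen_r:
 assumes "v' : lists (carrier M)" "kb' el K" "g : word_gens"
 shows "g \<otimes>\<^sub>W frag_of (v', kb') : word_gens" using assms(3)
proof (cases rule: word_gens_cases)
 case (add u X Y v ka)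
 then show ?thesis using assms word_gensI(1)[of u v X Y "ka \<otimes>\<^sub>K kb'"]
   word_gensI(1)[of u "v @ lact K M ka (hd v') # tl v'" X Y kb']
  by (cases v') (auto simp: W_mult_diff W_mult_of)
next
 case (scalar u ka kb)
 then show ?thesis
  using assms word_gensI(2)[of u "ka \<otimes>\<^sub>K kb'" "kb \<otimes>\<^sub>K kb'"]
   word_gensI(1)[of u "tl v'" "lact K M ka (hd v')" "lact K M kb (hd v')" kb']
  by (cases v') (auto simp: W_mult_diff W_mult_of K.l_distr lact_add_left)
next
 case (balanced u X Y v ka kb)
 then show ?thesis using assms word_gensI(3)[of u v X Y "ka \<otimes>\<^sub>K kb'" kb]
   word_gensI(3)[of u "v @ lact K M ka (hd v') # tl v'" X Y kb' kb]
  by (cases v') (auto simp: W_mult_diff W_mult_of)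
next
 case (last u X ka kb)
 then show ?thesis using assms word_gensI(4)[of u X "ka \<otimes>\<^sub>K kb'" kb]
   word_gensI(3)[of u "tl v'" X "lact K M ka (hd v')" kb' kb]
  by (cases v') (auto simp: W_mult_diff W_mult_of K.m_assoc lact_lact)
qed

lemma R_absorb:
 assumes "x el W" "i : R"
 shows "x \<otimes>\<^sub>W i : R" "i \<otimes>\<^sub>W x : R"
proof -
 have k: "Poly_Mapping.keys x \<subseteq> words K M" using assms by (simp add: W_simps)
 have i: "i : generate (free_Abelian_group (words K M)) word_gens" using assms(2) by (simp add: R_eq)
 from k show "x \<otimes>\<^sub>W i : R"
 proof (induction rule: frag_induction)
  case (one u)
  from i word_gens_carrier show ?case by (induction rule: generate_frag_induct)
    (use one in \<open>auto simp: words_def W_mult_zero W_mult_diff R_zero R_diff intro: R_gen word_mult_gen_l\<close>)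
 qed (auto simp: W_mult_zero W_mult_diff R_zero R_diff)
 from k show "i \<otimes>\<^sub>W x : R"
 proof (induction rule: frag_induction)
  case (one u)
  from i word_gens_carrier show ?case by (induction rule: generate_frag_induct)
    (use one in \<open>auto simp: words_def W_mult_zero W_mult_diff R_zero R_diff intro: R_gen word_mult_gen_r\<close>)
 qed (auto simp: W_mult_zero W_mult_diff R_zero R_diff)
qed

lemma addmap_W_mult:
 assumes "x el W"
 shows "addmap W W (%y. x \<otimes>\<^sub>W y)" "addmap W W (%y. y \<otimes>\<^sub>W x)"
 by (rule addmapI; use assms in \<open>simp add: W_mult_closed W_simps(2) W_mult_add\<close>)+

lemma W_one:
 assumes "x el W"
 shows "\<one>\<^sub>W el W" "\<one>\<^sub>W \<otimes>\<^sub>W x = x" "x \<otimes>\<^sub>W \<one>\<^sub>W = x"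
proof -
 show "\<one>\<^sub>W el W" by (simp add: W_simps words_def)
 have k: "Poly_Mapping.keys x \<subseteq> words K M" using assms by (simp add: W_simps)
 then show "\<one>\<^sub>W \<otimes>\<^sub>W x = x"
  by (induction rule: frag_induction) (auto simp: W_mult_zero W_mult_diff W_simps(4) W_mult_of word_mult_one)
 from k show "x \<otimes>\<^sub>W \<one>\<^sub>W = x"
  by (induction rule: frag_induction) (auto simp: W_mult_zero W_mult_diff W_simps(4) W_mult_of word_mult_one)
qed

lemma T_eq: "T = W.Q" by (simp add: tensor_alg_def)

lemma ring_T: "ring T" unfolding T_eq
 by (rule W.ring_Q) (auto simp: addmap_W_mult R_absorb W_mult_assoc W_one W_one(1)[OF W_zero_closed])

definition tw :: "'m list => 'k => ('k, 'm) tens" where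
 "tw u ka = W.cls (frag_of (u, ka))"

lemma frag_of_W: "frag_of (u, ka) el W \<longleftrightarrow> u : lists (carrier M) & ka el K"
 by (simp add: W_simps words_def)

lemma tw_closed [simp]: "[|u : lists (carrier M); ka el K|] ==> tw u ka el T"
 by (simp add: tw_def T_eq frag_of_W)

lemma cls_diff: "[|x el W; y el W|] ==> W.cls (x - y) = W.cls x \<ominus>\<^sub>T W.cls y"
 unfolding T_eq by (rule addmap_frag_diff[OF abelian_group_W W.abelian_group_Q W.addmap_cls]) (simp_all add: W_simps)

lemma cls_rel0: "g : word_gens ==> W.cls g = \<zero>\<^sub>T"
 unfolding T_eq using R_gen[of g] word_gens_carrier W.cls_zero_iff[of g]
 by (auto simp: W_simps(1) simp del: carrier_free_Abelian_group_iff)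

lemma cls_rel:
 assumes "a - b : word_gens" "a el W" "b el W"
 shows "W.cls a = W.cls b"
proof -
 interpret T: ring T by (rule ring_T)
 have "W.cls a \<ominus>\<^sub>T W.cls b = \<zero>\<^sub>T"
  using cls_rel0[OF assms(1)] assms by (simp add: cls_diff)
 then show ?thesis using assms W.cls_closed by (simp add: T_eq[symmetric] T.minus_eq_zero_iff)
qed

lemma cls_rel2:
 assumes "a - b - c : word_gens" "a el W" "b el W" "c el W"
 shows "W.cls a = W.cls b \<oplus>\<^sub>T W.cls c"
proof -
 interpret T: ring T by (rule ring_T)
 have c: "W.cls a el T" "W.cls b el T" "W.cls c el T"
  using assms W.cls_closed by (simp_all add: T_eq)
 have "W.cls a \<ominus>\<^sub>T W.cls b \<ominus>\<^sub>T W.cls c = \<zero>\<^sub>T"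
  using cls_rel0[OF assms(1)] assms by (simp add: cls_diff W_diff_closed)
 then have "W.cls a \<ominus>\<^sub>T (W.cls b \<oplus>\<^sub>T W.cls c) = \<zero>\<^sub>T"
  using c by (simp add: T.minus_eq T.minus_add T.a_ac)
 then show ?thesis using c by (simp add: T.minus_eq_zero_iff)
qed

lemma tw_add:
 assumes "u : lists (carrier M)" "v : lists (carrier M)" "X el M" "Y el M" "ka el K"
 shows "tw (u @ (X \<oplus>\<^sub>M Y) # v) ka = tw (u @ X # v) ka \<oplus>\<^sub>T tw (u @ Y # v) ka"
 unfolding tw_def by (rule cls_rel2[OF word_gensI(1)]) (use assms in \<open>auto simp: frag_of_W\<close>)

lemma tw_add_scalar:
 assumes "u : lists (carrier M)" "ka el K" "kb el K"
 shows "tw u (ka \<oplus>\<^sub>K kb) = tw u ka \<oplus>\<^sub>T tw u kb"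
 unfolding tw_def by (rule cls_rel2[OF word_gensI(2)]) (use assms in \<open>auto simp: frag_of_W\<close>)

lemma tw_balanced:
 assumes "u : lists (carrier M)" "v : lists (carrier M)" "X el M" "Y el M"
  "ka el K" "kb el K"
 shows "tw (u @ act M X kb # Y # v) ka = tw (u @ X # lact K M kb Y # v) ka"
 unfolding tw_def by (rule cls_rel[OF word_gensI(3)]) (use assms in \<open>auto simp: frag_of_W act_closed\<close>)

lemma tw_last:
 assumes "u : lists (carrier M)" "X el M" "ka el K" "kb el K"
 shows "tw (u @ [act M X kb]) ka = tw (u @ [X]) (kb \<otimes>\<^sub>K ka)"
 unfolding tw_def by (rule cls_rel[OF word_gensI(4)]) (use assms in \<open>auto simp: frag_of_W act_closed\<close>)

lemma T_mult_cls:
 "[|x el W; y el W|] ==> W.cls x \<otimes>\<^sub>T W.cls y = W.cls (x \<otimes>\<^sub>W y)"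
 unfolding T_eq by (rule W.cls_mult) (auto simp: addmap_W_mult R_absorb)

lemma tw_mult_Nil:
 "[|u : lists (carrier M); ka el K; kb el K|] ==>
  tw u ka \<otimes>\<^sub>T tw [] kb = tw u (ka \<otimes>\<^sub>K kb)"
 unfolding tw_def by (subst T_mult_cls) (auto simp: frag_of_W W_mult_of)

lemma tw_mult_Cons:
 "[|u : lists (carrier M); v : lists (carrier M); X el M; ka el K; kb el K|] ==>
  tw u ka \<otimes>\<^sub>T tw (X # v) kb = tw (u @ lact K M ka X # v) kb"
 unfolding tw_def by (subst T_mult_cls) (auto simp: frag_of_W W_mult_of)

lemma tw_mult_one:
 "[|u : lists (carrier M); v : lists (carrier M); kb el K|] ==>
  tw u \<one>\<^sub>K \<otimes>\<^sub>T tw v kb = tw (u @ v) kb"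
 by (cases v) (auto simp: tw_mult_Nil tw_mult_Cons)

lemma T_one: "\<one>\<^sub>T = tw [] \<one>\<^sub>K" by (simp add: T_eq W.one_Q W_simps tw_def)

lemma tw_uminus_scalar:
 assumes "u : lists (carrier M)" "ka el K"
 shows "tw u (\<ominus>\<^sub>K ka) = \<ominus>\<^sub>T tw u ka"
proof -
 interpret T: ring T by (rule ring_T)
 have "addmap K T (tw u)" using assms by (intro addmapI) (auto simp: tw_add_scalar)
 then show ?thesis by (rule addmap_minus[OF K.ag T.ag _ assms(2)])
qed

lemma tw_zero_scalar:
 assumes "u : lists (carrier M)"
 shows "tw u \<zero>\<^sub>K = \<zero>\<^sub>T"
proof -
 interpret T: ring T by (rule ring_T)
 have "addmap K T (tw u)" using assms by (intro addmapI) (auto simp: tw_add_scalar)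
 then show ?thesis by (rule addmap_zero[OF K.ag T.ag])
qed

lemma T_induct [consumes 1, case_names word add]:
 assumes "x el T"
  and "!!u ka. [|u : lists (carrier M); ka el K|] ==> P (tw u ka)"
  and "!!x y. [|x el T; y el T; P x; P y|] ==> P (x \<oplus>\<^sub>T y)"
 shows "P x"
proof -
 interpret T: ring T by (rule ring_T)
 obtain c where c: "c el W" "x = W.cls c" using assms(1) W.cls_cases by (auto simp: T_eq)
 have "Poly_Mapping.keys c \<subseteq> words K M" using c by (simp add: W_simps)
 \<comment> \<open>Formal combinations are built by differences while \<open>P\<close> is closed
   under sums, so the negative is carried along. The negative of a word is a word with negated
   scalar.\<close>
 then have "c el W & P (W.cls c) & P (\<ominus>\<^sub>T W.cls c)"
 proof (induction rule: frag_induction)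
  case zero
  have "W.cls 0 = tw [] \<zero>\<^sub>K" using W.cls_zero by (simp add: tw_zero_scalar W_simps T_eq)
  moreover have "\<ominus>\<^sub>T tw [] \<zero>\<^sub>K = tw [] \<zero>\<^sub>K"
   by (simp add: tw_zero_scalar)
  ultimately show ?case using assms(2)[of "[]" "\<zero>\<^sub>K"] by (simp add: W_simps)
 next
  case (one w)
  then obtain u ka where "w = (u, ka)" "u : lists (carrier M)" "ka el K"
   by (auto simp: words_def)
  then show ?case using assms(2)[of u ka] assms(2)[of u "\<ominus>\<^sub>K ka"]
   by (simp add: frag_of_W tw_uminus_scalar tw_def[symmetric])
 next
  case (diff a b)
  then have "W.cls a el T" "W.cls b el T" by (simp_all add: T_eq)
  then show ?case
   using diff assms(3)[of "W.cls a" "\<ominus>\<^sub>T W.cls b"] assms(3)[of "\<ominus>\<^sub>T W.cls a" "W.cls b"]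
   by (simp add: W_diff_closed cls_diff T.minus_eq T.minus_add)
 qed
 then show ?thesis using c by simp
qed

lemma act_tw:
 assumes "u : lists (carrier M)" "ka el K" "kb el K"
 shows "act T (tw u ka) kb = tw u (ka \<otimes>\<^sub>K kb)"
proof -
 have e: "act W x kb = x \<otimes>\<^sub>W frag_of ([], kb)" for x
 proof (induction x rule: frag_induction[OF subset_UNIV])
  case (2 w)
  then show ?case by (cases w) (simp add: W_simps)
 qed (auto simp: W_simps frag_extend_diff)
 have b: "frag_of ([], kb) el W" using assms by (simp add: frag_of_W)
 have "act T (tw u ka) kb = W.cls (act W (frag_of (u, ka)) kb)" unfolding T_eq tw_def
  by (rule W.act_cls) (use assms b in \<open>auto simp: e addmap_W_mult R_absorb frag_of_W\<close>)
 then show ?thesis by (simp add: tw_def W_simps)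
qed

lemma act_T: "[|x el T; kb el K|] ==> act T x kb = x \<otimes>\<^sub>T tw [] kb"
proof -
 interpret T: ring T by (rule ring_T)
 assume x: "x el T" and kb: "kb el K"
 have e: "act W x kb = x \<otimes>\<^sub>W frag_of ([], kb)" for x
 proof (induction x rule: frag_induction[OF subset_UNIV])
  case (2 w)
  then show ?case by (cases w) (simp add: W_simps)
 qed (auto simp: W_simps frag_extend_diff)
 have b: "frag_of ([], kb) el W" using kb by (simp add: frag_of_W)
 obtain c where c: "c el W" "x = W.cls c" using x W.cls_cases by (auto simp: T_eq)
 have "act T (W.cls c) kb = W.cls (act W c kb)"
  unfolding T_eq by (rule W.act_cls) (use c b in \<open>auto simp: e addmap_W_mult R_absorb\<close>)
 then show ?thesis using c b by (simp add: e T_mult_cls tw_def)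
qed

end

text \<open>The parity is stored next to each letter because the letter does not determine it: zero
  is homogeneous of both parities.\<close>

definition hwords :: "('m, 'x) superring_scheme => (bit \<times> 'm) list set" where
 "hwords M = {w. \<forall>(p, X) \<in> set w. X : grade M p}"

definition wpar :: "(bit \<times> 'm) list => bit" where
 "wpar w = sum_list (map fst w)"

lemma hwords_Nil [simp]: "[] : hwords M" by (simp add: hwords_def)

lemma hwords_Cons [simp]: "Z # w : hwords M \<longleftrightarrow> snd Z : grade M (fst Z) & w : hwords M"
 by (auto simp: hwords_def case_prod_beta)

lemma hwords_append [simp]: "v @ w : hwords M \<longleftrightarrow> v : hwords M & w : hwords M"
 by (induction v) auto

lemma wpar_simps [simp]: "wpar [] = 0" "wpar (Z # w) = fst Z + wpar w" "wpar (v @ w) = wpar v + wpar w"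
 by (simp_all add: wpar_def)

lemma (in super_group) hwords_lists: "w : hwords A ==> map snd w : lists (carrier A)"
 by (induction w) auto

lemma list_all2_hwords:
 "list_all2 (%X p. X : grade M p) u ps \<longleftrightarrow> (EX w:hwords M. u = map snd w & ps = map fst w)"
proof
 assume "list_all2 (%X p. X : grade M p) u ps"
 then have "zip ps u : hwords M & u = map snd (zip ps u) & ps = map fst (zip ps u)"
  by (induction rule: list_all2_induct) auto
 then show "EX w:hwords M. u = map snd w & ps = map fst w" by blast
next
 assume "EX w:hwords M. u = map snd w & ps = map fst w"
 then obtain w where "w : hwords M" "u = map snd w" "ps = map fst w" by blast
 then show "list_all2 (%X p. X : grade M p) u ps" by (induction w arbitrary: u ps) auto
qed

text \<open>The unit 2 is used in two places: in \<open>T_double_zero\<close>, by which the two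
  grades of T(M) meet only in 0, and in \<open>sym_ideal_shortening\<close>, where the square of an
  odd generator of U(gg) is expressed as half a bracket.\<close>

locale half_supermodule = supermodule K M
 for K :: "('k, 'x) superring_scheme" and M :: "('k, 'm, 'y) supermodule_scheme" +
 assumes half: "nat_unit K 2"
begin

lemma half_obtain:
 obtains h where "h el K" "(\<one>\<^sub>K \<oplus>\<^sub>K \<one>\<^sub>K) \<otimes>\<^sub>K h = \<one>\<^sub>K"
proof -
 have "[(2::nat)] \<cdot>\<^sub>K \<one>\<^sub>K = \<one>\<^sub>K \<oplus>\<^sub>K \<one>\<^sub>K"
  by (simp add: numeral_2_eq_2)
 then have "\<one>\<^sub>K \<oplus>\<^sub>K \<one>\<^sub>K : Units K"
  using half by (simp add: nat_unit_def)
 then show ?thesis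
  using that[of "inv\<^bsub>K\<^esub> (\<one>\<^sub>K \<oplus>\<^sub>K \<one>\<^sub>K)"] by simp
qed

lemma T_double_zero:
 assumes "x el T" "x \<oplus>\<^sub>T x = \<zero>\<^sub>T"
 shows "x = \<zero>\<^sub>T"
proof -
 interpret T: ring T by (rule ring_T)
 obtain h where h: "h el K" "(\<one>\<^sub>K \<oplus>\<^sub>K \<one>\<^sub>K) \<otimes>\<^sub>K h = \<one>\<^sub>K"
  by (rule half_obtain)
 have "x = x \<otimes>\<^sub>T tw [] ((\<one>\<^sub>K \<oplus>\<^sub>K \<one>\<^sub>K) \<otimes>\<^sub>K h)"
  using assms(1) by (simp add: h T_one[symmetric])
 also have "... = x \<otimes>\<^sub>T ((\<one>\<^sub>T \<oplus>\<^sub>T \<one>\<^sub>T) \<otimes>\<^sub>T tw [] h)"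
  using h(1) by (simp add: T_one tw_add_scalar[symmetric] tw_mult_Nil)
 also have "... = (x \<oplus>\<^sub>T x) \<otimes>\<^sub>T tw [] h"
  using assms(1) h(1) by (simp add: T.m_assoc[symmetric] T.r_distr)
 finally show ?thesis using assms(2) h(1) by simp
qed

section \<open>The grading of the tensor algebra\<close>

definition hom_gens where
 "hom_gens r = {frag_of (u, ka) | u ka ps q. list_all2 (%X p. X : grade M p) u ps &
     ka : grade K q & sum_list ps + q = r}"

lemma hom_gens_iff: "g : hom_gens r \<longleftrightarrow>
  (EX w ka. w : hwords M & ka : grade K (wpar w + r) & g = frag_of (map snd w, ka))"
proof -
 have e: "p + q = r \<longleftrightarrow> q = p + r" for p q :: bit by (cases p; cases q; cases r) auto
 show ?thesis unfolding hom_gens_def list_all2_hwords e by (auto simp: wpar_def)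
qed

lemma grade_T: "grade T r = W.cls ` generate (free_Abelian_group (words K M)) (hom_gens r)"
 unfolding T_eq W.grade_Q by (simp add: word_alg_def hom_gens_def)

lemma hom_gens_carrier: "hom_gens r \<subseteq> carrier (free_Abelian_group (words K M))"
proof
 fix g assume "g : hom_gens r"
 then obtain w ka where "w : hwords M" "ka el K" "g = frag_of (map snd w, ka)"
  unfolding hom_gens_iff using K.grade_carrier by blast
 then show "g el (free_Abelian_group (words K M))" using M.hwords_lists[of w] by (simp add: words_def)
qed

lemma grade_W_carrier: "generate (free_Abelian_group (words K M)) (hom_gens r) \<subseteq> carrier W"
 using subgroup.subset[OF generate_frag_subgroup[OF hom_gens_carrier]] by (simp add: W_simps)

lemma grade_T_carrier: "x : grade T r ==> x el T"
 using grade_W_carrier W.cls_closed unfolding grade_T by (auto simp: T_eq)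

lemma tw_grade:
 assumes "w : hwords M" "ka : grade K q"
 shows "tw (map snd w) ka : grade T (wpar w + q)"
proof -
 have "frag_of (map snd w, ka) : hom_gens (wpar w + q)"
  using assms unfolding hom_gens_iff by (intro exI[of _ w] exI[of _ ka]) auto
 then show ?thesis unfolding grade_T tw_def by (intro imageI generate.incl)
qed

lemma grade_T_diff:
 assumes "x : grade T r" "y : grade T r"
 shows "x \<ominus>\<^sub>T y : grade T r"
proof -
 obtain a b where ab: "a : generate (free_Abelian_group (words K M)) (hom_gens r)" "x = W.cls a"
  "b : generate (free_Abelian_group (words K M)) (hom_gens r)" "y = W.cls b" using assms by (auto simp: grade_T)
 then have "x \<ominus>\<^sub>T y = W.cls (a - b)" using grade_W_carrier by (auto simp: cls_diff subset_iff)
 then show ?thesis using generate_frag_diff[OF hom_gens_carrier ab(1,3)] by (auto simp: grade_T)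
qed

lemma grade_T_zero: "\<zero>\<^sub>T : grade T r"
proof -
 have "W.cls 0 : grade T r" unfolding grade_T by (intro imageI generate_frag_zero)
 then show ?thesis using W.cls_zero by (simp add: W_simps T_eq)
qed

lemma grade_T_induct [consumes 1, case_names word diff]:
 assumes "x : grade T r"
  and "!!w ka. [|w : hwords M; ka : grade K (wpar w + r)|] ==> P (tw (map snd w) ka)"
  and "!!x y. [|x : grade T r; y : grade T r; P x; P y|] ==> P (x \<ominus>\<^sub>T y)"
 shows "P x"
proof -
 obtain c where c: "c : generate (free_Abelian_group (words K M)) (hom_gens r)" "x = W.cls c"
  using assms(1) by (auto simp: grade_T)
 have "P (W.cls c)" using c(1) hom_gens_carrier
 proof (induction rule: generate_frag_induct)
  case zero
  have "W.cls 0 = tw (map snd []) \<zero>\<^sub>K" using W.cls_zero by (simp add: tw_zero_scalar W_simps T_eq)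
  then show ?case using assms(2)[of "[]" "\<zero>\<^sub>K"] by simp
 next
  case (gen g)
  then show ?case using assms(2) by (auto simp: hom_gens_iff tw_def)
 next
  case (diff a b)
  then have "W.cls (a - b) = W.cls a \<ominus>\<^sub>T W.cls b" using grade_W_carrier by (intro cls_diff) auto
  then show ?case using diff assms(3) by (auto simp: grade_T)
 qed
 then show ?thesis using c by simp
qed

lemma tw_ksign:
 assumes "u : lists (carrier M)" "v : lists (carrier M)" "X el M" "ka el K"
 shows "tw (u @ ksign M p X # v) ka = ksign T p (tw (u @ X # v) ka)"
proof -
 interpret T: ring T by (rule ring_T)
 have "addmap M T (%X. tw (u @ X # v) ka)" using assms by (intro addmapI) (auto simp: tw_add)
 from addmap_ksign[OF M.ag T.ag this assms(3)]
 show ?thesis .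
qed

lemma tw_ksign_scalar:
 assumes "u : lists (carrier M)" "ka el K"
 shows "tw u (ksign K p ka) = ksign T p (tw u ka)" using assms by (simp add: ksign_def tw_uminus_scalar)

text \<open>The parity involution exists on \<open>T\<close>; since 2 is invertible it separates the two grades.\<close>

definition pfrag where
 "pfrag = frag_extend (%(u, ka). frag_of (map (pinv M) u, pinv K ka))"

lemma pinv_lists: "u : lists (carrier M) ==> map (pinv M) u : lists (carrier M)" by (induction u) auto

lemma pfrag_gen:
 assumes "g : word_gens"
 shows "pfrag g : word_gens" using assms
proof (cases rule: word_gens_cases)
 case (add u X Y v ka)
 then show ?thesis
  using pinv_lists word_gensI(1)[of "map (pinv M) u" "map (pinv M) v" "pinv M X" "pinv M Y" "pinv K ka"]
  by (simp add: pfrag_def frag_extend_diff M.pinv_add)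
next
 case (scalar u ka kb)
 then show ?thesis using pinv_lists word_gensI(2)[of "map (pinv M) u" "pinv K ka" "pinv K kb"]
  by (simp add: pfrag_def frag_extend_diff K.pinv_add)
next
 case (balanced u X Y v ka kb)
 then show ?thesis
  using pinv_lists word_gensI(3)[of "map (pinv M) u" "map (pinv M) v" "pinv M X" "pinv M Y" "pinv K ka" "pinv K kb"]
  by (simp add: pfrag_def frag_extend_diff pinv_act pinv_lact)
next
 case (last u X ka kb)
 then show ?thesis using pinv_lists word_gensI(4)[of "map (pinv M) u" "pinv M X" "pinv K ka" "pinv K kb"]
  by (simp add: pfrag_def frag_extend_diff pinv_act K.pinv_mult)
qed

lemma parity_involution:
 obtains g where "addmap T T g" "!!r x. x : grade T r ==> g x = ksign T r x"
proof -
 interpret T: ring T by (rule ring_T)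
 have c: "pfrag x el W" if x: "x el W" for x
 proof -
  from x have "Poly_Mapping.keys x \<subseteq> words K M" by (simp add: W_simps)
  then show ?thesis
  proof (induction rule: frag_induction)
   case (one w)
   then show ?case by (auto simp: pfrag_def words_def frag_of_W)
  qed (auto simp: pfrag_def frag_extend_diff W_diff_closed W_zero_closed)
 qed
 have add: "addmap W T (%x. W.cls (pfrag x))"
  by (rule addmapI) (use c in \<open>auto simp: T_eq W_simps(2) pfrag_def frag_extend_add W.cls_add[unfolded W_simps(2)]\<close>)
 have zero: "W.cls (pfrag x) = \<zero>\<^sub>T" if x: "x : R" for x
 proof -
  have "pfrag x : R" using x word_gens_carrier unfolding R_eq
  proof (induction rule: generate_frag_induct)
   case (gen g)
   then show ?case by (intro generate.incl pfrag_gen)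
  qed (auto simp: pfrag_def frag_extend_diff intro: generate_frag_zero generate_frag_diff[OF word_gens_carrier])
  then show ?thesis using W.cls_zero_iff[of "pfrag x"] W.I.a_Hcarr by (simp add: T_eq)
 qed
 define g where "g = qlift W R (%x. W.cls (pfrag x))"
 have g: "addmap T T g" "!!x. x el W ==> g (W.cls x) = W.cls (pfrag x)"
  using W.addmap_qlift[OF T.ag add zero]
   W.qlift_cls[OF T.ag add zero] by (simp_all add: g_def T_eq)
 have tw: "g (tw u ka) = tw (map (pinv M) u) (pinv K ka)" if "u : lists (carrier M)" "ka el K" for u ka
  using that by (simp add: tw_def g(2) frag_of_W pfrag_def)
 have hw: "tw (v @ map (pinv M) (map snd w)) ka = ksign T (wpar w) (tw (v @ map snd w) ka)"
  if "v : lists (carrier M)" "w : hwords M" "ka el K" for v w ka using that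
 proof (induction w arbitrary: v)
  case (Cons Z w)
  have Z: "snd Z : grade M (fst Z)" "w : hwords M" "snd Z el M" using Cons.prems by auto
  have l: "map snd w : lists (carrier M)" using Cons.prems M.hwords_lists[of w] by simp
  then have l': "map (pinv M) (map snd w) : lists (carrier M)" by (induction w) auto
  have "tw (v @ map (pinv M) (map snd (Z # w))) ka =
    tw (v @ ksign M (fst Z) (snd Z) # map (pinv M) (map snd w)) ka"
   using Z by (simp add: M.pinv_homogeneous[of _ "fst Z"])
  also have "... = ksign T (fst Z) (tw ((v @ [snd Z]) @ map (pinv M) (map snd w)) ka)"
   using Cons.prems l l' Z by (subst tw_ksign) (simp_all del: map_map)
  also have "... = ksign T (fst Z) (ksign T (wpar w) (tw ((v @ [snd Z]) @ map snd w) ka))"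
   using Cons.prems Z by (subst Cons.IH) simp_all
  finally show ?case using Cons.prems l Z by simp
 qed simp
 have "g x = ksign T r x" if "x : grade T r" for r x using that
 proof (induction rule: grade_T_induct)
  case (word w ka)
  have l: "map snd w : lists (carrier M)" using word M.hwords_lists by blast
  then show ?case using word hw[of "[]" w "pinv K ka"]
   by (simp add: tw K.pinv_homogeneous tw_ksign_scalar flip: map_map)
 next
  case (diff x y)
  then show ?case using grade_T_carrier[OF diff(1)] grade_T_carrier[OF diff(2)]
   by (simp add: addmap_add[OF g(1)] addmap_minus[OF T.ag T.ag g(1)]
     T.minus_eq T.ksign_add T.ksign_uminus)
 qed
 then show ?thesis using g(1) that by blast
qed

text \<open>The letters are split into their components one after the other; \<open>v\<close>
  collects those already homogeneous, and the scalar is split last.\<close>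

lemma tw_split:
 assumes "v : hwords M" "u : lists (carrier M)" "ka el K"
 shows "EX y:grade T 0. EX z:grade T 1. tw (map snd v @ u) ka = y \<oplus>\<^sub>T z"
proof -
 interpret T: ring T by (rule ring_T)
 have um: "\<ominus>\<^sub>T x : grade T r" if "x : grade T r" for x r
  using grade_T_diff[OF grade_T_zero that] grade_T_carrier[OF that] by (simp add: T.minus_eq)
 have ad: "x \<oplus>\<^sub>T y : grade T r" if "x : grade T r" "y : grade T r" for x y r
  using grade_T_diff[OF that(1) um[OF that(2)]] grade_T_carrier[OF that(1)] grade_T_carrier[OF that(2)]
  by (simp add: T.minus_eq)
 have comb: "EX y:grade T 0. EX z:grade T 1. a \<oplus>\<^sub>T b = y \<oplus>\<^sub>T z"
  if ab: "EX y:grade T 0. EX z:grade T 1. a = y \<oplus>\<^sub>T z"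
   "EX y:grade T 0. EX z:grade T 1. b = y \<oplus>\<^sub>T z" for a b
 proof -
  obtain y z y' z' where e: "y : grade T 0" "z : grade T 1" "a = y \<oplus>\<^sub>T z"
   "y' : grade T 0" "z' : grade T 1" "b = y' \<oplus>\<^sub>T z'" using ab by blast
  then have "a \<oplus>\<^sub>T b = (y \<oplus>\<^sub>T y') \<oplus>\<^sub>T (z \<oplus>\<^sub>T z')"
   using grade_T_carrier by (simp add: T.add_4_swap)
  then show ?thesis using e ad by blast
 qed
 show ?thesis using assms
 proof (induction u arbitrary: v)
  case Nil
  have l: "map snd v : lists (carrier M)" using Nil M.hwords_lists by blast
  have h: "EX y:grade T 0. EX z:grade T 1. tw (map snd v) kb = y \<oplus>\<^sub>T z"
   if "kb : grade K q" for kb q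
  proof (cases "wpar v + q")
   assume "wpar v + q = 0"
   then have "tw (map snd v) kb : grade T 0" using tw_grade[OF Nil(1) that] by simp
   then show ?thesis using grade_T_zero grade_T_carrier by (metis T.r_zero)
  next
   assume "wpar v + q = 1"
   then have "tw (map snd v) kb : grade T 1" using tw_grade[OF Nil(1) that] by simp
   then show ?thesis using grade_T_zero grade_T_carrier by (metis T.l_zero)
  qed
  have "tw (map snd v) ka = tw (map snd v) (hcomp K 0 ka) \<oplus>\<^sub>T tw (map snd v) (hcomp K 1 ka)"
   using l Nil by (subst tw_add_scalar[symmetric]) (auto simp: K.hcomp_sum)
  moreover have "EX y:grade T 0. EX z:grade T 1.
    tw (map snd v) (hcomp K 0 ka) \<oplus>\<^sub>T tw (map snd v) (hcomp K 1 ka) = y \<oplus>\<^sub>T z"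
   using Nil by (intro comb h[OF K.hcomp_grade])
  ultimately show ?case by simp
 next
  case (Cons X u)
  have l: "map snd v : lists (carrier M)" using Cons M.hwords_lists by blast
  have "tw (map snd v @ X # u) ka =
   tw (map snd v @ hcomp M 0 X # u) ka \<oplus>\<^sub>T tw (map snd v @ hcomp M 1 X # u) ka"
   using l Cons.prems by (subst tw_add[symmetric]) (auto simp: M.hcomp_sum)
  then show ?case using comb Cons.IH[of "v @ [(0, hcomp M 0 X)]"] Cons.IH[of "v @ [(1, hcomp M 1 X)]"] Cons.prems by simp
 qed
qed

lemma super_group_T: "super_group T"
proof -
 interpret T: ring T by (rule ring_T)
 have um: "\<ominus>\<^sub>T x : grade T r" if "x : grade T r" for x r
  using grade_T_diff[OF grade_T_zero that] grade_T_carrier[OF that] by (simp add: T.minus_eq)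
 have ad: "x \<oplus>\<^sub>T y : grade T r" if "x : grade T r" "y : grade T r" for x y r
  using grade_T_diff[OF that(1) um[OF that(2)]] grade_T_carrier[OF that(1)] grade_T_carrier[OF that(2)]
  by (simp add: T.minus_eq)
 have dec: "EX y:grade T 0. EX z:grade T 1. x = y \<oplus>\<^sub>T z" if "x el T" for x
  using that
 proof (induction rule: T_induct)
  case (word u ka)
  then show ?case using tw_split[of "[]"] by simp
 next
  case (add a b)
  then obtain y z y' z' where e: "y : grade T 0" "z : grade T 1" "a = y \<oplus>\<^sub>T z"
   "y' : grade T 0" "z' : grade T 1" "b = y' \<oplus>\<^sub>T z'" by blast
  then have "a \<oplus>\<^sub>T b = (y \<oplus>\<^sub>T y') \<oplus>\<^sub>T (z \<oplus>\<^sub>T z')"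
   using grade_T_carrier by (simp add: T.add_4_swap)
  then show ?case using e ad by blast
 qed
 obtain g where g: "addmap T T g" "!!r x. x : grade T r ==> g x = ksign T r x"
  using parity_involution by blast
 have int: "x = \<zero>\<^sub>T" if x: "x : grade T 0" "x : grade T 1" for x
 proof -
  \<comment> \<open>On an element of both grades the parity involution is the identity and also the
    negation.\<close>
  have "x = \<ominus>\<^sub>T x" using g(2)[OF x(1)] g(2)[OF x(2)] by (simp add: T.ksign_1)
  then have "x \<oplus>\<^sub>T x = \<zero>\<^sub>T" using grade_T_carrier[OF x(1)] by (metis T.l_neg)
  then show ?thesis using T_double_zero grade_T_carrier[OF x(1)] by blast
 qed
 show ?thesis
 proof (intro super_group.intro super_group_axioms.intro T.ag)
  show "additive_subgroup (grade T p) T" for p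
   by (rule T.additive_subgroupI') (use um ad grade_T_zero grade_T_carrier in auto)
  show "grade T 0 <+>\<^sub>T grade T 1 = carrier T"
  proof
   show "grade T 0 <+>\<^sub>T grade T 1 \<subseteq> carrier T"
    unfolding set_add_def' using grade_T_carrier by auto
   show "carrier T \<subseteq> grade T 0 <+>\<^sub>T grade T 1" unfolding set_add_def' using dec by blast
  qed
  show "grade T 0 \<inter> grade T 1 = {\<zero>\<^sub>T}" using int grade_T_zero by auto
 qed
qed

text \<open>By the balancing relations a scalar wanders through the word from left to right and
  joins the scalar at the end. Each letter passed contributes the product of the two
  parities.\<close>

lemma tw_slide:
 assumes "v : lists (carrier M)" "X : grade M p" "w : hwords M" "ka : grade K q" "kb el K"
 shows "tw (v @ lact K M ka X # map snd w) kb =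
  ksign T (q * (p + wpar w)) (tw (v @ X # map snd w) (ka \<otimes>\<^sub>K kb))"
proof -
 interpret T: ring T by (rule ring_T)
 show ?thesis using assms
 proof (induction w arbitrary: v X p)
  case Nil
  have "tw (v @ [lact K M ka X]) kb = ksign T (q * p) (tw (v @ [act M X ka]) kb)"
   using Nil tw_ksign[of v "[]" "act M X ka" kb "q * p"] by (simp add: lact_homogeneous act_closed)
  then show ?case using Nil by (simp add: tw_last)
 next
  case (Cons Z w)
  have l: "map snd w : lists (carrier M)" using Cons.prems M.hwords_lists by simp
  have Z: "snd Z : grade M (fst Z)" "w : hwords M" "snd Z el M" "X el M" "ka el K"
   using Cons.prems by auto
  have "tw (v @ lact K M ka X # map snd (Z # w)) kb =
    ksign T (q * p) (tw (v @ act M X ka # map snd (Z # w)) kb)"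
   using Cons.prems l Z tw_ksign[of v "map snd (Z # w)" "act M X ka" kb "q * p"]
   by (simp add: lact_homogeneous act_closed)
  also have "tw (v @ act M X ka # map snd (Z # w)) kb = tw (v @ X # lact K M ka (snd Z) # map snd w) kb"
   using Cons.prems l Z by (simp add: tw_balanced)
  also have "... = ksign T (q * (fst Z + wpar w)) (tw ((v @ [X]) @ snd Z # map snd w) (ka \<otimes>\<^sub>K kb))"
   using Cons.prems Z Cons.IH[of "v @ [X]" "snd Z" "fst Z"] by simp
  finally show ?case using Cons.prems Z l by (simp add: distrib_left add.assoc)
 qed
qed

lemma tw_scalar_left:
 assumes "w : hwords M" "ka : grade K q" "kb el K"
 shows "tw [] ka \<otimes>\<^sub>T tw (map snd w) kb = ksign T (q * wpar w) (tw (map snd w) (ka \<otimes>\<^sub>K kb))"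
proof (cases w)
 case Nil
 interpret T: ring T by (rule ring_T)
 show ?thesis using Nil assms by (simp add: tw_mult_Nil)
next
 case (Cons Z w')
 then have "map snd w' : lists (carrier M)" "snd Z : grade M (fst Z)" "snd Z el M" "ka el K"
  using assms M.hwords_lists by auto
 then show ?thesis using Cons assms tw_slide[of "[]" "snd Z" "fst Z" w' ka q kb] by (simp add: tw_mult_Cons)
qed

lemma supermodule_T: "supermodule K T"
proof -
 interpret T: ring T by (rule ring_T)
 interpret TS: super_group T by (rule super_group_T)
 have ga: "act T m ka : grade T (p + q)" if "m : grade T p" "ka : grade K q" for m p ka q
  using that(1)
 proof (induction rule: grade_T_induct)
  case (word w kb)
  have "map snd w : lists (carrier M)" using word M.hwords_lists by blast
  moreover have "wpar w + (wpar w + p + q) = p + q" by (simp add: add.assoc)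
  ultimately show ?case using word that(2) tw_grade[OF word(1) K.grade_mult[OF word(2) that(2)]]
   by (simp add: act_tw add.assoc)
 next
  case (diff x y)
  then show ?case using that(2) grade_T_carrier grade_T_diff
   by (simp add: act_T T.minus_eq T.l_distr T.l_minus TS.grade_add)
 qed
 have ga': "m \<otimes>\<^sub>T tw [] ka : grade T (p + q)" if "m : grade T p" "ka : grade K q" for m p ka q
  using ga[OF that] that grade_T_carrier[OF that(1)] by (simp add: act_T)
 show ?thesis by (intro supermodule.intro[OF K.comm_superring_axioms super_group_T] supermodule_axioms.intro)
   (simp_all add: act_T T.l_distr T.r_distr tw_add_scalar T.m_assoc tw_mult_Nil T_one[symmetric]
    ga')
qed

lemma superalg_T: "superalg K T"
proof -
 interpret T: ring T by (rule ring_T)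
 interpret TS: super_group T by (rule super_group_T)
 interpret TM: supermodule K T by (rule supermodule_T)
 have one: "act T \<one>\<^sub>T ka = tw [] ka" if "ka el K" for ka
  using that by (simp add: T_one act_tw)
 have lact: "lact K T ka x = tw [] ka \<otimes>\<^sub>T x" if x: "x el T" and a: "ka el K" for ka x
  using a
 proof (induction rule: K.grade_induct)
  case (homogeneous q ka)
  show ?case using x
  proof (induction rule: TS.grade_induct)
   case (homogeneous p x)
   then show ?case
   proof (induction rule: grade_T_induct)
    case (word w kb)
    have l: "map snd w : lists (carrier M)" using word M.hwords_lists by blast
    have g: "tw (map snd w) kb : grade T p" using tw_grade[OF word] by simp
    have "lact K T ka (tw (map snd w) kb) = ksign T (q * p) (tw (map snd w) (kb \<otimes>\<^sub>K ka))"
     using TM.lact_homogeneous[OF g \<open>ka : _\<close>] l word \<open>ka : _\<close> by (simp add: act_tw)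
    also have "kb \<otimes>\<^sub>K ka = ksign K ((wpar w + p) * q) (ka \<otimes>\<^sub>K kb)"
     using word \<open>ka : _\<close> by (intro K.super_comm)
    finally show ?case
     using l word \<open>ka : _\<close> tw_scalar_left[OF word(1) \<open>ka : _\<close>, of kb]
     by (simp add: tw_ksign_scalar algebra_simps)
   next
    case (diff x y)
    then show ?case using \<open>ka : _\<close> grade_T_carrier
     by (simp add: T.minus_eq TM.lact_add_right T.r_distr T.r_minus
       addmap_minus[OF T.ag T.ag TM.addmap_lact])
   qed
  qed (use homogeneous in \<open>auto simp: TM.lact_add_right T.r_distr\<close>)
 qed (use x in \<open>auto simp: TM.lact_add_left tw_add_scalar T.l_distr\<close>)
 have gm: "x \<otimes>\<^sub>T y : grade T (p + q)" if "x : grade T p" "y : grade T q" for x p y q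
  using that(1)
 proof (induction rule: grade_T_induct)
  case x: (word w ka)
  have lw: "map snd w : lists (carrier M)" using x M.hwords_lists by blast
  show ?case using that(2)
  proof (induction rule: grade_T_induct)
   case y: (word v kb)
   have lv: "map snd v : lists (carrier M)" using y M.hwords_lists by blast
   have "tw (map snd w) ka = tw (map snd w) \<one>\<^sub>K \<otimes>\<^sub>T tw [] ka"
    using lw x by (simp add: tw_mult_Nil)
   then have "tw (map snd w) ka \<otimes>\<^sub>T tw (map snd v) kb =
     tw (map snd w) \<one>\<^sub>K \<otimes>\<^sub>T ksign T ((wpar w + p) * wpar v) (tw (map snd v) (ka \<otimes>\<^sub>K kb))"
    using lw lv x y tw_scalar_left[OF y(1) x(2), of kb] by (simp add: T.m_assoc)
   also have "... = ksign T ((wpar w + p) * wpar v) (tw (map snd (w @ v)) (ka \<otimes>\<^sub>K kb))"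
    using lw lv x y by (simp add: T.ring_ksign_r tw_mult_one)
   also have "... : grade T (p + q)"
   proof (rule TS.grade_ksign)
    have "wpar (w @ v) + (wpar w + p + (wpar v + q)) = p + q" by (cases "wpar w"; cases "wpar v"; cases p; cases q; simp)
    then show "tw (map snd (w @ v)) (ka \<otimes>\<^sub>K kb) : grade T (p + q)"
     using tw_grade[of "w @ v", OF _ K.grade_mult[OF x(2) y(2)]] x y by simp
   qed
   finally show ?case .
  next
   case (diff y z)
   then show ?case using lw x grade_T_carrier by (simp add: T.minus_eq T.r_distr T.r_minus)
  qed
 next
  case (diff x z)
  then show ?case using grade_T_carrier[OF that(2)] grade_T_carrier by (simp add: T.minus_eq T.l_distr T.l_minus)
 qed
 show ?thesis
 proof (intro superalg.intro[OF supermodule_T ring_T] superalg_axioms.intro)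
  show "\<one>\<^sub>T : grade T 0"
   using tw_grade[of "[]" "\<one>\<^sub>K" 0] K.one_even by (simp add: T_one)
 qed (simp_all add: one act_T lact gm)
qed

sublocale T: superalg K T by (rule superalg_T)

lemma T_kap: "ka el K ==> T.kap ka = tw [] ka"
 by (simp add: T.kap_def T_one act_tw)

lemma tensor_inc_tw: "tensor_inc K M X = tw [X] \<one>\<^sub>K" by (simp add: tensor_inc_def tw_def)

lemma tensor_inc_closed [simp]: "X el M ==> tensor_inc K M X el T"
 by (simp add: tensor_inc_tw)

lemma tensor_inc_grade: "X : grade M p ==> tensor_inc K M X : grade T p"
 using tw_grade[of "[(p, X)]" "\<one>\<^sub>K" 0] K.one_even by (simp add: tensor_inc_tw)

lemma tensor_inc_add: "[|X el M; Y el M|] ==>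
  tensor_inc K M (X \<oplus>\<^sub>M Y) = tensor_inc K M X \<oplus>\<^sub>T tensor_inc K M Y"
 using tw_add[of "[]" "[]" X Y "\<one>\<^sub>K"] by (simp add: tensor_inc_tw)

lemma tensor_inc_act: "[|X el M; ka el K|] ==>
  tensor_inc K M (act M X ka) = tensor_inc K M X \<otimes>\<^sub>T T.kap ka"
 using tw_last[of "[]" X "\<one>\<^sub>K" ka] by (simp add: tensor_inc_tw T_kap tw_mult_Nil)

lemma tensor_inc_lact: "[|X el M; ka el K|] ==>
  T.kap ka \<otimes>\<^sub>T tensor_inc K M X = tensor_inc K M (lact K M ka X)"
 by (simp add: tensor_inc_tw T_kap tw_mult_Cons)

lemma tw_Cons: "[|X el M; u : lists (carrier M); ka el K|] ==>
  tw (X # u) ka = tensor_inc K M X \<otimes>\<^sub>T tw u ka" by (simp add: tensor_inc_tw tw_mult_one)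

section \<open>Maps out of the tensor algebra\<close>

definition wprod :: "('b, 'z) ring_scheme => ('m => 'b) => 'm list => 'b => 'b" where
 "wprod B j u b = foldr (%X c. j X \<otimes>\<^sub>B c) u b"

text \<open>The additive form of the universal property. It also yields maps that are no ring
  morphisms, such as the projections \<open>pr\<close> onto the tensor degrees.\<close>

lemma T_addmap:
 assumes "abelian_group B" and c: "!!u ka. [|u : lists (carrier M); ka el K|] ==> P u ka el B"
  and add: "!!u v X Y ka. [|u : lists (carrier M); v : lists (carrier M); X el M; Y el M; ka el K|] ==>
   P (u @ (X \<oplus>\<^sub>M Y) # v) ka = P (u @ X # v) ka \<oplus>\<^sub>B P (u @ Y # v) ka"
  and scalar: "!!u ka kb. [|u : lists (carrier M); ka el K; kb el K|] ==>
   P u (ka \<oplus>\<^sub>K kb) = P u ka \<oplus>\<^sub>B P u kb"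
  and balanced: "!!u v X Y ka kb. [|u : lists (carrier M); v : lists (carrier M); X el M; Y el M;
   ka el K; kb el K|] ==> P (u @ act M X kb # Y # v) ka = P (u @ X # lact K M kb Y # v) ka"
  and last: "!!u X ka kb. [|u : lists (carrier M); X el M; ka el K; kb el K|] ==>
   P (u @ [act M X kb]) ka = P (u @ [X]) (kb \<otimes>\<^sub>K ka)"
 shows "EX h. addmap T B h & (ALL u:lists (carrier M). ALL ka:carrier K. h (tw u ka) = P u ka)"
proof -
 interpret B: abelian_group B by fact
 have zz: "(a \<oplus>\<^sub>B b) \<ominus>\<^sub>B a \<ominus>\<^sub>B b = \<zero>\<^sub>B" if "a el B" "b el B" for a b
 proof -
  have "(a \<oplus>\<^sub>B b) \<ominus>\<^sub>B a \<ominus>\<^sub>B b = (a \<oplus>\<^sub>B b) \<oplus>\<^sub>B (\<ominus>\<^sub>B a \<oplus>\<^sub>B \<ominus>\<^sub>B b)"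
   using that by (simp add: B.minus_eq B.a_assoc)
  then show ?thesis using that by (simp add: B.r_neg flip: B.minus_add)
 qed
 have "(%(u, ka). P u ka) s el B" if "s : words K M" for s
  using that c by (cases s) (simp add: words_def)
 then obtain f where f: "addmap W B f" "!!s. s : words K M ==> f (frag_of s) = (%(u, ka). P u ka) s"
  using frag_lift[OF B.ag W_simps(1,2), of "%(u, ka). P u ka"] by blast
 have fw: "f (frag_of (u, ka)) = P u ka" if "u : lists (carrier M)" "ka el K" for u ka
  using f(2)[of "(u, ka)"] that by (simp add: words_def)
 have fd: "f (x - y) = f x \<ominus>\<^sub>B f y" if "x el W" "y el W" for x y
  using addmap_frag_diff[OF abelian_group_W B.ag f(1)] that by (simp add: W_simps)
 have fz: "f x = \<zero>\<^sub>B" if "x : R" for x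
 proof -
  have "x : generate (free_Abelian_group (words K M)) word_gens" using that by (simp add: R_eq)
  from this word_gens_carrier show ?thesis
  proof (induction rule: generate_frag_induct)
   case zero
   show ?case using addmap_zero[OF abelian_group_W B.ag f(1)] by (simp add: W_simps)
  next
   case (gen g)
   then show ?case
   proof (cases rule: word_gens_cases)
    case (add u X Y v ka)
    then show ?thesis using c[of "u @ X # v" ka] c[of "u @ Y # v" ka]
     by (simp add: fd fw frag_of_W W_diff_closed zz assms(3))
   next
    case (scalar u ka kb)
    then show ?thesis using c by (simp add: fd fw frag_of_W W_diff_closed zz assms(4))
   next
    case (balanced u X Y v ka kb)
    then show ?thesis using c[of "u @ X # lact K M kb Y # v" ka]
     by (simp add: fd fw frag_of_W act_closed assms(5) B.minus_eq B.r_neg)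
   next
    case (last u X ka kb)
    then show ?thesis using c[of "u @ [X]" "kb \<otimes>\<^sub>K ka"]
     by (simp add: fd fw frag_of_W act_closed assms(6) B.minus_eq B.r_neg)
   qed
  next
   case (diff x y)
   then have "x el W" "y el W"
    unfolding W_simps(1) using subgroup.subset[OF generate_frag_subgroup[OF word_gens_carrier]] by blast+
   then show ?case using diff by (simp add: fd B.minus_eq)
  qed
 qed
 have "addmap T B (qlift W R f)" using W.addmap_qlift[OF B.ag f(1) fz] by (simp add: T_eq)
 moreover have "qlift W R f (tw u ka) = P u ka" if "u : lists (carrier M)" "ka el K" for u ka
  using W.qlift_cls[OF B.ag f(1) fz] that by (simp add: tw_def frag_of_W fw)
 ultimately show ?thesis by blast
qed

text \<open>The target is a plain ring with scalars supplied by \<kappa>. The tensor square, the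
  square-zero extension and the ring of endomorphisms can therefore serve as targets without first
  being made into superalgebras.\<close>

theorem T_universal:
 assumes "ring B" "\<kappa> : ring_hom K B" "addmap M B j"
  and "!!X ka. [|X el M; ka el K|] ==> j (act M X ka) = j X \<otimes>\<^sub>B \<kappa> ka"
  and "!!X ka. [|X el M; ka el K|] ==> \<kappa> ka \<otimes>\<^sub>B j X = j (lact K M ka X)"
 shows "EX h. h : ring_hom T B & (ALL X:carrier M. h (tensor_inc K M X) = j X) &
  (ALL ka:carrier K. h (T.kap ka) = \<kappa> ka)"
proof -
 interpret B: ring B by fact
 define P where "P = wprod B j"
 have P_simps: "P [] b = b" "P (X # u) b = j X \<otimes>\<^sub>B P u b" "P (u @ v) b = P u (P v b)" for X u v b
  by (simp_all add: P_def wprod_def)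
 note j = addmap_closed[OF assms(3)]
 note k = ring_hom_closed[OF assms(2)]
 have Pc: "P u b el B" if "u : lists (carrier M)" "b el B" for u b
  using that by (induction u) (auto simp: P_simps j)
 have Pm: "P u (b \<otimes>\<^sub>B c) = P u b \<otimes>\<^sub>B c" if "u : lists (carrier M)" "b el B" "c el B" for u b c
  using that by (induction u) (auto simp: P_simps j B.m_assoc Pc)
 have Pa: "P u (b \<oplus>\<^sub>B c) = P u b \<oplus>\<^sub>B P u c" if "u : lists (carrier M)" "b el B" "c el B" for u b c
  using that by (induction u) (auto simp: P_simps j B.r_distr Pc)
 obtain h where h: "addmap T B h" "!!u ka. [|u : lists (carrier M); ka el K|] ==> h (tw u ka) = P u (\<kappa> ka)"
 proof -
  have "EX h. addmap T B h & (ALL u:lists (carrier M). ALL ka:carrier K. h (tw u ka) = P u (\<kappa> ka))"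
   by (rule T_addmap[OF B.ag])
    (simp_all add: P_simps Pa[symmetric] Pc j k B.l_distr addmap_add[OF assms(3)] ring_hom_add[OF assms(2)]
     ring_hom_mult[OF assms(2)] assms(4) assms(5)[symmetric] B.m_assoc)
  then show thesis using that by blast
 qed
 note htw = h(2)
 have hm: "h (x \<otimes>\<^sub>T y) = h x \<otimes>\<^sub>B h y" if "x el T" "y el T" for x y
  using that(1)
 proof (induction rule: T_induct)
  case x: (word u ka)
  show ?case using that(2)
  proof (induction rule: T_induct)
   case y: (word v kb)
   show ?case
   proof (cases v)
    case Nil
    then show ?thesis using x y by (simp add: tw_mult_Nil htw ring_hom_mult[OF assms(2)] Pm k P_simps)
   next
    case (Cons X v')
    then show ?thesis using x y
     by (simp add: tw_mult_Cons htw P_simps assms(5)[symmetric] Pm[symmetric] B.m_assoc j k Pc)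
   qed
  next
   case (add y z)
   then show ?case using x addmap_closed[OF h(1)] by (simp add: T.A.r_distr addmap_add[OF h(1)] B.r_distr)
  qed
 next
  case (add x z)
  then show ?case using that(2) addmap_closed[OF h(1)] by (simp add: T.A.l_distr addmap_add[OF h(1)] B.l_distr)
 qed
 have 1: "h : ring_hom T B" by (rule ring_hom_memI)
   (use h(1) hm in \<open>auto simp: addmap_closed addmap_add T_one htw P_simps ring_hom_one[OF assms(2)]\<close>)
 have 2: "h (tensor_inc K M X) = j X" if "X el M" for X
  using that by (simp add: tensor_inc_tw htw P_simps j ring_hom_one[OF assms(2)])
 have 3: "h (T.kap ka) = \<kappa> ka" if "ka el K" for ka
  using that by (simp add: T_kap htw P_simps)
 from 1 2 3 show ?thesis by (intro exI[of _ h]) simp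
qed

end

section \<open>The symmetric and the enveloping algebra\<close>

lemma (in half_supermodule) T_hinduct [consumes 1, case_names word add]:
 assumes "x el T"
  and "!!w ka. [|w : hwords M; ka el K|] ==> P (tw (map snd w) ka)"
  and "!!x y. [|x el T; y el T; P x; P y|] ==> P (x \<oplus>\<^sub>T y)"
 shows "P x" using assms(1)
proof (induction rule: T.M.grade_induct)
 case (homogeneous r x)
 then have "P x & P (\<ominus>\<^sub>T x)"
 proof (induction rule: grade_T_induct)
  case (word w ka)
  then have "\<ominus>\<^sub>T tw (map snd w) ka = tw (map snd w) (\<ominus>\<^sub>K ka)"
   using M.hwords_lists[OF word(1)] by (simp add: tw_uminus_scalar)
  then show ?case using word assms(2)[of w ka] assms(2)[of w "\<ominus>\<^sub>K ka"] by simp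
 next
  case (diff x y)
  then show ?case
   using assms(3)[of x "\<ominus>\<^sub>T y"] assms(3)[of "\<ominus>\<^sub>T x" y] grade_T_carrier
   by (simp add: T.M.minus_eq T.M.minus_add)
 qed
 then show ?case by simp
qed (use assms(3) in blast)

text \<open>A common frame for S(M) and U(gg), both quotients of T(M) by a graded ideal. On
  instantiation \<open>pinc\<close> turns into \<open>sym_inc\<close> or \<open>env_inc\<close>, and
  for the symmetric algebra \<open>psp\<close> turns into \<open>sym_prod\<close>.\<close>

locale presented = half_supermodule K M
 for K :: "('k, 'x) superring_scheme" and M :: "('k, 'm, 'y) supermodule_scheme" and I +
 assumes I_ideal: "ideal I (tensor_alg K M)"
  and I_graded: "x : I ==> hcomp (tensor_alg K M) p x : I"
begin

sublocale Iq: superalg_quotient K "tensor_alg K M" I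
 by (intro superalg_quotient.intro superalg_quotient_axioms.intro superalg_T I_ideal I_graded)

abbreviation "P \<equiv> quot_alg (tensor_alg K M) I"

sublocale P: superalg K "quot_alg (tensor_alg K M) I" by (rule Iq.superalg_Q)

definition pinc where "pinc X = I +>\<^bsub>tensor_alg K M\<^esub> tensor_inc K M X"

definition psp where "psp Xs = foldr (\<otimes>\<^sub>P) (map pinc Xs) \<one>\<^sub>P"

lemma pinc_closed [simp]: "X el M ==> pinc X el P" by (simp add: pinc_def)

lemma pinc_add: "[|X el M; Y el M|] ==> pinc (X \<oplus>\<^sub>M Y) = pinc X \<oplus>\<^sub>P pinc Y"
 by (simp add: pinc_def tensor_inc_add Iq.quo.cls_add)

lemma addmap_pinc: "addmap M P pinc" by (rule addmapI) (simp_all add: pinc_add)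

lemma pinc_grade: "X : grade M p ==> pinc X : grade P p"
 by (simp add: pinc_def Iq.quo.grade_Q tensor_inc_grade)

lemma pinc_act: "[|X el M; ka el K|] ==> pinc (act M X ka) = act P (pinc X) ka"
 by (simp add: pinc_def tensor_inc_act Iq.act_cls T.act_kap)

lemma pinc_lact: "[|X el M; ka el K|] ==> pinc (lact K M ka X) = lact K P ka (pinc X)"
 by (simp add: pinc_def tensor_inc_lact[symmetric] Iq.lact_cls T.lact_kap)

lemma kap_cls: "ka el K ==> P.kap ka = I +>\<^sub>T T.kap ka"
 by (simp add: P.kap_def T.kap_def Iq.quo.one_Q Iq.act_cls)

lemma psp_simps [simp]: "psp [] = \<one>\<^sub>P" "psp (X # u) = pinc X \<otimes>\<^sub>P psp u"
 by (simp_all add: psp_def)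

lemma psp_closed [simp]: "u : lists (carrier M) ==> psp u el P" by (induction u) auto

lemma psp_hclosed [simp]: "w : hwords M ==> psp (map snd w) el P"
 using M.hwords_lists psp_closed by blast

lemma psp_grade: "w : hwords M ==> psp (map snd w) : grade P (wpar w)"
 by (induction w) (auto simp: P.one_even intro: P.grade_mult pinc_grade)

lemma act_psp: "[|u : lists (carrier M); ka el K|] ==> act P (psp u) ka = I +>\<^sub>T tw u ka"
proof (induction u)
 case Nil
 then show ?case by (simp add: P.kap_def[symmetric] kap_cls T_kap)
next
 case (Cons X u)
 then show ?case by (simp add: P.mult_act[symmetric] pinc_def Iq.cls_mult tw_Cons)
qed

lemma P_induct [consumes 1, case_names word add]:
 assumes "x el P"
  and "!!w ka. [|w : hwords M; ka el K|] ==> Q (act P (psp (map snd w)) ka)"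
  and "!!x y. [|x el P; y el P; Q x; Q y|] ==> Q (x \<oplus>\<^sub>P y)"
 shows "Q x"
proof -
 obtain t where t: "t el T" "x = I +>\<^sub>T t" by (rule Iq.quo.cls_cases[OF assms(1)])
 have "Q (I +>\<^sub>T t)" using t(1)
 proof (induction rule: T_hinduct)
  case (word w ka)
  then show ?case using assms(2)[OF word] M.hwords_lists[OF word(1)] by (simp add: act_psp)
 next
  case (add x y)
  then show ?case using assms(3) by (simp add: Iq.quo.cls_add[symmetric])
 qed
 then show ?thesis using t by simp
qed

lemma grade_P_induct [consumes 1, case_names word diff]:
 assumes "x : grade P r"
  and "!!w ka. [|w : hwords M; ka : grade K (wpar w + r)|] ==> Q (act P (psp (map snd w)) ka)"
  and "!!x y. [|x : grade P r; y : grade P r; Q x; Q y|] ==> Q (x \<ominus>\<^sub>P y)"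
 shows "Q x"
proof -
 obtain t where t: "t : grade T r" "x = I +>\<^sub>T t" using assms(1) by (auto simp: Iq.quo.grade_Q)
 have "Q (I +>\<^sub>T t)" using t(1)
 proof (induction rule: grade_T_induct)
  case (word w ka)
  then show ?case using assms(2)[OF word] M.hwords_lists[OF word(1)] K.grade_carrier[OF word(2)] by (simp add: act_psp)
 next
  case (diff x y)
  have "I +>\<^sub>T (x \<ominus>\<^sub>T y) = (I +>\<^sub>T x) \<ominus>\<^sub>P (I +>\<^sub>T y)"
   using grade_T_carrier[OF diff(1)] grade_T_carrier[OF diff(2)]
   by (simp add: T.M.minus_eq P.M.minus_eq Iq.quo.cls_add[symmetric] Iq.quo.cls_uminus)
  then show ?case using diff assms(3) by (simp add: Iq.quo.grade_Q)
 qed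
 then show ?thesis using t by simp
qed

lemma addmap_word_eq:
 assumes "addmap P B f" "addmap P B g" "x el P"
  and "!!w ka. [|w : hwords M; ka el K|] ==>
   f (act P (psp (map snd w)) ka) = g (act P (psp (map snd w)) ka)"
 shows "f x = g x" using assms(3) by (induction rule: P_induct) (use assms in \<open>auto simp: addmap_add\<close>)

lemma superalg_hom_eq:
 assumes "f : superalg_hom K P B" "g : superalg_hom K P B" "!!X. X el M ==> f (pinc X) = g (pinc X)"
 shows "f = g"
proof (rule PiE_ext[of _ "carrier P" "%_. carrier B"])
 show "f : carrier P \<rightarrow>\<^sub>E carrier B" "g : carrier P \<rightarrow>\<^sub>E carrier B"
  using assms(1,2) by (auto simp: superalg_hom_def Hom_def)
 have w: "f (psp (map snd w)) = g (psp (map snd w))" if "w : hwords M" for w using that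
 proof (induction w)
  case (Cons Z w)
  then have "snd Z el M" "w : hwords M" by auto
  then show ?case using Cons.IH assms by (simp add: superalg_hom_def)
 qed (use assms in \<open>simp add: superalg_hom_def\<close>)
 fix x assume "x el P"
 then show "f x = g x"
  by (induction rule: P_induct) (use w assms(1,2) in \<open>simp_all add: superalg_hom_def Hom_def\<close>)
qed

theorem P_universal:
 assumes B: "ring B" "\<kappa> : ring_hom K B" "addmap M B j"
  "!!X ka. [|X el M; ka el K|] ==> j (act M X ka) = j X \<otimes>\<^sub>B \<kappa> ka"
  "!!X ka. [|X el M; ka el K|] ==> \<kappa> ka \<otimes>\<^sub>B j X = j (lact K M ka X)"
  and G: "I = Idl\<^bsub>T\<^esub> G" "G \<subseteq> carrier T"
  and rel: "!!h g. [|h : ring_hom T B; !!X. X el M ==> h (tensor_inc K M X) = j X; g : G|]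
   ==> h g = \<zero>\<^sub>B"
 shows "EX h. h : ring_hom P B & (ALL X:carrier M. h (pinc X) = j X) &
  (ALL ka:carrier K. h (P.kap ka) = \<kappa> ka)"
proof -
 interpret B: ring B by fact
 obtain h where h: "h : ring_hom T B" "!!X. X el M ==> h (tensor_inc K M X) = j X"
  "!!ka. ka el K ==> h (T.kap ka) = \<kappa> ka"
  using T_universal[OF B] by blast
 have hr: "ring_hom_ring T B h" by (rule ring_hom_ringI2[OF T.A.ring_axioms B.ring_axioms h(1)])
 have add: "addmap T B h" by (rule addmapI[OF ring_hom_closed[OF h(1)] ring_hom_add[OF h(1)]])
 have "G \<subseteq> a_kernel T B h"
 proof
  fix g assume g: "g : G"
  have "h g = \<zero>\<^sub>B" by (rule rel[OF h(1) _ g]) (rule h(2))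
  then show "g : a_kernel T B h" unfolding a_kernel_def' using g G(2) by blast
 qed
 then have "I \<subseteq> a_kernel T B h"
  unfolding G(1) by (rule T.A.genideal_minimal[OF ring_hom_ring.kernel_is_ideal[OF hr]])
 then have z: "h x = \<zero>\<^sub>B" if "x : I" for x
  using that \<open>I \<subseteq> _\<close> unfolding a_kernel_def' by blast
 define h' where "h' = qlift T I h"
 have h': "h' (I +>\<^sub>T x) = h x" if "x el T" for x
  using Iq.quo.qlift_cls[OF B.ag add z that] by (simp add: h'_def)
 have "h' : ring_hom P B" by (rule ring_hom_memI)
   (auto elim!: Iq.quo.cls_cases simp: h' Iq.cls_mult Iq.quo.cls_add Iq.quo.one_Q
    ring_hom_closed[OF h(1)] ring_hom_mult[OF h(1)] ring_hom_add[OF h(1)] ring_hom_one[OF h(1)])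
 then show ?thesis using h by (intro exI[of _ h']) (simp add: h' pinc_def kap_cls)
qed

end

section \<open>The symmetric algebra as a quotient of the tensor algebra\<close>

context half_supermodule
begin

abbreviation "S \<equiv> sym_alg K M"

definition "sym_gens = {(tensor_inc K M v \<otimes>\<^sub>T tensor_inc K M w) \<ominus>\<^sub>T
   ksign T (p * q) (tensor_inc K M w \<otimes>\<^sub>T tensor_inc K M v)
     | v w p q. v : grade M p & w : grade M q} \<union>
    {tensor_inc K M u \<otimes>\<^sub>T tensor_inc K M u | u. u : grade M 1}"

lemma sym_ideal_eq: "sym_ideal K M = Idl\<^bsub>T\<^esub> sym_gens" by (simp add: sym_ideal_def sym_gens_def Let_def)

lemma sym_gens_grade:
 assumes "g : sym_gens" obtains r where "g : grade T r"
proof -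
 have *: "tensor_inc K M v \<otimes>\<^sub>T tensor_inc K M w \<ominus>\<^sub>T
   ksign T (p * q) (tensor_inc K M w \<otimes>\<^sub>T tensor_inc K M v) : grade T (p + q)"
  if "v : grade M p" "w : grade M q" for v w p q
  using T.grade_mult[OF tensor_inc_grade[OF that(1)] tensor_inc_grade[OF that(2)]]
   T.grade_mult[OF tensor_inc_grade[OF that(2)] tensor_inc_grade[OF that(1)]]
  by (intro T.M.grade_minus T.M.grade_ksign) (simp_all add: add.commute)
 have "tensor_inc K M u \<otimes>\<^sub>T tensor_inc K M u : grade T (1 + 1)" if "u : grade M 1" for u
  using T.grade_mult[OF tensor_inc_grade[OF that] tensor_inc_grade[OF that]] .
 with * assms that show ?thesis unfolding sym_gens_def by blast
qed

lemma graded_ideal_of_homogeneous: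
 assumes "!!g. g : G ==> EX r. g : grade T r" "x : Idl\<^bsub>T\<^esub> G"
 shows "G \<subseteq> carrier T" "hcomp T p x : Idl\<^bsub>T\<^esub> G"
proof -
 show G: "G \<subseteq> carrier T" using assms(1) T.M.grade_carrier by blast
 interpret I: ideal "Idl\<^bsub>T\<^esub> G" T by (rule T.A.genideal_ideal[OF G])
 show "hcomp T p x : Idl\<^bsub>T\<^esub> G"
 proof (rule T.graded_idealI[OF G _ assms(2)])
  fix g p assume g: "g : G"
  then obtain r where "g : grade T r" using assms(1) by blast
  then show "hcomp T p g : Idl\<^bsub>T\<^esub> G"
   using g T.A.genideal_self[OF G] by (auto simp: T.M.hcomp_homogeneous)
 qed
qed

lemma sym_gens_carrier: "sym_gens \<subseteq> carrier T" using sym_gens_grade T.M.grade_carrier by blast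

lemma presented_sym: "presented K M (sym_ideal K M)"
proof (intro presented.intro presented_axioms.intro half_supermodule_axioms)
 show "ideal (sym_ideal K M) T" unfolding sym_ideal_eq by (rule T.A.genideal_ideal[OF sym_gens_carrier])
 show "hcomp T p x : sym_ideal K M" if "x : sym_ideal K M" for x p using that unfolding sym_ideal_eq
  by (rule graded_ideal_of_homogeneous(2)[rotated]) (blast elim: sym_gens_grade)
qed

end

sublocale half_supermodule \<subseteq> S: presented K M "sym_ideal K M"
 rewrites "quot_alg (tensor_alg K M) (sym_ideal K M) = sym_alg K M"
  and "presented.pinc K M (sym_ideal K M) = sym_inc K M"
  and "presented.psp K M (sym_ideal K M) = sym_prod K M"
proof -
 show "presented K M (sym_ideal K M)" by (rule presented_sym)
 then interpret presented K M "sym_ideal K M" .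
 show 1: "quot_alg (tensor_alg K M) (sym_ideal K M) = sym_alg K M" by (simp add: sym_alg_def)
 show 2: "presented.pinc K M (sym_ideal K M) = sym_inc K M" by (simp add: fun_eq_iff pinc_def sym_inc_def)
 show "presented.psp K M (sym_ideal K M) = sym_prod K M" by (simp add: fun_eq_iff psp_def sym_prod_def 1 2)
qed

context half_supermodule
begin

lemma sym_comm:
 assumes "v : grade M p" "w : grade M q"
 shows "sym_inc K M v \<otimes>\<^sub>S sym_inc K M w = ksign S (p * q) (sym_inc K M w \<otimes>\<^sub>S sym_inc K M v)"
proof -
 have g: "(tensor_inc K M v \<otimes>\<^sub>T tensor_inc K M w) \<ominus>\<^sub>T
   ksign T (p * q) (tensor_inc K M w \<otimes>\<^sub>T tensor_inc K M v) : sym_ideal K M"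
  unfolding sym_ideal_eq
  by (rule subsetD[OF T.A.genideal_self[OF sym_gens_carrier]]) (use assms in \<open>auto simp: sym_gens_def\<close>)
 have c: "v el M" "w el M" using assms by auto
 have "sym_ideal K M +>\<^sub>T (tensor_inc K M v \<otimes>\<^sub>T tensor_inc K M w) =
   sym_ideal K M +>\<^sub>T ksign T (p * q) (tensor_inc K M w \<otimes>\<^sub>T tensor_inc K M v)"
  using g c by (subst S.Iq.quo.cls_eq_iff) auto
 then show ?thesis using c by (simp add: sym_inc_def S.Iq.cls_mult S.Iq.quo.cls_ksign)
qed

end

section \<open>The enveloping algebra as a quotient of the tensor algebra\<close>

locale half_lie = lie_superalgebra K gg
 for K :: "('k, 'x) superring_scheme" and gg :: "('k, 'g, 'y) lie_superalgebra_scheme" +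
 assumes half': "nat_unit K 2"

sublocale half_lie \<subseteq> half_supermodule K gg
 by (intro half_supermodule.intro supermodule_axioms half_supermodule_axioms.intro half')

context half_lie
begin

abbreviation "U \<equiv> env_alg K gg"

definition "env_gens = {(tensor_inc K gg a \<otimes>\<^sub>T tensor_inc K gg b) \<ominus>\<^sub>T
  ksign T (p * q) (tensor_inc K gg b \<otimes>\<^sub>T tensor_inc K gg a) \<ominus>\<^sub>T tensor_inc K gg (bracket gg a b)
    | a b p q. a : grade gg p & b : grade gg q}"

lemma env_ideal_eq: "env_ideal K gg = Idl\<^bsub>T\<^esub> env_gens" by (simp add: env_ideal_def env_gens_def Let_def)

lemma env_gens_grade:
 assumes "g : env_gens" obtains r where "g : grade T r"
proof -
 have *: "tensor_inc K gg v \<otimes>\<^sub>T tensor_inc K gg w \<ominus>\<^sub>T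
   ksign T (p * q) (tensor_inc K gg w \<otimes>\<^sub>T tensor_inc K gg v) \<ominus>\<^sub>T tensor_inc K gg (bracket gg v w)
   : grade T (p + q)"
  if "v : grade gg p" "w : grade gg q" for v w p q
  using T.grade_mult[OF tensor_inc_grade[OF that(1)] tensor_inc_grade[OF that(2)]]
   T.grade_mult[OF tensor_inc_grade[OF that(2)] tensor_inc_grade[OF that(1)]]
   tensor_inc_grade[OF grade_bracket[OF that]] by (intro T.M.grade_minus T.M.grade_ksign) (simp_all add: add.commute)
 with assms that show ?thesis unfolding env_gens_def by blast
qed

lemma env_gens_carrier: "env_gens \<subseteq> carrier T" using env_gens_grade T.M.grade_carrier by blast

lemma presented_env: "presented K gg (env_ideal K gg)"
proof (intro presented.intro presented_axioms.intro half_supermodule_axioms)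
 show "ideal (env_ideal K gg) T" unfolding env_ideal_eq by (rule T.A.genideal_ideal[OF env_gens_carrier])
 show "hcomp T p x : env_ideal K gg" if "x : env_ideal K gg" for x p using that unfolding env_ideal_eq
  by (rule graded_ideal_of_homogeneous(2)[rotated]) (blast elim: env_gens_grade)
qed

end

sublocale half_lie \<subseteq> U: presented K gg "env_ideal K gg"
 rewrites "quot_alg (tensor_alg K gg) (env_ideal K gg) = env_alg K gg"
  and "presented.pinc K gg (env_ideal K gg) = env_inc K gg"
proof -
 show "presented K gg (env_ideal K gg)" by (rule presented_env)
 then interpret presented K gg "env_ideal K gg" .
 show "quot_alg (tensor_alg K gg) (env_ideal K gg) = env_alg K gg" by (simp add: env_alg_def)
 show "presented.pinc K gg (env_ideal K gg) = env_inc K gg" by (simp add: fun_eq_iff pinc_def env_inc_def)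
qed

context half_lie
begin

lemma env_rel:
 assumes "a : grade gg p" "b : grade gg q"
 shows "env_inc K gg a \<otimes>\<^sub>U env_inc K gg b =
  ksign U (p * q) (env_inc K gg b \<otimes>\<^sub>U env_inc K gg a) \<oplus>\<^sub>U env_inc K gg (bracket gg a b)"
proof -
 let ?i = "tensor_inc K gg"
 have c: "a el gg" "b el gg" "bracket gg a b el gg"
  using assms by (auto simp: bracket_closed)
 have "?i a \<otimes>\<^sub>T ?i b \<ominus>\<^sub>T ksign T (p * q) (?i b \<otimes>\<^sub>T ?i a) \<ominus>\<^sub>T ?i (bracket gg a b) : env_ideal K gg"
  unfolding env_ideal_eq
  by (rule subsetD[OF T.A.genideal_self[OF env_gens_carrier]]) (use assms in \<open>auto simp: env_gens_def\<close>)
 moreover have "?i a \<otimes>\<^sub>T ?i b \<ominus>\<^sub>T ksign T (p * q) (?i b \<otimes>\<^sub>T ?i a) \<ominus>\<^sub>T ?i (bracket gg a b) =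
   ?i a \<otimes>\<^sub>T ?i b \<ominus>\<^sub>T (ksign T (p * q) (?i b \<otimes>\<^sub>T ?i a) \<oplus>\<^sub>T ?i (bracket gg a b))"
  using c by (simp add: T.M.minus_eq T.M.minus_add T.M.a_assoc)
 ultimately have "env_ideal K gg +>\<^sub>T (?i a \<otimes>\<^sub>T ?i b) =
   env_ideal K gg +>\<^sub>T (ksign T (p * q) (?i b \<otimes>\<^sub>T ?i a) \<oplus>\<^sub>T ?i (bracket gg a b))"
  using c by (subst U.Iq.quo.cls_eq_iff) auto
 then show ?thesis using c by (simp add: env_inc_def U.Iq.cls_mult U.Iq.quo.cls_ksign U.Iq.quo.cls_add[symmetric])
qed

end

section \<open>The tensor product of two superalgebras\<close>

locale tensor_square = superalg K A
 for K :: "('k, 'x) superring_scheme" and A :: "('k, 'm, 'y) supermodule_scheme"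
begin

abbreviation "V \<equiv> pair_alg A A"
abbreviation "TR \<equiv> tensor_rels K A A"
abbreviation "TP \<equiv> tensor_prod K A A"
abbreviation "pt \<equiv> pure_tensor K A A"

definition tgens where "tgens =
  ({frag_of (a \<oplus>\<^sub>A a', b) - frag_of (a, b) - frag_of (a', b) | a a' b.
    a el A & a' el A & b el A} \<union>
   {frag_of (a, b \<oplus>\<^sub>A b') - frag_of (a, b) - frag_of (a, b') | a b b'.
    a el A & b el A & b' el A} \<union>
   {frag_of (act A a ka, b) - frag_of (a, lact K A ka b) | a b ka.
    a el A & b el A & ka el K})"

lemma TR_eq: "TR = generate (free_Abelian_group (carrier A \<times> carrier A)) tgens"
 by (simp add: tensor_rels_def tgens_def)

lemma tgens_cases [consumes 1, case_names add1 add2 balanced]: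
 assumes "g : tgens"
 obtains a a' b where "g = frag_of (a \<oplus>\<^sub>A a', b) - frag_of (a, b) - frag_of (a', b)"
   "a el A" "a' el A" "b el A"
 | a b b' where "g = frag_of (a, b \<oplus>\<^sub>A b') - frag_of (a, b) - frag_of (a, b')"
   "a el A" "b el A" "b' el A"
 | a b ka where "g = frag_of (act A a ka, b) - frag_of (a, lact K A ka b)"
   "a el A" "b el A" "ka el K" using assms unfolding tgens_def by blast

lemma tgensI:
 "[|a el A; a' el A; b el A|] ==>
  frag_of (a \<oplus>\<^sub>A a', b) - frag_of (a, b) - frag_of (a', b) : tgens"
 "[|a el A; b el A; b' el A|] ==>
  frag_of (a, b \<oplus>\<^sub>A b') - frag_of (a, b) - frag_of (a, b') : tgens"
 "[|a el A; b el A; ka el K|] ==>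
  frag_of (act A a ka, b) - frag_of (a, lact K A ka b) : tgens" unfolding tgens_def by blast+

lemma V_simps: "carrier V = carrier (free_Abelian_group (carrier A \<times> carrier A))" "ring.add V = (+)"
 "ring.zero V = 0" "\<one>\<^sub>V = frag_of (\<one>\<^sub>A, \<one>\<^sub>A)"
 "act V x ka = frag_extend (%(a, b). frag_of (a, act A b ka)) x" by (simp_all add: pair_alg_def)

lemma frag_of_V: "frag_of (a, b) el V \<longleftrightarrow> a el A & b el A"
 by (simp add: V_simps)

lemma V_diff_closed: "[|x el V; y el V|] ==> x - y el V"
 unfolding V_simps(1) using keys_diff[of x y] by auto

lemma V_add_closed: "[|x el V; y el V|] ==> x + y el V"
 unfolding V_simps(1) using keys_add[of x y] by auto

lemma V_zero_closed: "0 el V" by (simp add: V_simps)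

lemma V_keys: "x el V ==> Poly_Mapping.keys x \<subseteq> carrier A \<times> carrier A"
 by (simp add: V_simps)

lemma tgens_V: "tgens \<subseteq> carrier V"
proof
 fix g assume "g : tgens"
 then show "g el V" by (cases rule: tgens_cases) (simp_all add: V_diff_closed frag_of_V act_closed)
qed

lemma tgens_carrier: "tgens \<subseteq> carrier (free_Abelian_group (carrier A \<times> carrier A))"
 using tgens_V unfolding V_simps(1) .

lemma abelian_group_V: "abelian_group V" by (rule abelian_group_frag) (simp_all add: V_simps)

lemma additive_subgroup_TR: "additive_subgroup TR V"
 unfolding TR_eq by (rule additive_subgroup_generate[OF V_simps(1-3) tgens_carrier])

sublocale V: alg_quotient V TR by (intro alg_quotient.intro abelian_group_V additive_subgroup_TR)

lemma TP_eq: "TP = V.Q" by (simp add: tensor_prod_def)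

lemma abelian_group_TP: "abelian_group TP" unfolding TP_eq by (rule V.abelian_group_Q)

lemma pt_eq: "pt a b = V.cls (frag_of (a, b))" by (simp add: pure_tensor_def)

lemma pt_closed [simp]: "[|a el A; b el A|] ==> pt a b el TP"
 by (simp add: pt_eq TP_eq frag_of_V)

sublocale TPG: abelian_group TP by (rule abelian_group_TP)

lemma V_cls_diff: "[|x el V; y el V|] ==> V.cls (x - y) = V.cls x \<ominus>\<^sub>TP V.cls y"
 unfolding TP_eq by (rule addmap_frag_diff[OF abelian_group_V V.abelian_group_Q V.addmap_cls V_simps(2,3)])

lemma V_cls_add: "[|x el V; y el V|] ==> V.cls (x + y) = V.cls x \<oplus>\<^sub>TP V.cls y"
 unfolding TP_eq using V.cls_add by (simp add: V_simps)

lemma V_cls_zero: "V.cls 0 = \<zero>\<^sub>TP" unfolding TP_eq using V.cls_zero by (simp add: V_simps)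

lemma V_cls_closed: "x el V ==> V.cls x el TP" unfolding TP_eq by (rule V.cls_closed)

lemma V_cls_zero_iff: "x el V ==> V.cls x = \<zero>\<^sub>TP \<longleftrightarrow> x : TR"
 unfolding TP_eq by (rule V.cls_zero_iff)

lemma TR_gen: "g : tgens ==> V.cls g = \<zero>\<^sub>TP"
 using V_cls_zero_iff[of g] tgens_V generate.incl[of g tgens] by (auto simp: TR_eq)

lemma TR_induct [consumes 1, case_names zero gen diff]:
 assumes "x : TR" "P 0" "!!g. g : tgens ==> P g"
  "!!x y. [|x el V; y el V; P x; P y|] ==> P (x - y)"
 shows "P x"
proof -
 have "x : generate (free_Abelian_group (carrier A \<times> carrier A)) tgens" using assms(1) by (simp add: TR_eq)
 from this tgens_carrier show ?thesis
 proof (induction rule: generate_frag_induct)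
  case (diff x y)
  then show ?case using assms(4) V.I.a_subset unfolding TR_eq by blast
 qed (use assms in blast)+
qed

lemma TP_diff_zero2:
 assumes "a el TP" "b el TP" "c el TP" "a \<ominus>\<^sub>TP b \<ominus>\<^sub>TP c = \<zero>\<^sub>TP"
 shows "a = b \<oplus>\<^sub>TP c"
proof -
 have "a \<ominus>\<^sub>TP (b \<oplus>\<^sub>TP c) = \<zero>\<^sub>TP"
  using assms by (simp add: TPG.minus_eq TPG.minus_add TPG.a_assoc)
 then show ?thesis using assms(1-3) by (simp add: TPG.minus_eq_zero_iff)
qed

lemma pt_add_l: "[|a el A; a' el A; b el A|] ==>
  pt (a \<oplus>\<^sub>A a') b = pt a b \<oplus>\<^sub>TP pt a' b" using TR_gen[OF tgensI(1)[of a a' b]]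
 by (intro TP_diff_zero2) (simp_all add: pt_eq V_cls_closed V_cls_diff V_diff_closed frag_of_V)

lemma pt_add_r: "[|a el A; b el A; b' el A|] ==>
  pt a (b \<oplus>\<^sub>A b') = pt a b \<oplus>\<^sub>TP pt a b'" using TR_gen[OF tgensI(2)[of a b b']]
 by (intro TP_diff_zero2) (simp_all add: pt_eq V_cls_closed V_cls_diff V_diff_closed frag_of_V)

lemma pt_balanced: "[|a el A; b el A; ka el K|] ==>
  pt (act A a ka) b = pt a (lact K A ka b)" using TR_gen[OF tgensI(3)[of a b ka]]
  TPG.minus_eq_zero_iff[of "pt (act A a ka) b" "pt a (lact K A ka b)"]
 by (simp add: pt_eq V_cls_closed V_cls_diff frag_of_V act_closed)

lemma addmap_pt_l: "b el A ==> addmap A TP (%a. pt a b)"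
 by (rule addmapI) (simp_all add: pt_add_l)

lemma addmap_pt_r: "a el A ==> addmap A TP (%b. pt a b)"
 by (rule addmapI) (simp_all add: pt_add_r)

lemma pt_ksign_l: "[|a el A; b el A|] ==> pt (ksign A p a) b = ksign TP p (pt a b)"
 by (rule addmap_ksign[OF M.ag TPG.ag addmap_pt_l])

lemma pt_ksign_r: "[|a el A; b el A|] ==> pt a (ksign A p b) = ksign TP p (pt a b)"
 by (rule addmap_ksign[OF M.ag TPG.ag addmap_pt_r])

lemma pt_uminus_l: "[|a el A; b el A|] ==> pt (\<ominus>\<^sub>A a) b = \<ominus>\<^sub>TP pt a b"
 by (rule addmap_minus[OF M.ag TPG.ag addmap_pt_l])

lemma pt_zero: "a el A ==> pt \<zero>\<^sub>A a = \<zero>\<^sub>TP" "a el A ==> pt a \<zero>\<^sub>A = \<zero>\<^sub>TP"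
 using addmap_zero[OF M.ag TPG.ag addmap_pt_l]
  addmap_zero[OF M.ag TPG.ag addmap_pt_r] by auto

lemma TP_induct [consumes 1, case_names pure add]:
 assumes "x el TP"
  and "!!a b. [|a el A; b el A|] ==> P (pt a b)"
  and "!!x y. [|x el TP; y el TP; P x; P y|] ==> P (x \<oplus>\<^sub>TP y)"
 shows "P x"
proof -
 obtain c where c: "c el V" "x = V.cls c" using assms(1) unfolding TP_eq by (rule V.cls_cases)
 from V_keys[OF c(1)] have "c el V & P (V.cls c) & P (\<ominus>\<^sub>TP V.cls c)"
 proof (induction rule: frag_induction)
  case zero
  have "V.cls 0 = pt \<zero>\<^sub>A \<zero>\<^sub>A" "\<ominus>\<^sub>TP V.cls 0 = pt \<zero>\<^sub>A \<zero>\<^sub>A"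
   by (simp_all add: pt_zero V_cls_zero)
  then show ?case using assms(2)[of "\<zero>\<^sub>A" "\<zero>\<^sub>A"] V_zero_closed by simp
 next
  case (one w)
  then obtain a b where "w = (a, b)" "a el A" "b el A" by auto
  then show ?case
   using assms(2)[of a b] assms(2)[of "\<ominus>\<^sub>A a" b] by (simp add: frag_of_V pt_eq[symmetric] pt_uminus_l)
 next
  case (diff a b)
  then have "V.cls a el TP" "V.cls b el TP" by (simp_all add: V_cls_closed)
  then show ?case
   using diff assms(3)[of "V.cls a" "\<ominus>\<^sub>TP V.cls b"] assms(3)[of "\<ominus>\<^sub>TP V.cls a" "V.cls b"]
   by (simp add: V_diff_closed V_cls_diff TPG.minus_eq TPG.minus_add)
 qed
 then show ?thesis using c by simp
qed

lemma TP_addmap_eq: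
 assumes "addmap TP B f" "addmap TP B g" "x el TP"
  and "!!a b. [|a el A; b el A|] ==> f (pt a b) = g (pt a b)"
 shows "f x = g x" using assms(3) by (induction rule: TP_induct) (use assms in \<open>simp_all add: addmap_add\<close>)

theorem TP_universal:
 assumes "abelian_group B"
  and l: "!!b. b el A ==> addmap A B (%a. f a b)"
  and r: "!!a. a el A ==> addmap A B (%b. f a b)"
  and bal: "!!a b ka. [|a el A; b el A; ka el K|] ==> f (act A a ka) b = f a (lact K A ka b)"
 shows "EX h. addmap TP B h & (ALL a:carrier A. ALL b:carrier A. h (pt a b) = f a b)"
proof -
 interpret B: abelian_group B by fact
 have fc: "f a b el B" if "a el A" "b el A" for a b using addmap_closed[OF l] that by simp
 have "(%(a, b). f a b) s el B" if "s : carrier A \<times> carrier A" for s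
  using that fc by (cases s) simp
 then obtain h where h: "addmap V B h" "\<forall>s \<in> carrier A \<times> carrier A. h (frag_of s) = (%(a, b). f a b) s"
  using frag_lift[OF B.ag V_simps(1,2), of "%(a, b). f a b"] by blast
 have hf: "h (frag_of (a, b)) = f a b" if "a el A" "b el A" for a b using h(2) that by auto
 have hd: "h (x - y) = h x \<ominus>\<^sub>B h y" if "x el V" "y el V" for x y
  using addmap_frag_diff[OF abelian_group_V B.ag h(1) V_simps(2,3) that] .
 have zz: "(a \<oplus>\<^sub>B b) \<ominus>\<^sub>B a \<ominus>\<^sub>B b = \<zero>\<^sub>B" if "a el B" "b el B" for a b
 proof -
  have "(a \<oplus>\<^sub>B b) \<ominus>\<^sub>B a \<ominus>\<^sub>B b = (a \<oplus>\<^sub>B b) \<oplus>\<^sub>B (\<ominus>\<^sub>B a \<oplus>\<^sub>B \<ominus>\<^sub>B b)"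
   using that by (simp add: B.minus_eq B.a_assoc)
  also have "... = \<zero>\<^sub>B" using that by (simp add: B.r_neg flip: B.minus_add)
  finally show ?thesis .
 qed
 have hz: "h x = \<zero>\<^sub>B" if "x : TR" for x using that
 proof (induction rule: TR_induct)
  case zero
  then show ?case using addmap_zero[OF abelian_group_V B.ag h(1)] by (simp add: V_simps)
 next
  case (gen g)
  then show ?case
  proof (cases rule: tgens_cases)
   case (add1 a a' b)
   then show ?thesis by (simp add: hd hf V_diff_closed frag_of_V addmap_add[OF l] zz fc)
  next
   case (add2 a b b')
   then show ?thesis by (simp add: hd hf V_diff_closed frag_of_V addmap_add[OF r] zz fc)
  next
   case (balanced a b ka)
   then show ?thesis by (simp add: hd hf V_diff_closed frag_of_V bal fc act_closed B.minus_eq B.r_neg)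
  qed
 next
  case (diff x y)
  then show ?case by (simp add: hd B.minus_eq)
 qed
 define h' where "h' = qlift V TR h"
 have "addmap TP B h'" unfolding TP_eq h'_def by (rule V.addmap_qlift[OF B.ag h(1) hz])
 moreover have "h' (pt a b) = f a b" if "a el A" "b el A" for a b
  using V.qlift_cls[OF B.ag h(1) hz, of "frag_of (a, b)"] that by (simp add: h'_def pt_eq frag_of_V hf)
 ultimately show ?thesis by blast
qed

text \<open>The product of a (x) b and c (x) d in the tensor square. \<open>pair_alg\<close>
  multiplies formal combinations; that this \<open>L\<close> is additive in each place and balanced
  is what makes the tensor relations absorb products.\<close>

definition L where
 "L a b c d = koszul_sum TP (%p q. pt (a \<otimes>\<^sub>A hcomp A q c) (hcomp A p b \<otimes>\<^sub>A d))"

lemma L_closed: "[|a el A; b el A; c el A; d el A|] ==> L a b c d el TP"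
 unfolding L_def by (rule TPG.koszul_sum_closed) simp

lemma L_add:
 assumes "a el A" "b el A" "c el A" "d el A" "x el A"
 shows "L (a \<oplus>\<^sub>A x) b c d = L a b c d \<oplus>\<^sub>TP L x b c d"
  "L a (b \<oplus>\<^sub>A x) c d = L a b c d \<oplus>\<^sub>TP L a x c d"
  "L a b (c \<oplus>\<^sub>A x) d = L a b c d \<oplus>\<^sub>TP L a b x d"
  "L a b c (d \<oplus>\<^sub>A x) = L a b c d \<oplus>\<^sub>TP L a b c x" unfolding L_def
 by (subst TPG.koszul_sum_add[symmetric];
   simp add: assms M.hcomp_add A.l_distr A.r_distr pt_add_l pt_add_r)+

lemma L_homogeneous:
 assumes "a el A" "b : grade A p" "c : grade A q" "d el A"
 shows "L a b c d = ksign TP (p * q) (pt (a \<otimes>\<^sub>A c) (b \<otimes>\<^sub>A d))" unfolding L_def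
 by (subst TPG.koszul_sum_single[where p = p and q = q])
  (use assms in \<open>auto simp: M.hcomp_homogeneous pt_zero\<close>)

lemma act_lact_homogeneous:
 assumes "x : grade A p" "ka : grade K r"
 shows "act A x ka = ksign A (r * p) (lact K A ka x)" using assms by (simp add: lact_homogeneous act_closed)

text \<open>Both sides reduce to ac (x) (ka b)d. The exponent p*r arises on the left from the parity
  of the product of c with \<open>ka\<close>, and on the right from moving \<open>ka\<close> in
  front of b.\<close>

lemma L_balanced1:
 assumes "a el A" "b el A" "c el A" "d el A" "ka el K"
 shows "L a b (act A c ka) d = L a b c (lact K A ka d)" using assms(2)
proof (induction rule: M.grade_induct)
 case b: (homogeneous p b)
 show ?case using assms(3)
 proof (induction rule: M.grade_induct)
  case c: (homogeneous q c)
  show ?case using assms(5)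
  proof (induction rule: K.grade_induct)
   case al: (homogeneous r ka)
   have cc: "b el A" "c el A" "ka el K" using b c al by auto
   have "L a b (act A c ka) d = ksign TP (p * (q + r)) (pt (act A (a \<otimes>\<^sub>A c) ka) (b \<otimes>\<^sub>A d))"
    using L_homogeneous[OF assms(1) b grade_act[OF c al] assms(4)] cc assms(1) by (simp add: mult_act)
   also have "pt (act A (a \<otimes>\<^sub>A c) ka) (b \<otimes>\<^sub>A d) = pt (a \<otimes>\<^sub>A c) (lact K A ka b \<otimes>\<^sub>A d)"
    using cc assms by (simp add: pt_balanced lact_mult)
   finally have 1: "L a b (act A c ka) d =
    ksign TP (p * (q + r)) (pt (a \<otimes>\<^sub>A c) (lact K A ka b \<otimes>\<^sub>A d))" .
   have "b \<otimes>\<^sub>A lact K A ka d = ksign A (r * p) (lact K A ka b \<otimes>\<^sub>A d)"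
    using cc assms act_lact_homogeneous[OF b al] by (simp add: act_mult[symmetric] A.ring_ksign_l)
   then have "L a b c (lact K A ka d) =
     ksign TP (p * q + r * p) (pt (a \<otimes>\<^sub>A c) (lact K A ka b \<otimes>\<^sub>A d))"
    using cc assms by (simp add: L_homogeneous[OF assms(1) b c] pt_ksign_r)
   then show ?case unfolding 1 by (simp add: algebra_simps)
  next
   case (add x y)
   then show ?case using b c assms by (simp add: act_add_right lact_add_left L_add act_closed)
  qed
 next
  case (add x y)
  then show ?case using b assms by (simp add: act_add_left L_add act_closed)
 qed
next
 case (add x y)
 then show ?case using assms by (simp add: L_add act_closed)
qed

lemma L_balanced2:
 assumes "a el A" "b el A" "c el A" "d el A" "ka el K"
 shows "L (act A a ka) b c d = L a (lact K A ka b) c d" using assms(2)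
proof (induction rule: M.grade_induct)
 case b: (homogeneous p b)
 show ?case using assms(3)
 proof (induction rule: M.grade_induct)
  case c: (homogeneous q c)
  show ?case using assms(5)
  proof (induction rule: K.grade_induct)
   case al: (homogeneous r ka)
   have cc: "b el A" "c el A" "ka el K" using b c al by auto
   have "act A a ka \<otimes>\<^sub>A c = ksign A (r * q) (act A (a \<otimes>\<^sub>A c) ka)"
    using cc assms c al by (simp add: act_mult lact_homogeneous A.ring_ksign_r mult_act act_closed)
   then have "L (act A a ka) b c d =
     ksign TP (p * q + r * q) (pt (a \<otimes>\<^sub>A c) (lact K A ka b \<otimes>\<^sub>A d))"
    using cc assms by (simp add: L_homogeneous[OF _ b c] act_closed pt_ksign_l pt_balanced lact_mult)
   also have "... = L a (lact K A ka b) c d"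
    using cc assms L_homogeneous[OF assms(1) lact_grade[OF b al] c assms(4)] by (simp add: algebra_simps)
   finally show ?case .
  next
   case (add x y)
   then show ?case using b c assms by (simp add: act_add_right lact_add_left L_add act_closed)
  qed
 next
  case (add x y)
  then show ?case using b assms by (simp add: L_add act_closed)
 qed
next
 case (add x y)
 then show ?case using assms by (simp add: lact_add_right L_add act_closed)
qed

definition fmul where "fmul a b c d = (\<Sum>p \<in> {0, 1}. \<Sum>q \<in> {0, 1}. frag_cmul (if p * q = (0::bit) then 1 else -1)
     (frag_of (a \<otimes>\<^sub>A hcomp A q c, hcomp A p b \<otimes>\<^sub>A d)))"

lemma V_mult: "x \<otimes>\<^sub>V y = frag_extend (%(a, b). frag_extend (%(c, d). fmul a b c d) y) x"
 by (simp add: pair_alg_def fmul_def)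

lemma V_mult_of: "frag_of (a, b) \<otimes>\<^sub>V frag_of (c, d) = fmul a b c d" by (simp add: V_mult)

lemma fmul_V:
 assumes "a el A" "b el A" "c el A" "d el A"
 shows "fmul a b c d el V" "V.cls (fmul a b c d) = L a b c d"
proof -
 let ?f = "%p q. frag_of (a \<otimes>\<^sub>A hcomp A q c, hcomp A p b \<otimes>\<^sub>A d)"
 have c: "?f p q el V" for p q using assms by (simp add: frag_of_V)
 have e: "fmul a b c d = (?f 0 0 + ?f 0 1) + (?f 1 0 - ?f 1 1)" by (simp add: fmul_def)
 show "fmul a b c d el V" unfolding e using c by (intro V_add_closed V_diff_closed)
 have k: "L a b c d = (V.cls (?f 0 0) \<oplus>\<^sub>TP V.cls (?f 0 1)) \<oplus>\<^sub>TP (V.cls (?f 1 0) \<oplus>\<^sub>TP \<ominus>\<^sub>TP V.cls (?f 1 1))"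
  unfolding L_def pt_eq using TPG.koszul_sum_eq[of "%p q. V.cls (?f p q)"] V_cls_closed[OF c] by blast
 show "V.cls (fmul a b c d) = L a b c d"
  unfolding e k using c by (simp add: V_cls_add V_cls_diff V_add_closed V_diff_closed TPG.minus_eq)
qed

lemma V_mult_diff: "(x - y) \<otimes>\<^sub>V z = x \<otimes>\<^sub>V z - y \<otimes>\<^sub>V z" "z \<otimes>\<^sub>V (x - y) = z \<otimes>\<^sub>V x - z \<otimes>\<^sub>V y"
proof -
 show "(x - y) \<otimes>\<^sub>V z = x \<otimes>\<^sub>V z - y \<otimes>\<^sub>V z"
  by (simp add: V_mult frag_extend_diff)
 have "(%(a, b). frag_extend (%(c, d). fmul a b c d) (x - y)) =
   (%u. (%(a, b). frag_extend (%(c, d). fmul a b c d) x) u - (%(a, b). frag_extend (%(c, d). fmul a b c d) y) u)"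
  by (auto simp: frag_extend_diff)
 then show "z \<otimes>\<^sub>V (x - y) = z \<otimes>\<^sub>V x - z \<otimes>\<^sub>V y"
  unfolding V_mult by (simp only: frag_extend_diff_fun)
qed

lemma V_mult_zero: "0 \<otimes>\<^sub>V z = 0" "z \<otimes>\<^sub>V 0 = 0"
 using V_mult_diff(1)[of 0 0 z] V_mult_diff(2)[of z 0 0] by simp_all

lemma V_mult_add: "(x + y) \<otimes>\<^sub>V z = x \<otimes>\<^sub>V z + y \<otimes>\<^sub>V z" "z \<otimes>\<^sub>V (x + y) = z \<otimes>\<^sub>V x + z \<otimes>\<^sub>V y"
 using V_mult_diff(1)[of x "0 - y" z] V_mult_diff(1)[of 0 y z] V_mult_diff(2)[of z x "0 - y"]
  V_mult_diff(2)[of z 0 y] by (simp_all add: V_mult_zero)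

lemma V_induct [consumes 1, case_names zero one diff]:
 assumes "x el V" "P 0" "!!a b. [|a el A; b el A|] ==> P (frag_of (a, b))"
  "!!x y. [|P x; P y|] ==> P (x - y)"
 shows "P x" using V_keys[OF assms(1)] by (induction rule: frag_induction) (use assms in auto)

lemma V_mult_closed: "[|x el V; y el V|] ==> x \<otimes>\<^sub>V y el V"
proof (induction x rule: V_induct)
 case (one a b)
 from \<open>y el V\<close> show ?case
  by (induction rule: V_induct) (use one in \<open>simp_all add: V_mult_of fmul_V V_mult_diff V_mult_zero V_zero_closed V_diff_closed\<close>)
qed (simp_all add: V_mult_diff V_mult_zero V_zero_closed V_diff_closed)

lemma addmap_V_mult:
 assumes "x el V"
 shows "addmap V V (%y. x \<otimes>\<^sub>V y)" "addmap V V (%y. y \<otimes>\<^sub>V x)"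
 by (rule addmapI; use assms in \<open>simp add: V_mult_closed V_simps(2) V_mult_add\<close>)+

lemma TP_add_cancel:
 assumes "a = b \<oplus>\<^sub>TP c" "b el TP" "c el TP"
 shows "a \<ominus>\<^sub>TP b \<ominus>\<^sub>TP c = \<zero>\<^sub>TP"
proof -
 have "a \<ominus>\<^sub>TP b \<ominus>\<^sub>TP c = (b \<oplus>\<^sub>TP c) \<oplus>\<^sub>TP (\<ominus>\<^sub>TP b \<oplus>\<^sub>TP \<ominus>\<^sub>TP c)"
  using assms by (simp add: TPG.minus_eq TPG.a_assoc)
 also have "... = \<zero>\<^sub>TP" using assms by (simp add: TPG.r_neg flip: TPG.minus_add)
 finally show ?thesis .
qed

lemma TR_absorb1:
 assumes "a el A" "b el A" "g : tgens"
 shows "V.cls (frag_of (a, b) \<otimes>\<^sub>V g) = \<zero>\<^sub>TP" using assms(3)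
proof (cases rule: tgens_cases)
 case (add1 c c' d)
 then show ?thesis using assms
  by (simp add: V_mult_diff V_mult_of V_cls_diff V_diff_closed fmul_V TP_add_cancel[OF L_add(3)] L_closed)
next
 case (add2 c d d')
 then show ?thesis using assms
  by (simp add: V_mult_diff V_mult_of V_cls_diff V_diff_closed fmul_V TP_add_cancel[OF L_add(4)] L_closed)
next
 case (balanced c d ka)
 then show ?thesis using assms
  by (simp add: V_mult_diff V_mult_of V_cls_diff V_diff_closed fmul_V L_balanced1 act_closed L_closed
    TPG.minus_eq_zero_iff)
qed

lemma TR_absorb2:
 assumes "a el A" "b el A" "g : tgens"
 shows "V.cls (g \<otimes>\<^sub>V frag_of (a, b)) = \<zero>\<^sub>TP" using assms(3)
proof (cases rule: tgens_cases)
 case (add1 c c' d)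
 then show ?thesis using assms
  by (simp add: V_mult_diff V_mult_of V_cls_diff V_diff_closed fmul_V TP_add_cancel[OF L_add(1)] L_closed)
next
 case (add2 c d d')
 then show ?thesis using assms
  by (simp add: V_mult_diff V_mult_of V_cls_diff V_diff_closed fmul_V TP_add_cancel[OF L_add(2)] L_closed)
next
 case (balanced c d ka)
 then show ?thesis using assms
  by (simp add: V_mult_diff V_mult_of V_cls_diff V_diff_closed fmul_V L_balanced2 act_closed L_closed
    TPG.minus_eq_zero_iff)
qed

lemma TR_absorb:
 assumes "x el V" "i : TR"
 shows "x \<otimes>\<^sub>V i : TR" "i \<otimes>\<^sub>V x : TR"
proof -
 have 1: "frag_of (a, b) \<otimes>\<^sub>V i : TR" "i \<otimes>\<^sub>V frag_of (a, b) : TR"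
  if ab: "a el A" "b el A" for a b
 proof -
  from assms(2) have "i el V & V.cls (frag_of (a, b) \<otimes>\<^sub>V i) = \<zero>\<^sub>TP & V.cls (i \<otimes>\<^sub>V frag_of (a, b)) = \<zero>\<^sub>TP"
  proof (induction rule: TR_induct)
   case (gen g)
   show ?case using TR_absorb1[OF ab gen] TR_absorb2[OF ab gen] subsetD[OF tgens_V gen] by simp
  next
   case (diff x y)
   then show ?case using ab by (simp add: V_mult_diff V_cls_diff V_mult_closed frag_of_V V_diff_closed TPG.minus_eq)
  qed (simp add: V_mult_zero V_cls_zero V_zero_closed)
  then show "frag_of (a, b) \<otimes>\<^sub>V i : TR" "i \<otimes>\<^sub>V frag_of (a, b) : TR"
   using ab V_cls_zero_iff[of "frag_of (a, b) \<otimes>\<^sub>V i"] V_cls_zero_iff[of "i \<otimes>\<^sub>V frag_of (a, b)"]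
   by (simp_all add: V_mult_closed frag_of_V)
 qed
 have d: "x - y : TR" if "x : TR" "y : TR" for x y
  using that unfolding TR_eq by (rule generate_frag_diff[OF tgens_carrier])
 have z: "0 : TR" unfolding TR_eq by (rule generate_frag_zero)
 from assms(1) show "x \<otimes>\<^sub>V i : TR"
  by (induction rule: V_induct) (use 1 d z in \<open>simp_all add: V_mult_diff V_mult_zero\<close>)
 from assms(1) show "i \<otimes>\<^sub>V x : TR"
  by (induction rule: V_induct) (use 1 d z in \<open>simp_all add: V_mult_diff V_mult_zero\<close>)
qed

lemma TP_mult_cls: "[|x el V; y el V|] ==> V.cls x \<otimes>\<^sub>TP V.cls y = V.cls (x \<otimes>\<^sub>V y)"
 unfolding TP_eq by (rule V.cls_mult[OF addmap_V_mult TR_absorb])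

lemma pt_mult: "[|a el A; b el A; c el A; d el A|] ==>
  pt a b \<otimes>\<^sub>TP pt c d = L a b c d" by (simp add: pt_eq TP_mult_cls frag_of_V V_mult_of fmul_V)

lemma pt_mult_homogeneous: "[|a el A; b : grade A p; c : grade A q; d el A|] ==>
  pt a b \<otimes>\<^sub>TP pt c d = ksign TP (p * q) (pt (a \<otimes>\<^sub>A c) (b \<otimes>\<^sub>A d))"
 by (simp add: pt_mult L_homogeneous)

lemma TP_cls_cases: assumes "x el TP" obtains c where "c el V" "x = V.cls c"
 using assms unfolding TP_eq by (rule V.cls_cases)

lemma TP_mult_closed: "[|x el TP; y el TP|] ==> x \<otimes>\<^sub>TP y el TP"
 by (elim TP_cls_cases) (simp add: TP_mult_cls V_mult_closed V_cls_closed)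

lemma TP_distr:
 assumes "x el TP" "y el TP" "z el TP"
 shows "(x \<oplus>\<^sub>TP y) \<otimes>\<^sub>TP z = x \<otimes>\<^sub>TP z \<oplus>\<^sub>TP y \<otimes>\<^sub>TP z"
  "z \<otimes>\<^sub>TP (x \<oplus>\<^sub>TP y) = z \<otimes>\<^sub>TP x \<oplus>\<^sub>TP z \<otimes>\<^sub>TP y"
proof -
 obtain a where a: "a el V" "x = V.cls a" by (rule TP_cls_cases[OF assms(1)])
 obtain b where b: "b el V" "y = V.cls b" by (rule TP_cls_cases[OF assms(2)])
 obtain c where c: "c el V" "z = V.cls c" by (rule TP_cls_cases[OF assms(3)])
 note abc = a b c
 show "(x \<oplus>\<^sub>TP y) \<otimes>\<^sub>TP z = x \<otimes>\<^sub>TP z \<oplus>\<^sub>TP y \<otimes>\<^sub>TP z"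
  "z \<otimes>\<^sub>TP (x \<oplus>\<^sub>TP y) = z \<otimes>\<^sub>TP x \<oplus>\<^sub>TP z \<otimes>\<^sub>TP y"
  using abc(1,3,5) unfolding abc(2,4,6)
  by (simp_all add: V_cls_add[symmetric] TP_mult_cls V_add_closed V_mult_closed V_mult_add)
qed

lemma TP_hinduct [consumes 1, case_names pure add]:
 assumes "x el TP"
  and "!!a b p q. [|a : grade A p; b : grade A q|] ==> P (pt a b)"
  and "!!x y. [|x el TP; y el TP; P x; P y|] ==> P (x \<oplus>\<^sub>TP y)"
 shows "P x" using assms(1)
proof (induction rule: TP_induct)
 case (pure a b)
 from \<open>a el A\<close> show ?case
 proof (induction rule: M.grade_induct)
  case a: (homogeneous p a)
  from \<open>b el A\<close> show ?case
  proof (induction rule: M.grade_induct)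
   case (homogeneous q b)
   then show ?case using a assms(2) by blast
  next
   case (add x y)
   then show ?case using a assms(3)[of "pt a x" "pt a y"] by (simp add: pt_add_r)
  qed
 next
  case (add x y)
  then show ?case using pure(2) assms(3)[of "pt x b" "pt y b"] by (simp add: pt_add_l)
 qed
qed (use assms(3) in blast)

lemma TP_ksign_mult: "[|x el TP; y el TP|] ==> ksign TP p x \<otimes>\<^sub>TP y = ksign TP p (x \<otimes>\<^sub>TP y)"
 "[|x el TP; y el TP|] ==> y \<otimes>\<^sub>TP ksign TP p x = ksign TP p (y \<otimes>\<^sub>TP x)"
proof -
 assume x: "x el TP" and y: "y el TP"
 have 1: "addmap TP TP (%x. x \<otimes>\<^sub>TP y)"
  by (rule addmapI[OF TP_mult_closed[OF _ y] TP_distr(1)[OF _ _ y]])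
 have 2: "addmap TP TP (%x. y \<otimes>\<^sub>TP x)"
  by (rule addmapI[OF TP_mult_closed[OF y] TP_distr(2)[OF _ _ y]])
 show "ksign TP p x \<otimes>\<^sub>TP y = ksign TP p (x \<otimes>\<^sub>TP y)"
  by (rule addmap_ksign[OF abelian_group_TP abelian_group_TP 1 x])
 show "y \<otimes>\<^sub>TP ksign TP p x = ksign TP p (y \<otimes>\<^sub>TP x)"
  by (rule addmap_ksign[OF abelian_group_TP abelian_group_TP 2 x])
qed

lemma TP_one: "\<one>\<^sub>TP = pt \<one>\<^sub>A \<one>\<^sub>A"
 unfolding TP_eq V.one_Q by (simp add: V_simps pt_eq)

lemma TP_assoc:
 assumes "x el TP" "y el TP" "z el TP"
 shows "(x \<otimes>\<^sub>TP y) \<otimes>\<^sub>TP z = x \<otimes>\<^sub>TP (y \<otimes>\<^sub>TP z)"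
 using assms(1)
proof (induction rule: TP_hinduct)
 case x: (pure a b p q)
 show ?case using assms(2)
 proof (induction rule: TP_hinduct)
  case y: (pure c d r s)
  show ?case using assms(3)
  proof (induction rule: TP_hinduct)
   case z: (pure e f t u)
   have cc: "a el A" "b el A" "c el A" "d el A" "e el A" "f el A"
    using x y z by auto
   have "(pt a b \<otimes>\<^sub>TP pt c d) \<otimes>\<^sub>TP pt e f =
     ksign TP (q * r + (q + s) * t) (pt (a \<otimes>\<^sub>A c \<otimes>\<^sub>A e) (b \<otimes>\<^sub>A d \<otimes>\<^sub>A f))"
    using cc pt_mult_homogeneous[OF cc(1) x(2) y(1) cc(4)]
     pt_mult_homogeneous[OF _ grade_mult[OF x(2) y(2)] z(1) cc(6), of "a \<otimes>\<^sub>A c"]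
    by (simp add: TP_ksign_mult)
   also have "... = pt a b \<otimes>\<^sub>TP (pt c d \<otimes>\<^sub>TP pt e f)"
    using cc pt_mult_homogeneous[OF cc(3) y(2) z(1) cc(6)]
     pt_mult_homogeneous[OF cc(1) x(2) grade_mult[OF y(1) z(1)], of "d \<otimes>\<^sub>A f"]
    by (simp add: TP_ksign_mult A.m_assoc algebra_simps)
   finally show ?case .
  next
   case (add u v)
   then show ?case using x y by (simp add: TP_distr TP_mult_closed)
  qed
 next
  case (add u v)
  then show ?case using x assms by (simp add: TP_distr TP_mult_closed)
 qed
next
 case (add u v)
 then show ?case using assms by (simp add: TP_distr TP_mult_closed)
qed

lemma TP_unit:
 assumes "x el TP"
 shows "\<one>\<^sub>TP \<otimes>\<^sub>TP x = x" "x \<otimes>\<^sub>TP \<one>\<^sub>TP = x"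
proof -
 show "\<one>\<^sub>TP \<otimes>\<^sub>TP x = x" using assms
 proof (induction rule: TP_hinduct)
  case (pure a b p q)
  then show ?case using pt_mult_homogeneous[OF A.one_closed one_even, of a p b] by (simp add: TP_one)
 qed (simp add: TP_distr TP_one)
 show "x \<otimes>\<^sub>TP \<one>\<^sub>TP = x" using assms
 proof (induction rule: TP_hinduct)
  case (pure a b p q)
  then show ?case using pt_mult_homogeneous[OF _ _ one_even A.one_closed, of a b q] by (simp add: TP_one)
 qed (simp add: TP_distr TP_one)
qed

theorem ring_TP: "ring TP"
proof (rule ringI[OF abelian_group_TP])
 show "Group.monoid TP" by (rule monoidI) (simp_all add: TP_mult_closed TP_assoc TP_unit, simp add: TP_one)
qed (simp_all add: TP_distr)

sublocale TP: ring TP by (rule ring_TP)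

section \<open>Scalars and grading on the tensor square\<close>

lemma act_V_gen:
 assumes "g : tgens" "ka el K"
 shows "act V g ka : tgens" using assms(1)
proof (cases rule: tgens_cases)
 case (add1 c c' d)
 then show ?thesis using tgensI(1)[of c c' "act A d ka"] assms by (simp add: V_simps frag_extend_diff act_closed)
next
 case (add2 c d d')
 then show ?thesis using tgensI(2)[of c "act A d ka" "act A d' ka"] assms
  by (simp add: V_simps frag_extend_diff act_closed act_add_left)
next
 case (balanced c d kb)
 then show ?thesis using tgensI(3)[of c "act A d ka" kb] assms
  by (simp add: V_simps frag_extend_diff act_closed lact_act)
qed

lemma act_V:
 assumes "ka el K"
 shows "addmap V V (%x. act V x ka)" "!!x. x : TR ==> act V x ka : TR"
proof -
 have c: "act V x ka el V" if "x el V" for x using that by (induction rule: V_induct)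
   (simp_all add: V_simps(5) frag_extend_diff V_zero_closed V_diff_closed frag_of_V act_closed assms)
 show "addmap V V (%x. act V x ka)" by (rule addmapI[OF c]) (simp_all add: V_simps(2,5) frag_extend_add)
 show "act V x ka : TR" if "x : TR" for x using that
 proof (induction rule: TR_induct)
  case zero
  then show ?case unfolding TR_eq using generate_frag_zero by (simp add: V_simps)
 next
  case (gen g)
  then show ?case unfolding TR_eq using act_V_gen[OF gen assms] by (simp add: generate.incl)
 next
  case (diff x y)
  then show ?case unfolding TR_eq using generate_frag_diff[OF tgens_carrier] by (simp add: V_simps frag_extend_diff)
 qed
qed

lemma act_pt: "[|a el A; b el A; ka el K|] ==> act TP (pt a b) ka = pt a (act A b ka)"
 unfolding TP_eq pt_eq by (subst V.act_cls[OF act_V]) (simp_all add: frag_of_V, simp add: V_simps)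

lemma addmap_act_TP: "ka el K ==> addmap TP TP (%x. act TP x ka)"
proof (rule addmapI)
 assume a: "ka el K"
 have e: "act TP (V.cls c) ka = V.cls (act V c ka)" if "c el V" for c
  unfolding TP_eq using V.act_cls[OF act_V[OF a] that] .
 fix x assume "x el TP"
 then obtain c where c: "c el V" "x = V.cls c" by (rule TP_cls_cases)
 then show "act TP x ka el TP" using addmap_closed[OF act_V(1)[OF a]] by (simp add: e V_cls_closed)
 fix y assume "y el TP"
 then obtain d where d: "d el V" "y = V.cls d" by (rule TP_cls_cases)
 then show "act TP (x \<oplus>\<^sub>TP y) ka = act TP x ka \<oplus>\<^sub>TP act TP y ka"
  using c addmap_closed[OF act_V(1)[OF a]] addmap_add[OF act_V(1)[OF a]]
  by (simp add: V_cls_add[symmetric] e V_add_closed V_simps(2)[symmetric])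
qed

lemma act_TP: "[|x el TP; ka el K|] ==> act TP x ka = x \<otimes>\<^sub>TP pt \<one>\<^sub>A (kap ka)"
proof (induction rule: TP_hinduct)
 case (pure a b p q)
 then show ?case using pt_mult_homogeneous[OF M.grade_carrier[OF pure(1)] pure(2) one_even kap_closed[OF pure(3)]]
  by (simp add: act_pt act_kap)
next
 case (add x y)
 then show ?case by (simp add: TP_distr addmap_add[OF addmap_act_TP])
qed

lemma grade_TP: "grade TP r = V.cls ` generate (free_Abelian_group (carrier A \<times> carrier A))
  {frag_of (a, b) | a b p q. a : grade A p & b : grade A q & p + q = r}"
 unfolding TP_eq V.grade_Q by (simp add: pair_alg_def)

lemma pt_grade: "[|a : grade A p; b : grade A q|] ==> pt a b : grade TP (p + q)"
 unfolding grade_TP pt_eq by (intro imageI generate.incl) blast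

lemma grade_TP_sub:
 "{frag_of (a, b) | a b p q. a : grade A p & b : grade A q & p + q = r} \<subseteq> carrier (free_Abelian_group (carrier A \<times> carrier A))"
 by auto

lemma grade_TP_gen_carrier: "generate (free_Abelian_group (carrier A \<times> carrier A))
  {frag_of (a, b) | a b p q. a : grade A p & b : grade A q & p + q = r} \<subseteq> carrier V"
 unfolding V_simps(1) by (rule subgroup.subset[OF generate_frag_subgroup[OF grade_TP_sub]])

lemma grade_TP_carrier: "x : grade TP r ==> x el TP"
 using grade_TP_gen_carrier V_cls_closed unfolding grade_TP by blast

lemma grade_TP_diff:
 assumes "x : grade TP r" "y : grade TP r"
 shows "x \<ominus>\<^sub>TP y : grade TP r"
proof -
 let ?G = "generate (free_Abelian_group (carrier A \<times> carrier A))
  {frag_of (a, b) | a b p q. a : grade A p & b : grade A q & p + q = r}"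
 obtain c d where cd: "c : ?G" "x = V.cls c" "d : ?G" "y = V.cls d" using assms unfolding grade_TP by blast
 have "x \<ominus>\<^sub>TP y = V.cls (c - d)" using cd grade_TP_gen_carrier by (simp add: V_cls_diff subset_iff)
 then show ?thesis unfolding grade_TP using generate_frag_diff[OF grade_TP_sub cd(1,3)] by blast
qed

lemma grade_TP_zero: "\<zero>\<^sub>TP : grade TP r"
 unfolding grade_TP V_cls_zero[symmetric] by (intro imageI generate_frag_zero)

lemma grade_TP_uminus: "x : grade TP r ==> \<ominus>\<^sub>TP x : grade TP r"
 using grade_TP_diff[OF grade_TP_zero, of x r] grade_TP_carrier by (simp add: TPG.minus_eq)

lemma grade_TP_add: "[|x : grade TP r; y : grade TP r|] ==> x \<oplus>\<^sub>TP y : grade TP r"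
 using grade_TP_diff[of x r "\<ominus>\<^sub>TP y"] grade_TP_uminus[of y r] grade_TP_carrier by (simp add: TPG.minus_eq)

lemma grade_TP_induct [consumes 1, case_names pure diff]:
 assumes "x : grade TP r"
  and "!!a b p q. [|a : grade A p; b : grade A q; p + q = r|] ==> P (pt a b)"
  and "!!x y. [|x : grade TP r; y : grade TP r; P x; P y|] ==> P (x \<ominus>\<^sub>TP y)"
 shows "P x"
proof -
 let ?g = "{frag_of (a, b) | a b p q. a : grade A p & b : grade A q & p + q = r}"
 obtain c where c: "c : generate (free_Abelian_group (carrier A \<times> carrier A)) ?g" "x = V.cls c"
  using assms(1) unfolding grade_TP by blast
 from c(1) grade_TP_sub have "P (V.cls c)"
 proof (induction rule: generate_frag_induct)
  case zero
  have "V.cls 0 = pt \<zero>\<^sub>A \<zero>\<^sub>A" by (simp add: pt_zero V_cls_zero)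
  then show ?case using assms(2)[of "\<zero>\<^sub>A" 0 "\<zero>\<^sub>A" r] by simp
 next
  case (gen g)
  then obtain a b p q where "g = frag_of (a, b)" "a : grade A p" "b : grade A q" "p + q = r" by blast
  then show ?case using assms(2)[of a p b q] by (simp add: pt_eq)
 next
  case (diff x y)
  then have "x el V" "y el V" "V.cls x : grade TP r" "V.cls y : grade TP r"
   using grade_TP_gen_carrier unfolding grade_TP by blast+
  then show ?case using diff assms(3) by (simp add: V_cls_diff)
 qed
 then show ?thesis using c(2) by simp
qed

lemma grade_TP_mult:
 assumes "x : grade TP r" "y : grade TP s"
 shows "x \<otimes>\<^sub>TP y : grade TP (r + s)" using assms(1)
proof (induction rule: grade_TP_induct)
 case x: (pure a b p q)
 show ?case using assms(2)
 proof (induction rule: grade_TP_induct)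
  case y: (pure c d t u)
  have "pt (a \<otimes>\<^sub>A c) (b \<otimes>\<^sub>A d) : grade TP ((p + t) + (q + u))"
   by (intro pt_grade grade_mult x y)
  moreover have "(p + t) + (q + u) = r + s" using x(3) y(3) by (auto simp: algebra_simps)
  ultimately have *: "pt (a \<otimes>\<^sub>A c) (b \<otimes>\<^sub>A d) : grade TP (r + s)" by simp
  have "ksign TP z (pt (a \<otimes>\<^sub>A c) (b \<otimes>\<^sub>A d)) : grade TP (r + s)" for z
   using * grade_TP_uminus[OF *] by (simp add: ksign_def)
  then show ?case using pt_mult_homogeneous[OF M.grade_carrier[OF x(1)] x(2) y(1) M.grade_carrier[OF y(2)]] by simp
 next
  case (diff y z)
  have c: "y el TP" "z el TP" "pt a b el TP" using grade_TP_carrier diff x by auto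
  then have "pt a b \<otimes>\<^sub>TP (y \<ominus>\<^sub>TP z) = pt a b \<otimes>\<^sub>TP y \<ominus>\<^sub>TP pt a b \<otimes>\<^sub>TP z"
   by (simp add: TPG.minus_eq TP_distr TP.r_minus)
  then show ?case using grade_TP_diff diff by simp
 qed
next
 case (diff x z)
 have c: "y el TP" "z el TP" "x el TP" using grade_TP_carrier diff assms by auto
 then have "(x \<ominus>\<^sub>TP z) \<otimes>\<^sub>TP y = x \<otimes>\<^sub>TP y \<ominus>\<^sub>TP z \<otimes>\<^sub>TP y"
  by (simp add: TPG.minus_eq TP_distr TP.l_minus)
 then show ?case using grade_TP_diff diff by simp
qed

end

section \<open>The coproduct and convolutions\<close>

context tensor_square
begin

lemma pt_mult_one_r:
 assumes "a el A" "b el A" "d el A"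
 shows "pt a b \<otimes>\<^sub>TP pt \<one>\<^sub>A d = pt a (b \<otimes>\<^sub>A d)"
 using assms(2)
proof (induction rule: M.grade_induct)
 case (homogeneous p b)
 then show ?case using assms pt_mult_homogeneous[OF assms(1) homogeneous one_even assms(3)] by simp
next
 case (add x y)
 then show ?case using assms by (simp add: pt_add_r TP_distr A.l_distr)
qed

lemma pt_mult_one_l:
 assumes "a el A" "c el A" "d el A"
 shows "pt a \<one>\<^sub>A \<otimes>\<^sub>TP pt c d = pt (a \<otimes>\<^sub>A c) d"
 using assms(2)
proof (induction rule: M.grade_induct)
 case (homogeneous p c)
 then show ?case using assms pt_mult_homogeneous[OF assms(1) one_even homogeneous assms(3)] by simp
next
 case (add x y)
 then show ?case using assms by (simp add: pt_add_l TP_distr A.r_distr)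
qed

end

sublocale half_supermodule \<subseteq> SS: tensor_square K "sym_alg K M" by (intro tensor_square.intro S.P.superalg_axioms)

context half_supermodule
begin

abbreviation "SS \<equiv> tensor_prod K (sym_alg K M) (sym_alg K M)"
abbreviation "pt \<equiv> pure_tensor K (sym_alg K M) (sym_alg K M)"
abbreviation "inc \<equiv> sym_inc K M"
abbreviation "sp w \<equiv> sym_prod K M (map snd w)"

lemma sym_odd:
 assumes "u : grade M 1"
 shows "inc u \<otimes>\<^sub>S inc u = \<zero>\<^sub>S"
proof -
 have "tensor_inc K M u \<otimes>\<^sub>T tensor_inc K M u : sym_ideal K M" unfolding sym_ideal_eq
  by (rule subsetD[OF T.A.genideal_self[OF sym_gens_carrier]]) (use assms in \<open>auto simp: sym_gens_def\<close>)
 then show ?thesis using M.grade_carrier[OF assms] S.Iq.quo.cls_zero_iff by (simp add: sym_inc_def S.Iq.cls_mult)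
qed

definition cop_inc where
 "cop_inc X = pt (inc X) \<one>\<^sub>S \<oplus>\<^sub>SS pt \<one>\<^sub>S (inc X)"

lemma cop_inc_closed [simp]: "X el M ==> cop_inc X el SS" by (simp add: cop_inc_def)

lemma addmap_cop_inc: "addmap M SS cop_inc" by (rule addmapI)
  (simp_all add: cop_inc_def S.pinc_add SS.pt_add_l SS.pt_add_r SS.TPG.add_4_swap)

lemma cop_inc_mult:
 assumes "v : grade M p" "w : grade M q"
 shows "cop_inc v \<otimes>\<^sub>SS cop_inc w =
  (pt (inc v \<otimes>\<^sub>S inc w) \<one>\<^sub>S \<oplus>\<^sub>SS pt \<one>\<^sub>S (inc v \<otimes>\<^sub>S inc w)) \<oplus>\<^sub>SS
  (pt (inc v) (inc w) \<oplus>\<^sub>SS ksign SS (p * q) (pt (inc w) (inc v)))"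
proof -
 have c: "v el M" "w el M" using assms by auto
 have "pt \<one>\<^sub>S (inc v) \<otimes>\<^sub>SS pt (inc w) \<one>\<^sub>S = ksign SS (p * q) (pt (inc w) (inc v))"
  using SS.pt_mult_homogeneous[OF S.P.A.one_closed S.pinc_grade[OF assms(1)] S.pinc_grade[OF assms(2)] S.P.A.one_closed] c
  by simp
 then show ?thesis using c by (simp add: cop_inc_def SS.TP_distr SS.pt_mult_one_l SS.pt_mult_one_r SS.TPG.a_ac)
qed

text \<open>Exchanging v and w permutes the two mixed terms of \<open>cop_inc_mult\<close> up to the
  sign, while the two outer terms supercommute already in S(M).\<close>

lemma cop_inc_comm:
 assumes "v : grade M p" "w : grade M q"
 shows "cop_inc v \<otimes>\<^sub>SS cop_inc w = ksign SS (p * q) (cop_inc w \<otimes>\<^sub>SS cop_inc v)"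
proof -
 have c: "v el M" "w el M" using assms by auto
 have s: "inc v \<otimes>\<^sub>S inc w = ksign S (p * q) (inc w \<otimes>\<^sub>S inc v)"
  by (rule sym_comm[OF assms])
 show ?thesis unfolding cop_inc_mult[OF assms] cop_inc_mult[OF assms(2,1)] s
  using c by (simp add: SS.pt_ksign_l SS.pt_ksign_r SS.TPG.ksign_add SS.TPG.a_comm mult.commute[of q p])
qed

lemma cop_inc_odd:
 assumes "u : grade M 1"
 shows "cop_inc u \<otimes>\<^sub>SS cop_inc u = \<zero>\<^sub>SS"
 using M.grade_carrier[OF assms] sym_odd[OF assms]
 by (simp add: cop_inc_mult[OF assms assms] SS.pt_zero SS.TPG.ksign_1 SS.TPG.r_neg)

text \<open>Scalars of the tensor square are the elements 1 (x) ka. From the right such an element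
  meets the summand X (x) 1 through the balancing relation; from the left it passes X with a sign,
  which turns the right action into the left one.\<close>

lemma cop_kap:
 assumes "X el M" "ka el K"
 shows "cop_inc (act M X ka) = cop_inc X \<otimes>\<^sub>SS pt \<one>\<^sub>S (S.P.kap ka)"
  "pt \<one>\<^sub>S (S.P.kap ka) \<otimes>\<^sub>SS cop_inc X = cop_inc (lact K M ka X)"
proof -
 have k: "lact K S ka \<one>\<^sub>S = S.P.kap ka" using assms by (simp add: S.P.lact_kap)
 show "cop_inc (act M X ka) = cop_inc X \<otimes>\<^sub>SS pt \<one>\<^sub>S (S.P.kap ka)"
 proof -
  have "pt (act S (inc X) ka) \<one>\<^sub>S = pt (inc X) (S.P.kap ka)"
   using assms by (simp only: SS.pt_balanced[OF S.pinc_closed S.P.A.one_closed] k)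
  then show ?thesis using assms by (simp add: cop_inc_def S.pinc_act SS.TP_distr SS.pt_mult_one_r S.P.act_kap)
 qed
 show "pt \<one>\<^sub>S (S.P.kap ka) \<otimes>\<^sub>SS cop_inc X = cop_inc (lact K M ka X)"
  using assms(2)
 proof (induction rule: K.grade_induct)
  case al: (homogeneous r ka)
  show ?case using assms(1)
  proof (induction rule: M.grade_induct)
   case (homogeneous p X)
   have c: "X el M" "ka el K" using homogeneous al by auto
   have kg: "S.P.kap ka : grade S r" using S.P.grade_act[OF S.P.one_even al] by (simp add: S.P.kap_def)
   have "pt \<one>\<^sub>S (S.P.kap ka) \<otimes>\<^sub>SS pt (inc X) \<one>\<^sub>S = ksign SS (r * p) (pt (inc X) (S.P.kap ka))"
    using SS.pt_mult_homogeneous[OF S.P.A.one_closed kg S.pinc_grade[OF homogeneous] S.P.A.one_closed] c by simp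
   also have "... = ksign SS (r * p) (pt (act S (inc X) ka) \<one>\<^sub>S)"
    using c by (simp add: SS.pt_balanced S.P.lact_kap)
   also have "... = pt (lact K S ka (inc X)) \<one>\<^sub>S"
    using c by (simp add: S.P.lact_homogeneous[OF S.pinc_grade[OF homogeneous] al] SS.pt_ksign_l S.P.act_closed)
   finally show ?case using c by (simp add: cop_inc_def SS.TP_distr SS.pt_mult_one_r S.pinc_lact S.P.lact_kap)
  next
   case (add x y)
   then show ?case using al by (simp add: addmap_add[OF addmap_cop_inc] SS.TP_distr lact_add_right)
  qed
 next
  case (add x y)
  then show ?case using assms(1)
   by (simp add: addmap_add[OF addmap_cop_inc] SS.TP_distr lact_add_left S.P.kap_add SS.pt_add_r)
 qed
qed

lemma coproduct_exists:
 "EX D. D : superalg_hom K S SS & (ALL X:carrier M. D (inc X) = cop_inc X)"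
proof -
 define k where "k ka = pt \<one>\<^sub>S (S.P.kap ka)" for ka
 have kh: "k : ring_hom K SS" by (rule ring_hom_memI)
   (simp_all add: k_def SS.pt_mult_one_r S.P.kap_mult S.P.kap_add S.P.kap_one SS.pt_add_r SS.TP_one)
 have rel: "h g = \<zero>\<^sub>SS"
  if h: "h : ring_hom T SS" "!!X. X el M ==> h (tensor_inc K M X) = cop_inc X" and g: "g : sym_gens" for h g
 proof -
  note hm = ring_hom_mult[OF h(1)] and hc = ring_hom_closed[OF h(1)]
  have add: "addmap T SS h" by (rule addmapI[OF ring_hom_closed[OF h(1)] ring_hom_add[OF h(1)]])
  show ?thesis using g unfolding sym_gens_def
  proof (elim UnE CollectE exE conjE)
   fix v w p q assume g: "g = tensor_inc K M v \<otimes>\<^sub>T tensor_inc K M w \<ominus>\<^sub>T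
    ksign T (p * q) (tensor_inc K M w \<otimes>\<^sub>T tensor_inc K M v)" and vw: "v : grade M p" "w : grade M q"
   have c: "v el M" "w el M" using vw by auto
   have "h g = cop_inc v \<otimes>\<^sub>SS cop_inc w \<ominus>\<^sub>SS ksign SS (p * q) (cop_inc w \<otimes>\<^sub>SS cop_inc v)"
    unfolding g using c by (simp add: T.M.minus_eq SS.TPG.minus_eq addmap_add[OF add] hm h(2)
      addmap_minus[OF T.M.ag SS.abelian_group_TP add]
      addmap_ksign[OF T.M.ag SS.abelian_group_TP add])
   then show "h g = \<zero>\<^sub>SS" using c cop_inc_comm[OF vw] by (simp add: SS.TPG.minus_eq_zero_iff)
  next
   fix u assume g: "g = tensor_inc K M u \<otimes>\<^sub>T tensor_inc K M u" and u: "u : grade M 1"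
   have c: "u el M" using u by auto
   show "h g = \<zero>\<^sub>SS" unfolding g using c by (simp add: hm h(2) cop_inc_odd[OF u])
  qed
 qed
 have ex: "EX h. h : ring_hom S SS & (ALL X:carrier M. h (inc X) = cop_inc X) &
   (ALL ka:carrier K. h (S.P.kap ka) = k ka)"
 proof (rule S.P_universal[OF SS.ring_TP kh addmap_cop_inc cop_kap[folded k_def] sym_ideal_eq sym_gens_carrier])
  fix h g assume "h : ring_hom T SS" "!!X. X el M ==> h (tensor_inc K M X) = cop_inc X" "g : sym_gens"
  then show "h g = \<zero>\<^sub>SS" by (rule rel)
 qed assumption+
 obtain h where h: "h : ring_hom S SS" "ALL X:carrier M. h (inc X) = cop_inc X"
  "ALL ka:carrier K. h (S.P.kap ka) = k ka" using ex by blast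
 define D where "D = restrict h (carrier S)"
 note hc = ring_hom_closed[OF h(1)] and hm = ring_hom_mult[OF h(1)] and ha = ring_hom_add[OF h(1)]
  and ho = ring_hom_one[OF h(1)]
 have addh: "addmap S SS h" by (rule addmapI[OF hc ha])
 have act: "h (act S x ka) = act SS (h x) ka" if "x el S" "ka el K" for x ka
  using that h(3) by (simp add: S.P.act_kap hm SS.act_TP hc k_def)
 have hw: "h (sp w) : grade SS (wpar w)" if "w : hwords M" for w using that
 proof (induction w)
  case Nil
  then show ?case using SS.pt_grade[OF S.P.one_even S.P.one_even] by (simp add: ho SS.TP_one)
 next
  case (Cons Z w)
  then have Z: "snd Z : grade M (fst Z)" "snd Z el M" "w : hwords M" by auto
  have "cop_inc (snd Z) : grade SS (fst Z)" unfolding cop_inc_def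
   using SS.pt_grade[OF S.pinc_grade[OF Z(1)] S.P.one_even] SS.pt_grade[OF S.P.one_even S.pinc_grade[OF Z(1)]]
   by (intro SS.grade_TP_add) simp_all
  then show ?case using Z Cons.IH h(2) by (simp add: hm SS.grade_TP_mult)
 qed
 have gr: "h x : grade SS r" if "x : grade S r" for x r using that
 proof (induction rule: S.grade_P_induct)
  case (word w ka)
  have "S.P.kap ka : grade S (wpar w + r)"
   using S.P.grade_act[OF S.P.one_even word(2)] by (simp add: S.P.kap_def)
  then have "k ka : grade SS (wpar w + r)"
   using SS.pt_grade[OF S.P.one_even, of "S.P.kap ka" "wpar w + r"] by (simp add: k_def)
  from SS.grade_TP_mult[OF hw[OF word(1)] this] show ?case
   using word K.grade_carrier[OF word(2)] h(3) by (simp add: S.P.act_kap hm)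
 next
  case (diff x y)
  then show ?case using SS.grade_TP_diff
   by (simp add: S.P.M.minus_eq SS.TPG.minus_eq ha addmap_minus[OF S.P.M.ag SS.abelian_group_TP addh])
 qed
 have "D : superalg_hom K S SS" unfolding superalg_hom_def Hom_def
  using hc hm ha ho act gr by (auto simp: D_def S.P.act_closed)
 moreover have "ALL X:carrier M. D (inc X) = cop_inc X" using h(2) by (simp add: D_def)
 ultimately show ?thesis by blast
qed

abbreviation "cop \<equiv> coproduct K M"

text \<open>The coproduct is a definite description: the universal property gives existence, and
  uniqueness holds because S(M) is generated by \<open>M\<close> over the scalars.\<close>

lemma cop: "cop : superalg_hom K S SS" "X el M ==> cop (inc X) = cop_inc X"
proof -
 obtain D where D: "D : superalg_hom K S SS" "ALL X:carrier M. D (inc X) = cop_inc X"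
  using coproduct_exists by blast
 have "cop = D" unfolding coproduct_def Let_def cop_inc_def[symmetric]
 proof (rule the_equality)
  fix E assume "E : superalg_hom K S SS & (ALL X:carrier M. E (inc X) = cop_inc X)"
  then show "E = D" using D by (intro S.superalg_hom_eq[of E SS D]) simp_all
 qed (use D in blast)
 then show "cop : superalg_hom K S SS" "X el M ==> cop (inc X) = cop_inc X" using D by simp_all
qed

lemma cop_closed [simp]: "x el S ==> cop x el SS"
 using cop(1) by (auto simp: superalg_hom_def Hom_def)

lemma cop_add: "[|x el S; y el S|] ==> cop (x \<oplus>\<^sub>S y) = cop x \<oplus>\<^sub>SS cop y"
 using cop(1) by (simp add: superalg_hom_def Hom_def)

lemma cop_mult: "[|x el S; y el S|] ==> cop (x \<otimes>\<^sub>S y) = cop x \<otimes>\<^sub>SS cop y"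
 using cop(1) by (simp add: superalg_hom_def)

lemma cop_act: "[|x el S; ka el K|] ==> cop (act S x ka) = act SS (cop x) ka"
 using cop(1) by (simp add: superalg_hom_def Hom_def)

lemma cop_one: "cop \<one>\<^sub>S = pt \<one>\<^sub>S \<one>\<^sub>S"
 using cop(1) by (simp add: superalg_hom_def SS.TP_one)

end

section \<open>Convolutions along the coproduct\<close>

locale conv_target = half_supermodule K M + N: supermodule K N
 for K :: "('k, 'x) superring_scheme" and M :: "('k, 'm, 'y) supermodule_scheme"
  and N :: "('k, 'n, 'z) supermodule_scheme"
begin

text \<open>Bilinear maps composed of an even \<open>F\<close> and a \<open>G\<close> of parity \<open>g\<close>: moving a scalar across costs a sign.\<close>

definition tb where
 "tb g b \<longleftrightarrow> (ALL w:carrier S. addmap S N (%v. b v w)) & (ALL v:carrier S. addmap S N (b v)) &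
  (ALL v:carrier S. ALL w:carrier S. ALL r. ALL ka:grade K r.
   b (act S v ka) w = ksign N (g * r) (b v (lact K S ka w))) &
  (ALL v:carrier S. ALL w:carrier S. ALL ka:carrier K. b v (act S w ka) = act N (b v w) ka)"

lemma tbD:
 assumes "tb g b"
 shows "w el S ==> addmap S N (%v. b v w)" "v el S ==> addmap S N (b v)"
  "[|v el S; w el S; ka : grade K r|] ==> b (act S v ka) w = ksign N (g * r) (b v (lact K S ka w))"
  "[|v el S; w el S; ka el K|] ==> b v (act S w ka) = act N (b v w) ka"
  "[|v el S; w el S|] ==> b v w el N"
proof -
 note t1 = assms[unfolded tb_def, THEN conjunct1]
  and t2 = assms[unfolded tb_def, THEN conjunct2, THEN conjunct1]
  and t3 = assms[unfolded tb_def, THEN conjunct2, THEN conjunct2, THEN conjunct1]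
  and t4 = assms[unfolded tb_def, THEN conjunct2, THEN conjunct2, THEN conjunct2]
 show 2: "v el S ==> addmap S N (b v)" by (rule t2[rule_format])
 show "w el S ==> addmap S N (%v. b v w)" by (rule t1[rule_format])
 show "[|v el S; w el S; ka : grade K r|] ==>
   b (act S v ka) w = ksign N (g * r) (b v (lact K S ka w))" by (rule t3[rule_format])
 show "[|v el S; w el S; ka el K|] ==> b v (act S w ka) = act N (b v w) ka"
  by (rule t4[rule_format])
 show "[|v el S; w el S|] ==> b v w el N"
  by (rule addmap_closed[OF 2])
qed

text \<open>The value b v w with the sign (-1)^(g p(v)) of an operator of parity g passing v. This
  sign turns the twisted balancing in \<open>tb\<close> into plain balancing, so that the form
  factors through the tensor square.\<close>

definition bil where
 "bil g b v w = b (hcomp S 0 v) w \<oplus>\<^sub>N ksign N g (b (hcomp S 1 v) w)"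

lemma bil_closed: "[|tb g b; v el S; w el S|] ==> bil g' b v w el N"
 by (simp add: bil_def tbD(5))

lemma bil_homogeneous:
 assumes "tb g b" "v : grade S q" "w el S"
 shows "bil g' b v w = ksign N (g' * q) (b v w)"
proof -
 have z: "b \<zero>\<^sub>S w = \<zero>\<^sub>N"
  using addmap_zero[OF S.P.M.ag N.M.ag tbD(1)[OF assms(1,3)]] .
 show ?thesis using tbD(5)[OF assms(1) S.P.M.grade_carrier[OF assms(2)] assms(3)]
  by (cases q) (simp_all add: bil_def S.P.M.hcomp_homogeneous[OF assms(2)] z)
qed

lemma addmap_bil_l: "[|tb g b; w el S|] ==> addmap S N (%v. bil g' b v w)"
 by (rule addmapI)
  (simp_all add: bil_closed, simp add: bil_def S.P.M.hcomp_add addmap_add[OF tbD(1)] tbD(5)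
   N.M.ksign_add N.M.add_4_swap)

lemma addmap_bil_r: "[|tb g b; v el S|] ==> addmap S N (bil g' b v)" by (rule addmapI)
  (simp_all add: bil_closed, simp add: bil_def addmap_add[OF tbD(2)] tbD(5)
   N.M.ksign_add N.M.add_4_swap)

lemma bil_balanced:
 assumes "tb g b" "v el S" "w el S" "ka el K"
 shows "bil g b (act S v ka) w = bil g b v (lact K S ka w)" using assms(4)
proof (induction rule: K.grade_induct)
 case al: (homogeneous r ka)
 show ?case using assms(2)
 proof (induction rule: S.P.M.grade_induct)
  case (homogeneous q v)
  have c: "v el S" "ka el K" "lact K S ka w el S"
   using homogeneous al assms(3) by auto
  have "bil g b (act S v ka) w = ksign N (g * (q + r)) (ksign N (g * r) (b v (lact K S ka w)))"
   using bil_homogeneous[OF assms(1) S.P.grade_act[OF homogeneous al] assms(3), of g]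
    tbD(3)[OF assms(1) c(1) assms(3) al] by simp
  also have "... = ksign N (g * q) (b v (lact K S ka w))"
   using tbD(5)[OF assms(1) c(1,3)] by (simp add: algebra_simps)
  finally show ?case by (simp add: bil_homogeneous[OF assms(1) homogeneous c(3)])
 next
  case (add x y)
  then show ?case using al assms(3) by (simp add: S.P.act_add_left S.P.act_closed addmap_add[OF addmap_bil_l[OF assms(1)]])
 qed
next
 case (add x y)
 then show ?case using assms(2,3)
  by (simp add: S.P.act_add_right S.P.act_closed S.P.lact_add_left addmap_add[OF addmap_bil_l[OF assms(1)]]
    addmap_add[OF addmap_bil_r[OF assms(1)]])
qed

text \<open>On the carrier of the tensor square the additive map is determined by its values on pure
  tensors; outside it is arbitrary, hence \<open>SOME\<close>.\<close>

definition tlift where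
 "tlift f = (SOME h. addmap SS N h & (ALL a:carrier S. ALL b:carrier S. h (pt a b) = f a b))"

lemma tlift_bil:
 assumes "tb g b"
 shows "addmap SS N (tlift (bil g b))"
  "[|v el S; w el S|] ==> tlift (bil g b) (pt v w) = bil g b v w"
proof -
 have "EX h. addmap SS N h & (ALL a:carrier S. ALL c:carrier S. h (pt a c) = bil g b a c)"
  by (rule SS.TP_universal[OF N.M.ag addmap_bil_l[OF assms] addmap_bil_r[OF assms]
     bil_balanced[OF assms]])
 from someI_ex[OF this] show "addmap SS N (tlift (bil g b))"
  "[|v el S; w el S|] ==> tlift (bil g b) (pt v w) = bil g b v w"
  unfolding tlift_def by blast+
qed

text \<open>For b v w = F(v) G(w), with F even and G of parity g, this is the convolution product:
  multiplication after F (x) G after the coproduct. With the Lie bracket in place of the product it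
  gives the bracket of maps from S(gg) to \<open>gg\<close>.\<close>

definition conv where "conv g b = (\<lambda>s\<in>carrier S. tlift (bil g b) (cop s))"

lemma conv_eq: "s el S ==> conv g b s = tlift (bil g b) (cop s)" by (simp add: conv_def)

lemma addmap_conv: "tb g b ==> addmap S N (conv g b)" by (rule addmapI)
  (simp_all add: conv_eq cop_add addmap_closed[OF tlift_bil(1)] addmap_add[OF tlift_bil(1)])

lemma bil_act:
 "[|tb g b; v el S; w el S; ka el K|] ==> bil g' b v (act S w ka) = act N (bil g' b v w) ka"
 by (simp add: bil_def tbD(4,5) N.act_add_left N.act_ksign)

lemma tlift_act:
 assumes "tb g b" "x el SS" "ka el K"
 shows "tlift (bil g b) (act SS x ka) = act N (tlift (bil g b) x) ka" using assms(2)
proof (induction rule: SS.TP_induct)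
 case (pure a c)
 then show ?case using assms by (simp add: SS.act_pt tlift_bil(2) S.P.act_closed bil_act)
next
 case (add x y)
 then show ?case using assms addmap_closed[OF SS.addmap_act_TP] addmap_closed[OF tlift_bil(1)[OF assms(1)]]
  by (simp add: addmap_add[OF SS.addmap_act_TP] addmap_add[OF tlift_bil(1)] N.act_add_left)
qed

lemma conv_Hom: "tb g b ==> conv g b : Hom K S N" unfolding Hom_def
 using addmap_closed[OF addmap_conv] addmap_add[OF addmap_conv]
 by (auto simp: conv_eq S.P.act_closed cop_act tlift_act) (simp add: conv_def)

lemma conv_one: "tb g b ==> conv g b \<one>\<^sub>S = b \<one>\<^sub>S \<one>\<^sub>S"
 using tbD(5)[of g b "\<one>\<^sub>S" "\<one>\<^sub>S"]
 by (simp add: conv_eq cop_one tlift_bil(2) bil_homogeneous[OF _ S.P.one_even])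

lemma tb_left:
 assumes "tb g b" "x el S"
 shows "tb g (%v w. b (x \<otimes>\<^sub>S v) w)" unfolding tb_def
proof (intro conjI ballI allI)
 fix w assume w: "w el S"
 show "addmap S N (%v. b (x \<otimes>\<^sub>S v) w)"
  by (rule addmap_compose[OF S.P.addmap_mult_l[OF assms(2)] tbD(1)[OF assms(1) w]])
next
 fix v assume v: "v el S"
 show "addmap S N (b (x \<otimes>\<^sub>S v))" using tbD(2)[OF assms(1)] assms(2) v by simp
next
 fix v w r ka assume h: "v el S" "w el S" "ka : grade K r"
 then show "b (x \<otimes>\<^sub>S act S v ka) w = ksign N (g * r) (b (x \<otimes>\<^sub>S v) (lact K S ka w))"
  using tbD(3)[OF assms(1) _ h(2,3), of "x \<otimes>\<^sub>S v"] assms(2) K.grade_carrier[OF h(3)]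
  by (simp add: S.P.mult_act)
next
 fix v w ka assume "v el S" "w el S" "ka el K"
 then show "b (x \<otimes>\<^sub>S v) (act S w ka) = act N (b (x \<otimes>\<^sub>S v) w) ka"
  using tbD(4)[OF assms(1)] assms(2) by simp
qed

lemma tb_right:
 assumes "tb g b" "x : grade S z"
 shows "tb (g + z) (%v w. b v (x \<otimes>\<^sub>S w))" unfolding tb_def
proof (intro conjI ballI allI)
 have x: "x el S" using assms(2) by simp
 {
  fix w assume w: "w el S"
  show "addmap S N (%v. b v (x \<otimes>\<^sub>S w))" using tbD(1)[OF assms(1)] x w by simp
 next
  fix v assume v: "v el S"
  show "addmap S N (%w. b v (x \<otimes>\<^sub>S w))"
   by (rule addmap_compose[OF S.P.addmap_mult_l[OF x] tbD(2)[OF assms(1) v]])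
 next
  fix v w r ka assume h: "v el S" "w el S" "ka : grade K r"
  have a: "ka el K" using h by auto
  have "lact K S ka (x \<otimes>\<^sub>S w) = lact K S ka x \<otimes>\<^sub>S w"
   using x a h by (simp add: S.P.lact_mult)
  also have "... = ksign S (r * z) (act S x ka \<otimes>\<^sub>S w)"
   using x a h by (simp add: S.P.lact_homogeneous[OF assms(2) h(3)] S.P.A.ring_ksign_l S.P.act_closed)
  also have "... = ksign S (r * z) (x \<otimes>\<^sub>S lact K S ka w)"
   using x a h by (simp add: S.P.act_mult)
  finally have e: "lact K S ka (x \<otimes>\<^sub>S w) = ksign S (r * z) (x \<otimes>\<^sub>S lact K S ka w)" .
  have "b (act S v ka) (x \<otimes>\<^sub>S w) = ksign N (g * r) (b v (lact K S ka (x \<otimes>\<^sub>S w)))"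
   using tbD(3)[OF assms(1) h(1) _ h(3)] x h by simp
  also have "... = ksign N (g * r + r * z) (b v (x \<otimes>\<^sub>S lact K S ka w))"
   unfolding e using addmap_ksign[OF S.P.M.ag N.M.ag tbD(2)[OF assms(1) h(1)]]
    tbD(5)[OF assms(1) h(1)] x h a by simp
  finally show "b (act S v ka) (x \<otimes>\<^sub>S w) = ksign N ((g + z) * r) (b v (x \<otimes>\<^sub>S lact K S ka w))"
   by (simp add: algebra_simps)
 next
  fix v w ka assume "v el S" "w el S" "ka el K"
  then show "b v (x \<otimes>\<^sub>S act S w ka) = act N (b v (x \<otimes>\<^sub>S w)) ka"
   using tbD(4)[OF assms(1)] x by (simp add: S.P.mult_act)
 }
qed

text \<open>The coproduct of \<open>X s\<close> splits \<open>X\<close> off to either side.\<close>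

lemma conv_Cons:
 assumes "tb g b" "X : grade M z" "s el S"
 shows "conv g b (inc X \<otimes>\<^sub>S s) =
  ksign N (g * z) (conv g (%v w. b (inc X \<otimes>\<^sub>S v) w) s) \<oplus>\<^sub>N
  conv (g + z) (%v w. b v (inc X \<otimes>\<^sub>S w)) s"
proof -
 have X: "X el M" "inc X : grade S z" "inc X el S" using assms(2) S.pinc_grade by auto
 note t1 = tb_left[OF assms(1) X(3)] and t2 = tb_right[OF assms(1) X(2)]
 note T0 = tlift_bil[OF assms(1)] and T1 = tlift_bil[OF t1] and T2 = tlift_bil[OF t2]
 have p1: "tlift (bil g b) (pt (inc X) \<one>\<^sub>S \<otimes>\<^sub>SS x) =
   ksign N (g * z) (tlift (bil g (%v w. b (inc X \<otimes>\<^sub>S v) w)) x)" if "x el SS" for x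
  using that
 proof (induction rule: SS.TP_hinduct)
  case (pure v w p q)
  have c: "v el S" "w el S" using pure by auto
  have "tlift (bil g b) (pt (inc X) \<one>\<^sub>S \<otimes>\<^sub>SS pt v w) = ksign N (g * (z + p)) (b (inc X \<otimes>\<^sub>S v) w)"
   using c X by (simp add: SS.pt_mult_one_l T0(2) bil_homogeneous[OF assms(1) S.P.grade_mult[OF X(2) pure(1)]])
  then show ?case using c X tbD(5)[OF t1 c] by (simp add: T1(2) bil_homogeneous[OF t1 pure(1)] distrib_left)
 next
  case (add x y)
  then show ?case using X addmap_closed[OF T1(1)]
   by (simp add: SS.TP_distr addmap_add[OF T0(1)] addmap_add[OF T1(1)] N.M.ksign_add)
 qed
 have p2: "tlift (bil g b) (pt \<one>\<^sub>S (inc X) \<otimes>\<^sub>SS x) =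
   tlift (bil (g + z) (%v w. b v (inc X \<otimes>\<^sub>S w))) x" if "x el SS" for x
  using that
 proof (induction rule: SS.TP_hinduct)
  case (pure v w p q)
  have c: "v el S" "w el S" using pure by auto
  have "tlift (bil g b) (pt \<one>\<^sub>S (inc X) \<otimes>\<^sub>SS pt v w) =
    ksign N (z * p) (ksign N (g * p) (b v (inc X \<otimes>\<^sub>S w)))"
   using c X SS.pt_mult_homogeneous[OF S.P.A.one_closed X(2) pure(1) c(2)]
    addmap_ksign[OF SS.abelian_group_TP N.M.ag T0(1)]
   by (simp add: T0(2) bil_homogeneous[OF assms(1) pure(1)])
  then show ?case using c X tbD(5)[OF t2 c] by (simp add: T2(2) bil_homogeneous[OF t2 pure(1)] algebra_simps)
 next
  case (add x y)
  then show ?case using X by (simp add: SS.TP_distr addmap_add[OF T0(1)] addmap_add[OF T2(1)])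
 qed
 show ?thesis using X assms(3) by (simp add: conv_eq cop_mult cop(2) cop_inc_def SS.TP_distr addmap_add[OF T0(1)] p1 p2)
qed

end

section \<open>Calculus of word functions\<close>

text \<open>The unshuffle coproduct on words: every letter goes to the left or to the right half.
  Here \<open>g\<close> is the parity of the operator together with the letters already sent right;
  a letter going left has to pass all of this.\<close>

primrec splitw :: "('n, 'z) ring_scheme => (bit \<times> 'm) list => bit =>
  ((bit \<times> 'm) list => (bit \<times> 'm) list => 'n) => 'n" where
 "splitw N [] g b = b [] []"
| "splitw N (Z # w) g b =
  ksign N (g * fst Z) (splitw N w g (%v u. b (Z # v) u)) \<oplus>\<^sub>N splitw N w (g + fst Z) (%v u. b v (Z # u))"

lemma splitw_addmap:
 assumes "abelian_group A" "abelian_group B" "addmap A B h" "w : hwords M"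
  "!!v u. [|v : hwords M; u : hwords M|] ==> b v u el A"
 shows "splitw A w g b el A & h (splitw A w g b) = splitw B w g (%v u. h (b v u))"
proof -
 interpret A: abelian_group A by fact
 show ?thesis using assms(4,5)
 proof (induction w arbitrary: g b)
  case (Cons Z w)
  then have Z: "snd Z : grade M (fst Z)" "w : hwords M" by auto
  have 1: "splitw A w g (%v u. b (Z # v) u) el A &
    h (splitw A w g (%v u. b (Z # v) u)) = splitw B w g (%v u. h (b (Z # v) u))"
   by (rule Cons.IH[OF Z(2)]) (use Z Cons.prems in auto)
  have 2: "splitw A w (g + fst Z) (%v u. b v (Z # u)) el A &
    h (splitw A w (g + fst Z) (%v u. b v (Z # u))) = splitw B w (g + fst Z) (%v u. h (b v (Z # u)))"
   by (rule Cons.IH[OF Z(2)]) (use Z Cons.prems in auto)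
  show ?case using 1 2 by (simp add: addmap_add[OF assms(3)] addmap_ksign[OF assms(1-3)])
 qed simp
qed

lemma splitw_cong:
 assumes "!!v u. [|v : hwords M; u : hwords M|] ==> b v u = b' v u" "w : hwords M"
 shows "splitw N w g b = splitw N w g b'" using assms
proof (induction w arbitrary: g b b')
 case (Cons Z w)
 then have Z: "snd Z : grade M (fst Z)" "w : hwords M" by auto
 have "splitw N w g (%v u. b (Z # v) u) = splitw N w g (%v u. b' (Z # v) u)"
  by (rule Cons.IH) (use Z Cons.prems in auto)
 moreover have "splitw N w (g + fst Z) (%v u. b v (Z # u)) = splitw N w (g + fst Z) (%v u. b' v (Z # u))"
  by (rule Cons.IH) (use Z Cons.prems in auto)
 ultimately show ?case by simp
qed simp

lemma splitw_closed:
 assumes "abelian_group A" "w : hwords M" "!!v u. [|v : hwords M; u : hwords M|] ==> b v u el A"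
 shows "splitw A w g b el A"
proof -
 have "addmap A A (%x. x)" by (rule addmapI) simp_all
 from splitw_addmap[OF assms(1,1) this assms(2), of b] assms(3) show ?thesis by blast
qed

lemma splitw_zero:
 assumes "abelian_group A" "w : hwords M"
 shows "splitw A w g (%v u. \<zero>\<^sub>A) = \<zero>\<^sub>A"
proof -
 interpret abelian_group A by fact
 have "addmap A A (%x. \<zero>\<^sub>A)" by (rule addmapI) simp_all
 from splitw_addmap[OF assms(1,1) this assms(2), of "%v u. \<zero>\<^sub>A"] show ?thesis by simp
qed

lemma splitw_add:
 assumes "abelian_group A" "w : hwords M"
  "!!v u. [|v : hwords M; u : hwords M|] ==> b v u el A"
  "!!v u. [|v : hwords M; u : hwords M|] ==> b' v u el A"
 shows "splitw A w g (%v u. b v u \<oplus>\<^sub>A b' v u) = splitw A w g b \<oplus>\<^sub>A splitw A w g b'"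
proof -
 interpret abelian_group A by fact
 show ?thesis using assms(2-4)
 proof (induction w arbitrary: g b b')
  case (Cons Z w)
  then have Z: "snd Z : grade M (fst Z)" "w : hwords M" by auto
  note c = splitw_closed[OF abelian_group_axioms Z(2)]
  have "splitw A w g (%v u. b (Z # v) u \<oplus>\<^sub>A b' (Z # v) u) =
    splitw A w g (%v u. b (Z # v) u) \<oplus>\<^sub>A splitw A w g (%v u. b' (Z # v) u)"
   by (rule Cons.IH[OF Z(2)]) (use Z Cons.prems in auto)
  moreover have "splitw A w (g + fst Z) (%v u. b v (Z # u) \<oplus>\<^sub>A b' v (Z # u)) =
    splitw A w (g + fst Z) (%v u. b v (Z # u)) \<oplus>\<^sub>A splitw A w (g + fst Z) (%v u. b' v (Z # u))"
   by (rule Cons.IH[OF Z(2)]) (use Z Cons.prems in auto)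
  moreover have "splitw A w g (%v u. b (Z # v) u) el A" "splitw A w g (%v u. b' (Z # v) u) el A"
   "splitw A w (g + fst Z) (%v u. b v (Z # u)) el A" "splitw A w (g + fst Z) (%v u. b' v (Z # u)) el A"
   by (rule c, use Z Cons.prems in auto)+
  ultimately show ?case by (simp add: ksign_add add_4_swap)
 qed simp
qed

lemma splitw_finsum:
 assumes "abelian_group A" "w : hwords M" "finite I"
  "!!i v u. [|i : I; v : hwords M; u : hwords M|] ==> b i v u el A"
 shows "splitw A w g (%v u. finsum A (%i. b i v u) I) = finsum A (%i. splitw A w g (b i)) I"
proof -
 interpret abelian_group A by fact
 show ?thesis using assms(3,4)
 proof (induction I)
  case empty
  then show ?case using splitw_zero[OF assms(1,2)] by simp
 next
  case (insert i I)
  have "splitw A w g (%v u. finsum A (%i. b i v u) (insert i I)) =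
    splitw A w g (%v u. b i v u \<oplus>\<^sub>A finsum A (%i. b i v u) I)"
   by (rule splitw_cong[OF _ assms(2)], rule finsum_insert) (use insert in auto)
  also have "... = splitw A w g (b i) \<oplus>\<^sub>A finsum A (%i. splitw A w g (b i)) I"
   using insert by (subst splitw_add[OF assms(1,2)]) auto
  also have "... = finsum A (%i. splitw A w g (b i)) (insert i I)"
   by (rule finsum_insert[symmetric]) (use insert splitw_closed[OF assms(1,2)] in auto)
  finally show ?case .
 qed
qed

lemma (in super_group) splitw_grade:
 assumes "w : hwords M" "!!v u. [|v : hwords M; u : hwords M|] ==> b v u : grade A (wpar v + wpar u + c)"
 shows "splitw A w g b : grade A (wpar w + c)" using assms
proof (induction w arbitrary: g b c)
 case Nil
 then show ?case using Nil(2)[of "[]" "[]"] by simp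
next
 case (Cons Z w)
 then have Z: "snd Z : grade M (fst Z)" "w : hwords M" by auto
 have "splitw A w g (%v u. b (Z # v) u) : grade A (wpar w + (c + fst Z))"
 proof (rule Cons.IH[OF Z(2)])
  fix v u assume "v : hwords M" "u : hwords M"
  then show "b (Z # v) u : grade A (wpar v + wpar u + (c + fst Z))"
   using Cons.prems(2)[of "Z # v" u] Z(1) by (simp add: ac_simps)
 qed
 moreover have "splitw A w (g + fst Z) (%v u. b v (Z # u)) : grade A (wpar w + (c + fst Z))"
 proof (rule Cons.IH[OF Z(2)])
  fix v u assume "v : hwords M" "u : hwords M"
  then show "b v (Z # u) : grade A (wpar v + wpar u + (c + fst Z))"
   using Cons.prems(2)[of v "Z # u"] Z(1) by (simp add: ac_simps)
 qed
 ultimately show ?case by (simp add: ac_simps)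
qed

section \<open>Homogeneous word functions, their bracket and their composition\<close>

context half_lie
begin

type_synonym ('a) hw = "(bit \<times> 'a) list"

lemma addmap_bracket_l: "Y el gg ==> addmap gg gg (%X. bracket gg X Y)"
 by (rule addmapI) (simp_all add: bracket_closed bracket_add_left)

lemma addmap_bracket_r: "X el gg ==> addmap gg gg (%Y. bracket gg X Y)"
 by (rule addmapI) (simp_all add: bracket_closed bracket_add_right)

lemma bracket_ksign:
 "[|X el gg; Y el gg|] ==> bracket gg (ksign gg p X) Y = ksign gg p (bracket gg X Y)"
 "[|X el gg; Y el gg|] ==> bracket gg X (ksign gg p Y) = ksign gg p (bracket gg X Y)"
 using addmap_ksign[OF M.ag M.ag addmap_bracket_l]
  addmap_ksign[OF M.ag M.ag addmap_bracket_r] by auto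

lemma bracket_zero:
 "Y el gg ==> bracket gg \<zero>\<^sub>gg Y = \<zero>\<^sub>gg" "X el gg ==> bracket gg X \<zero>\<^sub>gg = \<zero>\<^sub>gg"
 using addmap_zero[OF M.ag M.ag addmap_bracket_l]
  addmap_zero[OF M.ag M.ag addmap_bracket_r] by auto

lemma jacobi:
 assumes "X : grade gg p" "Y : grade gg q" "Z el gg"
 shows "bracket gg X (bracket gg Y Z) =
  bracket gg (bracket gg X Y) Z \<oplus>\<^sub>gg ksign gg (p * q) (bracket gg Y (bracket gg X Z))"
proof -
 have c: "bracket gg X (bracket gg Y Z) el gg" "ksign gg (p * q) (bracket gg Y (bracket gg X Z)) el gg"
  using assms by (simp_all add: bracket_closed)
 then show ?thesis unfolding bracket_jacobi[OF assms] by (simp add: M.minus_eq M.a_assoc M.l_neg)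
qed

text \<open>Word functions of parity f, the traces on words of homogeneous maps from S(gg) to
  \<open>gg\<close>. They see the order of the letters, and this permits inductions that split off
  the first letter.\<close>

definition wf where "wf f F \<longleftrightarrow> (ALL w:hwords gg. F w : grade gg (f + wpar w))"

lemma wfD: "[|wf f F; w : hwords gg|] ==> F w : grade gg (f + wpar w)"
 by (simp add: wf_def)

lemma wf_closed [simp]: "[|wf f F; w : hwords gg|] ==> F w el gg"
 using wfD M.grade_carrier by blast

lemma wf_shift [simp]: "[|wf f F; snd Z : grade gg (fst Z)|] ==> wf (f + fst Z) (%v. F (Z # v))"
 unfolding wf_def
proof
 fix w assume "ALL w:hwords gg. F w : grade gg (f + wpar w)" "snd Z : grade gg (fst Z)" "w : hwords gg"
 then have "F (Z # w) : grade gg (f + wpar (Z # w))" by (metis hwords_Cons)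
 then show "F (Z # w) : grade gg (f + fst Z + wpar w)" by (simp add: add.assoc)
qed

lemma wf_add [simp]: "[|wf f F; wf f G|] ==> wf f (%v. F v \<oplus>\<^sub>gg G v)"
 by (simp add: wf_def)

lemma wf_ksign [simp]: "wf f F ==> wf f (%v. ksign gg p (F v))" by (simp add: wf_def)

text \<open>The convolution bracket {F, G}: split the word, evaluate F on the left half and G on the
  right half, and take the Lie bracket.\<close>

definition br where "br w g F G = splitw gg w g (%v u. bracket gg (F v) (G u))"

text \<open>F after the operator with symbol H, as \<open>hh_cmp\<close> shows. H consumes the right
  half u, and its value is appended as a new last letter; its parity is recorded as h plus the
  parity of u.\<close>

definition cmp where "cmp w h F H = splitw gg w h (%v u. F (v @ [(h + wpar u, H u)]))"

lemma br_simps [simp]: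
 "br [] g F G = bracket gg (F []) (G [])"
 "br (Z # w) g F G =
  ksign gg (g * fst Z) (br w g (%v. F (Z # v)) G) \<oplus>\<^sub>gg br w (g + fst Z) F (%v. G (Z # v))"
 by (simp_all add: br_def)

lemma cmp_simps [simp]:
 "cmp [] h F H = F [(h, H [])]"
 "cmp (Z # w) h F H =
  ksign gg (h * fst Z) (cmp w h (%v. F (Z # v)) H) \<oplus>\<^sub>gg cmp w (h + fst Z) F (%v. H (Z # v))"
 by (simp_all add: cmp_def add.assoc)

lemma br_grade:
 assumes "w : hwords gg" "wf f F" "wf g G"
 shows "br w g F G : grade gg (f + g + wpar w)"
proof -
 have "splitw gg w g (%v u. bracket gg (F v) (G u)) : grade gg (wpar w + (f + g))"
 proof (rule M.splitw_grade[OF assms(1)])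
  show "bracket gg (F v) (G u) : grade gg (wpar v + wpar u + (f + g))" if "v : hwords gg" "u : hwords gg" for v u
   using grade_bracket[OF wfD[OF assms(2) that(1)] wfD[OF assms(3) that(2)]] by (simp add: ac_simps)
 qed
 then show ?thesis by (simp add: br_def add.commute)
qed

lemma br_closed [simp]: "[|w : hwords gg; wf f F; wf g G|] ==> br w g F G el gg"
 using br_grade M.grade_carrier by blast

lemma wf_br [simp]: "[|wf f F; wf g G|] ==> wf (f + g) (%w. br w g F G)"
 unfolding wf_def[of "f + g"] using br_grade by blast

lemma br_cong:
 assumes "!!v. v : hwords gg ==> F v = F' v" "!!v. v : hwords gg ==> G v = G' v" "w : hwords gg"
 shows "br w g F G = br w g F' G'" unfolding br_def by (rule splitw_cong[OF _ assms(3)]) (simp add: assms)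

lemma br_add_l:
 assumes "w : hwords gg" "wf f F" "wf f F'" "wf g G"
 shows "br w g (%v. F v \<oplus>\<^sub>gg F' v) G = br w g F G \<oplus>\<^sub>gg br w g F' G"
 unfolding br_def by (subst splitw_add[OF M.ag assms(1), symmetric])
  (use assms in \<open>auto intro!: splitw_cong[OF _ assms(1)] simp: bracket_add_left bracket_closed\<close>)

lemma br_add_r:
 assumes "w : hwords gg" "wf f F" "wf g G" "wf g G'"
 shows "br w g F (%v. G v \<oplus>\<^sub>gg G' v) = br w g F G \<oplus>\<^sub>gg br w g F G'"
 unfolding br_def by (subst splitw_add[OF M.ag assms(1), symmetric])
  (use assms in \<open>auto intro!: splitw_cong[OF _ assms(1)] simp: bracket_add_right bracket_closed\<close>)

lemma br_map:
 assumes "w : hwords gg" "wf f F" "wf g G" "addmap gg gg h"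
  "!!v u. [|v : hwords gg; u : hwords gg|] ==> bracket gg (F' v) (G' u) = h (bracket gg (F v) (G u))"
 shows "br w g F' G' = h (br w g F G)" unfolding br_def
 by (subst splitw_addmap[OF M.ag M.ag assms(4,1), THEN conjunct2])
  (use assms in \<open>auto intro!: splitw_cong[OF _ assms(1)] simp: bracket_closed\<close>)

lemma addmap_ksign_self: "addmap gg gg (ksign gg p)" by (rule addmapI) (simp_all add: M.ksign_add)

lemma br_ksign:
 assumes "w : hwords gg" "wf f F" "wf g G"
 shows "br w g (%v. ksign gg p (F v)) G = ksign gg p (br w g F G)"
  "br w g F (%v. ksign gg p (G v)) = ksign gg p (br w g F G)"
 by (rule br_map[OF assms addmap_ksign_self], use assms in \<open>simp add: bracket_ksign\<close>)+

text \<open>Sending the first letter left in {F, G} corresponds to sending it right in {G, F}. The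
  recursions exchange their two terms, and the empty word is skew symmetry in
  \<open>gg\<close>.\<close>

lemma br_skew:
 assumes "w : hwords gg" "wf f F" "wf g G"
 shows "br w g F G = ksign gg (1 + f * g) (br w f G F)" using assms
proof (induction w arbitrary: f g F G)
 case Nil
 have c: "F [] : grade gg f" "G [] : grade gg g" using wfD[OF Nil(2), of "[]"] wfD[OF Nil(3), of "[]"] by auto
 then have "bracket gg (G []) (F []) el gg" by (simp add: bracket_closed)
 then show ?case using bracket_skew[OF c] by (simp add: M.uminus_ksign)
next
 case (Cons Z w)
 then have Z: "snd Z : grade gg (fst Z)" "w : hwords gg" by auto
 note q = wf_shift[OF Cons.prems(2) Z(1)] wf_shift[OF Cons.prems(3) Z(1)]
 note c = br_closed[OF Z(2) Cons.prems(3) q(1)] br_closed[OF Z(2) q(2) Cons.prems(2)]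
 show ?case using Cons.IH[OF Z(2) q(1) Cons.prems(3)] Cons.IH[OF Z(2) Cons.prems(2) q(2)] c
  by (simp add: M.ksign_add) (simp add: algebra_simps M.a_comm)
qed

text \<open>The first letter is handed to F, to G or to H, and the induction hypothesis is used once
  for each recipient. The empty word is the Jacobi identity of \<open>gg\<close>; the remaining work
  consists in matching sign exponents.\<close>

lemma br_jacobi:
 assumes "w : hwords gg" "wf f F" "wf g G" "wf h H"
 shows "br w (g + h) F (%v. br v h G H) =
  br w h (%v. br v g F G) H \<oplus>\<^sub>gg ksign gg (f * g) (br w (f + h) G (%v. br v h F H))"
 using assms
proof (induction w arbitrary: f g h F G H)
 case Nil
 have "F [] : grade gg f" "G [] : grade gg g" "H [] el gg"
  using wfD[OF Nil(2), of "[]"] wfD[OF Nil(3), of "[]"] wf_closed[OF Nil(4), of "[]"] by auto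
 from jacobi[OF this] show ?case by simp
next
 case (Cons Z w)
 then have Z: "snd Z : grade gg (fst Z)" and w: "w : hwords gg" by auto
 let ?z = "fst Z"
 note F = Cons.prems(2) and G = Cons.prems(3) and H = Cons.prems(4)
 note F' = wf_shift[OF F Z] and G' = wf_shift[OF G Z] and H' = wf_shift[OF H Z]
 let ?F = "%v. F (Z # v)" and ?G = "%v. G (Z # v)" and ?H = "%v. H (Z # v)"
 have wH: "wf (g + h + ?z) (%v. br v h ?G H)" "wf (g + h + ?z) (%v. br v (h + ?z) G ?H)"
  using wf_br[OF G' H] wf_br[OF G H'] by (simp_all add: ac_simps)
 have wG: "wf (f + g + ?z) (%v. br v g ?F G)" "wf (f + g + ?z) (%v. br v (g + ?z) F ?G)"
  using wf_br[OF F' G] wf_br[OF F G'] by (simp_all add: ac_simps)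
 have wF: "wf (f + h + ?z) (%v. br v h ?F H)" "wf (f + h + ?z) (%v. br v (h + ?z) F ?H)"
  using wf_br[OF F' H] wf_br[OF F H'] by (simp_all add: ac_simps)
 have L: "br (Z # w) (g + h) F (%v. br v h G H) =
   ksign gg ((g + h) * ?z) (br w (g + h) ?F (%v. br v h G H)) \<oplus>\<^sub>gg
   (ksign gg (h * ?z) (br w (g + h + ?z) F (%v. br v h ?G H)) \<oplus>\<^sub>gg
    br w (g + h + ?z) F (%v. br v (h + ?z) G ?H))"
  using br_add_r[OF w F wf_ksign[OF wH(1)] wH(2)] br_ksign(2)[OF w F wH(1)] by simp
 have R1: "br (Z # w) h (%v. br v g F G) H =
   ksign gg (h * ?z) (ksign gg (g * ?z) (br w h (%v. br v g ?F G) H) \<oplus>\<^sub>gg br w h (%v. br v (g + ?z) F ?G) H) \<oplus>\<^sub>gg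
   br w (h + ?z) (%v. br v g F G) ?H"
  using br_add_l[OF w wf_ksign[OF wG(1)] wG(2) H] br_ksign(1)[OF w wG(1) H] by simp
 have R2: "br (Z # w) (f + h) G (%v. br v h F H) =
   ksign gg ((f + h) * ?z) (br w (f + h) ?G (%v. br v h F H)) \<oplus>\<^sub>gg
   (ksign gg (h * ?z) (br w (f + h + ?z) G (%v. br v h ?F H)) \<oplus>\<^sub>gg
    br w (f + h + ?z) G (%v. br v (h + ?z) F ?H))"
  using br_add_r[OF w G wf_ksign[OF wF(1)] wF(2)] br_ksign(2)[OF w G wF(1)] by simp
 have I1: "br w (g + h) ?F (%v. br v h G H) =
   br w h (%v. br v g ?F G) H \<oplus>\<^sub>gg ksign gg ((f + ?z) * g) (br w (f + h + ?z) G (%v. br v h ?F H))"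
  using Cons.IH[OF w F' G H] by (simp add: ac_simps)
 have I2: "br w (g + h + ?z) F (%v. br v h ?G H) =
   br w h (%v. br v (g + ?z) F ?G) H \<oplus>\<^sub>gg ksign gg (f * (g + ?z)) (br w (f + h) ?G (%v. br v h F H))"
  using Cons.IH[OF w F G' H] by (simp add: ac_simps)
 have I3: "br w (g + h + ?z) F (%v. br v (h + ?z) G ?H) =
   br w (h + ?z) (%v. br v g F G) ?H \<oplus>\<^sub>gg ksign gg (f * g) (br w (f + h + ?z) G (%v. br v (h + ?z) F ?H))"
  using Cons.IH[OF w F G H'] by (simp add: ac_simps)
 define a1 a2 a3 b1 b2 b3 where d:
  "a1 = br w h (%v. br v g ?F G) H" "a2 = br w h (%v. br v (g + ?z) F ?G) H"
  "a3 = br w (h + ?z) (%v. br v g F G) ?H"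
  "b1 = br w (f + h + ?z) G (%v. br v h ?F H)" "b2 = br w (f + h) ?G (%v. br v h F H)"
  "b3 = br w (f + h + ?z) G (%v. br v (h + ?z) F ?H)"
 have c: "a1 el gg" "a2 el gg" "a3 el gg" "b1 el gg" "b2 el gg" "b3 el gg"
  unfolding d using br_closed[OF w wG(1) H] br_closed[OF w wG(2) H] br_closed[OF w wf_br[OF F G] H']
   br_closed[OF w G wF(1)] br_closed[OF w G' wf_br[OF F H]] br_closed[OF w G wF(2)] by simp_all
 have s: "(g + h) * ?z + (f + ?z) * g = f * g + h * ?z" "h * ?z + f * (g + ?z) = f * g + (f + h) * ?z"
  by (simp_all add: algebra_simps)
 show ?case unfolding L R1 R2 I1 I2 I3 d[symmetric] using c s by (simp add: M.ksign_add) (simp add: algebra_simps M.a_ac)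
qed

lemma wf_snoc:
 assumes "wf f F" "wf h H" "v : hwords gg" "u : hwords gg"
 shows "F (v @ [(h + wpar u, H u)]) : grade gg (wpar v + wpar u + (f + h))"
 using wfD[OF assms(1), of "v @ [(h + wpar u, H u)]"] wfD[OF assms(2,4)] assms(3) by (simp add: ac_simps)

lemma wf_snoc_closed [simp]:
 "[|wf f F; wf h H; v : hwords gg; u : hwords gg|] ==> F (v @ [(h + wpar u, H u)]) el gg"
 using wf_snoc M.grade_carrier by blast

lemma cmp_closed: "[|w : hwords gg; wf f F; wf h H|] ==> cmp w h F H : grade gg (f + h + wpar w)"
proof -
 assume w: "w : hwords gg" and F: "wf f F" and H: "wf h H"
 have "splitw gg w h (%v u. F (v @ [(h + wpar u, H u)])) : grade gg (wpar w + (f + h))"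
  by (rule M.splitw_grade[OF w]) (rule wf_snoc[OF F H])
 then show ?thesis unfolding cmp_def by (simp add: add.commute)
qed

lemma wf_cmp: "[|wf f F; wf h H|] ==> wf (f + h) (%w. cmp w h F H)"
 unfolding wf_def[of "f + h"] using cmp_closed by blast

lemma cmp_cong:
 assumes "!!v. v : hwords gg ==> F v = F' v" "!!v. v : hwords gg ==> H v = H' v" "w : hwords gg" "wf h H"
 shows "cmp w h F H = cmp w h F' H'" unfolding cmp_def
proof (rule splitw_cong[OF _ assms(3)])
 fix v u assume vu: "v : hwords gg" "u : hwords gg"
 then show "F (v @ [(h + wpar u, H u)]) = F' (v @ [(h + wpar u, H' u)])"
  using assms(1)[of "v @ [(h + wpar u, H u)]"] assms(2)[OF vu(2)] wfD[OF assms(4) vu(2)] by simp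
qed

lemma cmp_add:
 assumes "w : hwords gg" "wf f F" "wf f F'" "wf h H"
 shows "cmp w h (%v. F v \<oplus>\<^sub>gg F' v) H = cmp w h F H \<oplus>\<^sub>gg cmp w h F' H"
 unfolding cmp_def by (rule splitw_add[OF M.ag assms(1)])
  (rule wf_snoc_closed[OF assms(2,4)] wf_snoc_closed[OF assms(3,4)], assumption+)+

lemma cmp_map:
 assumes "w : hwords gg" "wf f F" "wf h H" "addmap gg gg k"
 shows "cmp w h (%v. k (F v)) H = k (cmp w h F H)" unfolding cmp_def
 by (rule splitw_addmap[OF M.ag M.ag assms(4,1), THEN conjunct2, symmetric])
  (rule wf_snoc_closed[OF assms(2,3)])

lemmas cmp_ksign = cmp_map[OF _ _ _ addmap_ksign_self]

lemma cmp_zero: "cmp w h (%v. \<zero>\<^sub>gg) H = \<zero>\<^sub>gg"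
 by (induction w arbitrary: h H) simp_all

lemma br_zero:
 assumes "w : hwords gg" "wf g G"
 shows "br w g (%v. \<zero>\<^sub>gg) G = \<zero>\<^sub>gg" "br w h G (%v. \<zero>\<^sub>gg) = \<zero>\<^sub>gg"
proof -
 note z = splitw_zero[OF M.ag assms(1)]
 show "br w g (%v. \<zero>\<^sub>gg) G = \<zero>\<^sub>gg"
  unfolding br_def by (rule trans[OF splitw_cong[OF _ assms(1)] z]) (simp add: bracket_zero wf_closed[OF assms(2)])
 show "br w h G (%v. \<zero>\<^sub>gg) = \<zero>\<^sub>gg"
  unfolding br_def by (rule trans[OF splitw_cong[OF _ assms(1)] z]) (simp add: bracket_zero wf_closed[OF assms(2)])
qed

text \<open>Precomposition with the vector field of \<open>H\<close> is a derivation of the convolution bracket.\<close>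

lemma cmp_br:
 assumes "w : hwords gg" "wf f F" "wf g G" "wf h H"
 shows "cmp w h (%v. br v g F G) H =
  ksign gg (g * h) (br w g (%v. cmp v h F H) G) \<oplus>\<^sub>gg br w (g + h) F (%v. cmp v h G H)"
 using assms
proof (induction w arbitrary: f g h F G H)
 case Nil
 then show ?case by simp
next
 case (Cons Z w)
 then have Z: "snd Z : grade gg (fst Z)" and w: "w : hwords gg" by auto
 let ?z = "fst Z"
 note F = Cons.prems(2) and G = Cons.prems(3) and H = Cons.prems(4)
 note F' = wf_shift[OF F Z] and G' = wf_shift[OF G Z] and H' = wf_shift[OF H Z]
 let ?F = "%v. F (Z # v)" and ?G = "%v. G (Z # v)" and ?H = "%v. H (Z # v)"
 have wFG: "wf (f + g + ?z) (%v. br v g ?F G)" "wf (f + g + ?z) (%v. br v (g + ?z) F ?G)"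
  using wf_br[OF F' G] wf_br[OF F G'] by (simp_all add: ac_simps)
 have wFH: "wf (f + h + ?z) (%v. cmp v h ?F H)" "wf (f + h + ?z) (%v. cmp v (h + ?z) F ?H)"
  using wf_cmp[OF F' H] wf_cmp[OF F H'] by (simp_all add: ac_simps)
 have wGH: "wf (g + h + ?z) (%v. cmp v h ?G H)" "wf (g + h + ?z) (%v. cmp v (h + ?z) G ?H)"
  using wf_cmp[OF G' H] wf_cmp[OF G H'] by (simp_all add: ac_simps)
 have L: "cmp (Z # w) h (%v. br v g F G) H =
   ksign gg (h * ?z) (ksign gg (g * ?z) (cmp w h (%v. br v g ?F G) H) \<oplus>\<^sub>gg cmp w h (%v. br v (g + ?z) F ?G) H) \<oplus>\<^sub>gg
   cmp w (h + ?z) (%v. br v g F G) ?H"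
  using cmp_add[OF w wf_ksign[OF wFG(1)] wFG(2) H] cmp_ksign[OF w wFG(1) H] by simp
 have R1: "br (Z # w) g (%v. cmp v h F H) G =
   ksign gg (g * ?z) (ksign gg (h * ?z) (br w g (%v. cmp v h ?F H) G) \<oplus>\<^sub>gg br w g (%v. cmp v (h + ?z) F ?H) G) \<oplus>\<^sub>gg
   br w (g + ?z) (%v. cmp v h F H) ?G"
  using br_add_l[OF w wf_ksign[OF wFH(1)] wFH(2) G] br_ksign(1)[OF w wFH(1) G] by simp
 have R2: "br (Z # w) (g + h) F (%v. cmp v h G H) =
   ksign gg ((g + h) * ?z) (br w (g + h) ?F (%v. cmp v h G H)) \<oplus>\<^sub>gg
   (ksign gg (h * ?z) (br w (g + h + ?z) F (%v. cmp v h ?G H)) \<oplus>\<^sub>gg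
    br w (g + h + ?z) F (%v. cmp v (h + ?z) G ?H))"
  using br_add_r[OF w F wf_ksign[OF wGH(1)] wGH(2)] br_ksign(2)[OF w F wGH(1)] by simp
 have I1: "cmp w h (%v. br v g ?F G) H =
   ksign gg (g * h) (br w g (%v. cmp v h ?F H) G) \<oplus>\<^sub>gg br w (g + h) ?F (%v. cmp v h G H)"
  by (rule Cons.IH[OF w F' G H])
 have I2: "cmp w h (%v. br v (g + ?z) F ?G) H =
   ksign gg ((g + ?z) * h) (br w (g + ?z) (%v. cmp v h F H) ?G) \<oplus>\<^sub>gg br w (g + h + ?z) F (%v. cmp v h ?G H)"
  using Cons.IH[OF w F G' H] by (simp add: ac_simps)
 have I3: "cmp w (h + ?z) (%v. br v g F G) ?H =
   ksign gg (g * (h + ?z)) (br w g (%v. cmp v (h + ?z) F ?H) G) \<oplus>\<^sub>gg br w (g + h + ?z) F (%v. cmp v (h + ?z) G ?H)"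
  using Cons.IH[OF w F G H'] by (simp add: ac_simps)
 define a1 a2 a3 b1 b2 b3 where d:
  "a1 = br w g (%v. cmp v h ?F H) G" "a2 = br w (g + ?z) (%v. cmp v h F H) ?G"
  "a3 = br w g (%v. cmp v (h + ?z) F ?H) G"
  "b1 = br w (g + h) ?F (%v. cmp v h G H)" "b2 = br w (g + h + ?z) F (%v. cmp v h ?G H)"
  "b3 = br w (g + h + ?z) F (%v. cmp v (h + ?z) G ?H)"
 have c: "a1 el gg" "a2 el gg" "a3 el gg" "b1 el gg" "b2 el gg" "b3 el gg"
  unfolding d using br_closed[OF w wFH(1) G] br_closed[OF w wf_cmp[OF F H] G'] br_closed[OF w wFH(2) G]
   br_closed[OF w F' wf_cmp[OF G H]] br_closed[OF w F wGH(1)] br_closed[OF w F wGH(2)] by simp_all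
 show ?case unfolding L R1 R2 I1 I2 I3 d[symmetric] using c by (simp add: M.ksign_add) (simp add: algebra_simps M.a_ac)
qed

definition xw :: "'g hw => 'g" where
 "xw w = (if length w = 1 then snd (hd w) else \<zero>\<^sub>gg)"

definition const :: "'g => 'g hw => 'g" where
 "const a w = (if w = [] then a else \<zero>\<^sub>gg)"

lemma xw_simps [simp]: "xw [] = \<zero>\<^sub>gg" "(%v. xw (Z # v)) = const (snd Z)"
 by (auto simp: xw_def const_def)

lemma const_simps [simp]: "const a [] = a" "(%v. const a (Z # v)) = (%v. \<zero>\<^sub>gg)"
 by (simp_all add: const_def)

lemma wf_const [simp]: "a : grade gg p ==> wf p (const a)" by (auto simp: wf_def const_def)

lemma wf_xw [simp]: "wf 0 xw"
proof -
 have "xw w : grade gg (0 + wpar w)" if "w : hwords gg" for w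
  using that by (cases w; cases "tl w") (auto simp: xw_def)
 then show ?thesis by (simp add: wf_def)
qed

lemma wf_zero [simp]: "wf p (%v. \<zero>\<^sub>gg)" by (simp add: wf_def)

lemma br_const:
 assumes "w : hwords gg" "wf g G" "Y el gg"
 shows "br w g (const Y) G = bracket gg Y (G w)" using assms
proof (induction w arbitrary: g G)
 case (Cons Z w)
 then have Z: "snd Z : grade gg (fst Z)" "w : hwords gg" by auto
 then show ?case using Cons.IH[OF Z(2) wf_shift[OF Cons.prems(2) Z(1)]] Cons.prems
   wf_closed[OF wf_shift[OF Cons.prems(2) Z(1)] Z(2)] by (simp add: br_zero(1) bracket_closed)
qed simp

lemma br_x_Cons:
 assumes "Z # w : hwords gg" "wf g G"
 shows "br (Z # w) g xw G =
  ksign gg (g * fst Z) (bracket gg (snd Z) (G w)) \<oplus>\<^sub>gg br w (g + fst Z) xw (%v. G (Z # v))"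
proof -
 have "w : hwords gg" "snd Z el gg" using assms by auto
 then show ?thesis using assms(2) by (simp add: br_const)
qed

lemma cmp_const: "cmp w h (const a) H = \<zero>\<^sub>gg"
 by (induction w arbitrary: h H) (simp_all add: cmp_zero const_def)

text \<open>A vector field applied to the coordinate x returns its own coefficient: x is nonzero
  only on one-letter words, so H must consume the entire word.\<close>

lemma cmp_x:
 assumes "w : hwords gg" "wf h H"
 shows "cmp w h xw H = H w" using assms
proof (induction w arbitrary: h H)
 case Nil
 then show ?case by (simp add: xw_def)
next
 case (Cons Z w)
 then have Z: "snd Z : grade gg (fst Z)" "w : hwords gg" by auto
 then show ?case using Cons.IH[OF Z(2) wf_shift[OF Cons.prems(2) Z(1)]] wf_closed[OF wf_shift[OF Cons.prems(2) Z(1)] Z(2)]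
  by (simp add: cmp_const)
qed

primrec adw :: "bit => 'g => nat => 'g hw => 'g" where
 "adw p a 0 = const a"
| "adw p a (Suc n) = (%w. br w p xw (adw p a n))"

lemma wf_adw [simp]: "a : grade gg p ==> wf p (adw p a n)"
proof (induction n)
 case (Suc n)
 then show ?case using wf_br[OF wf_xw, of p "adw p a n"] by simp
qed simp

lemma br_length:
 assumes "w : hwords gg" "wf f F" "wf g G" "!!v. [|v : hwords gg; length v \<noteq> i|] ==> F v = \<zero>\<^sub>gg"
  "!!v. [|v : hwords gg; length v \<noteq> j|] ==> G v = \<zero>\<^sub>gg" "length w \<noteq> i + j"
 shows "br w g F G = \<zero>\<^sub>gg" using assms
proof (induction w arbitrary: f g F G i j)
 case Nil
 then have "F [] = \<zero>\<^sub>gg \<or> G [] = \<zero>\<^sub>gg" by (cases i) auto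
 moreover have "F [] el gg" "G [] el gg" using Nil wf_closed by auto
 ultimately show ?case by (auto simp: bracket_zero)
next
 case (Cons Z w)
 then have Z: "snd Z : grade gg (fst Z)" "w : hwords gg" by auto
 have 1: "br w g (%v. F (Z # v)) G = \<zero>\<^sub>gg"
 proof (cases i)
  case 0
  then have "br w g (%v. F (Z # v)) G = br w g (%v. \<zero>\<^sub>gg) G"
   using Z Cons.prems(4) by (intro br_cong) auto
  then show ?thesis using br_zero(1)[OF Z(2) Cons.prems(3)] by simp
 next
  case (Suc i')
  show ?thesis by (rule Cons.IH[OF Z(2) wf_shift[OF Cons.prems(2) Z(1)] Cons.prems(3), of i' j])
    (use Z Cons.prems Suc in auto)
 qed
 have 2: "br w (g + fst Z) F (%v. G (Z # v)) = \<zero>\<^sub>gg"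
 proof (cases j)
  case 0
  then have "br w (g + fst Z) F (%v. G (Z # v)) = br w (g + fst Z) F (%v. \<zero>\<^sub>gg)"
   using Z Cons.prems(5) by (intro br_cong) auto
  then show ?thesis using br_zero(2)[OF Z(2) Cons.prems(2)] by simp
 next
  case (Suc j')
  show ?thesis by (rule Cons.IH[OF Z(2) Cons.prems(2) wf_shift[OF Cons.prems(3) Z(1)], of i j'])
    (use Z Cons.prems Suc in auto)
 qed
 show ?case using 1 2 by simp
qed

lemma adw_length: "[|a : grade gg p; w : hwords gg; length w \<noteq> n|] ==> adw p a n w = \<zero>\<^sub>gg"
proof (induction n arbitrary: w)
 case (Suc n)
 have "br w p xw (adw p a n) = \<zero>\<^sub>gg"
  by (rule br_length[where i = 1 and j = n, OF Suc.prems(2) wf_xw wf_adw[OF Suc.prems(1)]])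
   (use Suc in \<open>auto simp: xw_def\<close>)
 then show ?case by simp
qed (simp add: const_def)

end

section \<open>The coefficients of \<open>t / (e\<^sup>t - 1)\<close>\<close>

definition bern :: "nat => rat" where
 "bern n = fps_nth (fps_X / (fps_exp 1 - 1)) n"

text \<open>The series xt/(e^(xt) - 1) in t with a rational parameter x. An identity in two
  variables is treated as a family of identities in one variable at rational parameters.\<close>

definition bfps :: "rat => rat fps" where
 "bfps x = Abs_fps (%n. bern n * x ^ n)"

lemma bern_fps: "Abs_fps bern * (fps_exp 1 - 1) = fps_X"
proof -
 have s: "subdegree (fps_exp 1 - 1 :: rat fps) = 1" by (rule subdegreeI) simp_all
 \<comment> \<open>The series e^t - 1 has order 1, so it divides t and the quotient defining
   \<open>bern\<close> is exact.\<close>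
 have "(fps_exp 1 - 1 :: rat fps) dvd fps_X" using s by (subst fps_dvd_iff) auto
 then have "fps_X / (fps_exp 1 - 1) * (fps_exp 1 - 1) = (fps_X :: rat fps)" by simp
 moreover have "Abs_fps bern = fps_X / (fps_exp 1 - 1)" by (simp add: fps_eq_iff bern_def)
 ultimately show ?thesis by simp
qed

lemma bfps_exp: "bfps x * (fps_exp x - 1) = fps_const x * fps_X"
proof (rule fps_ext)
 fix n
 have e: "fps_nth (fps_exp x - 1) k = x ^ k * fps_nth (fps_exp 1 - 1 :: rat fps) k" for k by (cases k) simp_all
 have "fps_nth (bfps x * (fps_exp x - 1)) n = (\<Sum>i=0..n. bern i * x ^ i * (x ^ (n - i) * fps_nth (fps_exp 1 - 1 :: rat fps) (n - i)))"
  unfolding fps_mult_nth e by (simp add: bfps_def)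
 also have "... = (\<Sum>i=0..n. x ^ n * (fps_nth (Abs_fps bern) i * fps_nth (fps_exp 1 - 1 :: rat fps) (n - i)))"
  by (rule sum.cong) (simp_all flip: power_add add: mult_ac)
 also have "... = x ^ n * fps_nth (Abs_fps bern * (fps_exp 1 - 1)) n" by (simp only: fps_mult_nth sum_distrib_left)
 also have "... = x ^ n * fps_nth fps_X n" by (simp only: bern_fps)
 also have "... = fps_nth (fps_const x * fps_X) n" by (simp add: fps_X_def fps_mult_left_const_nth)
 finally show "fps_nth (bfps x * (fps_exp x - 1)) n = fps_nth (fps_const x * fps_X) n" .
qed

text \<open>The functional equation behind the representation property.\<close>

lemma bfps_functional:
 assumes "x \<noteq> 0" "y \<noteq> 0" "x + y \<noteq> 0"
 shows "bfps (x + y) * (fps_const y * bfps x + fps_const x * bfps y + fps_const (x * y) * fps_X) =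
  fps_const (x + y) * bfps x * bfps y"
proof -
 define Ex Ey where E: "Ex = fps_exp x" "Ey = fps_exp y"
 have nz: "fps_exp z - 1 \<noteq> (0 :: rat fps)" if "z \<noteq> 0" for z
  using that by (metis eq_iff_diff_eq_0 fps_exp_0 fps_exp_eq_iff)
 define A B C where ABC: "A = bfps x" "B = bfps y" "C = bfps (x + y)"
 have a: "A * (Ex - 1) = fps_const x * fps_X" and b: "B * (Ey - 1) = fps_const y * fps_X"
  and c: "C * (Ex * Ey - 1) = fps_const (x + y) * fps_X"
  unfolding ABC E using bfps_exp by (simp_all add: fps_exp_add_mult[symmetric])
 define X Y Z where XYZ: "X = fps_const x" "Y = fps_const y" "Z = (fps_X :: rat fps)"
 have xy: "fps_const (x + y) = X + Y" "fps_const (x * y) = X * Y" by (simp_all add: XYZ)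
 have a: "A * (Ex - 1) = X * Z" and b: "B * (Ey - 1) = Y * Z" and c: "C * (Ex * Ey - 1) = (X + Y) * Z"
  using a b c by (simp_all add: xy flip: XYZ)
 have "(C * (Y * A + X * B + X * Y * Z)) * ((Ex - 1) * (Ey - 1) * (Ex * Ey - 1)) =
   (C * (Ex * Ey - 1)) * (Y * (A * (Ex - 1)) * (Ey - 1) + X * (B * (Ey - 1)) * (Ex - 1) + X * Y * Z * (Ex - 1) * (Ey - 1))"
  by (simp add: algebra_simps)
 also have "... = ((X + Y) * Z) * (Y * (X * Z) * (Ey - 1) + X * (Y * Z) * (Ex - 1) + X * Y * Z * (Ex - 1) * (Ey - 1))"
  by (simp only: a b c)
 \<comment> \<open>The bracket collects (Ey - 1) + (Ex - 1) + (Ex - 1)(Ey - 1) = Ex Ey - 1, each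
   time with the factor XYZ.\<close>
 also have "... = (X + Y) * (X * Z) * (Y * Z) * (Ex * Ey - 1)" by (simp add: algebra_simps)
 also have "... = (X + Y) * (A * (Ex - 1)) * (B * (Ey - 1)) * (Ex * Ey - 1)" by (simp only: a b)
 also have "... = ((X + Y) * A * B) * ((Ex - 1) * (Ey - 1) * (Ex * Ey - 1))" by (simp add: algebra_simps)
 finally have "(C * (Y * A + X * B + X * Y * Z)) * ((Ex - 1) * (Ey - 1) * (Ex * Ey - 1)) =
  ((X + Y) * A * B) * ((Ex - 1) * (Ey - 1) * (Ex * Ey - 1))" .
 moreover have nzE: "(Ex - 1) * (Ey - 1) * (Ex * Ey - 1) \<noteq> 0"
  unfolding E using nz[OF assms(1)] nz[OF assms(2)] nz[OF assms(3)] by (simp add: fps_exp_add_mult)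
 ultimately have "C * (Y * A + X * B + X * Y * Z) = (X + Y) * A * B" using mult_right_cancel[OF nzE] by blast
 then show ?thesis by (simp only: ABC xy XYZ)
qed

text \<open>The coefficient of t^(m+1) in the functional equation with parameters 1 and y.
  Positivity of y keeps the parameters y and 1 + y away from zero.\<close>

lemma bfps_coeffs:
 fixes y :: rat
 assumes "y > 0"
 shows "(\<Sum>n\<le>Suc m. bern n * bern (Suc m - n) * (y ^ (Suc m - n) * ((1 + y) ^ n - 1) + y * ((1 + y) ^ n - y ^ n))) +
  bern m * y * (1 + y) ^ m = 0"
proof -
 have e: "bfps (1 + y) * (fps_const y * bfps 1 + bfps y + fps_const y * fps_X) =
   fps_const (1 + y) * bfps 1 * bfps y" using bfps_functional[of 1 y] assms by simp
 let ?S = "%f g. \<Sum>n\<le>Suc m. f n * g (Suc m - n :: nat) :: rat"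
 have prod: "fps_nth (bfps u * bfps v) (Suc m) = ?S (%n. bern n * u ^ n) (%k. bern k * v ^ k)" for u v
  by (simp only: fps_mult_nth atLeast0AtMost bfps_def fps_nth_Abs_fps)
 have d: "a * (c * b + d + c * x) = c * (a * b) + a * d + c * (a * x)" for a b c d x :: "rat fps"
  by (simp add: algebra_simps)
 have "fps_nth (bfps (1 + y) * (fps_const y * bfps 1 + bfps y + fps_const y * fps_X)) (Suc m) =
   y * fps_nth (bfps (1 + y) * bfps 1) (Suc m) + fps_nth (bfps (1 + y) * bfps y) (Suc m) + y * fps_nth (bfps (1 + y)) m"
  by (simp only: d fps_add_nth fps_mult_left_const_nth) simp
 moreover have "fps_nth (fps_const (1 + y) * bfps 1 * bfps y) (Suc m) =
   fps_nth (bfps 1 * bfps y) (Suc m) + y * fps_nth (bfps y * bfps 1) (Suc m)"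
  by (simp only: mult.assoc fps_mult_left_const_nth distrib_right mult.commute[of "bfps y"] mult_1)
 ultimately have *: "y * fps_nth (bfps (1 + y) * bfps 1) (Suc m) + fps_nth (bfps (1 + y) * bfps y) (Suc m) + y * fps_nth (bfps (1 + y)) m
   - fps_nth (bfps 1 * bfps y) (Suc m) - y * fps_nth (bfps y * bfps 1) (Suc m) = 0" using e by simp
 let ?b = "%u n. bern n * u ^ n"
 let ?f = "%u v n. ?b u n * ?b v (Suc m - n)"
 have "(\<Sum>n\<le>Suc m. bern n * bern (Suc m - n) * (y ^ (Suc m - n) * ((1 + y) ^ n - 1) + y * ((1 + y) ^ n - y ^ n))) =
   (\<Sum>n\<le>Suc m. y * ?f (1 + y) 1 n + ?f (1 + y) y n - ?f 1 y n - y * ?f y 1 n)"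
  by (rule sum.cong[OF refl]) (simp only: power_one mult_1_right right_diff_distrib distrib_left ac_simps diff_diff_eq diff_add_eq add_diff_eq)
 also have "... = y * sum (?f (1 + y) 1) {..Suc m} + sum (?f (1 + y) y) {..Suc m} - sum (?f 1 y) {..Suc m} - y * sum (?f y 1) {..Suc m}"
  by (simp only: sum.distrib sum_subtractf sum_distrib_left)
 also have "... = - (y * fps_nth (bfps (1 + y)) m)"
  using * unfolding prod by (simp only: algebra_simps eq_neg_iff_add_eq_0)
 finally have sum: "(\<Sum>n\<le>Suc m. bern n * bern (Suc m - n) * (y ^ (Suc m - n) * ((1 + y) ^ n - 1) + y * ((1 + y) ^ n - y ^ n))) =
  - (y * fps_nth (bfps (1 + y)) m)" .
 show ?thesis unfolding sum by (simp add: bfps_def)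
qed

section \<open>A binomial identity for the coefficients of t/(e^t - 1)\<close>

lemma coeff_binomial_poly: "coeff ([:1, 1:] ^ n) i = (of_nat (n choose i) :: 'a :: comm_ring_1)"
proof (induction n arbitrary: i)
 case 0
 then show ?case by (cases i) simp_all
next
 case (Suc n)
 then show ?case by (cases i) (simp_all add: coeff_pCons)
qed

text \<open>By \<open>bfps_coeffs\<close> the polynomial \<open>P\<close> in y vanishes at every
  positive rational, so it is zero. The claim is its coefficient at y^(q+1).\<close>

lemma bern_identity:
 assumes "p + q = m"
 shows "(\<Sum>n\<le>Suc m. bern n * bern (Suc m - n) *
   ((if p < n then of_nat (n choose p) else 0) + (if q < n then of_nat (n choose q) else 0))) =
  - bern m * of_nat (m choose p)"
proof -
 define P where "P = (\<Sum>n\<le>Suc m. smult (bern n * bern (Suc m - n))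
   (monom 1 (Suc m - n) * ([:1, 1:] ^ n - 1) + monom 1 1 * ([:1, 1:] ^ n - monom 1 n))) +
  smult (bern m) (monom 1 1 * [:1, 1:] ^ m)"
 have "poly P y = 0" if "y > 0" for y
 proof -
  have p: "poly [:1, 1:] y = 1 + y" by simp
  show ?thesis using bfps_coeffs[OF that, of m]
   by (simp only: P_def p poly_add poly_diff poly_sum poly_smult poly_mult poly_power poly_monom poly_1
     mult_1 power_one_right mult.assoc)
 qed
 then have "{0<..} \<subseteq> {y. poly P y = 0}" by auto
 then have "infinite {y. poly P y = 0}" using infinite_Ioi infinite_super by blast
 then have "P = 0" using poly_roots_finite by blast
 then have P0: "coeff P (Suc q) = 0" by simp
 \<comment> \<open>After y^(m+1-n) the exponent n - p is left for (1 + y)^n, and the binomial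
   coefficient is symmetric. The subtracted 1 removes the contribution of n = p, which explains the
   strict inequality.\<close>
 have c1: "coeff (monom 1 (Suc m - n) * ([:1, 1:] ^ n - 1) :: rat poly) (Suc q) =
   (if p < n then of_nat (n choose p) else 0)" if "n \<le> Suc m" for n
 proof (cases "p < n")
  case True
  then have "Suc q - (Suc m - n) = n - p" "Suc m - n \<le> Suc q" using assms that by auto
  moreover have "n choose (n - p) = n choose p" using True binomial_symmetric[of p n] by simp
  ultimately show ?thesis using True by (simp add: coeff_monom_mult coeff_binomial_poly)
 next
  case False
  then have "Suc q < Suc m - n \<or> Suc q - (Suc m - n) = 0" using assms that by auto
  then show ?thesis using False by (auto simp: coeff_monom_mult coeff_binomial_poly)
 qed
 have c2: "coeff (monom 1 1 * ([:1, 1:] ^ n - monom 1 n) :: rat poly) (Suc q) =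
   (if q < n then of_nat (n choose q) else 0)" for n
  by (cases "q = n") (auto simp: coeff_monom_mult coeff_binomial_poly binomial_eq_0)
 have c3: "coeff (monom 1 1 * [:1, 1:] ^ m :: rat poly) (Suc q) = of_nat (m choose p)"
 proof -
  have "m choose q = m choose p" using assms binomial_symmetric[of p m] by auto
  then show ?thesis by (simp add: coeff_monom_mult coeff_binomial_poly)
 qed
 have "(\<Sum>n\<le>Suc m. bern n * bern (Suc m - n) *
   ((if p < n then of_nat (n choose p) else 0) + (if q < n then of_nat (n choose q) else 0))) =
  (\<Sum>n\<le>Suc m. bern n * bern (Suc m - n) * (coeff (monom 1 (Suc m - n) * ([:1, 1:] ^ n - 1)) (Suc q) +
   coeff (monom 1 1 * ([:1, 1:] ^ n - monom 1 n)) (Suc q)))" by (rule sum.cong[OF refl]) (simp only: c1 c2 atMost_iff)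
 also have "... = coeff P (Suc q) - bern m * of_nat (m choose p)"
  by (simp only: P_def coeff_add coeff_sum coeff_smult c3 add_diff_cancel)
 finally show ?thesis by (simp only: P0 diff_0 mult_minus_left)
qed

text \<open>With f(t) = t/(e^t - 1) this says f(-t) = f(t) + t; it is proved by multiplying with e^t
  - 1. It relates the coefficients for c = -1 to those for c = 1 and c = 0.\<close>

lemma bern_parity: "bern n * (- 1) ^ n - bern n = (if n = 1 then 1 else 0)"
proof -
 define E where "E = (fps_exp 1 :: rat fps)"
 have i: "fps_exp (- 1) * E = 1" unfolding E_def by (simp flip: fps_exp_add_mult)
 have "bfps (- 1) * (fps_exp (- 1) - 1) * E = - (fps_X * E)" by (simp add: bfps_exp flip: fps_const_neg)
 moreover have "bfps (- 1) * (fps_exp (- 1) - 1) * E = bfps (- 1) * (fps_exp (- 1) * E - E)" by (simp add: algebra_simps)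
 ultimately have "bfps (- 1) * (1 - E) = - (fps_X * E)" unfolding i by simp
 moreover have "bfps 1 * (E - 1) = fps_X" using bfps_exp[of 1] by (simp add: E_def)
 ultimately have "(bfps (- 1) - bfps 1) * (E - 1) = fps_X * (E - 1)" by (simp add: algebra_simps)
 moreover have "E - 1 \<noteq> 0" unfolding E_def by (metis eq_iff_diff_eq_0 fps_exp_0 fps_exp_eq_iff zero_neq_one)
 ultimately have "bfps (- 1) - bfps 1 = fps_X" by simp
 then have "fps_nth (bfps (- 1) - bfps 1) n = fps_nth fps_X n" by simp
 then show ?thesis by (simp add: bfps_def)
qed

text \<open>The coefficient of t^(n+1) in f(t)(e^t - 1) = t, solved for the n-th one. Only
  factorials up to (n+1)! occur as denominators, and this controls where \<open>bern n\<close> can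
  be interpreted in \<open>K\<close>.\<close>

lemma bern_rec: "bern n = (if n = 0 then 1 else 0) - (\<Sum>i<n. bern i / fact (Suc n - i))"
proof -
 have "fps_nth (Abs_fps bern * (fps_exp 1 - 1)) (Suc n) = (\<Sum>i\<le>Suc n. bern i * fps_nth (fps_exp 1 - 1 :: rat fps) (Suc n - i))"
  by (simp only: fps_mult_nth atLeast0AtMost fps_nth_Abs_fps)
 also have "... = (\<Sum>i\<le>n. bern i * fps_nth (fps_exp 1 - 1 :: rat fps) (Suc n - i))" by simp
 also have "... = (\<Sum>i\<le>n. bern i / fact (Suc n - i))"
 proof (rule sum.cong[OF refl])
  have "fps_nth (fps_exp 1 - 1 :: rat fps) k = 1 / fact k" if "k > 0" for k using that by simp
  then show "bern i * fps_nth (fps_exp 1 - 1 :: rat fps) (Suc n - i) = bern i / fact (Suc n - i)"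
   if "i : {..n}" for i using that by (simp del: fact_Suc)
 qed
 also have "... = (\<Sum>i<n. bern i / fact (Suc n - i)) + bern n" by (simp add: lessThan_Suc_atMost[symmetric])
 finally show ?thesis unfolding bern_fps by simp
qed

section \<open>Rational scalars\<close>

context comm_superring
begin

definition ik :: "int => 'k" where "ik n = [n] \<cdot> \<one>"

lemma ik_closed [simp]: "ik n el K" by (simp add: ik_def)

lemma ik_add: "ik (m + n) = ik m \<oplus> ik n" by (simp add: ik_def add.int_pow_mult)

lemma ik_mult: "ik (m * n) = ik m \<otimes> ik n" by (simp add: ik_def add_pow_ldistr_int add.int_pow_pow mult.commute)

lemma ik_0 [simp]: "ik 0 = \<zero>" and ik_1 [simp]: "ik 1 = \<one>" by (simp_all add: ik_def add_pow_def int_pow_def2)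

lemma ik_uminus: "ik (- n) = \<ominus> ik n" by (simp add: ik_def add.int_pow_neg)

lemma ik_commute: "x el K ==> ik n \<otimes> x = x \<otimes> ik n"
 by (simp add: ik_def add_pow_ldistr_int add_pow_rdistr_int)

lemma ik_even: "ik n : grade K 0"
proof -
 have "ik (int k) : grade K 0" for k by (induction k) (simp_all add: ik_add one_even)
 then show ?thesis by (cases n rule: int_cases2) (simp_all add: ik_uminus)
qed

lemma ik_nat_unit: "nat_unit K n \<longleftrightarrow> ik (int n) : Units K"
 by (simp add: nat_unit_def ik_def add_pow_int_ge)

definition ikinv where "ikinv n = inv (ik n)"

lemma ikinv:
 assumes "ik n : Units K"
 shows "ikinv n el K" "ik n \<otimes> ikinv n = \<one>" "ikinv n \<otimes> ik n = \<one>"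
 using assms by (simp_all add: ikinv_def)

text \<open>Since \<open>ik n\<close> is even, the component of grade 0 in 1 = n v shows that the
  even part of the inverse v is itself a right inverse; inverses being unique, v is even.\<close>

lemma ikinv_even:
 assumes "ik n : Units K"
 shows "ikinv n : grade K 0"
proof -
 define v where "v = ikinv n"
 have v: "v el K" "ik n \<otimes> v = \<one>" "v \<otimes> ik n = \<one>"
  using ikinv[OF assms] by (simp_all add: v_def)
 have g: "ik n \<otimes> hcomp K 0 v : grade K 0" "ik n \<otimes> hcomp K 1 v : grade K 1"
  using grade_mult[OF ik_even hcomp_grade[OF v(1)], of n 0] grade_mult[OF ik_even hcomp_grade[OF v(1)], of n 1] by simp_all
 have "\<one> = ik n \<otimes> hcomp K 0 v \<oplus> ik n \<otimes> hcomp K 1 v"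
  using v by (simp add: r_distr[symmetric] hcomp_sum)
 moreover have "hcomp K 0 (ik n \<otimes> hcomp K 0 v \<oplus> ik n \<otimes> hcomp K 1 v) = ik n \<otimes> hcomp K 0 v"
  by (rule hcomp_unique) (use g in simp_all)
 moreover have "hcomp K 0 \<one> = \<one>" using hcomp_homogeneous[OF one_even] by simp
 ultimately have "ik n \<otimes> hcomp K 0 v = \<one>" by metis
 then have "v = v \<otimes> (ik n \<otimes> hcomp K 0 v)" using v by simp
 also have "... = hcomp K 0 v" using v by (simp add: m_assoc[symmetric])
 finally have "v = hcomp K 0 v" .
 then show ?thesis using hcomp_grade[OF v(1), of 0] by (simp add: v_def)
qed

lemma ik_unit_mult: "[|ik m : Units K; ik n : Units K|] ==> ik (m * n) : Units K"
 by (simp add: ik_mult)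

lemma ik_unit_factor:
 assumes "ik (m * n) : Units K"
 shows "ik m : Units K"
proof -
 let ?v = "ikinv (m * n)"
 note v = ikinv[OF assms]
 have "ik m \<otimes> (ik n \<otimes> ?v) = \<one>" using v by (simp add: ik_mult m_assoc)
 moreover have "(ik n \<otimes> ?v) \<otimes> ik m = \<one>"
  using v ik_commute[of "ik n \<otimes> ?v" m] by (simp add: ik_mult m_assoc)
 ultimately show ?thesis using v by (auto simp: Units_def intro!: bexI[of _ "ik n \<otimes> ?v"])
qed

text \<open>Rationals with a meaning in \<open>K\<close>: some fraction representing r, reduced or
  not, has a unit as denominator.\<close>

definition rok :: "rat => bool" where
 "rok r \<longleftrightarrow> (EX a b. r = of_int a / of_int b & b > 0 & ik b : Units K)"

text \<open>\<open>rat_in\<close> works with the reduced fraction c/d. By coprimality d divides b,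
  so it is a unit along with b, and the complementary factor f cancels. Common denominators become
  available for sums and products.\<close>

lemma rat_in_eq:
 assumes "b > 0" "ik b : Units K"
 shows "rat_in K (of_int a / of_int b) = ik a \<otimes> ikinv b"
proof -
 obtain c d where cd: "quotient_of (of_int a / of_int b) = (c, d)" by fastforce
 have d: "d > 0" using quotient_of_denom_pos[OF cd] .
 have cop: "coprime c d" using quotient_of_coprime[OF cd] .
 have "of_int a / of_int b = (of_int c / of_int d :: rat)" using quotient_of_div[OF cd] .
 then have "of_int a * of_int d = (of_int c * of_int b :: rat)" using d assms(1) by (simp add: field_simps)
 then have e: "a * d = c * b" by (metis of_int_eq_iff of_int_mult)
 then have "d dvd b" using cop by (metis coprime_commute coprime_dvd_mult_right_iff dvd_triv_right)
 then obtain f where f: "b = d * f" by auto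
 have a: "a = c * f" using e d unfolding f by simp
 have ud: "ik d : Units K" using assms(2) ik_unit_factor[of d f] f by simp
 have uf: "ik f : Units K" using assms(2) ik_unit_factor[of f d] f by (simp add: mult.commute)
 note vd = ikinv[OF ud] and vb = ikinv[OF assms(2)] and vf = ikinv[OF uf]
 have "ikinv d = ikinv d \<otimes> (ik b \<otimes> ikinv b)" using vb vd by simp
 also have "... = (ikinv d \<otimes> ik d) \<otimes> (ik f \<otimes> ikinv b)"
  using vd(1) vb(1) by (simp only: f ik_mult m_assoc ik_closed m_closed)
 also have "... = ik f \<otimes> ikinv b" using vd vb by simp
 finally have "ikinv d = ik f \<otimes> ikinv b" .
 then have "ik a \<otimes> ikinv b = ik c \<otimes> ikinv d" using vb by (simp add: a ik_mult m_assoc)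
 then show ?thesis using cd d by (simp add: rat_in_def ik_def ikinv_def)
qed

lemma rokE:
 assumes "rok r"
 obtains a b where "r = of_int a / of_int b" "b > 0" "ik b : Units K" "rat_in K r = ik a \<otimes> ikinv b"
 using assms rat_in_eq unfolding rok_def by blast

lemma rokI: "[|b > 0; ik b : Units K|] ==> rok (of_int a / of_int b)" by (auto simp: rok_def)

lemma rok_int [simp]: "rok (of_int a)" using rokI[of 1 a] by simp

lemma rat_in_int: "rat_in K (of_int a) = ik a" using rat_in_eq[of 1 a] ikinv[of 1] by simp

lemma rok_nat [simp]: "rok (of_nat n)" using rok_int[of "int n"] by simp

lemma rok_0 [simp]: "rok 0" and rok_1 [simp]: "rok 1" using rok_int[of 0] rok_int[of 1] by simp_all

lemma rat_in_0 [simp]: "rat_in K 0 = \<zero>" and rat_in_1 [simp]: "rat_in K 1 = \<one>"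
 using rat_in_int[of 0] rat_in_int[of 1] by simp_all

lemma rat_in_even: "rok r ==> rat_in K r : grade K 0"
proof (elim rokE)
 fix a b assume "ik b : Units K" "rat_in K r = ik a \<otimes> ikinv b"
 then show ?thesis using grade_mult[OF ik_even ikinv_even, of b a] by simp
qed

lemma rat_in_closed [simp]: "rok r ==> rat_in K r el K" using rat_in_even grade_carrier by blast

lemma rat_in_add:
 assumes "rok r" "rok s"
 shows "rok (r + s)" "rat_in K (r + s) = rat_in K r \<oplus> rat_in K s"
proof -
 obtain a b where r: "r = of_int a / of_int b" "b > 0" "ik b : Units K" "rat_in K r = ik a \<otimes> ikinv b"
  by (rule rokE[OF assms(1)])
 obtain c d where s: "s = of_int c / of_int d" "d > 0" "ik d : Units K" "rat_in K s = ik c \<otimes> ikinv d"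
  by (rule rokE[OF assms(2)])
 have u: "ik (b * d) : Units K" "b * d > 0" using r s by (simp_all add: ik_unit_mult)
 have e: "r + s = of_int (a * d + c * b) / of_int (b * d)" using r s by (simp add: field_simps)
 show "rok (r + s)" unfolding e by (rule rokI[OF u(2,1)])
 have "r = of_int (a * d) / of_int (b * d)" using r s by simp
 then have 1: "rat_in K r = ik (a * d) \<otimes> ikinv (b * d)" by (simp only: rat_in_eq[OF u(2,1)])
 have "s = of_int (c * b) / of_int (b * d)" using r s by simp
 then have 2: "rat_in K s = ik (c * b) \<otimes> ikinv (b * d)" by (simp only: rat_in_eq[OF u(2,1)])
 show "rat_in K (r + s) = rat_in K r \<oplus> rat_in K s"
  unfolding 1 2 unfolding e rat_in_eq[OF u(2,1)] using ikinv[OF u(1)] by (simp add: ik_add l_distr)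
qed

lemma rat_in_mult:
 assumes "rok r" "rok s"
 shows "rok (r * s)" "rat_in K (r * s) = rat_in K r \<otimes> rat_in K s"
proof -
 obtain a b where r: "r = of_int a / of_int b" "b > 0" "ik b : Units K" "rat_in K r = ik a \<otimes> ikinv b"
  by (rule rokE[OF assms(1)])
 obtain c d where s: "s = of_int c / of_int d" "d > 0" "ik d : Units K" "rat_in K s = ik c \<otimes> ikinv d"
  by (rule rokE[OF assms(2)])
 have u: "ik (b * d) : Units K" "b * d > 0" using r s by (simp_all add: ik_unit_mult)
 have e: "r * s = of_int (a * c) / of_int (b * d)" using r s by simp
 show "rok (r * s)" unfolding e by (rule rokI[OF u(2,1)])
 note vb = ikinv[OF r(3)] and vd = ikinv[OF s(3)] and vu = ikinv[OF u(1)]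
 have bd: "ik (b * d) = ik d \<otimes> ik b" using ik_mult[of d b] by (simp add: mult.commute)
 have "ikinv b \<otimes> ikinv d = ikinv b \<otimes> ikinv d \<otimes> (ik (b * d) \<otimes> ikinv (b * d))"
  using vb vd vu by simp
 also have "... = ikinv b \<otimes> (ikinv d \<otimes> ik d) \<otimes> ik b \<otimes> ikinv (b * d)"
  using vb(1) vd(1) vu(1) by (simp add: bd m_assoc)
 also have "... = ikinv (b * d)" using vb vd vu by simp
 finally have i: "ikinv b \<otimes> ikinv d = ikinv (b * d)" .
 have "rat_in K r \<otimes> rat_in K s = ik a \<otimes> (ikinv b \<otimes> ik c) \<otimes> ikinv d"
  using r s vb vd by (simp add: m_assoc)
 also have "... = ik a \<otimes> ik c \<otimes> (ikinv b \<otimes> ikinv d)"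
  using vb(1) vd(1) ik_commute[OF vb(1), of c, symmetric] by (simp add: m_assoc[symmetric])
 finally show "rat_in K (r * s) = rat_in K r \<otimes> rat_in K s" unfolding e rat_in_eq[OF u(2,1)] i by (simp add: ik_mult)
qed

lemma rok_uminus: "rok r ==> rok (- r)" using rat_in_mult(1)[of "- 1" r] rok_int[of "- 1"] by simp

lemma rat_in_uminus: "rok r ==> rat_in K (- r) = \<ominus> rat_in K r"
 using rat_in_mult(2)[of "- 1" r] rok_int[of "- 1"] rat_in_int[of "- 1"] by (simp add: ik_uminus l_minus)

lemma rok_diff: "[|rok r; rok s|] ==> rok (r - s)"
 using rat_in_add(1)[OF _ rok_uminus, of r s] by simp

lemma rok_sum: "(!!i. i : I ==> rok (f i)) ==> rok (sum f I)"
 by (induction I rule: infinite_finite_induct) (auto intro: rat_in_add(1))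

lemma rok_inverse_nat:
 assumes "nat_unit K n"
 shows "rok (1 / of_nat n)"
proof (cases "n = 0")
 case False
 then show ?thesis using rokI[of "int n" 1] assms by (simp add: ik_nat_unit)
qed simp

lemma rok_inverse_fact:
 assumes "!!k. k : {2..n} ==> nat_unit K k"
 shows "rok (1 / fact n)" using assms
proof (induction n)
 case (Suc n)
 have "rok (1 / of_nat (Suc n))" using Suc.prems[of "Suc n"] by (cases "n = 0") (simp, intro rok_inverse_nat, simp)
 moreover have "rok (1 / fact n)" using Suc by auto
 ultimately have "rok (1 / of_nat (Suc n) * (1 / fact n))" by (rule rat_in_mult(1))
 then show ?case by (simp add: fact_Suc)
qed simp

text \<open>\<open>bern n\<close> has denominators composed of numbers up to n + 1. For indices
  below N the units 2, ..., N are therefore sufficient.\<close>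

lemma rok_bern: "(!!k. k : {2..Suc n} ==> nat_unit K k) ==> rok (bern n)"
proof (induction n rule: less_induct)
 case (less n)
 have "rok (bern i * (1 / fact (Suc n - i)))" if "i < n" for i
  using that less by (intro rat_in_mult(1) less.IH rok_inverse_fact) auto
 then have "rok (\<Sum>i<n. bern i * (1 / fact (Suc n - i)))" by (intro rok_sum) auto
 then show ?case by (subst bern_rec) (auto intro!: rok_diff rok_uminus)
qed

end

context supermodule
begin

definition rs :: "rat => 'm => 'm" where "rs r v = act M v (rat_in K r)"

lemma rs_closed [simp]: "[|K.rok r; v el M|] ==> rs r v el M"
 by (simp add: rs_def act_closed)

lemma rs_grade [simp]: "[|K.rok r; v : grade M p|] ==> rs r v : grade M p"
 using grade_act[of v p "rat_in K r" 0] K.rat_in_even by (simp add: rs_def)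

lemma addmap_rs: "K.rok r ==> addmap M M (rs r)" unfolding rs_def by (rule addmap_act) simp

lemma rs_add: "[|K.rok r; v el M; w el M|] ==> rs r (v \<oplus>\<^sub>M w) = rs r v \<oplus>\<^sub>M rs r w"
 by (rule addmap_add[OF addmap_rs])

lemma rs_add_rat: "[|K.rok r; K.rok s; v el M|] ==> rs (r + s) v = rs r v \<oplus>\<^sub>M rs s v"
 by (simp add: rs_def K.rat_in_add act_add_right)

lemma rs_mult: "[|K.rok r; K.rok s; v el M|] ==> rs r (rs s v) = rs (s * r) v"
 by (simp add: rs_def K.rat_in_mult act_act)

lemma rs_0 [simp]: "v el M ==> rs 0 v = \<zero>\<^sub>M" by (simp add: rs_def)

lemma rs_1 [simp]: "v el M ==> rs 1 v = v" by (simp add: rs_def act_one)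

lemma rs_zero [simp]: "K.rok r ==> rs r \<zero>\<^sub>M = \<zero>\<^sub>M"
 by (simp add: rs_def)

lemma rs_uminus: "[|K.rok r; v el M|] ==> rs (- r) v = \<ominus>\<^sub>M rs r v"
 unfolding rs_def using addmap_minus[OF K.ag M.ag addmap_act_scalar]
 by (simp add: K.rat_in_uminus)

lemma rs_ksign: "[|K.rok r; v el M|] ==> rs r (ksign M p v) = ksign M p (rs r v)"
 by (rule addmap_ksign[OF M.ag M.ag addmap_rs])

end

section \<open>Convolution brackets of iterated adjoint actions\<close>

lemma addmap_finsum:
 assumes "abelian_group A" "abelian_group B" "addmap A B f" "!!i. i : I ==> g i el A"
 shows "f (finsum A g I) = finsum B (%i. f (g i)) I"
proof -
 interpret A: abelian_group A by fact
 interpret B: abelian_group B by fact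
 show ?thesis using assms(4)
 proof (induction I rule: infinite_finite_induct)
  case (insert i I)
  then show ?case using addmap_closed[OF assms(3)]
   by (simp add: A.finsum_insert B.finsum_insert Pi_def addmap_add[OF assms(3)])
 qed (simp_all add: addmap_zero[OF assms(1-3)])
qed

lemma (in supermodule) lact_even:
 assumes "m el M" "ka : grade K 0"
 shows "lact K M ka m = act M m ka" using assms(1)
proof (induction rule: M.grade_induct)
 case (homogeneous q m)
 then show ?case using lact_homogeneous[OF homogeneous assms(2)] by simp
next
 case (add x y)
 then show ?case using K.grade_carrier[OF assms(2)] by (simp add: lact_add_right act_add_left)
qed

context half_lie
begin

lemma bracket_rs:
 assumes "K.rok r" "X el gg" "Y el gg"
 shows "bracket gg X (rs r Y) = rs r (bracket gg X Y)" "bracket gg (rs r X) Y = rs r (bracket gg X Y)"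
 using assms by (simp_all add: rs_def bracket_act bracket_balanced lact_even K.rat_in_even)

lemma wf_rs [simp]: "[|K.rok r; wf f F|] ==> wf f (%v. rs r (F v))" by (simp add: wf_def)

lemma br_rs_r: "[|w : hwords gg; wf f F; wf g G; K.rok r|] ==> br w g F (%v. rs r (G v)) = rs r (br w g F G)"
 by (rule br_map[OF _ _ _ addmap_rs]) (simp_all add: bracket_rs)

lemmas cmp_rs = cmp_map[OF _ _ _ addmap_rs]

lemma finsum_wf_insert:
 assumes "finite I" "i \<notin> I" "!!j. j : insert i I ==> wf g (G j)" "v : hwords gg"
 shows "finsum gg (%j. G j v) (insert i I) = G i v \<oplus>\<^sub>gg finsum gg (%j. G j v) I"
 by (rule M.finsum_insert[OF assms(1,2)]) (use wf_closed[OF assms(3,4)] in auto)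

lemma wf_cong:
 assumes "wf f F" "!!v. v : hwords gg ==> F' v = F v"
 shows "wf f F'" using assms by (simp add: wf_def)

lemma wf_finsum:
 assumes "finite I" "!!i. i : I ==> wf g (G i)"
 shows "wf g (%v. finsum gg (%i. G i v) I)" using assms
proof (induction I)
 case (insert i I)
 show ?case by (rule wf_cong[OF wf_add[of g "G i" "%v. finsum gg (%i. G i v) I"]])
   (use insert finsum_wf_insert[OF insert.hyps insert.prems] in auto)
qed simp

lemma br_finsum_r:
 assumes "finite I" "!!i. i : I ==> wf g (G i)" "wf f F" "w : hwords gg"
 shows "br w g F (%v. finsum gg (%i. G i v) I) = finsum gg (%i. br w g F (G i)) I"
proof -
 have c: "!!i v. [|i : I; v : hwords gg|] ==> G i v el gg" by (rule wf_closed[OF assms(2)])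
 show ?thesis unfolding br_def by (subst splitw_finsum[OF M.ag assms(4,1), symmetric])
   (use c assms(3) in \<open>auto intro!: splitw_cong[OF _ assms(4)] addmap_finsum[OF M.ag M.ag addmap_bracket_r]
    simp: bracket_closed\<close>)
qed

lemma cmp_finsum:
 assumes "finite I" "!!i. i : I ==> wf f (F i)" "wf h H" "w : hwords gg"
 shows "cmp w h (%v. finsum gg (%i. F i v) I) H = finsum gg (%i. cmp w h (F i) H) I"
 unfolding cmp_def by (rule splitw_finsum[OF M.ag assms(4,1)]) (rule wf_snoc_closed[OF assms(2,3)])

lemma finsum_single:
 assumes "n : I" "finite I" "f n el gg" "!!i. [|i : I; i \<noteq> n|] ==> f i = \<zero>\<^sub>gg"
 shows "finsum gg f I = f n"
proof -
 have "finsum gg f I = finsum gg (%i. if n = i then f n else \<zero>\<^sub>gg) I"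
  by (rule M.finsum_cong') (use assms in auto)
 also have "... = f n" by (rule M.finsum_singleton[of n I "%i. f n"]) (use assms in auto)
 finally show ?thesis .
qed

lemma br_x_br:
 assumes "w : hwords gg" "a : grade gg p" "b : grade gg q"
 shows "br w (p + q) xw (%v. br v q (adw p a i) (adw q b j)) =
  br w q (adw p a (Suc i)) (adw q b j) \<oplus>\<^sub>gg br w q (adw p a i) (adw q b (Suc j))"
 using br_jacobi[OF assms(1) wf_xw wf_adw[OF assms(2)] wf_adw[OF assms(3)], of i j] by simp

text \<open>The combination of all {(ad x)^i a, (ad x)^(m-i) b} with coefficients
  \<open>l i\<close>. Identities between iterated brackets turn into identities between the
  coefficient functions.\<close>

definition ev where
 "ev p a q b m l w = finsum gg (%i. rs (l i) (br w q (adw p a i) (adw q b (m - i)))) {..m}"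

context
 fixes p q a b
 assumes a: "a : grade gg p" and b: "b : grade gg q"
begin

lemma bra_closed [simp]: "w : hwords gg ==> br w q (adw p a i) (adw q b j) el gg"
 by (rule br_closed[OF _ wf_adw[OF a] wf_adw[OF b]])

lemma wf_bra: "wf (p + q) (%w. br w q (adw p a i) (adw q b j))" by (rule wf_br[OF wf_adw[OF a] wf_adw[OF b]])

lemma wf_ev: "(!!i. K.rok (l i)) ==> wf (p + q) (ev p a q b m l)"
 unfolding ev_def by (rule wf_finsum) (simp_all add: wf_bra)

lemma ev_closed: "[|!!i. K.rok (l i); w : hwords gg|] ==> ev p a q b m l w el gg"
 by (rule wf_closed[OF wf_ev])

lemma ev_cong:
 assumes "!!i. i \<le> m ==> l i = l' i" "!!i. K.rok (l' i)" "w : hwords gg"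
 shows "ev p a q b m l w = ev p a q b m l' w" unfolding ev_def by (rule M.finsum_cong') (use assms in auto)

lemma ev_add:
 assumes "!!i. K.rok (l i)" "!!i. K.rok (l' i)" "w : hwords gg"
 shows "ev p a q b m (%i. l i + l' i) w = ev p a q b m l w \<oplus>\<^sub>gg ev p a q b m l' w"
 using assms by (simp add: ev_def rs_add_rat M.finsum_addf Pi_def)

lemma ev_rs:
 assumes "!!i. K.rok (l i)" "K.rok r" "w : hwords gg"
 shows "rs r (ev p a q b m l w) = ev p a q b m (%i. r * l i) w" unfolding ev_def
proof (subst addmap_finsum[OF M.ag M.ag addmap_rs[OF assms(2)]])
 show "finsum gg (%i. rs r (rs (l i) (br w q (adw p a i) (adw q b (m - i))))) {..m} =
   finsum gg (%i. rs (r * l i) (br w q (adw p a i) (adw q b (m - i)))) {..m}"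
  by (rule M.finsum_cong') (use assms in \<open>auto simp: rs_mult mult.commute K.rat_in_mult(1)\<close>)
qed (use assms in auto)

lemma ev_uminus:
 assumes "!!i. K.rok (l i)" "w : hwords gg"
 shows "ev p a q b m (%i. - l i) w = \<ominus>\<^sub>gg ev p a q b m l w"
 using ev_rs[of l "- 1" w m] assms ev_closed[of l w m] K.rok_uminus[of 1] rs_uminus[of 1 "ev p a q b m l w"] by simp

lemma ev_zero:
 assumes "!!i. i \<le> m ==> l i = 0" "w : hwords gg"
 shows "ev p a q b m l w = \<zero>\<^sub>gg"
proof -
 have "ev p a q b m l w = finsum gg (%i. \<zero>\<^sub>gg) {..m}"
  unfolding ev_def by (rule M.finsum_cong') (use assms in auto)
 then show ?thesis by simp
qed

lemma ev_sum:
 assumes "finite I" "!!n i. K.rok (l n i)" "w : hwords gg"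
 shows "ev p a q b m (%i. \<Sum>n\<in>I. l n i) w = finsum gg (%n. ev p a q b m (l n) w) I"
 using assms(1)
proof (induction I)
 case empty
 then show ?case using assms(3) by (simp add: ev_zero)
next
 case (insert n I)
 then show ?case using assms ev_closed by (simp add: ev_add K.rok_sum M.finsum_insert Pi_def)
qed

lemma ev_single:
 assumes "n \<le> m" "w : hwords gg"
 shows "ev p a q b m (%i. if i = n then 1 else 0) w = br w q (adw p a n) (adw q b (m - n))"
 unfolding ev_def using assms by (subst finsum_single[of n]) auto

text \<open>By the Jacobi identity ad x is a derivation of the bracket and raises either the first
  or the second exponent. On coefficients this is the recursion of Pascal's triangle.\<close>

lemma ev_shift:
 assumes "!!i. K.rok (l i)" "w : hwords gg"
 shows "br w (p + q) xw (ev p a q b m l) =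
  ev p a q b (Suc m) (%i. (if i = 0 then 0 else l (i - 1)) + (if i \<le> m then l i else 0)) w"
proof -
 let ?E = "%i j. br w q (adw p a i) (adw q b j)"
 have "br w (p + q) xw (ev p a q b m l) =
   finsum gg (%i. br w (p + q) xw (%v. rs (l i) (br v q (adw p a i) (adw q b (m - i))))) {..m}"
  unfolding ev_def by (rule br_finsum_r[OF _ _ wf_xw assms(2)]) (simp_all add: wf_bra assms(1))
 also have "... = finsum gg (%i. rs (l i) (?E (Suc i) (m - i)) \<oplus>\<^sub>gg rs (l i) (?E i (Suc (m - i)))) {..m}"
  using assms by (intro M.finsum_cong') (auto simp: br_rs_r[OF _ wf_xw wf_bra] br_x_br a b rs_add simp del: adw.simps)
 also have "... = finsum gg (%i. rs (l i) (?E (Suc i) (m - i))) {..m} \<oplus>\<^sub>gg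
   finsum gg (%i. rs (l i) (?E i (Suc (m - i)))) {..m}"
  using assms by (intro M.finsum_addf) (auto simp del: adw.simps)
 also have "finsum gg (%i. rs (l i) (?E (Suc i) (m - i))) {..m} = ev p a q b (Suc m) (%i. if i = 0 then 0 else l (i - 1)) w"
  unfolding ev_def using assms by (subst M.finsum_Suc2) (auto simp del: adw.simps intro!: M.finsum_closed)
 also have "finsum gg (%i. rs (l i) (?E i (Suc (m - i)))) {..m} = ev p a q b (Suc m) (%i. if i \<le> m then l i else 0) w"
 proof -
  have "ev p a q b (Suc m) (%i. if i \<le> m then l i else 0) w =
    finsum gg (%i. rs (if i \<le> m then l i else 0) (?E i (Suc m - i))) {..m}"
   unfolding ev_def using assms by (subst M.finsum_Suc) (auto simp del: adw.simps intro!: M.finsum_closed)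
  also have "... = finsum gg (%i. rs (l i) (?E i (Suc (m - i)))) {..m}"
   using assms by (intro M.finsum_cong') (auto simp: Suc_diff_le simp del: adw.simps)
  finally show ?thesis by simp
 qed
 finally show ?thesis using assms by (simp add: ev_add)
qed

text \<open>The Leibniz rule for (ad x)^m applied to [a, b], by repeated use of
  \<open>ev_shift\<close>.\<close>

lemma adw_bracket:
 assumes "w : hwords gg"
 shows "adw (p + q) (bracket gg a b) m w = ev p a q b m (%i. of_nat (m choose i)) w" using assms
proof (induction m arbitrary: w)
 case 0
 then show ?case using a b br_const[OF 0 wf_const[OF b], of a] by (auto simp: ev_def const_def bracket_closed bracket_zero)
next
 case (Suc m)
 have "adw (p + q) (bracket gg a b) (Suc m) w = br w (p + q) xw (ev p a q b m (%i. of_nat (m choose i)))"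
  unfolding adw.simps by (rule br_cong[OF refl Suc.IH Suc.prems])
 also have "... = ev p a q b (Suc m) (%i. of_nat (Suc m choose i)) w"
  unfolding ev_shift[of "%i. of_nat (m choose i)", OF K.rok_nat Suc.prems]
 proof (rule ev_cong)
  fix i
  show "(if i = 0 then 0 else of_nat (m choose (i - 1))) + (if i \<le> m then of_nat (m choose i) else 0) =
    (of_nat (Suc m choose i) :: rat)" by (cases i) (auto simp: binomial_eq_0)
 qed (use Suc in auto)
 finally show ?case .
qed

text \<open>The derivative of (ad x)^n a in the direction of r (ad x)^k b. Replacing the outermost x
  gives {(ad x)^k b, (ad x)^(n-1) a}, which skew symmetry turns round with a minus sign; replacing
  an inner x gives ad x of the previous derivative. Pascal's rule then produces n choose i for i <
  n, and the index i = n never occurs.\<close>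

lemma cmp_adw:
 assumes "w : hwords gg" "K.rok r"
 shows "cmp w q (adw p a n) (%v. rs r (adw q b k v)) =
  \<ominus>\<^sub>gg rs r (ev p a q b (n + k - 1) (%i. if i < n then of_nat (n choose i) else 0) w)"
 using assms(1)
proof (induction n arbitrary: w)
 case 0
 then show ?case using assms(2) by (simp add: cmp_const ev_zero)
next
 case (Suc n)
 note w = Suc.prems
 let ?H = "%v. rs r (adw q b k v)"
 have H: "wf q ?H" using b assms(2) by simp
 have A: "wf p (adw p a n)" using a by simp
 have "cmp w q (adw p a (Suc n)) ?H =
   ksign gg (p * q) (br w p (%v. cmp v q xw ?H) (adw p a n)) \<oplus>\<^sub>gg
   br w (p + q) xw (%v. cmp v q (adw p a n) ?H)" using cmp_br[OF w wf_xw A H] by simp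
 also have "br w p (%v. cmp v q xw ?H) (adw p a n) = br w p ?H (adw p a n)"
  by (rule br_cong[OF _ refl w]) (simp add: cmp_x[OF _ H])
 also have "ksign gg (p * q) (br w p ?H (adw p a n)) = \<ominus>\<^sub>gg rs r (br w q (adw p a n) (adw q b k))"
  using br_skew[OF w H A] br_rs_r[OF w A wf_adw[OF b] assms(2), of k] bra_closed[OF w] assms(2)
  by (simp add: M.uminus_ksign mult.commute add.assoc[symmetric] add.commute[of _ 1])
 finally have 1: "cmp w q (adw p a (Suc n)) ?H =
   \<ominus>\<^sub>gg rs r (br w q (adw p a n) (adw q b k)) \<oplus>\<^sub>gg br w (p + q) xw (%v. cmp v q (adw p a n) ?H)" .
 show ?case
 \<comment> \<open>The value n = 0 is separated because the degree n + k - 1 of the hypothesis is a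
   truncated difference, correct as soon as n is positive.\<close>
 proof (cases n)
  case 0
  have "br w (p + q) xw (%v. cmp v q (adw p a n) ?H) = \<zero>\<^sub>gg"
   using 0 br_zero(2)[OF w wf_xw] by (simp add: cmp_const)
  moreover have "ev p a q b (Suc n + k - 1) (%i. if i < Suc n then of_nat (Suc n choose i) else 0) w =
    br w q (adw p a n) (adw q b k)"
   using ev_single[of 0 k w] w 0 ev_cong[of k "%i. if i < Suc n then of_nat (Suc n choose i) else 0" "%i. if i = 0 then 1 else 0" w]
   by auto
  ultimately show ?thesis using 1 bra_closed[OF w, of n k] assms(2) by simp
 next
  case (Suc n')
  let ?l = "%n i. if i < n then of_nat (n choose i) else 0 :: rat"
  let ?m = "Suc (n' + k)"
  let ?sh = "%i. (if i = 0 then 0 else ?l n (i - 1)) + (if i \<le> n' + k then ?l n i else 0)"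
  have l: "K.rok (?l n i)" for n i by simp
  have sh: "K.rok (?sh i)" for i by (intro K.rat_in_add(1)) auto
  have wE: "wf (p + q) (ev p a q b (n' + k) (?l n))" by (rule wf_ev[OF l])
  have "br w (p + q) xw (%v. cmp v q (adw p a n) ?H) =
    br w (p + q) xw (%v. ksign gg 1 (rs r (ev p a q b (n' + k) (?l n) v)))"
   by (rule br_cong[OF refl _ w]) (use Suc.IH Suc ev_closed[of "?l n", OF l] assms(2) in \<open>simp add: M.ksign_1\<close>)
  also have "... = \<ominus>\<^sub>gg rs r (ev p a q b ?m ?sh w)"
   unfolding br_ksign(2)[OF w wf_xw wf_rs[OF assms(2) wE]] br_rs_r[OF w wf_xw wE assms(2)] ev_shift[of "?l n", OF l w, of "n' + k"]
   by (rule M.ksign_1)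
  finally have 2: "br w (p + q) xw (%v. cmp v q (adw p a n) ?H) = \<ominus>\<^sub>gg rs r (ev p a q b ?m ?sh w)" .
  have 3: "br w q (adw p a n) (adw q b k) = ev p a q b ?m (%i. if i = n then 1 else 0) w"
   using ev_single[of n ?m w] w Suc by simp
  have "ev p a q b ?m (%i. if i = n then 1 else 0) w \<oplus>\<^sub>gg ev p a q b ?m ?sh w =
    ev p a q b ?m (%i. (if i = n then 1 else 0) + ?sh i) w" by (rule ev_add[symmetric, OF _ sh w]) simp
  also have "... = ev p a q b ?m (?l (Suc n)) w"
  proof (rule ev_cong)
   fix i
   show "(if i = n then 1 else 0) + ?sh i = ?l (Suc n) i"
   proof (cases i)
    case (Suc j)
    consider "i < n" | "i = n" | "i > n" by linarith
    then show ?thesis using Suc \<open>n = Suc n'\<close> by cases auto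
   qed (use Suc in auto)
  qed (use w in auto)
  finally have 4: "ev p a q b ?m (%i. if i = n then 1 else 0) w \<oplus>\<^sub>gg ev p a q b ?m ?sh w =
   ev p a q b ?m (?l (Suc n)) w" .
  have c: "ev p a q b ?m (%i. if i = n then 1 else 0) w el gg" "ev p a q b ?m ?sh w el gg"
   using ev_closed[OF _ w, of "%i. if i = n then 1 else 0" ?m] ev_closed[OF sh w, of ?m] by auto
  have "cmp w q (adw p a (Suc n)) ?H = \<ominus>\<^sub>gg (rs r (ev p a q b ?m (%i. if i = n then 1 else 0) w \<oplus>\<^sub>gg ev p a q b ?m ?sh w))"
   unfolding 1 2 3 rs_add[OF assms(2) c] using c assms(2) by (simp add: M.minus_add)
  then show ?thesis unfolding 4 using Suc by simp
 qed
qed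

text \<open>Skew symmetry exchanges a and b and hence reverses the index i to m - i. This is why
  reflected indices occur in the second sum of the commutator identities.\<close>

lemma ev_swap:
 assumes "!!i. K.rok (l i)" "w : hwords gg"
 shows "ev q b p a m l w = ksign gg (1 + p * q) (ev p a q b m (%i. l (m - i)) w)"
proof -
 let ?f = "%i. rs (l (m - i)) (ksign gg (1 + p * q) (br w q (adw p a i) (adw q b (m - i))))"
 have s: "br w p (adw q b i) (adw p a j) = ksign gg (1 + p * q) (br w q (adw p a j) (adw q b i))" for i j
  using br_skew[OF assms(2) wf_adw[OF b] wf_adw[OF a], of i j] by (simp add: mult.commute)
 have img: "(%i. m - i) ` {..m} = {..m}"
 proof (intro equalityI subsetI)
  fix x assume "x : {..m}"
  then show "x : (%i. m - i) ` {..m}" by (intro image_eqI[of _ _ "m - x"]) auto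
 qed auto
 have "finsum gg ?f ((%i. m - i) ` {..m}) = finsum gg (%i. ?f (m - i)) {..m}"
  by (rule M.add.finprod_reindex) (use assms in \<open>auto simp: inj_on_def\<close>)
 moreover have "finsum gg (%i. ?f (m - i)) {..m} = ev q b p a m l w"
  unfolding ev_def by (rule M.finsum_cong') (use assms s in \<open>auto simp: Pi_def\<close>)
 moreover have "finsum gg ?f {..m} = ksign gg (1 + p * q) (ev p a q b m (%i. l (m - i)) w)"
 proof -
  have "addmap gg gg (ksign gg (1 + p * q))" by (rule addmapI) (simp_all add: M.ksign_add)
  then show ?thesis unfolding ev_def using assms
   by (simp add: addmap_finsum[OF M.ag M.ag] rs_ksign)
 qed
 ultimately show ?thesis unfolding img by simp
qed

end

end

section \<open>Power series in ad x and their commutators\<close>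

context half_lie
begin

text \<open>The argument of F is a part of w with one appended letter, so its length is at most that
  of w plus one. A power series in ad x may be replaced by a finite sum for this purpose.\<close>

lemma cmp_cong_length:
 assumes "w : hwords gg" "wf h H" "!!v. [|v : hwords gg; length v \<le> Suc (length w)|] ==> F v = F' v"
 shows "cmp w h F H = cmp w h F' H" using assms
proof (induction w arbitrary: h F H F')
 case Nil
 then show ?case using wfD[OF Nil(2), of "[]"] by simp
next
 case (Cons Z w)
 then have Z: "snd Z : grade gg (fst Z)" "w : hwords gg" by auto
 have "cmp w h (%v. F (Z # v)) H = cmp w h (%v. F' (Z # v)) H" by (rule Cons.IH) (use Z Cons.prems in auto)
 moreover have "cmp w (h + fst Z) F (%v. H (Z # v)) = cmp w (h + fst Z) F' (%v. H (Z # v))"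
  by (rule Cons.IH) (use Z Cons.prems in auto)
 ultimately show ?case by simp
qed

text \<open>If F lives on words of length n, the part of w left for it has n - 1 letters. The symbol
  H then sees exactly \<open>length w + 1 - n\<close> letters, so only one of its homogeneous parts
  matters.\<close>

lemma cmp_cong_field:
 assumes "w : hwords gg" "wf h H" "wf h H'" "!!v. [|v : hwords gg; length v \<noteq> n|] ==> F v = \<zero>\<^sub>gg"
  "!!v. [|v : hwords gg; length v + n = Suc (length w)|] ==> H v = H' v"
 shows "cmp w h F H = cmp w h F H'" using assms
proof (induction w arbitrary: h F H H' n)
 case Nil
 have g: "H [] : grade gg h" "H' [] : grade gg h"
  using wfD[OF Nil(2), of "[]"] wfD[OF Nil(3), of "[]"] by auto
 then show ?case using Nil(4)[of "[(h, H [])]"] Nil(4)[of "[(h, H' [])]"] Nil(5)[of "[]"] by (cases "n = 1") auto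
next
 case (Cons Z w)
 then have Z: "snd Z : grade gg (fst Z)" "w : hwords gg" by auto
 have "cmp w h (%v. F (Z # v)) H = cmp w h (%v. F (Z # v)) H'"
 proof (cases n)
  case 0
  have "cmp w h (%v. F (Z # v)) G = cmp w h (%v. \<zero>\<^sub>gg) G" if "wf h G" for G
   by (rule cmp_cong[OF _ refl Z(2) that]) (use Cons.prems(4) Z 0 in auto)
  then show ?thesis using Cons.prems(2,3) by (simp add: cmp_zero)
 next
  case (Suc n')
  show ?thesis by (rule Cons.IH[OF Z(2) Cons.prems(2,3), of n']) (use Z Cons.prems(4,5) Suc in auto)
 qed
 moreover have "cmp w (h + fst Z) F (%v. H (Z # v)) = cmp w (h + fst Z) F (%v. H' (Z # v))"
  by (rule Cons.IH[OF Z(2) wf_shift[OF Cons.prems(2) Z(1)] wf_shift[OF Cons.prems(3) Z(1)] Cons.prems(4)])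
   (use Z Cons.prems(5) in auto)
 ultimately show ?case by simp
qed

definition phw where
 "phw c p a w = rs (c (length w)) (adw p a (length w) w)"

lemma wf_phw: "[|!!n. K.rok (c n); a : grade gg p|] ==> wf p (phw c p a)"
 using wf_adw wfD[OF wf_adw] by (simp add: wf_def phw_def)

text \<open>Only pairs of degrees n and k with n + k - 1 = \<open>length w\<close> contribute. This
  accounts for the coefficient of d at \<open>Suc (length w) - n\<close>; each pair is evaluated by
  \<open>cmp_adw\<close>.\<close>

lemma cmp_phw:
 assumes c: "!!n. K.rok (c n)" and d: "!!n. K.rok (d n)" and a: "a : grade gg p" and b: "b : grade gg q"
  and w: "w : hwords gg"
 shows "cmp w q (phw c p a) (phw d q b) =
  \<ominus>\<^sub>gg ev p a q b (length w)
   (%i. \<Sum>n\<le>Suc (length w). c n * d (Suc (length w) - n) * (if i < n then of_nat (n choose i) else 0)) w"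
proof -
 let ?L = "length w"
 let ?l = "%n i. if i < n then of_nat (n choose i) else 0 :: rat"
 let ?k = "%n i. c n * d (Suc ?L - n) * ?l n i"
 have l: "K.rok (?l n i)" for n i by simp
 have k: "K.rok (?k n i)" for n i by (intro K.rat_in_mult(1) c d l)
 have G: "wf q (phw d q b)" by (rule wf_phw[OF d b])
 have A: "wf p (adw p a n)" for n by (rule wf_adw[OF a])
 have "cmp w q (phw c p a) (phw d q b) =
   cmp w q (%v. finsum gg (%n. rs (c n) (adw p a n v)) {..Suc ?L}) (phw d q b)"
 proof (rule cmp_cong_length[OF w G])
  fix v assume v: "v : hwords gg" "length v \<le> Suc ?L"
  have "finsum gg (%n. rs (c n) (adw p a n v)) {..Suc ?L} = rs (c (length v)) (adw p a (length v) v)"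
   by (rule finsum_single) (use v c adw_length[OF a] wf_closed[OF A] in auto)
  then show "phw c p a v = finsum gg (%n. rs (c n) (adw p a n v)) {..Suc ?L}" by (simp add: phw_def)
 qed
 also have "... = finsum gg (%n. cmp w q (%v. rs (c n) (adw p a n v)) (phw d q b)) {..Suc ?L}"
  by (rule cmp_finsum[OF _ wf_rs[OF c A] G w]) simp
 also have "... = finsum gg (%n. ev p a q b ?L (%i. - ?k n i) w) {..Suc ?L}"
 proof (rule M.finsum_cong')
  fix n assume "n : {..Suc ?L}"
  then have n: "n + (Suc ?L - n) - 1 = ?L" "n \<le> Suc ?L" by auto
  have "cmp w q (adw p a n) (phw d q b) =
    cmp w q (adw p a n) (%v. rs (d (Suc ?L - n)) (adw q b (Suc ?L - n) v))"
  proof (rule cmp_cong_field[OF w G wf_rs[OF d wf_adw[OF b]] adw_length[OF a]])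
   fix v :: "'g hw" assume "length v + n = Suc ?L"
   then have "length v = Suc ?L - n" by simp
   then show "phw d q b v = rs (d (Suc ?L - n)) (adw q b (Suc ?L - n) v)" by (simp only: phw_def)
  qed
  also have "... = \<ominus>\<^sub>gg rs (d (Suc ?L - n)) (ev p a q b ?L (?l n) w)"
   using cmp_adw[OF a b w d, of n _ "Suc ?L - n"] n by (simp del: adw.simps)
  also have "rs (d (Suc ?L - n)) (ev p a q b ?L (?l n) w) = ev p a q b ?L (%i. d (Suc ?L - n) * ?l n i) w"
   by (rule ev_rs[OF a b l d w])
  also have "\<ominus>\<^sub>gg ... = ev p a q b ?L (%i. - (d (Suc ?L - n) * ?l n i)) w"
   by (rule ev_uminus[OF a b K.rat_in_mult(1)[OF d l] w, symmetric])
  finally have "rs (c n) (cmp w q (adw p a n) (phw d q b)) =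
    rs (c n) (ev p a q b ?L (%i. - (d (Suc ?L - n) * ?l n i)) w)" by simp
  also have "... = ev p a q b ?L (%i. c n * - (d (Suc ?L - n) * ?l n i)) w"
   by (rule ev_rs[OF a b K.rok_uminus[OF K.rat_in_mult(1)[OF d l]] c w])
  finally have "rs (c n) (cmp w q (adw p a n) (phw d q b)) = ev p a q b ?L (%i. c n * - (d (Suc ?L - n) * ?l n i)) w" .
  then show "cmp w q (%v. rs (c n) (adw p a n v)) (phw d q b) = ev p a q b ?L (%i. - ?k n i) w"
   using cmp_rs[OF w A G c] by (simp add: mult.assoc)
 qed (use ev_closed[OF a b K.rok_uminus[OF k] w] in auto)
 also have "... = ev p a q b ?L (%i. \<Sum>n\<le>Suc ?L. - ?k n i) w"
  by (rule ev_sum[OF a b _ _ w, symmetric]) (simp_all only: finite_atMost K.rok_uminus[OF k])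
 also have "... = \<ominus>\<^sub>gg ev p a q b ?L (%i. \<Sum>n\<le>Suc ?L. ?k n i) w"
  unfolding sum_negf by (rule ev_uminus[OF a b K.rok_sum[OF k] w])
 finally show ?thesis .
qed

text \<open>All three terms are combinations of the same brackets {(ad x)^i a, (ad x)^(L-i) b} with
  L = \<open>length w\<close>, so it suffices to compare coefficients, or else to know that these
  brackets vanish. The second alternative is reserved for truncated series.\<close>

lemma phw_commutator:
 assumes c: "!!n. K.rok (c n)" and d: "!!n. K.rok (d n)" and e: "!!n. K.rok (e n)"
  and a: "a : grade gg p" and b: "b : grade gg q" and w: "w : hwords gg"
  and id: "(\<forall>i\<le>length w. br w q (adw p a i) (adw q b (length w - i)) = \<zero>\<^sub>gg) \<or>
   (\<forall>i\<le>length w.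
    (\<Sum>n\<le>Suc (length w). c n * d (Suc (length w) - n) * (if i < n then of_nat (n choose i) else 0)) +
    (\<Sum>n\<le>Suc (length w). d n * c (Suc (length w) - n) *
     (if length w - i < n then of_nat (n choose (length w - i)) else 0)) =
    - e (length w) * of_nat (length w choose i))"
 shows "cmp w q (phw c p a) (phw d q b) \<oplus>\<^sub>gg ksign gg (1 + p * q) (cmp w p (phw d q b) (phw c p a)) =
  phw e (p + q) (bracket gg a b) w"
proof -
 let ?L = "length w"
 let ?k1 = "%i. \<Sum>n\<le>Suc ?L. c n * d (Suc ?L - n) * (if i < n then of_nat (n choose i) else 0)"
 let ?k2 = "%i. \<Sum>n\<le>Suc ?L. d n * c (Suc ?L - n) * (if i < n then of_nat (n choose i) else 0)"
 have k1: "K.rok (?k1 i)" for i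
 proof (rule K.rok_sum)
  show "K.rok (c n * d (Suc ?L - n) * (if i < n then of_nat (n choose i) else 0))" for n
   by (intro K.rat_in_mult(1) c d) simp
 qed
 have k2: "K.rok (?k2 i)" for i
 proof (rule K.rok_sum)
  show "K.rok (d n * c (Suc ?L - n) * (if i < n then of_nat (n choose i) else 0))" for n
   by (intro K.rat_in_mult(1) c d) simp
 qed
 define l1 where "l1 = ?k1"
 define l2 where "l2 = (%i. ?k2 (?L - i))"
 have l: "K.rok (l1 i)" "K.rok (l2 i)" for i unfolding l1_def l2_def by (rule k1, rule k2)
 have 1: "cmp w q (phw c p a) (phw d q b) = \<ominus>\<^sub>gg ev p a q b ?L l1 w"
  using cmp_phw[OF c d a b w] by (simp only: l1_def)
 have 2: "cmp w p (phw d q b) (phw c p a) = \<ominus>\<^sub>gg ksign gg (1 + p * q) (ev p a q b ?L l2 w)"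
  using cmp_phw[OF d c b a w] ev_swap[OF a b k2 w, of ?L] by (simp only: l2_def)
 have E: "ev p a q b ?L l1 w el gg" "ev p a q b ?L l2 w el gg"
  using ev_closed[OF a b l(1) w] ev_closed[OF a b l(2) w] by auto
 have 3: "cmp w q (phw c p a) (phw d q b) \<oplus>\<^sub>gg ksign gg (1 + p * q) (cmp w p (phw d q b) (phw c p a)) =
   \<ominus>\<^sub>gg ev p a q b ?L (%i. l1 i + l2 i) w"
  unfolding 1 2 using E ev_add[OF a b l w, of ?L] by (simp add: M.ksign_uminus M.minus_add)
 have 4: "phw e (p + q) (bracket gg a b) w = ev p a q b ?L (%i. e ?L * of_nat (?L choose i)) w"
  unfolding phw_def adw_bracket[OF a b w] by (rule ev_rs[OF a b K.rok_nat e w])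
 have ee: "K.rok (e ?L * of_nat (?L choose i))" for i by (intro K.rat_in_mult(1) e) simp
 show ?thesis using id
 proof
  assume z: "\<forall>i\<le>?L. br w q (adw p a i) (adw q b (?L - i)) = \<zero>\<^sub>gg"
  have "ev p a q b ?L r w = \<zero>\<^sub>gg" if "!!i. K.rok (r i)" for r
  proof -
   have "ev p a q b ?L r w = finsum gg (%i. \<zero>\<^sub>gg) {..?L}"
    unfolding ev_def by (rule M.finsum_cong') (use z that in auto)
   then show ?thesis by simp
  qed
  from this[OF K.rat_in_add(1)[OF l]] this[OF ee] show ?thesis unfolding 3 4 by simp
 next
  assume "\<forall>i\<le>?L. ?k1 i + ?k2 (?L - i) = - e ?L * of_nat (?L choose i)"
  then have "ev p a q b ?L (%i. l1 i + l2 i) w = ev p a q b ?L (%i. - (e ?L * of_nat (?L choose i))) w"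
   by (intro ev_cong[OF a b _ K.rok_uminus[OF ee] w]) (simp only: l1_def l2_def mult_minus_left)
  also have "... = \<ominus>\<^sub>gg ev p a q b ?L (%i. e ?L * of_nat (?L choose i)) w"
   by (rule ev_uminus[OF a b ee w])
  finally show ?thesis unfolding 3 4 using ev_closed[OF a b ee w] by simp
 qed
qed

section \<open>Nilpotency\<close>

text \<open>The ascending central series: elements annihilated by every r-fold product of adjoint
  maps. In the N-nilpotent case \<open>killed N\<close> is everything.\<close>

definition killed where
 "killed r = {v : carrier gg. ALL Xs. set Xs \<subseteq> carrier gg & length Xs = r \<longrightarrow> foldr (bracket gg) Xs v = \<zero>\<^sub>gg}"

lemma addmap_foldr: "set Xs \<subseteq> carrier gg ==> addmap gg gg (foldr (bracket gg) Xs)"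
proof (induction Xs)
 case Nil
 then show ?case by (auto intro: addmapI)
next
 case (Cons X Xs)
 then show ?case
  using addmap_compose[of gg gg "foldr (bracket gg) Xs" gg "bracket gg X"] addmap_bracket_r[of X] by (simp add: comp_def)
qed

lemma foldr_zero: "set Xs \<subseteq> carrier gg ==> foldr (bracket gg) Xs \<zero>\<^sub>gg = \<zero>\<^sub>gg"
 by (rule addmap_zero[OF M.ag M.ag addmap_foldr])

lemma killed_carrier: "v : killed r ==> v el gg" by (simp add: killed_def)

lemma killed_0: "v : killed 0 ==> v = \<zero>\<^sub>gg" by (simp add: killed_def)

lemma killed_zero: "\<zero>\<^sub>gg : killed r" by (simp add: killed_def foldr_zero)

lemma killed_add: "[|v : killed r; v' : killed r|] ==> v \<oplus>\<^sub>gg v' : killed r"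
 unfolding killed_def by (auto simp: addmap_add[OF addmap_foldr])

lemma killed_ksign: "v : killed r ==> ksign gg p v : killed r" unfolding killed_def
 by (auto simp: addmap_ksign[OF M.ag M.ag addmap_foldr])

lemma killed_mono:
 assumes "v : killed r" "r \<le> s"
 shows "v : killed s" unfolding killed_def
proof (intro CollectI conjI allI impI)
 fix Xs assume Xs: "set Xs \<subseteq> carrier gg & length Xs = s"
 define Ys Zs where "Ys = take (s - r) Xs" "Zs = drop (s - r) Xs"
 then have "Xs = Ys @ Zs" "set Ys \<subseteq> carrier gg" "set Zs \<subseteq> carrier gg" "length Zs = r"
  using Xs assms(2) set_take_subset[of "s - r" Xs] set_drop_subset[of "s - r" Xs] by auto
 then show "foldr (bracket gg) Xs v = \<zero>\<^sub>gg" using assms(1) by (simp add: killed_def foldr_zero)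
qed (use assms killed_carrier in blast)

lemma killed_bracket:
 assumes "v : killed (Suc r)" "X el gg"
 shows "bracket gg X v : killed r" unfolding killed_def
proof (intro CollectI conjI allI impI)
 fix Xs assume "set Xs \<subseteq> carrier gg & length Xs = r"
 then have "foldr (bracket gg) (Xs @ [X]) v = \<zero>\<^sub>gg"
  using assms unfolding killed_def by (auto simp del: foldr_append)
 then show "foldr (bracket gg) Xs (bracket gg X v) = \<zero>\<^sub>gg" by simp
qed (use assms killed_carrier bracket_closed in blast)

lemma br_x_killed:
 assumes "w : hwords gg" "wf g G" "!!v. v : hwords gg ==> G v : killed (Suc r)"
 shows "br w g xw G : killed r" using assms
proof (induction w arbitrary: g G)
 case Nil
 then show ?case by (simp add: bracket_zero killed_zero)
next
 case (Cons Z w)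
 then have Z: "snd Z : grade gg (fst Z)" "w : hwords gg" by auto
 have "br w (g + fst Z) xw (%v. G (Z # v)) : killed r"
  by (rule Cons.IH[OF Z(2) wf_shift[OF Cons.prems(2) Z(1)]]) (use Z Cons.prems(3) in auto)
 moreover have "bracket gg (snd Z) (G w) : killed r" by (rule killed_bracket) (use Z Cons.prems(3) in auto)
 ultimately show ?case unfolding br_x_Cons[OF Cons.prems(1,2)] by (intro killed_add killed_ksign)
qed

text \<open>The map ad v lowers the ascending central series by i + 1 steps, as expected of a
  commutator of i + 1 elements.\<close>

definition lowers where
 "lowers i v \<longleftrightarrow> v el gg & (ALL r. ALL z:killed (Suc (r + i)). bracket gg v z : killed r)"

lemma lowers_zero: "lowers i \<zero>\<^sub>gg"
 using killed_carrier by (auto simp: lowers_def bracket_zero killed_zero)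

lemma lowers_add: "[|lowers i v; lowers i v'|] ==> lowers i (v \<oplus>\<^sub>gg v')"
 unfolding lowers_def by (auto simp: bracket_add_left killed_carrier killed_add)

lemma lowers_ksign: "lowers i v ==> lowers i (ksign gg p v)"
 unfolding lowers_def by (auto simp: bracket_ksign killed_carrier killed_ksign)

text \<open>In [[X, v], z] = [X, [v, z]] - (-1)^(pq) [v, [X, z]] both terms gain one more step
  through X.\<close>

lemma lowers_bracket:
 assumes "lowers i v" "v : grade gg q" "X : grade gg p"
 shows "lowers (Suc i) (bracket gg X v)" unfolding lowers_def
proof (intro conjI allI ballI)
 fix r z assume z: "z : killed (Suc (r + Suc i))"
 have c: "X el gg" "v el gg" "z el gg" using assms z killed_carrier by auto
 have "bracket gg v z : killed (Suc r)" using assms(1) z unfolding lowers_def by (metis add_Suc add_Suc_right)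
 then have 1: "bracket gg X (bracket gg v z) : killed r" using c(1) by (rule killed_bracket)
 have "bracket gg X z : killed (Suc (r + i))" by (rule killed_bracket) (use z c in auto)
 then have "bracket gg v (bracket gg X z) : killed r" using assms(1) unfolding lowers_def by blast
 then have "ksign gg (1 + p * q) (bracket gg v (bracket gg X z)) : killed r" by (rule killed_ksign)
 moreover have "bracket gg (bracket gg X v) z =
   bracket gg X (bracket gg v z) \<oplus>\<^sub>gg ksign gg (1 + p * q) (bracket gg v (bracket gg X z))"
  using bracket_jacobi[OF assms(3,2) c(3)] c by (simp add: M.minus_eq M.uminus_ksign bracket_closed)
 ultimately show "bracket gg (bracket gg X v) z : killed r" using 1 killed_add by simp
qed (use assms bracket_closed in auto)

lemma br_x_lowers:
 assumes "w : hwords gg" "wf g G" "!!v. v : hwords gg ==> lowers i (G v)"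
 shows "lowers (Suc i) (br w g xw G)" using assms
proof (induction w arbitrary: g G)
 case Nil
 then show ?case by (simp add: bracket_zero lowers_zero)
next
 case (Cons Z w)
 then have Z: "snd Z : grade gg (fst Z)" "w : hwords gg" by auto
 have "lowers (Suc i) (br w (g + fst Z) xw (%v. G (Z # v)))"
  by (rule Cons.IH[OF Z(2) wf_shift[OF Cons.prems(2) Z(1)]]) (use Z Cons.prems(3) in auto)
 moreover have "lowers (Suc i) (bracket gg (snd Z) (G w))"
  using Z by (intro lowers_bracket[OF Cons.prems(3) wfD[OF Cons.prems(2)]])
 ultimately show ?case unfolding br_x_Cons[OF Cons.prems(1,2)] by (intro lowers_add lowers_ksign)
qed

lemma br_lowers:
 assumes "w : hwords gg" "!!v. v : hwords gg ==> lowers i (F v)" "!!v. v : hwords gg ==> G v : killed (Suc i)"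
 shows "br w g F G = \<zero>\<^sub>gg" using assms
proof (induction w arbitrary: g F G)
 case Nil
 have "G [] : killed (Suc (0 + i))" "lowers i (F [])" using Nil by simp_all
 then have "bracket gg (F []) (G []) : killed 0" unfolding lowers_def by blast
 then show ?case using killed_0 by simp
next
 case (Cons Z w)
 then have Z: "snd Z : grade gg (fst Z)" "w : hwords gg" by auto
 have "br w g (%v. F (Z # v)) G = \<zero>\<^sub>gg" by (rule Cons.IH) (use Z Cons.prems in auto)
 moreover have "br w (g + fst Z) F (%v. G (Z # v)) = \<zero>\<^sub>gg"
  by (rule Cons.IH) (use Z Cons.prems in auto)
 ultimately show ?case by simp
qed

text \<open>The difference N - n is truncated: for n >= N the value lies in \<open>killed 0\<close>,
  that is, it vanishes.\<close>

lemma adw_killed: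
 assumes "nilpotent_lie gg N" "a : grade gg p" "w : hwords gg"
 shows "adw p a n w : killed (N - n)" using assms(3)
proof (induction n arbitrary: w)
 case 0
 then show ?case using assms(1,2) killed_zero by (auto simp: const_def killed_def nilpotent_lie_def foldr_zero)
next
 case (Suc n)
 have "adw p a n v : killed (Suc (N - Suc n))" if "v : hwords gg" for v
  by (rule killed_mono[OF Suc.IH[OF that]]) simp
 then show ?case using br_x_killed[OF Suc.prems wf_adw[OF assms(2)]] by simp
qed

lemma adw_lowers: "[|a : grade gg p; w : hwords gg|] ==> lowers n (adw p a n w)"
proof (induction n arbitrary: w)
 case 0
 then show ?case using lowers_zero killed_bracket by (auto simp: const_def) (auto simp: lowers_def)
next
 case (Suc n)
 then show ?case using br_x_lowers[OF Suc.prems(2) wf_adw[OF Suc.prems(1)]] by simp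
qed

text \<open>Nilpotency speaks of right-nested brackets, but {(ad x)^i a, (ad x)^j b} is not nested
  like that. Two filtrations bridge the gap: the right entry is killed after N - j <= i + 1 steps,
  and bracketing with the left entry goes down i + 1 steps at once.\<close>

lemma bra_nilpotent:
 assumes "nilpotent_lie gg N" "a : grade gg p" "b : grade gg q" "w : hwords gg" "N \<le> Suc (i + j)"
 shows "br w q (adw p a i) (adw q b j) = \<zero>\<^sub>gg"
proof (rule br_lowers[OF assms(4) adw_lowers[OF assms(2)]])
 fix v assume "v : hwords gg"
 then show "adw q b j v : killed (Suc i)" by (rule killed_mono[OF adw_killed[OF assms(1,3)]]) (use assms(5) in simp)
qed

end

section \<open>The symmetrized iterated bracket\<close>

lemma (in abelian_group) finsum_Times:
 assumes "finite A" "finite B" "!!i j. [|i : A; j : B|] ==> f (i, j) el G"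
 shows "finsum G f (A \<times> B) = finsum G (%i. finsum G (%j. f (i, j)) B) A" using assms(1,3)
proof (induction A)
 case (insert i A)
 have e: "insert i A \<times> B = Pair i ` B \<union> A \<times> B" by auto
 have "finsum G f (insert i A \<times> B) = finsum G f (Pair i ` B) \<oplus> finsum G f (A \<times> B)"
  unfolding e by (rule finsum_Un_disjoint) (use insert assms(2) in auto)
 also have "finsum G f (Pair i ` B) = finsum G (%j. f (i, j)) B"
  by (rule finsum_reindex) (use insert in \<open>auto simp: inj_on_def\<close>)
 finally show ?case using insert by (simp add: finsum_insert finsum_closed Pi_def)
qed simp

definition skip :: "nat => nat => nat" where
 "skip i j = (if j < i then j else Suc j)"

text \<open>The permutation with first value i whose remaining values repeat the pattern of s on the
  numbers other than i. \<open>skip i\<close> enumerates those numbers in increasing order, so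
  inversions inside s are preserved.\<close>

definition cons_perm :: "nat => (nat => nat) => nat => nat" where
 "cons_perm i s m = (case m of 0 => i | Suc k => skip i (s k))"

lemma cons_perm_simps [simp]: "cons_perm i s 0 = i" "cons_perm i s (Suc k) = skip i (s k)" by (simp_all add: cons_perm_def)

lemma skip_eq_iff [simp]: "skip i j = skip i k \<longleftrightarrow> j = k" by (auto simp: skip_def)

lemma skip_neq [simp]: "skip i j \<noteq> i" "i \<noteq> skip i j" by (auto simp: skip_def)

lemma skip_less [simp]: "skip i j < skip i k \<longleftrightarrow> j < k" "skip i j < i \<longleftrightarrow> j < i"
 by (auto simp: skip_def)

lemma cons_perm_permutes:
 assumes "i \<le> n" "s permutes {..<n}"
 shows "cons_perm i s permutes {..<Suc n}"
proof (rule bij_imp_permutes)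
 have s: "s k < n" if "k < n" for k using permutes_in_image[OF assms(2), of k] that by simp
 have "cons_perm i s x = cons_perm i s y \<longleftrightarrow> x = y" for x y
  by (cases x; cases y) (simp_all add: inj_eq[OF permutes_inj[OF assms(2)]])
 then have inj: "inj_on (cons_perm i s) {..<Suc n}" by (simp add: inj_on_def)
 have "cons_perm i s ` {..<Suc n} \<subseteq> {..<Suc n}"
 proof
  fix y assume "y : cons_perm i s ` {..<Suc n}"
  then obtain x where x: "x < Suc n" "y = cons_perm i s x" by auto
  show "y : {..<Suc n}"
  proof (cases x)
   case (Suc k)
   then have "s k < n" using x(1) s by simp
   then show ?thesis unfolding x(2) Suc by (simp add: skip_def)
  qed (use x assms(1) in simp)
 qed
 then show "bij_betw (cons_perm i s) {..<Suc n} {..<Suc n}"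
  unfolding bij_betw_def using inj endo_inj_surj[of "{..<Suc n}" "cons_perm i s"] by simp
 fix x assume "x \<notin> {..<Suc n}"
 then show "cons_perm i s x = x" using permutes_not_in[OF assms(2), of "x - 1"] assms(1) by (cases x) (auto simp: skip_def)
qed

lemma cons_perm_inj: "inj_on (%(i, s). cons_perm i s) A"
proof (rule inj_onI, clarify)
 fix i s j t assume e: "cons_perm i s = cons_perm j t"
 have i: "i = j" using fun_cong[OF e, of 0] by simp
 then show "i = j & s = t" using fun_cong[OF e, of "Suc _"] by auto
qed

text \<open>By counting: the map on pairs is injective, its image consists of permutations, and both
  sets have (n+1)! elements.\<close>

lemma permutes_Suc_image:
 "{s. s permutes {..<Suc n}} = (%(i, s). cons_perm i s) ` ({..<Suc n} \<times> {s. s permutes {..<n}})"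
proof (rule card_seteq[symmetric])
 have c: "card {s. s permutes {..<m}} = fact m" for m :: nat by (rule card_permutations) simp_all
 show "finite {s. s permutes {..<Suc n}}" by (rule finite_permutations) simp
 show "(%(i, s). cons_perm i s) ` ({..<Suc n} \<times> {s. s permutes {..<n}}) \<subseteq> {s. s permutes {..<Suc n}}"
  using cons_perm_permutes by auto
 show "card {s. s permutes {..<Suc n}} \<le> card ((%(i, s). cons_perm i s) ` ({..<Suc n} \<times> {s. s permutes {..<n}}))"
  by (simp only: card_image[OF cons_perm_inj] card_cartesian_product c card_lessThan fact_Suc of_nat_id le_refl)
qed

abbreviation del :: "nat => 'a list => 'a list" where
 "del i w \<equiv> take i w @ drop (Suc i) w"

lemma nth_del: "[|i < length w; j < length w - 1|] ==> del i w ! j = w ! skip i j"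
 by (auto simp: nth_append skip_def min_def)

text \<open>The new inversions are those with position 0, where the value i exceeds a later value.
  Reindexing by s turns them into the sum over all j < i, which is the cost of pulling letter i to
  the front.\<close>

lemma koszul_parity_cons_perm:
 assumes "i < Suc n" "s permutes {..<n}" "length ps = Suc n"
 shows "koszul_parity ps (cons_perm i s) = ps ! i * (\<Sum>j<i. ps ! j) + koszul_parity (del i ps) s"
proof -
 have sl: "s l < n" if "l < n" for l using permutes_in_image[OF assms(2), of l] that by simp
 have len: "length (del i ps) = n" using assms by simp
 let ?f = "%l k. if s l < s k then ps ! skip i (s k) * ps ! skip i (s l) else (0::bit)"
 have split0: "(\<Sum>k<Suc l. g k) = g 0 + (\<Sum>k<l. g (Suc k))" for g :: "nat => bit" and l
  by (rule sum.lessThan_Suc_shift)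
 have "koszul_parity ps (cons_perm i s) =
   (\<Sum>l<n. (if s l < i then ps ! i * ps ! skip i (s l) else 0) + (\<Sum>k<l. ?f l k))"
  unfolding koszul_parity_def assms(3) split0 by (simp cong: if_cong)
 also have "... = (\<Sum>l<n. if s l < i then ps ! i * ps ! skip i (s l) else 0) + (\<Sum>l<n. \<Sum>k<l. ?f l k)"
  by (rule sum.distrib)
 also have "(\<Sum>l<n. if s l < i then ps ! i * ps ! skip i (s l) else 0) =
   (\<Sum>l<n. if l < i then ps ! i * ps ! skip i l else 0)"
  using sum.permute[OF assms(2), of "%l. if l < i then ps ! i * ps ! skip i l else 0"] by (simp add: comp_def)
 also have "... = (\<Sum>l\<in>{..<n} \<inter> {l. l < i}. ps ! i * ps ! skip i l)" by (simp add: sum.inter_restrict)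
 also have "... = (\<Sum>j<i. ps ! i * ps ! j)" by (rule sum.cong) (use assms(1) in \<open>auto simp: skip_def\<close>)
 also have "(\<Sum>l<n. \<Sum>k<l. ?f l k) = koszul_parity (del i ps) s" unfolding koszul_parity_def len
  by (intro sum.cong refl) (use nth_del[of i ps] assms sl in auto)
 finally show ?thesis by (simp add: sum_distrib_left)
qed

context half_lie
begin

lemma hwords_del: "w : hwords gg ==> del i w : hwords gg"
 unfolding hwords_def using set_take_subset[of i w] set_drop_subset[of "Suc i" w] by auto

lemma hwords_nth: "[|w : hwords gg; i < length w|] ==> snd (w ! i) : grade gg (fst (w ! i))"
 unfolding hwords_def using nth_mem[of i w] by fastforce

lemma finsum_lessThan_Suc_shift:
 assumes "!!i. i < Suc n ==> f i el gg"
 shows "finsum gg f {..<Suc n} = f 0 \<oplus>\<^sub>gg finsum gg (%i. f (Suc i)) {..<n}"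
proof -
 have "finsum gg f (insert 0 (Suc ` {..<n})) = f 0 \<oplus>\<^sub>gg finsum gg f (Suc ` {..<n})"
  by (rule M.finsum_insert) (use assms in auto)
 also have "finsum gg f (Suc ` {..<n}) = finsum gg (%i. f (Suc i)) {..<n}"
  by (rule M.finsum_reindex) (use assms in auto)
 finally show ?thesis by (simp only: lessThan_Suc_eq_insert_0)
qed

text \<open>The recursion solved: in {x, G} each letter in turn feeds x, and it has to pass the
  operator of parity g as well as the letters before it.\<close>

lemma br_x_sum:
 assumes "w : hwords gg" "wf g G"
 shows "br w g xw G = finsum gg (%i. ksign gg (g * fst (w ! i) + fst (w ! i) * (\<Sum>j<i. fst (w ! j)))
  (bracket gg (snd (w ! i)) (G (del i w)))) {..<length w}" using assms
proof (induction w arbitrary: g G)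
 case Nil
 then show ?case by (simp add: bracket_zero)
next
 case (Cons Z w)
 then have Z: "snd Z : grade gg (fst Z)" "w : hwords gg" by auto
 let ?f = "%i. ksign gg (g * fst ((Z # w) ! i) + fst ((Z # w) ! i) * (\<Sum>j<i. fst ((Z # w) ! j)))
  (bracket gg (snd ((Z # w) ! i)) (G (del i (Z # w))))"
 have c: "?f i el gg" if "i < Suc (length w)" for i
  using that hwords_nth[OF Cons.prems(1), of i] wf_closed[OF Cons.prems(2) hwords_del[OF Cons.prems(1), of i]]
  by (auto intro!: bracket_closed)
 have "br (Z # w) g xw G = ksign gg (g * fst Z) (bracket gg (snd Z) (G w)) \<oplus>\<^sub>gg
   br w (g + fst Z) xw (%v. G (Z # v))" by (rule br_x_Cons[OF Cons.prems])
 also have "br w (g + fst Z) xw (%v. G (Z # v)) = finsum gg (%i. ?f (Suc i)) {..<length w}"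
  unfolding Cons.IH[OF Z(2) wf_shift[OF Cons.prems(2) Z(1)]] sum.lessThan_Suc_shift by (simp add: algebra_simps)
 also have "ksign gg (g * fst Z) (bracket gg (snd Z) (G w)) = ?f 0" by simp
 also have "?f 0 \<oplus>\<^sub>gg finsum gg (%i. ?f (Suc i)) {..<length w} = finsum gg ?f {..<Suc (length w)}"
  by (rule finsum_lessThan_Suc_shift[symmetric]) (rule c)
 finally show ?case by simp
qed

lemma wpar_del: "i < length w ==> wpar w = fst (w ! i) + wpar (del i w)"
proof -
 assume "i < length w"
 then have "wpar w = wpar (take i w @ w ! i # drop (Suc i) w)" by (simp add: id_take_nth_drop[symmetric])
 then show ?thesis by (simp add: ac_simps)
qed

lemma foldr_bracket_closed: "[|set Xs \<subseteq> carrier gg; a el gg|] ==> foldr (bracket gg) Xs a el gg"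
 by (rule addmap_closed[OF addmap_foldr])

text \<open>The n-th power of ad x on a word of n letters is the symmetrised bracket in the
  definition of \<phi>_c. The outermost letter i is chosen by \<open>br_x_sum\<close>, the other
  letters are ordered by the induction hypothesis, and \<open>cons_perm\<close> assembles both
  choices. The prefactor moves a past all letters.\<close>

lemma adw_sym_ad:
 assumes "w : hwords gg" "a : grade gg p" "length w = n"
 shows "adw p a n w = ksign gg (p * wpar w) (sym_ad gg (map fst w) (map snd w) a)" using assms(1,3)
proof (induction n arbitrary: w)
 case 0
 have "{s. s permutes {..<0::nat}} = {id}" by simp
 then show ?case using 0 assms(2) by (simp add: sym_ad_def koszul_parity_def const_def)
next
 case (Suc n)
 let ?B = "{s. s permutes {..<n}}"
 let ?A = "{..<Suc n} \<times> ?B"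
 let ?g = "%w s. foldr (bracket gg) (map (%k. map snd w ! s k) [0..<length w]) a"
 let ?h = "%s. ksign gg (p * wpar w + koszul_parity (map fst w) s) (?g w s)"
 have finB: "finite ?B" by (rule finite_permutations) simp
 have a: "a el gg" using assms(2) by auto
 have gc: "?g v s el gg" if "v : hwords gg" "s permutes {..<length v}" for v s
 proof (rule foldr_bracket_closed[OF _ a])
  have "snd (v ! s k) el gg & s k < length v" if "k < length v" for k
   using hwords_nth[of v "s k"] \<open>v : hwords gg\<close> permutes_in_image[OF \<open>s permutes _\<close>, of k] that by auto
  then show "set (map (%k. map snd v ! s k) [0..<length v]) \<subseteq> carrier gg" by auto
 qed
 have term_eq: "ksign gg (p * fst (w ! i) + fst (w ! i) * (\<Sum>j<i. fst (w ! j)))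
   (bracket gg (snd (w ! i)) (adw p a n (del i w))) = finsum gg (%s. ?h (cons_perm i s)) ?B"
  if i: "i < Suc n" for i
 proof -
  have len: "length (del i w) = n" using i Suc.prems(2) by simp
  have d: "del i w : hwords gg" by (rule hwords_del[OF Suc.prems(1)])
  have X: "snd (w ! i) el gg" using hwords_nth[OF Suc.prems(1), of i] i Suc.prems(2) by auto
  let ?e = "p * fst (w ! i) + fst (w ! i) * (\<Sum>j<i. fst (w ! j))"
  let ?t = "%s. ksign gg (p * wpar (del i w)) (ksign gg (koszul_parity (map fst (del i w)) s) (?g (del i w) s))"
  have gd: "?g (del i w) s el gg" if "s : ?B" for s using gc[OF d, of s] that unfolding len by simp
  have "adw p a n (del i w) = finsum gg ?t ?B" unfolding Suc.IH[OF d len] sym_ad_def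
   using gd by (subst addmap_finsum[OF M.ag M.ag addmap_ksign_self])
    (simp_all only: len length_map, simp_all)
  then have "ksign gg ?e (bracket gg (snd (w ! i)) (adw p a n (del i w))) =
    ksign gg ?e (finsum gg (%s. bracket gg (snd (w ! i)) (?t s)) ?B)"
   using addmap_finsum[OF M.ag M.ag addmap_bracket_r[OF X], of ?B ?t] gd by simp
  also have "... = finsum gg (%s. ksign gg ?e (bracket gg (snd (w ! i)) (?t s))) ?B"
   by (rule addmap_finsum[OF M.ag M.ag addmap_ksign_self])
    (use gd X in \<open>simp add: bracket_closed\<close>)
  also have "... = finsum gg (%s. ?h (cons_perm i s)) ?B"
  proof (rule M.finsum_cong'[OF refl])
   show "(%s. ?h (cons_perm i s)) : ?B \<rightarrow> carrier gg"
    using gc[OF Suc.prems(1)] cons_perm_permutes[of i n] i Suc.prems(2) by auto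
   fix s assume s: "s : ?B"
   have sk: "s k < n" if "k < n" for k using s permutes_in_image[of s "{..<n}" k] that by auto
   have nth: "map snd w ! skip i (s k) = map snd (del i w) ! s k" if "k < n" for k
   proof -
    have "map snd (del i w) ! s k = snd (del i w ! s k)" by (rule nth_map) (simp only: len sk[OF that])
    moreover have "del i w ! s k = w ! skip i (s k)" by (rule nth_del) (use i Suc.prems(2) sk[OF that] in simp_all)
    moreover have "map snd w ! skip i (s k) = snd (w ! skip i (s k))"
     by (rule nth_map) (use Suc.prems(2) sk[OF that] in \<open>simp add: skip_def\<close>)
    ultimately show ?thesis by simp
   qed
   have "map (%k. map snd w ! cons_perm i s k) [0..<length w] =
     snd (w ! i) # map (%k. map snd w ! skip i (s k)) [0..<n]"
    unfolding Suc.prems(2) map_upt_Suc cons_perm_simps using i Suc.prems(2) by simp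
   also have "map (%k. map snd w ! skip i (s k)) [0..<n] = map (%k. map snd (del i w) ! s k) [0..<n]"
    by (rule map_cong[OF refl nth]) simp
   finally have "map (%k. map snd w ! cons_perm i s k) [0..<length w] =
     snd (w ! i) # map (%k. map snd (del i w) ! s k) [0..<n]" .
   then have "?g w (cons_perm i s) = bracket gg (snd (w ! i)) (?g (del i w) s)"
    by (simp only: len foldr.simps comp_apply)
   moreover have "koszul_parity (map fst w) (cons_perm i s) =
     fst (w ! i) * (\<Sum>j<i. fst (w ! j)) + koszul_parity (map fst (del i w)) s"
    using koszul_parity_cons_perm[OF i, of s "map fst w"] s i Suc.prems(2) by (simp add: take_map drop_map)
   moreover have "wpar w = fst (w ! i) + wpar (del i w)" using wpar_del[of i w] i Suc.prems(2) by simp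
   ultimately show "ksign gg ?e (bracket gg (snd (w ! i)) (?t s)) = ?h (cons_perm i s)"
    using gd[OF s] X by (simp only: bracket_ksign M.ksign_closed M.ksign_ksign bracket_closed)
     (simp only: algebra_simps)
  qed
  finally show ?thesis .
 qed
 have "adw p a (Suc n) w = finsum gg (%i. finsum gg (%s. ?h (cons_perm i s)) ?B) {..<Suc n}"
  unfolding adw.simps br_x_sum[OF Suc.prems(1) wf_adw[OF assms(2)]] Suc.prems(2) by (rule M.finsum_cong')
   (use term_eq gc[OF Suc.prems(1)] cons_perm_permutes[of _ n] Suc.prems(2) in \<open>auto intro!: M.finsum_closed\<close>)
 also have "... = finsum gg (%x. ?h (case_prod cons_perm x)) ?A"
  by (rule M.finsum_Times[where f = "%x. ?h (case_prod cons_perm x)", unfolded prod.case, symmetric])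
   (use gc[OF Suc.prems(1)] cons_perm_permutes[of _ n] Suc.prems(2) finB in auto)
 also have "... = finsum gg ?h (case_prod cons_perm ` ?A)" by (rule M.finsum_reindex[symmetric, OF _ cons_perm_inj])
   (use gc[OF Suc.prems(1)] cons_perm_permutes[of _ n] Suc.prems(2) in auto)
 also have "... = finsum gg ?h {s. s permutes {..<Suc n}}" by (simp only: permutes_Suc_image)
 also have "... = finsum gg (%s. ksign gg (p * wpar w) (ksign gg (koszul_parity (map fst w) s) (?g w s))) {s. s permutes {..<Suc n}}"
  by (rule M.finsum_cong') (use gc[OF Suc.prems(1)] Suc.prems(2) in auto)
 also have "... = ksign gg (p * wpar w) (sym_ad gg (map fst w) (map snd w) a)"
  unfolding sym_ad_def using gc[OF Suc.prems(1)] Suc.prems(2)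
  by (subst addmap_finsum[OF M.ag M.ag addmap_ksign_self]) auto
 finally show ?case .
qed

end

section \<open>Linear maps on the symmetric algebra with given values on words\<close>

context conv_target
begin

text \<open>The bridge from S(M) to words: on a product of homogeneous elements the convolution
  follows the recursion \<open>splitw\<close>.\<close>

lemma conv_word:
 assumes "tb g b" "w : hwords M"
 shows "conv g b (sp w) = splitw N w g (%v u. b (sp v) (sp u))" using assms
proof (induction w arbitrary: g b)
 case Nil
 then show ?case by (simp add: conv_one)
next
 case (Cons Z w)
 then have Z: "snd Z : grade M (fst Z)" "snd Z el M" "w : hwords M" by auto
 note t = tb_left[OF Cons.prems(1), of "inc (snd Z)"] tb_right[OF Cons.prems(1), of "inc (snd Z)" "fst Z"]
 show ?case using conv_Cons[OF Cons.prems(1) Z(1), of "sp w"] Cons.IH[OF t(1) Z(3)] Cons.IH[OF t(2) Z(3)]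
   Z S.pinc_grade[OF Z(1)] by simp
qed

lemma graded_of_words:
 assumes "addmap S N F" "!!s ka. [|s el S; ka el K|] ==> F (act S s ka) = act N (F s) ka"
  "!!w. w : hwords M ==> F (sp w) : grade N (wpar w + f)" "s : grade S q"
 shows "F s : grade N (q + f)" using assms(4)
proof (induction rule: S.grade_P_induct)
 case (word w ka)
 then show ?case using N.grade_act[OF assms(3)[OF word(1)] word(2)] assms(2)[of "sp w" ka] K.grade_carrier[OF word(2)]
  by (simp add: algebra_simps)
next
 case (diff x y)
 then show ?case by (simp add: S.P.M.minus_eq addmap_add[OF assms(1)]
    addmap_minus[OF S.P.M.ag N.M.ag assms(1)])
qed

end

text \<open>The square-zero extension \<open>K \<oplus> M\<close> receives the components of degrees 0 and 1 of \<open>S(M)\<close>.\<close>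

definition sqz :: "('k, 'x) superring_scheme => ('k, 'm, 'y) supermodule_scheme => ('k \<times> 'm) ring" where
 "sqz K M = \<lparr>carrier = carrier K \<times> carrier M,
  monoid.mult = (%(ka, X) (kb, Y). (ka \<otimes>\<^sub>K kb, lact K M ka Y \<oplus>\<^sub>M act M X kb)),
  one = (\<one>\<^sub>K, \<zero>\<^sub>M), ring.zero = (\<zero>\<^sub>K, \<zero>\<^sub>M),
  ring.add = (%(ka, X) (kb, Y). (ka \<oplus>\<^sub>K kb, X \<oplus>\<^sub>M Y))\<rparr>"

lemma sqz_simps [simp]:
 "carrier (sqz K M) = carrier K \<times> carrier M"
 "(ka, X) \<otimes>\<^bsub>sqz K M\<^esub> (kb, Y) = (ka \<otimes>\<^sub>K kb, lact K M ka Y \<oplus>\<^sub>M act M X kb)"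
 "\<one>\<^bsub>sqz K M\<^esub> = (\<one>\<^sub>K, \<zero>\<^sub>M)" "\<zero>\<^bsub>sqz K M\<^esub> = (\<zero>\<^sub>K, \<zero>\<^sub>M)"
 "(ka, X) \<oplus>\<^bsub>sqz K M\<^esub> (kb, Y) = (ka \<oplus>\<^sub>K kb, X \<oplus>\<^sub>M Y)"
 by (simp_all add: sqz_def)

context supermodule
begin

lemma lact_zero [simp]: "m el M ==> lact K M \<zero>\<^sub>K m = \<zero>\<^sub>M" "ka el K ==> lact K M ka \<zero>\<^sub>M = \<zero>\<^sub>M"
 using addmap_zero[OF K.ag M.ag addmap_lact_scalar]
  addmap_zero[OF M.ag M.ag addmap_lact] by auto

lemma ring_sqz: "ring (sqz K M)"
proof (rule ringI)
 show "abelian_group (sqz K M)"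
 proof (rule abelian_groupI)
  fix x assume "x el (sqz K M)"
  then show "EX y:carrier (sqz K M). y \<oplus>\<^bsub>sqz K M\<^esub> x = \<zero>\<^bsub>sqz K M\<^esub>"
   by (intro bexI[of _ "(\<ominus>\<^sub>K fst x, \<ominus>\<^sub>M snd x)"]) (auto simp: K.l_neg M.l_neg)
 qed (auto simp: K.a_ac M.a_ac)
 show "Group.monoid (sqz K M)"
  by (rule monoidI) (auto simp: act_closed act_one K.m_assoc lact_add_right act_add_left lact_lact lact_act
    act_act M.a_assoc)
qed (auto simp: act_closed K.l_distr K.r_distr lact_add_left lact_add_right act_add_left act_add_right M.a_ac)

end

context half_supermodule
begin

text \<open>The counit and the projection onto degree one are the components of the ring morphism
  into the square-zero extension that sends X to (0, X). Two such elements have product zero, hence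
  the relations of S(M) hold trivially.\<close>

lemma low_degrees:
 "EX e x. addmap S K e & addmap S M x &
  (ALL s:carrier S. ALL ka:carrier K. e (act S s ka) = e s \<otimes>\<^sub>K ka & x (act S s ka) = act M (x s) ka) &
  (ALL w:hwords M. e (sp w) = (if w = [] then \<one>\<^sub>K else \<zero>\<^sub>K) &
   x (sp w) = (if length w = 1 then snd (hd w) else \<zero>\<^sub>M))"
proof -
 let ?B = "sqz K M"
 interpret B: ring ?B by (rule ring_sqz)
 define k :: "'k => 'k \<times> 'm" where "k ka = (ka, \<zero>\<^sub>M)" for ka
 define j :: "'m => 'k \<times> 'm" where "j X = (\<zero>\<^sub>K, X)" for X
 have kh: "k : ring_hom K ?B" by (rule ring_hom_memI) (simp_all add: k_def)
 have jh: "addmap M ?B j" by (rule addmapI) (simp_all add: j_def)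
 have jj: "j X \<otimes>\<^bsub>?B\<^esub> j Y = \<zero>\<^bsub>?B\<^esub>" if "X el M" "Y el M" for X Y
  using that by (simp add: j_def)
 have rel: "h g = \<zero>\<^bsub>?B\<^esub>"
  if h: "h : ring_hom T ?B" "!!X. X el M ==> h (tensor_inc K M X) = j X" and g: "g : sym_gens" for h g
 proof -
  have add: "addmap T ?B h" by (rule addmapI[OF ring_hom_closed[OF h(1)] ring_hom_add[OF h(1)]])
  have m: "h (tensor_inc K M v \<otimes>\<^sub>T tensor_inc K M w) = \<zero>\<^bsub>?B\<^esub>" if "v el M" "w el M" for v w
   using that jj by (simp only: ring_hom_mult[OF h(1)] h(2) tensor_inc_closed)
  show ?thesis using g unfolding sym_gens_def
  proof (elim UnE CollectE exE conjE)
   fix v w p q assume g: "g = tensor_inc K M v \<otimes>\<^sub>T tensor_inc K M w \<ominus>\<^sub>T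
    ksign T (p * q) (tensor_inc K M w \<otimes>\<^sub>T tensor_inc K M v)" and vw: "v : grade M p" "w : grade M q"
   have c: "v el M" "w el M" using vw by auto
   show "h g = \<zero>\<^bsub>?B\<^esub>" unfolding g using c by (simp add: T.M.minus_eq addmap_add[OF add] m
      addmap_minus[OF T.M.ag B.ag add]
      addmap_ksign[OF T.M.ag B.ag add] B.ksign_zero B.a_inv_zero
      del: sqz_simps)
  next
   fix u assume g: "g = tensor_inc K M u \<otimes>\<^sub>T tensor_inc K M u" and u: "u : grade M 1"
   then show "h g = \<zero>\<^bsub>?B\<^esub>" using m[of u u] by simp
  qed
 qed
 have ex: "EX h. h : ring_hom S ?B & (ALL X:carrier M. h (inc X) = j X) &
   (ALL ka:carrier K. h (S.P.kap ka) = k ka)"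
 proof (rule S.P_universal[OF B.ring_axioms kh jh _ _ sym_ideal_eq sym_gens_carrier])
  fix h g assume "h : ring_hom T ?B" "!!X. X el M ==> h (tensor_inc K M X) = j X" "g : sym_gens"
  then show "h g = \<zero>\<^bsub>?B\<^esub>" by (rule rel)
 qed (simp_all add: j_def k_def act_closed)
 obtain h where h: "h : ring_hom S ?B" "ALL X:carrier M. h (inc X) = j X"
  "ALL ka:carrier K. h (S.P.kap ka) = k ka" using ex by blast
 note hm = ring_hom_mult[OF h(1)] and ha = ring_hom_add[OF h(1)] and ho = ring_hom_one[OF h(1)]
 have hc: "fst (h s) el K" "snd (h s) el M" if "s el S" for s
  using ring_hom_closed[OF h(1) that] by auto
 have a: "h (x \<oplus>\<^sub>S y) = (fst (h x) \<oplus>\<^sub>K fst (h y), snd (h x) \<oplus>\<^sub>M snd (h y))"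
  if "x el S" "y el S" for x y using ha[OF that] by (metis prod.collapse sqz_simps(5))
 have m: "h (x \<otimes>\<^sub>S y) = (fst (h x) \<otimes>\<^sub>K fst (h y), lact K M (fst (h x)) (snd (h y)) \<oplus>\<^sub>M act M (snd (h x)) (fst (h y)))"
  if "x el S" "y el S" for x y using hm[OF that] by (metis prod.collapse sqz_simps(2))
 have e: "addmap S K (%s. fst (h s))" "addmap S M (%s. snd (h s))" by (rule addmapI, simp_all add: hc a)+
 have act: "fst (h (act S s ka)) = fst (h s) \<otimes>\<^sub>K ka & snd (h (act S s ka)) = act M (snd (h s)) ka"
  if "s el S" "ka el K" for s ka
  using that h(3) hc by (simp add: S.P.act_kap m k_def act_closed)
 have w0: "fst (h (sp w)) = (if w = [] then \<one>\<^sub>K else \<zero>\<^sub>K)" if "w : hwords M" for w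
  using that h(2) hc by (cases w) (auto simp: ho m j_def)
 have w1: "snd (h (sp w)) = (if length w = 1 then snd (hd w) else \<zero>\<^sub>M)" if w: "w : hwords M" for w
 proof (cases w)
  case Nil
  then show ?thesis by (simp add: ho)
 next
  case (Cons Z v)
  then have Z: "snd Z el M" "v : hwords M" using w by auto
  then show ?thesis using Cons h(2) hc[of "sp v"] w0[OF Z(2)] by (simp add: m j_def act_closed act_one)
 qed
 show ?thesis by (rule exI[of _ "%s. fst (h s)"], rule exI[of _ "%s. snd (h s)"]) (use e act w0 w1 in auto)
qed

end

sublocale half_lie \<subseteq> CG: conv_target K gg gg
 by (intro conv_target.intro half_supermodule_axioms supermodule_axioms)

sublocale half_lie \<subseteq> CS: conv_target K gg "sym_alg K gg"
 by (intro conv_target.intro half_supermodule_axioms S.P.supermodule_axioms)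

lemma (in supermodule) rs_act: "[|K.rok r; v el M; ka el K|] ==> rs r (act M v ka) = act M (rs r v) ka"
proof -
 assume r: "K.rok r" and v: "v el M" and "ka el K"
 from this(3) have "ka \<otimes>\<^sub>K rat_in K r = rat_in K r \<otimes>\<^sub>K ka"
 proof (induction rule: K.grade_induct)
  case (homogeneous p ka)
  then show ?case using K.super_comm[OF homogeneous K.rat_in_even[OF r]] by simp
 next
  case (add x y)
  then show ?case using r by (simp add: K.l_distr K.r_distr)
 qed
 then show ?thesis using r v \<open>ka el K\<close> by (simp add: rs_def act_act)
qed

section \<open>Linear maps from S(gg) to gg\<close>

context half_lie
begin

text \<open>Homogeneous right linear maps from S(gg) to \<open>gg\<close> of parity f. Values off
  the carrier stay open, so that sums, signs and compositions remain in the class as plain lambda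
  terms.\<close>

definition hh where
 "hh f F \<longleftrightarrow> addmap S gg F & (ALL s:carrier S. ALL ka:carrier K. F (act S s ka) = act gg (F s) ka) &
  (ALL q. ALL s:grade S q. F s : grade gg (q + f))"

lemma hhD:
 assumes "hh f F"
 shows "addmap S gg F" "s el S ==> F s el gg"
  "[|s el S; ka el K|] ==> F (act S s ka) = act gg (F s) ka"
  "s : grade S q ==> F s : grade gg (q + f)"
 using assms addmap_closed[of S gg F] unfolding hh_def by blast+

lemma hhI:
 assumes "addmap S gg F" "!!s ka. [|s el S; ka el K|] ==> F (act S s ka) = act gg (F s) ka"
  "!!w. w : hwords gg ==> F (sp w) : grade gg (wpar w + f)"
 shows "hh f F" unfolding hh_def using assms(1,2) CG.graded_of_words[OF assms] by blast

lemma hh_lact: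
 assumes "hh f F" "s el S" "ka : grade K r"
 shows "F (lact K S ka s) = ksign gg (f * r) (lact K gg ka (F s))" using assms(2)
proof (induction rule: S.P.M.grade_induct)
 case (homogeneous q s)
 have c: "s el S" "ka el K" using homogeneous assms(3) by auto
 note F = hhD[OF assms(1)]
 have "F (lact K S ka s) = ksign gg (r * q) (act gg (F s) ka)"
  using c addmap_ksign[OF S.P.M.ag M.ag F(1)]
  by (simp add: S.P.lact_homogeneous[OF homogeneous assms(3)] S.P.act_closed F(3))
 then show ?case
  using c F(2)[OF c(1)] by (simp add: lact_homogeneous[OF F(4)[OF homogeneous] assms(3)] act_closed) (simp add: algebra_simps)
next
 case (add x y)
 then show ?case using K.grade_carrier[OF assms(3)] hhD(2)[OF assms(1)]
  by (simp add: S.P.lact_add_right addmap_add[OF hhD(1)[OF assms(1)]] lact_add_right M.ksign_add)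
qed

lemma hh_word_eq:
 assumes "hh f F" "hh f G" "!!w. w : hwords gg ==> F (sp w) = G (sp w)" "s el S"
 shows "F s = G s" by (rule S.addmap_word_eq[OF hhD(1)[OF assms(1)] hhD(1)[OF assms(2)] assms(4)])
  (simp add: hhD(3)[OF assms(1)] hhD(3)[OF assms(2)] assms(3))

text \<open>That the symmetrised brackets depend only on the product in S(gg), and not on the word,
  is obtained by construction: start with a times the counit and take the convolution bracket with
  the degree-one projection repeatedly.\<close>

lemma adw_map_exists:
 assumes "a : grade gg p"
 shows "EX F. hh p F & (ALL w:hwords gg. F (sp w) = adw p a n w)"
proof -
 from low_degrees obtain e x where e: "addmap S K e" and x: "addmap S gg x"
  and act: "!!s ka. [|s el S; ka el K|] ==> e (act S s ka) = e s \<otimes>\<^sub>K ka"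
   "!!s ka. [|s el S; ka el K|] ==> x (act S s ka) = act gg (x s) ka"
  and w: "!!w. w : hwords gg ==> e (sp w) = (if w = [] then \<one>\<^sub>K else \<zero>\<^sub>K)"
   "!!w. w : hwords gg ==> x (sp w) = xw w" unfolding xw_def by blast
 note ec = addmap_closed[OF e] and xc = addmap_closed[OF x]
 have a: "a el gg" using assms by auto
 show ?thesis
 proof (induction n)
  case 0
  have "hh p (%s. act gg a (e s))"
  proof (rule hhI)
   show "addmap S gg (%s. act gg a (e s))" by (rule addmap_compose[OF e addmap_act_scalar[OF a]])
  qed (use assms a w(1) act(1) ec in \<open>auto simp: act_act act_one\<close>)
  then show ?case using w(1) a by (intro exI[of _ "%s. act gg a (e s)"]) (auto simp: act_one const_def)
 next
  case (Suc n)
  then obtain F where F: "hh p F" "!!w. w : hwords gg ==> F (sp w) = adw p a n w" by blast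
  note Fc = hhD(2)[OF F(1)]
  let ?b = "%v u. bracket gg (x v) (F u)"
  have tb: "CG.tb p ?b" unfolding CG.tb_def
  proof (intro conjI ballI allI)
   fix u assume "u el S"
   then show "addmap S gg (%v. ?b v u)" by (intro addmap_compose[OF x addmap_bracket_l] Fc)
  next
   fix v assume "v el S"
   then show "addmap S gg (%u. ?b v u)" by (intro addmap_compose[OF hhD(1)[OF F(1)] addmap_bracket_r] xc)
  next
   fix v u r ka assume h: "v el S" "u el S" "ka : grade K r"
   then have al: "ka el K" by auto
   show "?b (act S v ka) u = ksign gg (p * r) (?b v (lact K S ka u))" using h al xc[OF h(1)] Fc[OF h(2)]
    by (simp add: act(2) bracket_balanced hh_lact[OF F(1)] bracket_ksign bracket_closed)
  next
   fix v u ka assume "v el S" "u el S" "ka el K"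
   then show "?b v (act S u ka) = act gg (?b v u) ka"
    using xc Fc by (simp add: hhD(3)[OF F(1)] bracket_act)
  qed
  have word: "CG.conv p ?b (sp u) = adw p a (Suc n) u" if u: "u : hwords gg" for u
   unfolding CG.conv_word[OF tb u] adw.simps br_def by (rule splitw_cong[OF _ u]) (simp add: w(2) F(2))
  have "hh p (CG.conv p ?b)"
  proof (rule hhI[OF CG.addmap_conv[OF tb]])
   fix s ka assume "s el S" "ka el K"
   then show "CG.conv p ?b (act S s ka) = act gg (CG.conv p ?b s) ka"
    using CG.conv_Hom[OF tb] by (simp add: Hom_def)
  next
   fix u assume u: "u : hwords gg"
   show "CG.conv p ?b (sp u) : grade gg (wpar u + p)"
    unfolding word[OF u] using wfD[OF wf_adw[OF assms] u, of "Suc n"] by (simp add: add.commute)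
  qed
  then show ?case using word by blast
 qed
qed

text \<open>The infinite series is locally finite: each element of S(gg) is a sum of words, and the
  n-th term vanishes on words of length different from n.\<close>

lemma phi_exists:
 assumes c: "!!n. K.rok (c n)" and a: "a : grade gg p"
 shows "EX F. hh p F & (ALL w:hwords gg. F (sp w) = phw c p a w)"
proof -
 have "ALL n. EX F. hh p F & (ALL w:hwords gg. F (sp w) = adw p a n w)"
  using adw_map_exists[OF a] by blast
 then obtain A where A: "!!n. hh p (A n)" "!!n w. w : hwords gg ==> A n (sp w) = adw p a n w"
  using choice[of "%n F. hh p F & (ALL w:hwords gg. F (sp w) = adw p a n w)"] by blast
 note Ac = hhD(2)[OF A(1)] and Aadd = addmap_add[OF hhD(1)[OF A(1)]] and Aact = hhD(3)[OF A(1)]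
 have fin: "EX n0. \<forall>n\<ge>n0. A n s = \<zero>\<^sub>gg" if "s el S" for s using that
 proof (induction rule: S.P_induct)
  case (word w ka)
  have "A n (act S (sp w) ka) = \<zero>\<^sub>gg" if "n \<ge> Suc (length w)" for n
   using word that adw_length[OF a word(1), of n] by (simp add: Aact A(2))
  then show ?case by blast
 next
  case (add x y)
  then obtain m n where mn: "\<forall>k\<ge>m. A k x = \<zero>\<^sub>gg" "\<forall>k\<ge>n. A k y = \<zero>\<^sub>gg" by blast
  then show ?case using add(1,2) by (intro exI[of _ "max m n"]) (simp add: Aadd)
 qed
 \<comment> \<open>The sum runs over the support, which makes \<open>F\<close> independent of a
   bound; for computations any sufficiently large bound may be substituted.\<close>
 define F where "F s = finsum gg (%n. rs (c n) (A n s)) {n. A n s \<noteq> \<zero>\<^sub>gg}" for s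
 have F: "F s = finsum gg (%n. rs (c n) (A n s)) {..<n0}"
  if "s el S" "\<forall>n\<ge>n0. A n s = \<zero>\<^sub>gg" for s n0
 proof -
  have "{n. A n s \<noteq> \<zero>\<^sub>gg} \<subseteq> {..<n0}" using that(2) not_less by blast
  then show ?thesis unfolding F_def by (intro M.add.finprod_mono_neutral_cong_left) (use that c Ac in auto)
 qed
 have word: "F (sp w) = phw c p a w" if w: "w : hwords gg" for w
 proof -
  have z: "\<forall>k\<ge>Suc (length w). A k (sp w) = \<zero>\<^sub>gg"
   using adw_length[OF a w] by (simp add: A(2)[OF w])
  have "finsum gg (%n. rs (c n) (A n (sp w))) {..<Suc (length w)} = rs (c (length w)) (A (length w) (sp w))"
   by (rule finsum_single) (use w c Ac A(2)[OF w] adw_length[OF a w] wf_closed[OF wf_adw[OF a] w] in auto)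
  then show ?thesis using F[OF _ z] w by (simp add: phw_def A(2)[OF w])
 qed
 have "hh p F"
 proof (rule hhI)
  show "addmap S gg F"
  proof (rule addmapI)
   fix s assume s: "s el S"
   then show "F s el gg" unfolding F_def using c Ac by (intro M.finsum_closed) auto
   fix t assume t: "t el S"
   obtain m n where mn: "\<forall>k\<ge>m. A k s = \<zero>\<^sub>gg" "\<forall>k\<ge>n. A k t = \<zero>\<^sub>gg"
    using fin[OF s] fin[OF t] by blast
   let ?m = "max m n"
   have "F (s \<oplus>\<^sub>S t) = finsum gg (%n. rs (c n) (A n s) \<oplus>\<^sub>gg rs (c n) (A n t)) {..<?m}"
    using F[of "s \<oplus>\<^sub>S t" ?m] s t mn c Ac by (simp add: Aadd rs_add)
   also have "... = finsum gg (%n. rs (c n) (A n s)) {..<?m} \<oplus>\<^sub>gg finsum gg (%n. rs (c n) (A n t)) {..<?m}"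
    using s t c Ac by (intro M.finsum_addf) auto
   also have "... = F s \<oplus>\<^sub>gg F t" using F[OF s, of ?m] F[OF t, of ?m] mn by simp
   finally show "F (s \<oplus>\<^sub>S t) = F s \<oplus>\<^sub>gg F t" .
  qed
 next
  fix s ka assume s: "s el S" and al: "ka el K"
  obtain m where m: "\<forall>k\<ge>m. A k s = \<zero>\<^sub>gg" using fin[OF s] by blast
  have "F (act S s ka) = finsum gg (%n. rs (c n) (A n (act S s ka))) {..<m}"
   by (rule F) (use s al m in \<open>simp_all add: S.P.act_closed Aact\<close>)
  also have "... = finsum gg (%n. act gg (rs (c n) (A n s)) ka) {..<m}"
   by (rule M.finsum_cong') (use s al c Ac in \<open>auto simp: Aact rs_act act_closed\<close>)
  also have "... = act gg (finsum gg (%n. rs (c n) (A n s)) {..<m}) ka"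
   by (rule addmap_finsum[OF M.ag M.ag addmap_act[OF al], symmetric])
    (use s c Ac in auto)
  also have "... = act gg (F s) ka" using F[OF s m] by simp
  finally show "F (act S s ka) = act gg (F s) ka" .
 next
  fix w assume w: "w : hwords gg"
  from word[OF w] show "F (sp w) : grade gg (wpar w + p)" using wfD[OF wf_phw[OF c a] w] by (simp add: add.commute)
 qed
 then show ?thesis using word by blast
qed

end

context conv_target
begin

lemma conv_cong:
 assumes "tb g b" "tb g b'" "!!v u. [|v el S; u el S|] ==> b v u = b' v u" "s el S"
 shows "conv g b s = conv g b' s" unfolding conv_eq[OF assms(4)]
 by (rule SS.TP_addmap_eq[OF tlift_bil(1)[OF assms(1)] tlift_bil(1)[OF assms(2)] cop_closed[OF assms(4)]])
  (simp add: tlift_bil(2)[OF assms(1)] tlift_bil(2)[OF assms(2)] bil_def assms(3))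

lemma conv_add:
 assumes "tb g b" "tb g b'" "tb g (%v u. b v u \<oplus>\<^sub>N b' v u)" "s el S"
 shows "conv g (%v u. b v u \<oplus>\<^sub>N b' v u) s = conv g b s \<oplus>\<^sub>N conv g b' s"
 unfolding conv_eq[OF assms(4)]
proof (rule SS.TP_addmap_eq[OF tlift_bil(1)[OF assms(3)] _ cop_closed[OF assms(4)]])
 show "addmap SS N (%x. tlift (bil g b) x \<oplus>\<^sub>N tlift (bil g b') x)"
  using tlift_bil(1)[OF assms(1)] tlift_bil(1)[OF assms(2)]
  by (intro addmapI) (simp_all add: addmap_closed addmap_add N.M.add_4_swap)
 fix v u assume vu: "v el S" "u el S"
 show "tlift (bil g (%v u. b v u \<oplus>\<^sub>N b' v u)) (pt v u) =
   tlift (bil g b) (pt v u) \<oplus>\<^sub>N tlift (bil g b') (pt v u)"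
  unfolding tlift_bil(2)[OF assms(1) vu] tlift_bil(2)[OF assms(2) vu] tlift_bil(2)[OF assms(3) vu]
  using vu by (simp add: bil_def tbD(5)[OF assms(1)] tbD(5)[OF assms(2)] N.M.ksign_add N.M.add_4_swap)
qed

lemma conv_map:
 assumes "tb g b" "addmap N N h" "tb g (%v u. h (b v u))" "s el S"
 shows "conv g (%v u. h (b v u)) s = h (conv g b s)" unfolding conv_eq[OF assms(4)]
 by (rule SS.TP_addmap_eq[OF tlift_bil(1)[OF assms(3)] addmap_compose[OF tlift_bil(1)[OF assms(1)] assms(2)]
    cop_closed[OF assms(4)]])
  (simp add: tlift_bil(2)[OF assms(1)] tlift_bil(2)[OF assms(3)] bil_def tbD(5)[OF assms(1)]
   addmap_add[OF assms(2)] addmap_ksign[OF N.M.ag N.M.ag assms(2)])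

end

section \<open>The operators \<open>\<Phi>\<close> as convolutions\<close>

context half_lie
begin

text \<open>The definite description is resolved: \<open>adw_sym_ad\<close> shows that the power
  series in ad x, applied to the even and the odd part of a, have the prescribed values, and values
  on words determine a linear map.\<close>

lemma phi_map_eq:
 assumes a: "a el gg"
  and F0: "hh 0 F0" "!!w. w : hwords gg ==> F0 (sp w) = phw d 0 (hcomp gg 0 a) w"
  and F1: "hh 1 F1" "!!w. w : hwords gg ==> F1 (sp w) = phw d 1 (hcomp gg 1 a) w"
  and d: "!!n. K.rok (d n)" "!!n. phi_coeff K N c n = rat_in K (d n)"
 shows "phi_map K gg N c a = (\<lambda>s\<in>carrier S. F0 s \<oplus>\<^sub>gg F1 s)"
proof -
 let ?F = "\<lambda>s\<in>carrier S. F0 s \<oplus>\<^sub>gg F1 s"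
 let ?v = "%Xs ps. act gg (\<Oplus>\<^sub>gg q \<in> {0, 1}. ksign gg (q * sum_list ps) (sym_ad gg ps Xs (hcomp gg q a)))
  (phi_coeff K N c (length Xs))"
 have val: "?v (map snd w) (map fst w) = F0 (sp w) \<oplus>\<^sub>gg F1 (sp w)" if w: "w : hwords gg" for w
 proof -
  let ?n = "length w"
  have g: "hcomp gg q a : grade gg q" for q using a by simp
  have cl: "adw q (hcomp gg q a) ?n w el gg" for q by (rule wf_closed[OF wf_adw[OF g] w])
  have "(\<Oplus>\<^sub>gg q \<in> {0, 1}. ksign gg (q * sum_list (map fst w)) (sym_ad gg (map fst w) (map snd w) (hcomp gg q a))) =
    (\<Oplus>\<^sub>gg q \<in> {0, 1}. adw q (hcomp gg q a) ?n w)"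
  proof (rule M.finsum_cong'[OF refl])
   show "ksign gg (q * sum_list (map fst w)) (sym_ad gg (map fst w) (map snd w) (hcomp gg q a)) =
     adw q (hcomp gg q a) ?n w" for q using adw_sym_ad[OF w g refl, of q] by (simp add: wpar_def)
  qed (simp add: cl)
  also have "... = adw 0 (hcomp gg 0 a) ?n w \<oplus>\<^sub>gg adw 1 (hcomp gg 1 a) ?n w"
   using cl by simp
  finally show ?thesis using cl d(1) by (simp add: d(2) F0(2)[OF w] F1(2)[OF w] phw_def rs_def act_add_left)
 qed
 have F: "?F : Hom K S gg" unfolding Hom_def using hhD(2)[OF F0(1)] hhD(2)[OF F1(1)]
  by (auto simp: S.P.act_closed addmap_add[OF hhD(1)[OF F0(1)]] addmap_add[OF hhD(1)[OF F1(1)]]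
    hhD(3)[OF F0(1)] hhD(3)[OF F1(1)] M.add_4_swap act_add_left)
 show ?thesis unfolding phi_map_def
 proof (rule the_equality)
  show "?F : Hom K S gg & (ALL Xs ps. list_all2 (%X p. X : grade gg p) Xs ps \<longrightarrow> ?F (sym_prod K gg Xs) = ?v Xs ps)"
  proof (intro conjI F allI impI)
   fix Xs ps assume "list_all2 (%X p. X : grade gg p) Xs ps"
   then obtain w where w: "w : hwords gg" "Xs = map snd w" "ps = map fst w" unfolding list_all2_hwords by blast
   then show "?F (sym_prod K gg Xs) = ?v Xs ps" using val[OF w(1)] by simp
  qed
 next
  fix f assume f: "f : Hom K S gg &
   (ALL Xs ps. list_all2 (%X p. X : grade gg p) Xs ps \<longrightarrow> f (sym_prod K gg Xs) = ?v Xs ps)"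
  have fw: "f (sp w) = F0 (sp w) \<oplus>\<^sub>gg F1 (sp w)" if w: "w : hwords gg" for w
  proof -
   have "list_all2 (%X p. X : grade gg p) (map snd w) (map fst w)"
    unfolding list_all2_hwords using w by blast
   then show ?thesis using f val[OF w] by simp
  qed
  have add: "addmap S gg g" if "g : Hom K S gg" for g
   by (rule addmapI) (use that in \<open>auto simp: Hom_def\<close>)
  show "f = ?F"
  proof (rule extensionalityI[of _ "carrier S"])
   fix s assume s: "s el S"
   have af: "addmap S gg f" "addmap S gg ?F" using add f F by blast+
   show "f s = ?F s"
   proof (rule S.addmap_word_eq[OF af s])
    fix w ka assume "w : hwords gg" "ka el K"
    then have "f (act S (sp w) ka) = act gg (f (sp w)) ka" "?F (act S (sp w) ka) = act gg (?F (sp w)) ka"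
     using f F unfolding Hom_def by (blast intro: S.psp_hclosed)+
    then show "f (act S (sp w) ka) = ?F (act S (sp w) ka)"
     using fw \<open>w : hwords gg\<close> by simp
   qed
  qed (use f in \<open>auto simp: Hom_def PiE_def\<close>)
 qed
qed

text \<open>The operator D_F = Mult (id (x) F) \<Delta> on S(gg), to be viewed as a vector field
  with coefficient function F, its symbol.\<close>

definition dd where
 "dd f F = CS.conv f (%v u. v \<otimes>\<^sub>S inc (F u))"

lemma tb_dd:
 assumes "hh f F"
 shows "CS.tb f (%v u. v \<otimes>\<^sub>S inc (F u))" unfolding CS.tb_def
proof (intro conjI ballI allI)
 note Fc = hhD(2)[OF assms]
 {
  fix u assume "u el S"
  then show "addmap S S (%v. v \<otimes>\<^sub>S inc (F u))" by (intro S.P.addmap_mult_r S.pinc_closed Fc)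
 next
  fix v assume v: "v el S"
  show "addmap S S (%u. v \<otimes>\<^sub>S inc (F u))"
   by (rule addmap_compose[OF addmap_compose[OF hhD(1)[OF assms] S.addmap_pinc] S.P.addmap_mult_l[OF v]])
 next
  fix v u r ka assume h: "v el S" "u el S" "ka : grade K r"
  have al: "ka el K" using h by auto
  have "inc (F (lact K S ka u)) = ksign S (f * r) (inc (lact K gg ka (F u)))"
   using al Fc[OF h(2)] addmap_ksign[OF M.ag S.P.M.ag S.addmap_pinc]
   by (simp add: hh_lact[OF assms h(2,3)])
  then show "act S v ka \<otimes>\<^sub>S inc (F u) = ksign S (f * r) (v \<otimes>\<^sub>S inc (F (lact K S ka u)))"
   using h al Fc[OF h(2)] by (simp add: S.P.act_mult S.pinc_lact S.P.A.ring_ksign_r)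
 next
  fix v u ka assume "v el S" "u el S" "ka el K"
  then show "v \<otimes>\<^sub>S inc (F (act S u ka)) = act S (v \<otimes>\<^sub>S inc (F u)) ka"
   using Fc by (simp add: hhD(3)[OF assms] S.pinc_act S.P.mult_act)
 }
qed

lemma Mult_S:
 "Mult K S : Hom K SS S" "[|v el S; w el S|] ==> Mult K S (pt v w) = v \<otimes>\<^sub>S w"
proof -
 let ?P = "%H. H : Hom K SS S & (ALL v:carrier S. ALL w:carrier S. H (pt v w) = v \<otimes>\<^sub>S w)"
 have "EX h. addmap SS S h & (ALL a:carrier S. ALL b:carrier S. h (pt a b) = a \<otimes>\<^sub>S b)"
  by (rule SS.TP_universal[OF S.P.M.ag S.P.addmap_mult_r S.P.addmap_mult_l S.P.act_mult])
 then obtain h where h: "addmap SS S h" "!!v w. [|v el S; w el S|] ==> h (pt v w) = v \<otimes>\<^sub>S w"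
  by blast
 have act: "h (act SS x ka) = act S (h x) ka" if "x el SS" "ka el K" for x ka
  using that
 proof (induction rule: SS.TP_induct)
  case (pure a b)
  then show ?case by (simp add: SS.act_pt h(2) S.P.act_closed S.P.mult_act)
 next
  case (add x y)
  then show ?case using addmap_closed[OF SS.addmap_act_TP] addmap_closed[OF h(1)]
   by (simp add: addmap_add[OF SS.addmap_act_TP] addmap_add[OF h(1)] S.P.act_add_left)
 qed
 have "\<exists>!H. ?P H"
 proof (rule ex1I[of _ "restrict h (carrier SS)"])
  show "?P (restrict h (carrier SS))" using addmap_closed[OF h(1)] addmap_closed[OF SS.addmap_act_TP] act h(2)
   by (auto simp: Hom_def addmap_add[OF h(1)])
  fix H assume H: "?P H"
  have HH: "addmap SS S H" by (rule addmapI) (use H in \<open>auto simp: Hom_def\<close>)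
  show "H = restrict h (carrier SS)"
  proof (rule extensionalityI[of _ "carrier SS"])
   fix x assume "x el SS"
   then show "H x = restrict h (carrier SS) x" using SS.TP_addmap_eq[OF HH h(1)] H h(2) by simp
  qed (use H in \<open>auto simp: Hom_def PiE_def\<close>)
 qed
 then have "?P (Mult K S)" unfolding Mult_def by (rule theI')
 then show "Mult K S : Hom K SS S" "[|v el S; w el S|] ==> Mult K S (pt v w) = v \<otimes>\<^sub>S w"
  by blast+
qed

context
 fixes F0 F1 \<phi>
 assumes F0: "hh 0 F0" and F1: "hh 1 F1" and \<phi>: "\<phi> = (\<lambda>s\<in>carrier S. F0 s \<oplus>\<^sub>gg F1 s)"
begin

definition "Fc p = (if p = (0::bit) then F0 else F1)"

lemma hh_Fc: "hh p (Fc p)" by (cases p) (simp_all add: Fc_def F0 F1)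

lemmas Fc_closed = hhD(2)[OF hh_Fc]

lemma addmap_inc_Fc: "addmap S S (%w. inc (Fc p w))" by (rule addmap_compose[OF hhD(1)[OF hh_Fc] S.addmap_pinc])

lemma hom_comp_phi:
 assumes "w el S"
 shows "hom_comp S S p (compose (carrier S) inc \<phi>) w = inc (Fc p w)"
proof -
 have t: "hcomp S (p + q) (compose (carrier S) inc \<phi> (hcomp S q w)) = inc (Fc p (hcomp S q w))" for q
 proof -
  have c: "hcomp S q w el S" "hcomp S q w : grade S q" using assms by auto
  have g: "inc (Fc r (hcomp S q w)) : grade S (q + r)" for r by (rule S.pinc_grade[OF hhD(4)[OF hh_Fc c(2)]])
  have "compose (carrier S) inc \<phi> (hcomp S q w) = inc (Fc 0 (hcomp S q w)) \<oplus>\<^sub>S inc (Fc 1 (hcomp S q w))"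
   using c(1) hhD(2)[OF F0 c(1)] hhD(2)[OF F1 c(1)] by (simp add: compose_def \<phi> Fc_def S.pinc_add)
  then show ?thesis using Fc_closed[OF c(1)] S.P.M.hcomp_homogeneous[OF g[of 0]] S.P.M.hcomp_homogeneous[OF g[of 1]]
   by (cases p; cases q) (simp_all add: S.P.M.hcomp_add)
 qed
 have "hom_comp S S p (compose (carrier S) inc \<phi>) w = inc (Fc p (hcomp S 0 w)) \<oplus>\<^sub>S inc (Fc p (hcomp S 1 w))"
  using assms Fc_closed t[of 0] t[of 1] by (simp add: hom_comp_def)
 also have "... = inc (Fc p (hcomp S 0 w \<oplus>\<^sub>S hcomp S 1 w))"
  using assms by (simp add: addmap_add[OF addmap_inc_Fc])
 finally show ?thesis using assms by (simp add: S.P.M.hcomp_sum)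
qed

text \<open>The value of id (x) \<phi> on v (x) w, for \<phi> with both an even and an odd part.
  Only the odd part acquires a sign from v.\<close>

definition "LF v w = koszul_sum SS (%p q. pt (hcomp S q v) (inc (Fc p w)))"

lemma LF_eq:
 assumes "v el S" "w el S"
 shows "LF v w = (pt (hcomp S 0 v) (inc (Fc 0 w)) \<oplus>\<^sub>SS pt (hcomp S 1 v) (inc (Fc 0 w))) \<oplus>\<^sub>SS
  (pt (hcomp S 0 v) (inc (Fc 1 w)) \<oplus>\<^sub>SS \<ominus>\<^sub>SS pt (hcomp S 1 v) (inc (Fc 1 w)))"
 unfolding LF_def using assms Fc_closed[OF assms(2)]
 by (intro SS.TPG.koszul_sum_eq[of "%p q. pt (hcomp S q v) (inc (Fc p w))"]) auto

lemma LF_closed: "[|v el S; w el S|] ==> LF v w el SS"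
 using Fc_closed by (simp add: LF_eq)

lemma LF_homogeneous:
 assumes "v : grade S q" "w el S"
 shows "LF v w = pt v (inc (Fc 0 w)) \<oplus>\<^sub>SS ksign SS q (pt v (inc (Fc 1 w)))"
proof -
 have "v el S" using assms by auto
 then show ?thesis using assms(2) Fc_closed[OF assms(2)]
  by (cases q) (simp_all add: LF_eq S.P.M.hcomp_homogeneous[OF assms(1)] SS.pt_zero SS.TPG.ksign_1)
qed

lemma addmap_LF_l: "w el S ==> addmap S SS (%v. LF v w)"
proof (rule addmapI)
 fix x y assume "w el S" "x el S" "y el S"
 then show "LF (x \<oplus>\<^sub>S y) w = LF x w \<oplus>\<^sub>SS LF y w"
  unfolding LF_def using Fc_closed by (subst SS.TPG.koszul_sum_add[symmetric]) (auto simp: S.P.M.hcomp_add SS.pt_add_l)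
qed (simp add: LF_closed)

lemma addmap_LF_r: "v el S ==> addmap S SS (%w. LF v w)"
proof (rule addmapI)
 fix x y assume "v el S" "x el S" "y el S"
 then show "LF v (x \<oplus>\<^sub>S y) = LF v x \<oplus>\<^sub>SS LF v y"
  unfolding LF_def using Fc_closed
  by (subst SS.TPG.koszul_sum_add[symmetric]) (auto simp: addmap_add[OF addmap_inc_Fc] SS.pt_add_r)
qed (simp add: LF_closed)

lemma inc_Fc_lact:
 assumes "w el S" "ka : grade K r"
 shows "inc (Fc p (lact K S ka w)) = ksign S (p * r) (lact K S ka (inc (Fc p w)))"
 using K.grade_carrier[OF assms(2)] Fc_closed[OF assms(1)]
  addmap_ksign[OF M.ag S.P.M.ag S.addmap_pinc]
 by (simp add: hh_lact[OF hh_Fc assms] S.pinc_lact)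

lemma LF_balanced:
 assumes "v el S" "w el S" "ka el K"
 shows "LF (act S v ka) w = LF v (lact K S ka w)" using assms(3)
proof (induction rule: K.grade_induct)
 case al: (homogeneous r ka)
 show ?case using assms(1)
 proof (induction rule: S.P.M.grade_induct)
  case (homogeneous q v)
  have c: "v el S" "ka el K" using homogeneous al by auto
  then show ?case using assms(2) Fc_closed[OF assms(2)]
   by (simp add: LF_homogeneous[OF S.P.grade_act[OF homogeneous al] assms(2)] LF_homogeneous[OF homogeneous]
     inc_Fc_lact[OF assms(2) al] SS.pt_balanced SS.pt_ksign_r)
 next
  case (add x y)
  then show ?case using assms(2) K.grade_carrier[OF al]
   by (simp add: S.P.act_add_left addmap_add[OF addmap_LF_l] S.P.act_closed)
 qed
next
 case (add x y)
 then show ?case using assms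
  by (simp add: S.P.act_add_right S.P.lact_add_left addmap_add[OF addmap_LF_l] addmap_add[OF addmap_LF_r] S.P.act_closed)
qed

lemma LF_act:
 assumes "v el S" "w el S" "ka el K"
 shows "LF v (act S w ka) = act SS (LF v w) ka" using assms(1)
proof (induction rule: S.P.M.grade_induct)
 case (homogeneous q v)
 have e: "inc (Fc p (act S w ka)) = act S (inc (Fc p w)) ka" for p
  using assms Fc_closed by (simp add: hhD(3)[OF hh_Fc] S.pinc_act)
 have c: "v el S" using homogeneous by auto
 then show ?case using assms Fc_closed S.P.act_closed e
  by (simp add: LF_homogeneous[OF homogeneous] addmap_add[OF SS.addmap_act_TP] SS.act_pt
    addmap_ksign[OF SS.abelian_group_TP SS.abelian_group_TP SS.addmap_act_TP])
next
 case (add x y)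
 then show ?case using assms
  by (simp add: addmap_add[OF addmap_LF_l] S.P.act_closed addmap_add[OF SS.addmap_act_TP] LF_closed)
qed

lemma tensor_map_phi:
 defines "H \<equiv> tensor_map K S S (\<lambda>x\<in>carrier S. x) (compose (carrier S) inc \<phi>)"
 shows "addmap SS SS H" "[|v el S; w el S|] ==> H (pt v w) = LF v w"
proof -
 let ?v = "%v w. koszul_sum SS (%p q. pt ((\<lambda>x\<in>carrier S. x) (hcomp S q v))
  (hom_comp S S p (compose (carrier S) inc \<phi>) w))"
 let ?P = "%H. H : Hom K SS SS & (ALL v:carrier S. ALL w:carrier S. H (pt v w) = ?v v w)"
 have v: "?v v w = LF v w" if "v el S" "w el S" for v w using that by (simp add: LF_def hom_comp_phi)
 have "EX h. addmap SS SS h & (ALL a:carrier S. ALL b:carrier S. h (pt a b) = LF a b)"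
  by (rule SS.TP_universal[OF SS.abelian_group_TP addmap_LF_l addmap_LF_r LF_balanced])
 then obtain h where h: "addmap SS SS h" "!!v w. [|v el S; w el S|] ==> h (pt v w) = LF v w"
  by blast
 have act: "h (act SS x ka) = act SS (h x) ka" if "x el SS" "ka el K" for x ka
  using that
 proof (induction rule: SS.TP_induct)
  case (pure a b)
  then show ?case by (simp add: SS.act_pt h(2) S.P.act_closed LF_act)
 next
  case (add x y)
  then show ?case using addmap_closed[OF SS.addmap_act_TP] addmap_closed[OF h(1)]
   by (simp add: addmap_add[OF SS.addmap_act_TP] addmap_add[OF h(1)])
 qed
 have "\<exists>!H. ?P H"
 proof (rule ex1I[of _ "restrict h (carrier SS)"])
  show "?P (restrict h (carrier SS))" using addmap_closed[OF h(1)] addmap_closed[OF SS.addmap_act_TP] act h(2) v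
   by (auto simp: Hom_def addmap_add[OF h(1)])
  fix H assume H: "?P H"
  have HH: "addmap SS SS H" by (rule addmapI) (use H in \<open>auto simp: Hom_def\<close>)
  show "H = restrict h (carrier SS)"
  proof (rule extensionalityI[of _ "carrier SS"])
   fix x assume "x el SS"
   then show "H x = restrict h (carrier SS) x" using SS.TP_addmap_eq[OF HH h(1)] H h(2) v by simp
  qed (use H in \<open>auto simp: Hom_def PiE_def\<close>)
 qed
 then have P: "?P H" unfolding H_def tensor_map_def by (rule theI')
 show "addmap SS SS H" by (rule addmapI) (use P in \<open>auto simp: Hom_def\<close>)
 show "[|v el S; w el S|] ==> H (pt v w) = LF v w" using P v by simp
qed

lemma Mult_tensor_map_phi:
 assumes "s el S"
 shows "Mult K S (tensor_map K S S (\<lambda>x\<in>carrier S. x) (compose (carrier S) inc \<phi>) (cop s)) =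
  dd 0 F0 s \<oplus>\<^sub>S dd 1 F1 s"
proof -
 let ?H = "tensor_map K S S (\<lambda>x\<in>carrier S. x) (compose (carrier S) inc \<phi>)"
 note H = tensor_map_phi and b0 = tb_dd[OF F0] and b1 = tb_dd[OF F1]
 have M: "addmap SS S (Mult K S)" by (rule addmapI) (use Mult_S(1) in \<open>auto simp: Hom_def\<close>)
 have z: "Fc 0 = F0" "Fc 1 = F1" by (simp_all add: Fc_def)
 have "Mult K S (?H x) = CS.tlift (CS.bil 0 (%v u. v \<otimes>\<^sub>S inc (F0 u))) x \<oplus>\<^sub>S
   CS.tlift (CS.bil 1 (%v u. v \<otimes>\<^sub>S inc (F1 u))) x" if "x el SS" for x
 proof (rule SS.TP_addmap_eq[OF addmap_compose[OF H(1) M] _ that])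
  show "addmap SS S (%x. CS.tlift (CS.bil 0 (%v u. v \<otimes>\<^sub>S inc (F0 u))) x \<oplus>\<^sub>S
    CS.tlift (CS.bil 1 (%v u. v \<otimes>\<^sub>S inc (F1 u))) x)"
   using CS.tlift_bil(1)[OF b0] CS.tlift_bil(1)[OF b1]
   by (intro addmapI) (simp_all add: addmap_closed addmap_add S.P.M.add_4_swap)
  fix v w assume vw: "v el S" "w el S"
  have c: "F0 w el gg" "F1 w el gg" using vw hhD(2) F0 F1 by auto
  show "Mult K S (?H (pt v w)) = CS.tlift (CS.bil 0 (%v u. v \<otimes>\<^sub>S inc (F0 u))) (pt v w) \<oplus>\<^sub>S
    CS.tlift (CS.bil 1 (%v u. v \<otimes>\<^sub>S inc (F1 u))) (pt v w)" using vw c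
   by (simp add: H(2) LF_eq z addmap_add[OF M] Mult_S(2) CS.tlift_bil(2)[OF b0] CS.tlift_bil(2)[OF b1]
     CS.bil_def S.P.M.ksign_1 addmap_minus[OF SS.abelian_group_TP S.P.M.ag M])
 qed
 then show ?thesis using assms by (simp add: dd_def CS.conv_eq)
qed

end

lemma Phi_op_eq:
 assumes "a el gg"
  and "hh 0 F0" "!!w. w : hwords gg ==> F0 (sp w) = phw d 0 (hcomp gg 0 a) w"
  and "hh 1 F1" "!!w. w : hwords gg ==> F1 (sp w) = phw d 1 (hcomp gg 1 a) w"
  and "!!n. K.rok (d n)" "!!n. phi_coeff K N c n = rat_in K (d n)"
  and "s el S"
 shows "Phi_op K gg N c a s = dd 0 F0 s \<oplus>\<^sub>S dd 1 F1 s"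
proof -
 have "phi_map K gg N c a = (\<lambda>s\<in>carrier S. F0 s \<oplus>\<^sub>gg F1 s)"
  by (rule phi_map_eq[OF assms(1-7)])
 from Mult_tensor_map_phi[OF assms(2,4) this assms(8)] show ?thesis
  using assms(8) by (simp add: Phi_op_def Let_def compose_def)
qed

lemma Phi_op_extensional: "Phi_op K gg N c a : extensional (carrier S)" by (simp add: Phi_op_def Let_def compose_def)

section \<open>Commutators of convolution operators\<close>

lemma dd_props:
 assumes "hh f F"
 shows "addmap S S (dd f F)" "s el S ==> dd f F s el S"
  "[|s el S; ka el K|] ==> dd f F (act S s ka) = act S (dd f F s) ka"
  "w : hwords gg ==> dd f F (sp w) = splitw S w f (%v u. sp v \<otimes>\<^sub>S inc (F (sp u)))"
  "s : grade S q ==> dd f F s : grade S (q + f)"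
  "dd f F \<one>\<^sub>S = inc (F \<one>\<^sub>S)"
proof -
 note tb = tb_dd[OF assms]
 show a: "addmap S S (dd f F)" unfolding dd_def by (rule CS.addmap_conv[OF tb])
 show "s el S ==> dd f F s el S" by (rule addmap_closed[OF a])
 show act: "dd f F (act S s ka) = act S (dd f F s) ka" if "s el S" "ka el K" for s ka
  using CS.conv_Hom[OF tb] that by (simp add: Hom_def dd_def)
 show w: "dd f F (sp w) = splitw S w f (%v u. sp v \<otimes>\<^sub>S inc (F (sp u)))" if "w : hwords gg" for w
  unfolding dd_def by (rule CS.conv_word[OF tb that])
 show "dd f F s : grade S (q + f)" if "s : grade S q"
 proof (rule CS.graded_of_words[OF a act _ that])
  fix w assume w': "w : hwords gg"
  show "dd f F (sp w) : grade S (wpar w + f)" unfolding w[OF w']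
  proof (rule S.P.M.splitw_grade[OF w'])
   fix v u assume "v : hwords gg" "u : hwords gg"
   then show "sp v \<otimes>\<^sub>S inc (F (sp u)) : grade S (wpar v + wpar u + f)"
    using S.P.grade_mult[OF S.psp_grade S.pinc_grade[OF hhD(4)[OF assms S.psp_grade]], of v u] by (simp add: add.assoc)
  qed
 qed
 show "dd f F \<one>\<^sub>S = inc (F \<one>\<^sub>S)"
  unfolding dd_def using CS.conv_one[OF tb] hhD(2)[OF assms] by simp
qed

lemma dd_cong: "[|hh f F; hh f G; !!s. s el S ==> F s = G s; s el S|] ==> dd f F s = dd f G s"
 unfolding dd_def by (rule CS.conv_cong[OF tb_dd tb_dd]) simp_all

lemma hh_add: "[|hh f F; hh f G|] ==> hh f (%s. F s \<oplus>\<^sub>gg G s)"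
 unfolding hh_def using addmap_closed[of S gg F] addmap_closed[of S gg G]
 by (auto intro!: addmapI simp: addmap_add M.add_4_swap act_add_left)

lemma hh_ksign: "hh f F ==> hh f (%s. ksign gg p (F s))" unfolding hh_def
 using addmap_closed[of S gg F] by (auto intro!: addmapI simp: addmap_add M.ksign_add act_ksign)

lemma dd_add: "[|hh f F; hh f G; s el S|] ==> dd f (%s. F s \<oplus>\<^sub>gg G s) s = dd f F s \<oplus>\<^sub>S dd f G s"
proof -
 assume h: "hh f F" "hh f G" and s: "s el S"
 have e: "v \<otimes>\<^sub>S inc (F u \<oplus>\<^sub>gg G u) = v \<otimes>\<^sub>S inc (F u) \<oplus>\<^sub>S v \<otimes>\<^sub>S inc (G u)"
  if "v el S" "u el S" for v u using that h by (simp add: S.pinc_add hhD(2) S.P.A.r_distr)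
 have tb: "CS.tb f (%v u. v \<otimes>\<^sub>S inc (F u) \<oplus>\<^sub>S v \<otimes>\<^sub>S inc (G u))"
  using tb_dd[OF hh_add[OF h]] e h unfolding CS.tb_def addmap_def Pi_def
  by (simp add: S.P.act_closed S.pinc_add S.P.A.r_distr hhD(2))
 show ?thesis unfolding dd_def
  using CS.conv_cong[OF tb_dd[OF hh_add[OF h]] tb e s] CS.conv_add[OF tb_dd[OF h(1)] tb_dd[OF h(2)] tb s] by simp
qed

lemma dd_ksign: "[|hh f F; s el S|] ==> dd f (%s. ksign gg p (F s)) s = ksign S p (dd f F s)"
proof -
 assume h: "hh f F" and s: "s el S"
 have e: "v \<otimes>\<^sub>S inc (ksign gg p (F u)) = ksign S p (v \<otimes>\<^sub>S inc (F u))"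
  if "v el S" "u el S" for v u
  using that hhD(2)[OF h] addmap_ksign[OF M.ag S.P.M.ag S.addmap_pinc]
  by (simp add: S.P.A.ring_ksign_r)
 have a: "addmap S S (ksign S p)" by (rule addmapI) (simp_all add: S.P.M.ksign_add)
 have tb: "CS.tb f (%v u. ksign S p (v \<otimes>\<^sub>S inc (F u)))"
  using tb_dd[OF hh_ksign[OF h, of p]] e unfolding CS.tb_def addmap_def Pi_def by (simp add: S.P.act_closed)
 show ?thesis unfolding dd_def
  using CS.conv_cong[OF tb_dd[OF hh_ksign[OF h, of p]] tb e s] CS.conv_map[OF tb_dd[OF h] a tb s] by simp
qed

lemma hh_shift:
 assumes "hh f F" "X : grade gg z"
 shows "hh (f + z) (%s. F (inc X \<otimes>\<^sub>S s))"
proof -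
 have X: "X el gg" "inc X : grade S z" "inc X el S" using assms(2) S.pinc_grade by auto
 show ?thesis unfolding hh_def
 proof (intro conjI ballI allI)
  show "addmap S gg (%s. F (inc X \<otimes>\<^sub>S s))"
   by (rule addmap_compose[OF S.P.addmap_mult_l[OF X(3)] hhD(1)[OF assms(1)]])
  show "F (inc X \<otimes>\<^sub>S act S s ka) = act gg (F (inc X \<otimes>\<^sub>S s)) ka" if "s el S" "ka el K" for s ka
   using that X hhD(3)[OF assms(1)] by (simp add: S.P.mult_act)
  show "F (inc X \<otimes>\<^sub>S s) : grade gg (q + (f + z))" if "s : grade S q" for s q
   using hhD(4)[OF assms(1) S.P.grade_mult[OF X(2) that]] by (simp add: ac_simps)
 qed
qed

lemma dd_Cons:
 assumes "hh f F" "X : grade gg z" "s el S"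
 shows "dd f F (inc X \<otimes>\<^sub>S s) =
  ksign S (f * z) (inc X \<otimes>\<^sub>S dd f F s) \<oplus>\<^sub>S dd (f + z) (%s. F (inc X \<otimes>\<^sub>S s)) s"
proof -
 have X: "inc X el S" using assms(2) S.pinc_grade by auto
 note tb = tb_dd[OF assms(1)]
 have e: "(inc X \<otimes>\<^sub>S v) \<otimes>\<^sub>S inc (F u) = inc X \<otimes>\<^sub>S (v \<otimes>\<^sub>S inc (F u))"
  if "v el S" "u el S" for v u using that X hhD(2)[OF assms(1)] by (simp add: S.P.A.m_assoc)
 have tb2: "CS.tb f (%v u. inc X \<otimes>\<^sub>S (v \<otimes>\<^sub>S inc (F u)))"
  using CS.tb_left[OF tb X] e unfolding CS.tb_def addmap_def Pi_def by (simp add: S.P.act_closed)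
 have "CS.conv f (%v u. (inc X \<otimes>\<^sub>S v) \<otimes>\<^sub>S inc (F u)) s = inc X \<otimes>\<^sub>S dd f F s"
  unfolding dd_def
  using CS.conv_cong[OF CS.tb_left[OF tb X] tb2 e assms(3)] CS.conv_map[OF tb S.P.addmap_mult_l[OF X] tb2 assms(3)] by simp
 then show ?thesis using CS.conv_Cons[OF tb assms(2,3)] by (simp add: dd_def)
qed

text \<open>The symbol of the supercommutator of D_F and D_G: F after D_G minus (-1)^(fg) times G
  after D_F, like the coefficient of a commutator of vector fields.\<close>

definition hc where
 "hc f F g G s = F (dd g G s) \<oplus>\<^sub>gg ksign gg (1 + f * g) (G (dd f F s))"

lemma hh_comp_dd:
 assumes "hh f F" "hh g G"
 shows "hh (f + g) (%s. F (dd g G s))" unfolding hh_def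
proof (intro conjI ballI allI)
 show "addmap S gg (%s. F (dd g G s))" by (rule addmap_compose[OF dd_props(1)[OF assms(2)] hhD(1)[OF assms(1)]])
 show "F (dd g G (act S s ka)) = act gg (F (dd g G s)) ka" if "s el S" "ka el K" for s ka
  using that by (simp add: dd_props[OF assms(2)] hhD(3)[OF assms(1)])
 show "F (dd g G s) : grade gg (q + (f + g))" if "s : grade S q" for s q
  using hhD(4)[OF assms(1) dd_props(5)[OF assms(2) that]] by (simp add: ac_simps)
qed

lemma hh_hc:
 assumes "hh f F" "hh g G"
 shows "hh (f + g) (hc f F g G)"
proof -
 have "hh (f + g) (%s. G (dd f F s))" using hh_comp_dd[OF assms(2,1)] by (simp add: add.commute)
 from hh_add[OF hh_comp_dd[OF assms] hh_ksign[OF this, of "1 + f * g"]] show ?thesis unfolding hc_def .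
qed

text \<open>Second-order terms cancel, so the supercommutator of two such operators is again one of
  them. For a word with first letter X, \<open>dd_Cons\<close> either keeps X outside or feeds it to
  F or G; each case is an instance of the hypothesis, possibly with a shifted symbol.\<close>

lemma dd_commutator_word:
 assumes "hh f F" "hh g G" "w : hwords gg"
 shows "dd f F (dd g G (sp w)) \<oplus>\<^sub>S ksign S (1 + f * g) (dd g G (dd f F (sp w))) = dd (f + g) (hc f F g G) (sp w)"
 using assms
proof (induction w arbitrary: f F g G)
 case Nil
 note D = dd_props[OF Nil(1)] dd_props[OF Nil(2)]
 have one: "\<one>\<^sub>S el S" by simp
 have c: "F \<one>\<^sub>S : grade gg f" "G \<one>\<^sub>S : grade gg g"
  using hhD(4)[OF Nil(1) S.P.one_even] hhD(4)[OF Nil(2) S.P.one_even] by simp_all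
 have cc: "F \<one>\<^sub>S el gg" "G \<one>\<^sub>S el gg" using c by auto
 have u: "dd f F (inc X) = ksign S (f * z) (inc X \<otimes>\<^sub>S inc (F \<one>\<^sub>S)) \<oplus>\<^sub>S inc (F (inc X))"
  if "hh f F" "X : grade gg z" for f F X z
 proof -
  have X: "inc X el S" using that S.pinc_grade by auto
  show ?thesis using dd_Cons[OF that one] X dd_props(6)[OF that(1)] dd_props(6)[OF hh_shift[OF that]] by simp
 qed
 define p1 p2 where "p1 = inc (G \<one>\<^sub>S) \<otimes>\<^sub>S inc (F \<one>\<^sub>S)" "p2 = inc (F \<one>\<^sub>S) \<otimes>\<^sub>S inc (G \<one>\<^sub>S)"
 define i1 i2 where "i1 = inc (F (inc (G \<one>\<^sub>S)))" "i2 = inc (G (inc (F \<one>\<^sub>S)))"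
 have pc: "p1 el S" "p2 el S" "i1 el S" "i2 el S"
  unfolding p1_p2_def i1_i2_def using cc hhD(2)[OF Nil(1)] hhD(2)[OF Nil(2)] by simp_all
 \<comment> \<open>The quadratic terms F(1) G(1) and G(1) F(1) agree up to the Koszul sign and
   cancel in the supercommutator.\<close>
 have s: "p1 = ksign S (g * f) p2" unfolding p1_p2_def by (rule sym_comm[OF c(2,1)])
 have "dd f F (dd g G \<one>\<^sub>S) = ksign S (f * g) p1 \<oplus>\<^sub>S i1" "dd g G (dd f F \<one>\<^sub>S) = ksign S (g * f) p2 \<oplus>\<^sub>S i2"
  using u[OF Nil(1) c(2)] u[OF Nil(2) c(1)] D(6,12) by (simp_all add: p1_p2_def i1_i2_def)
 moreover have "dd (f + g) (hc f F g G) \<one>\<^sub>S = i1 \<oplus>\<^sub>S ksign S (1 + f * g) i2"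
  using dd_props(6)[OF hh_hc[OF Nil(1,2)]] cc hhD(2)[OF Nil(1)] hhD(2)[OF Nil(2)] D(6,12)
   addmap_ksign[OF M.ag S.P.M.ag S.addmap_pinc]
  by (simp add: hc_def S.pinc_add i1_i2_def)
 moreover have "ksign S (f * g) p1 \<oplus>\<^sub>S i1 \<oplus>\<^sub>S ksign S (1 + f * g) (ksign S (g * f) p2 \<oplus>\<^sub>S i2) =
   i1 \<oplus>\<^sub>S ksign S (1 + f * g) i2"
 proof -
  have "ksign S (f * g) p1 = p2" using pc s by (simp add: mult.commute)
  moreover have "ksign S (1 + f * g) (ksign S (g * f) p2) = \<ominus>\<^sub>S p2"
   using pc by (simp add: mult.commute add.assoc S.P.M.ksign_1)
  ultimately show ?thesis using pc by (simp add: S.P.M.ksign_add S.P.M.a_ac S.P.M.r_neg1 S.P.M.r_neg2)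
 qed
 ultimately show ?case by simp
next
 case (Cons Z w)
 define X z where "X = snd Z" "z = fst Z"
 have X: "X : grade gg z" and w: "w : hwords gg" using Cons.prems(3) by (auto simp: X_z_def)
 have Xc: "X el gg" "inc X el S" using X S.pinc_grade by auto
 define s where "s = sp w"
 have s: "s el S" using w by (simp add: s_def)
 let ?FX = "%s. F (inc X \<otimes>\<^sub>S s)" and ?GX = "%s. G (inc X \<otimes>\<^sub>S s)"
 note F = Cons.prems(1) and G = Cons.prems(2)
 note FX = hh_shift[OF F X] and GX = hh_shift[OF G X]
 note DF = dd_props[OF F] and DG = dd_props[OF G] and DFX = dd_props[OF FX] and DGX = dd_props[OF GX]
 note kF = addmap_ksign[OF S.P.M.ag S.P.M.ag DF(1)]
  and kG = addmap_ksign[OF S.P.M.ag S.P.M.ag DG(1)]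
  and hF = addmap_ksign[OF S.P.M.ag M.ag hhD(1)[OF F]]
  and hG = addmap_ksign[OF S.P.M.ag M.ag hhD(1)[OF G]]
 define FG GF FXG GXF F_GX G_FX where d: "FG = dd f F (dd g G s)" "GF = dd g G (dd f F s)"
  "FXG = dd (f + z) ?FX (dd g G s)" "GXF = dd (g + z) ?GX (dd f F s)"
  "F_GX = dd f F (dd (g + z) ?GX s)" "G_FX = dd g G (dd (f + z) ?FX s)"
 have c: "FG el S" "GF el S" "FXG el S" "GXF el S" "F_GX el S" "G_FX el S"
  unfolding d using s DF(2) DG(2) DFX(2) DGX(2) by simp_all
 have A: "dd f F (dd g G (inc X \<otimes>\<^sub>S s)) =
   ksign S (g * z) (ksign S (f * z) (inc X \<otimes>\<^sub>S FG) \<oplus>\<^sub>S FXG) \<oplus>\<^sub>S F_GX"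
  using s Xc DG(2) DGX(2) dd_Cons[OF F X, of "dd g G s"] by (simp add: dd_Cons[OF G X] addmap_add[OF DF(1)] kF d)
 have B: "dd g G (dd f F (inc X \<otimes>\<^sub>S s)) =
   ksign S (f * z) (ksign S (g * z) (inc X \<otimes>\<^sub>S GF) \<oplus>\<^sub>S GXF) \<oplus>\<^sub>S G_FX"
  using s Xc DF(2) DFX(2) dd_Cons[OF G X, of "dd f F s"] by (simp add: dd_Cons[OF F X] addmap_add[OF DG(1)] kG d)
 have I1: "dd (f + g) (hc f F g G) s = FG \<oplus>\<^sub>S ksign S (1 + f * g) GF"
  using Cons.IH[OF F G w] by (simp add: d s_def)
 have I2: "dd (f + g + z) (hc (f + z) ?FX g G) s = FXG \<oplus>\<^sub>S ksign S (1 + (f + z) * g) G_FX"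
  using Cons.IH[OF FX G w] by (simp add: d s_def ac_simps)
 have I3: "dd (f + g + z) (hc f F (g + z) ?GX) s = F_GX \<oplus>\<^sub>S ksign S (1 + f * (g + z)) GXF"
  using Cons.IH[OF F GX w] by (simp add: d s_def ac_simps)
 have h2: "hh (f + g + z) (hc (f + z) ?FX g G)" and h3: "hh (f + g + z) (hc f F (g + z) ?GX)"
  using hh_hc[OF FX G] hh_hc[OF F GX] by (simp_all add: ac_simps)
 \<comment> \<open>Feeding X to the symbol of the commutator means feeding it to F or to G: the
   terms with X outside both are common to the two expansions.\<close>
 have H: "hc f F g G (inc X \<otimes>\<^sub>S t) =
   ksign gg (g * z) (hc (f + z) ?FX g G t) \<oplus>\<^sub>gg hc f F (g + z) ?GX t" if t: "t el S" for t
 proof -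
  define x1 x2 x3 x4 where x: "x1 = F (inc X \<otimes>\<^sub>S dd g G t)" "x2 = F (dd (g + z) ?GX t)"
   "x3 = G (inc X \<otimes>\<^sub>S dd f F t)" "x4 = G (dd (f + z) ?FX t)"
  have xc: "x1 el gg" "x2 el gg" "x3 el gg" "x4 el gg"
   unfolding x using t Xc DF(2) DG(2) DFX(2) DGX(2) hhD(2)[OF F] hhD(2)[OF G] by simp_all
  have 1: "F (dd g G (inc X \<otimes>\<^sub>S t)) = ksign gg (g * z) x1 \<oplus>\<^sub>gg x2"
   using t Xc DG(2) DGX(2) by (simp add: dd_Cons[OF G X] addmap_add[OF hhD(1)[OF F]] hF x)
  have 2: "G (dd f F (inc X \<otimes>\<^sub>S t)) = ksign gg (f * z) x3 \<oplus>\<^sub>gg x4"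
   using t Xc DF(2) DFX(2) by (simp add: dd_Cons[OF F X] addmap_add[OF hhD(1)[OF G]] hG x)
  show ?thesis unfolding hc_def 1 2 x[symmetric] using xc by (simp add: M.ksign_add) (simp add: algebra_simps M.a_ac)
 qed
 have "dd (f + g + z) (%t. hc f F g G (inc X \<otimes>\<^sub>S t)) s =
   dd (f + g + z) (%t. ksign gg (g * z) (hc (f + z) ?FX g G t) \<oplus>\<^sub>gg hc f F (g + z) ?GX t) s"
  by (rule dd_cong[OF hh_shift[OF hh_hc[OF F G] X] hh_add[OF hh_ksign[OF h2] h3] H s])
 also have "... = ksign S (g * z) (dd (f + g + z) (hc (f + z) ?FX g G) s) \<oplus>\<^sub>S dd (f + g + z) (hc f F (g + z) ?GX) s"
  using dd_add[OF hh_ksign[OF h2] h3 s] dd_ksign[OF h2 s] by simp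
 finally have R: "dd (f + g) (hc f F g G) (inc X \<otimes>\<^sub>S s) =
   ksign S ((f + g) * z) (inc X \<otimes>\<^sub>S (FG \<oplus>\<^sub>S ksign S (1 + f * g) GF)) \<oplus>\<^sub>S
   (ksign S (g * z) (FXG \<oplus>\<^sub>S ksign S (1 + (f + z) * g) G_FX) \<oplus>\<^sub>S (F_GX \<oplus>\<^sub>S ksign S (1 + f * (g + z)) GXF))"
  using dd_Cons[OF hh_hc[OF F G] X s] by (simp add: I1 I2 I3)
 define XFG XGF where xd: "XFG = inc X \<otimes>\<^sub>S FG" "XGF = inc X \<otimes>\<^sub>S GF"
 have xdc: "XFG el S" "XGF el S" unfolding xd using c Xc by simp_all
 have RR: "inc X \<otimes>\<^sub>S (FG \<oplus>\<^sub>S ksign S (1 + f * g) GF) = XFG \<oplus>\<^sub>S ksign S (1 + f * g) XGF"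
  using c Xc by (simp add: xd S.P.A.r_distr S.P.A.ring_ksign_r)
 have sp: "sp (Z # w) = inc X \<otimes>\<^sub>S s" by (simp add: s_def X_z_def)
 show ?case unfolding sp A B R RR xd[symmetric]
  using c xdc by (simp add: S.P.M.ksign_add) (simp add: algebra_simps S.P.M.a_ac)
qed

lemma sp_snoc: "v : hwords gg ==> Y el gg ==> sp (v @ [(p, Y)]) = sp v \<otimes>\<^sub>S inc Y"
 by (induction v) (auto simp: S.P.A.m_assoc)

text \<open>Under D_G a product becomes a sum of products in which G of the right half is a new last
  factor. Evaluating F on these is the definition of \<open>cmp\<close>.\<close>

lemma hh_cmp:
 assumes F: "hh f F" "!!w. w : hwords gg ==> F (sp w) = F' w"
  and G: "hh g G" "!!w. w : hwords gg ==> G (sp w) = G' w" and w: "w : hwords gg"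
 shows "F (dd g G (sp w)) = cmp w g F' G'"
proof -
 have Gc: "G (sp u) : grade gg (g + wpar u)" if "u : hwords gg" for u
  using hhD(4)[OF G(1) S.psp_grade[OF that]] by (simp add: add.commute)
 have "F (dd g G (sp w)) = splitw gg w g (%v u. F (sp v \<otimes>\<^sub>S inc (G (sp u))))"
  unfolding dd_props(4)[OF G(1) w]
  by (rule splitw_addmap[OF S.P.M.ag M.ag hhD(1)[OF F(1)] w, THEN conjunct2])
   (use M.grade_carrier[OF Gc] in auto)
 also have "... = cmp w g F' G'" unfolding cmp_def
 proof (rule splitw_cong[OF _ w])
  fix v u assume vu: "v : hwords gg" "u : hwords gg"
  have "sp v \<otimes>\<^sub>S inc (G (sp u)) = sp (v @ [(g + wpar u, G (sp u))])"
   using sp_snoc[OF vu(1)] Gc[OF vu(2)] by simp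
  then show "F (sp v \<otimes>\<^sub>S inc (G (sp u))) = F' (v @ [(g + wpar u, G' u)])"
   using F(2)[of "v @ [(g + wpar u, G (sp u))]"] vu Gc[OF vu(2)] G(2)[OF vu(2)] by simp
 qed
 finally show ?thesis .
qed

lemma dd_commutator:
 assumes F: "hh f F" "!!w. w : hwords gg ==> F (sp w) = F' w"
  and G: "hh g G" "!!w. w : hwords gg ==> G (sp w) = G' w"
  and H: "hh (f + g) H" "!!w. w : hwords gg ==>
   H (sp w) = cmp w g F' G' \<oplus>\<^sub>gg ksign gg (1 + f * g) (cmp w f G' F')"
  and s: "s el S"
 shows "dd f F (dd g G s) \<oplus>\<^sub>S ksign S (1 + f * g) (dd g G (dd f F s)) = dd (f + g) H s"
proof -
 note DF = dd_props[OF F(1)] and DG = dd_props[OF G(1)] and DH = dd_props[OF hh_hc[OF F(1) G(1)]]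
 have "hc f F g G (sp w) = H (sp w)" if w: "w : hwords gg" for w
  unfolding hc_def using hh_cmp[OF F G w] hh_cmp[OF G F w] H(2)[OF w] by simp
 then have e: "hc f F g G t = H t" if "t el S" for t using hh_word_eq[OF hh_hc[OF F(1) G(1)] H(1)] that by blast
 have "dd f F (dd g G s) \<oplus>\<^sub>S ksign S (1 + f * g) (dd g G (dd f F s)) = dd (f + g) (hc f F g G) s"
 proof (rule S.addmap_word_eq[OF _ DH(1) s])
  show "addmap S S (%s. dd f F (dd g G s) \<oplus>\<^sub>S ksign S (1 + f * g) (dd g G (dd f F s)))"
   by (rule addmapI) (simp_all add: DF(2) DG(2) addmap_add[OF DF(1)] addmap_add[OF DG(1)] S.P.M.ksign_add S.P.M.add_4_swap)
  fix w ka assume w: "w : hwords gg" and al: "ka el K"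
  show "dd f F (dd g G (act S (sp w) ka)) \<oplus>\<^sub>S ksign S (1 + f * g) (dd g G (dd f F (act S (sp w) ka))) =
    dd (f + g) (hc f F g G) (act S (sp w) ka)" using w al dd_commutator_word[OF F(1) G(1) w]
   by (simp add: DF(2,3) DG(2,3) DH(3) S.P.act_ksign[symmetric] S.P.act_add_left[symmetric])
 qed
 also have "... = dd (f + g) H s" by (rule dd_cong[OF hh_hc[OF F(1) G(1)] H(1) e s])
 finally show ?thesis .
qed

end

section \<open>Degrees in the tensor algebra and length filtrations\<close>

context half_supermodule
begin

definition "pr n = (SOME h. addmap T T h &
 (ALL u:lists (carrier M). ALL ka:carrier K. h (tw u ka) = (if length u = n then tw u ka else \<zero>\<^sub>T)))"

lemma pr:
 "addmap T T (pr n)"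
 "[|u : lists (carrier M); ka el K|] ==> pr n (tw u ka) = (if length u = n then tw u ka else \<zero>\<^sub>T)"
proof -
 have "EX h. addmap T T h &
  (ALL u:lists (carrier M). ALL ka:carrier K. h (tw u ka) = (if length u = n then tw u ka else \<zero>\<^sub>T))"
  by (rule T_addmap[OF T.M.ag])
   (auto simp: tw_add tw_add_scalar tw_balanced tw_last)
 from someI_ex[OF this] show "addmap T T (pr n)"
  "[|u : lists (carrier M); ka el K|] ==> pr n (tw u ka) = (if length u = n then tw u ka else \<zero>\<^sub>T)"
  unfolding pr_def by blast+
qed

lemma pr_closed [simp]: "t el T ==> pr n t el T" by (rule addmap_closed[OF pr(1)])

lemma pr_add: "[|s el T; t el T|] ==> pr n (s \<oplus>\<^sub>T t) = pr n s \<oplus>\<^sub>T pr n t"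
 by (rule addmap_add[OF pr(1)])

lemma pr_uminus: "t el T ==> pr n (\<ominus>\<^sub>T t) = \<ominus>\<^sub>T pr n t"
 by (rule addmap_minus[OF T.M.ag T.M.ag pr(1)])

lemma pr_zero [simp]: "pr n \<zero>\<^sub>T = \<zero>\<^sub>T"
 by (rule addmap_zero[OF T.M.ag T.M.ag pr(1)])

lemma tw_mult_length:
 assumes "u : lists (carrier M)" "v : lists (carrier M)" "ka el K" "kb el K"
 shows "EX x:lists (carrier M). EX kc:carrier K. length x = length u + length v & tw u ka \<otimes>\<^sub>T tw v kb = tw x kc"
proof (cases v)
 case Nil
 then show ?thesis using assms by (intro bexI[of _ u] bexI[of _ "ka \<otimes>\<^sub>K kb"]) (auto simp: tw_mult_Nil)
next
 case (Cons X v')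
 then show ?thesis
  using assms by (intro bexI[of _ "u @ lact K M ka X # v'"] bexI[of _ kb]) (auto simp: tw_mult_Cons)
qed

lemma pr_mult_l:
 assumes "t el T" "u : lists (carrier M)" "ka el K"
 shows "pr n (tw u ka \<otimes>\<^sub>T t) = (if length u \<le> n then tw u ka \<otimes>\<^sub>T pr (n - length u) t else \<zero>\<^sub>T)"
 using assms(1)
proof (induction rule: T_induct)
 case (word v kb)
 obtain x kc where x: "x : lists (carrier M)" "kc el K" "length x = length u + length v"
  "tw u ka \<otimes>\<^sub>T tw v kb = tw x kc"
  using tw_mult_length[OF assms(2) word(1) assms(3) word(2)] by auto
 show ?case unfolding x(4) pr(2)[OF x(1,2)] pr(2)[OF word] using x(3,4) assms(2,3) by auto
next
 case (add x y)
 then show ?case using assms(2,3) by (simp add: T.A.r_distr pr_add)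
qed

lemma pr_mult_r:
 assumes "t el T" "u : lists (carrier M)" "ka el K"
 shows "pr n (t \<otimes>\<^sub>T tw u ka) = (if length u \<le> n then pr (n - length u) t \<otimes>\<^sub>T tw u ka else \<zero>\<^sub>T)"
 using assms(1)
proof (induction rule: T_induct)
 case (word v kb)
 obtain x kc where x: "x : lists (carrier M)" "kc el K" "length x = length v + length u"
  "tw v kb \<otimes>\<^sub>T tw u ka = tw x kc"
  using tw_mult_length[OF word(1) assms(2) word(2) assms(3)] by auto
 show ?case unfolding x(4) pr(2)[OF x(1,2)] pr(2)[OF word] using x(3,4) assms(2,3) by auto
next
 case (add x y)
 then show ?case using assms(2,3) by (simp add: T.A.l_distr pr_add)
qed

end

section \<open>The filtration by word length\<close>

context presented
begin

text \<open>Sums of words with fewer than n letters. The strict inequality makes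
  \<open>filt 0\<close> zero, where the inductions on the filtration start; it is also the origin of
  m + n - 1 in \<open>filt_mult\<close>.\<close>

inductive_set filt :: "nat => ('k, 'm) tens set set" for n where
 word: "[|w : hwords M; ka el K; length w < n|] ==> act P (psp (map snd w)) ka : filt n"
| zero: "\<zero>\<^sub>P : filt n"
| add: "[|x : filt n; y : filt n|] ==> x \<oplus>\<^sub>P y : filt n"

lemma filt_carrier: "x : filt n ==> x el P"
 by (induction rule: filt.induct) (auto simp: P.act_closed)

lemma filt_mono: "[|x : filt m; m \<le> n|] ==> x : filt n"
 by (induction rule: filt.induct) (auto intro: filt.intros)

lemma filt_0: "x : filt 0 ==> x = \<zero>\<^sub>P" by (induction rule: filt.induct) auto

lemma filt_word: "[|w : hwords M; length w < n|] ==> psp (map snd w) : filt n"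
 using filt.word[of w "\<one>\<^sub>K" n] by (simp add: P.act_one)

lemma filt_act: "[|x : filt n; ka el K|] ==> act P x ka : filt n"
 by (induction rule: filt.induct)
  (auto simp: P.act_act P.act_add_left filt_carrier intro: filt.intros)

lemma filt_uminus: "x : filt n ==> \<ominus>\<^sub>P x : filt n"
proof -
 assume x: "x : filt n"
 have "act P x (\<ominus>\<^sub>K \<one>\<^sub>K) = \<ominus>\<^sub>P x"
  using P.act_ksign_right[of x "\<one>\<^sub>K" 1] filt_carrier[OF x] by (simp add: K.ksign_1 P.M.ksign_1 P.act_one)
 then show ?thesis using filt_act[OF x, of "\<ominus>\<^sub>K \<one>\<^sub>K"] by simp
qed

lemma filt_ksign: "x : filt n ==> ksign P p x : filt n" by (simp add: ksign_def filt_uminus)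

lemma filt_all: "x el P ==> EX n. x : filt n"
proof (induction rule: P_induct)
 case (word w ka)
 then show ?case using filt.word[of w ka "Suc (length w)"] by auto
next
 case (add x y)
 then obtain m n where "x : filt m" "y : filt n" by blast
 then have "x : filt (max m n)" "y : filt (max m n)" using filt_mono by auto
 then show ?case using filt.add by blast
qed

lemma psp_append: "[|v : hwords M; w : hwords M|] ==> psp (map snd (v @ w)) = psp (map snd v) \<otimes>\<^sub>P psp (map snd w)"
 by (induction v) (auto simp: P.A.m_assoc)

lemma filt_mult:
 assumes "x : filt m" "y : filt n"
 shows "x \<otimes>\<^sub>P y : filt (m + n - 1)" using assms(1)
proof (induction rule: filt.induct)
 case x: (word v ka)
 show ?case using assms(2)
 proof (induction rule: filt.induct)
  case y: (word w kb)
  show ?case using x(2)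
  proof (induction rule: K.grade_induct)
   case (homogeneous r ka)
   have al: "ka el K" using homogeneous by auto
   have vw: "psp (map snd v) el P" "psp (map snd w) el P" using x y by auto
   have "act P (psp (map snd v)) ka \<otimes>\<^sub>P act P (psp (map snd w)) kb =
     ksign P (r * wpar w) (act P (psp (map snd (v @ w))) (ka \<otimes>\<^sub>K kb))"
    using vw al y by (simp only: psp_append x(1) y(1))
     (simp add: P.act_mult P.act_closed P.lact_act P.lact_homogeneous[OF psp_grade[OF y(1)] homogeneous]
      P.act_ksign P.A.ring_ksign_r P.mult_act P.act_act)
   then show ?case
    using filt_ksign[OF filt.word[of "v @ w" "ka \<otimes>\<^sub>K kb" "m + n - 1"]] x y al by simp
  next
   case (add a b)
   then show ?case using x y by (simp add: P.act_add_right P.act_closed P.A.l_distr filt.add)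
  qed
 next
  case (add a b)
  then show ?case using x by (simp add: P.act_closed P.A.r_distr filt_carrier filt.add)
 qed (use x in \<open>simp add: P.act_closed filt.zero\<close>)
next
 case (add a b)
 then show ?case using assms(2) by (simp add: P.A.l_distr filt_carrier filt.add)
qed (use assms(2) filt_carrier filt.zero in auto)

lemma filt_pinc: "X : grade M p ==> pinc X : filt 2"
proof -
 assume X: "X : grade M p"
 then have "X el M" by auto
 then show ?thesis using filt_word[of "[(p, X)]" 2] X by simp
qed

lemma filt_mult_pinc: "[|X : grade M p; x : filt n|] ==> pinc X \<otimes>\<^sub>P x : filt (Suc n)"
 using filt_mult[OF filt_pinc, of X p x n] by simp

text \<open>Representatives in T(M) can be chosen without components in degree n or above. They make
  S(gg) and U(gg) comparable through their common cover.\<close>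

lemma filt_lift:
 assumes "x : filt n"
 shows "EX t:carrier T. I +>\<^sub>T t = x & (\<forall>m \<ge> n. pr m t = \<zero>\<^sub>T)"
 using assms
proof (induction rule: filt.induct)
 case (word w ka)
 then show ?case using M.hwords_lists[OF word(1)] by (intro bexI[of _ "tw (map snd w) ka"]) (auto simp: act_psp pr(2))
next
 case zero
 then show ?case by (intro bexI[of _ "\<zero>\<^sub>T"]) (auto simp: Iq.quo.cls_zero)
next
 case (add x y)
 then obtain s t where "s el T" "I +>\<^sub>T s = x" "\<forall>m\<ge>n. pr m s = \<zero>\<^sub>T"
  "t el T" "I +>\<^sub>T t = y" "\<forall>m\<ge>n. pr m t = \<zero>\<^sub>T" by blast
 then show ?case by (intro bexI[of _ "s \<oplus>\<^sub>T t"]) (auto simp: pr_add Iq.quo.cls_add[symmetric])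
qed

end

context half_lie
begin

text \<open>The defining relations of \<open>S(gg)\<close> hold in \<open>U(gg)\<close> up to shorter words.\<close>

definition "shortening = {t : carrier T. ALL n. env_ideal K gg +>\<^sub>T pr n t : U.filt n}"

lemma cls_U: "[|x el T; y el T|] ==>
  env_ideal K gg +>\<^sub>T (x \<otimes>\<^sub>T y) = (env_ideal K gg +>\<^sub>T x) \<otimes>\<^sub>U (env_ideal K gg +>\<^sub>T y)"
 by (simp add: U.Iq.cls_mult)

text \<open>Multiplication by a word w shifts tensor degrees by its length, and in U(gg) the word
  lies in \<open>filt (Suc (length w))\<close>. By \<open>filt_mult\<close> the two shifts
  agree.\<close>

lemma shortening_mult:
 assumes "t : shortening" "x el T"
 shows "x \<otimes>\<^sub>T t : shortening & t \<otimes>\<^sub>T x : shortening"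
 using assms(2)
proof (induction rule: T_hinduct)
 case (word w ka)
 have t: "t el T" "!!n. env_ideal K gg +>\<^sub>T pr n t : U.filt n"
  using assms(1) by (auto simp: shortening_def)
 have u: "map snd w : lists (carrier gg)" using M.hwords_lists[OF word(1)] .
 have c: "tw (map snd w) ka el T" using u word by simp
 have z: "env_ideal K gg +>\<^sub>T \<zero>\<^sub>T : U.filt n" for n
  using U.filt.zero by (simp add: U.Iq.quo.cls_zero)
 have w: "env_ideal K gg +>\<^sub>T tw (map snd w) ka : U.filt (Suc (length w))"
  using U.filt.word[OF word, of "Suc (length w)"] U.act_psp[OF u word(2)] by simp
 have "env_ideal K gg +>\<^sub>T pr n (tw (map snd w) ka \<otimes>\<^sub>T t) : U.filt n" for n
  unfolding pr_mult_l[OF t(1) u word(2)]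
  using z U.filt_mult[OF w t(2), of "n - length w"] t(1) c by (cases "length w \<le> n") (simp_all add: cls_U)
 moreover have "env_ideal K gg +>\<^sub>T pr n (t \<otimes>\<^sub>T tw (map snd w) ka) : U.filt n" for n
  unfolding pr_mult_r[OF t(1) u word(2)]
  using z U.filt_mult[OF t(2) w, of "n - length w"] t(1) c by (cases "length w \<le> n") (simp_all add: cls_U)
 ultimately show ?case using t(1) c by (simp add: shortening_def)
next
 case (add x y)
 have t: "t el T" using assms(1) by (simp add: shortening_def)
 have "a \<oplus>\<^sub>T b : shortening" if "a : shortening" "b : shortening" for a b
  using that U.filt.add by (auto simp: shortening_def pr_add U.Iq.quo.cls_add[symmetric])
 then show ?case using add t by (simp add: T.A.l_distr T.A.r_distr)
qed

lemma ideal_shortening: "ideal shortening T"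
proof (intro idealI T.A.ring_axioms)
 have "additive_subgroup shortening T"
 proof (rule T.M.additive_subgroupI')
  show "\<ominus>\<^sub>T x : shortening" if "x : shortening" for x
   using that U.filt_uminus by (auto simp: shortening_def pr_uminus U.Iq.quo.cls_uminus)
  show "x \<oplus>\<^sub>T y : shortening" if "x : shortening" "y : shortening" for x y
   using that U.filt.add by (auto simp: shortening_def pr_add U.Iq.quo.cls_add[symmetric])
 qed (auto simp: shortening_def U.Iq.quo.cls_zero U.filt.zero)
 then show "subgroup shortening (add_monoid T)" by (rule additive_subgroup.a_subgroup)
qed (use shortening_mult in auto)

lemma pr_tensor_inc_mult:
 assumes "v el gg" "w el gg"
 shows "pr n (tensor_inc K gg v \<otimes>\<^sub>T tensor_inc K gg w) =
  (if n = 2 then tensor_inc K gg v \<otimes>\<^sub>T tensor_inc K gg w else \<zero>\<^sub>T)"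
 using assms by (auto simp: tensor_inc_tw tw_mult_one pr(2))

text \<open>The property defines an ideal, so generators are enough. In U(gg) the generator for v
  and w becomes [v, w], and the square of an odd u becomes half of [u, u]: one letter in place of
  two.\<close>

lemma sym_ideal_shortening: "sym_ideal K gg \<subseteq> shortening" unfolding sym_ideal_eq
proof (rule T.A.genideal_minimal[OF ideal_shortening], rule subsetI)
 fix g assume "g : sym_gens"
 then show "g : shortening" unfolding sym_gens_def
 proof (elim UnE CollectE exE conjE)
  fix v w p q assume g: "g = tensor_inc K gg v \<otimes>\<^sub>T tensor_inc K gg w \<ominus>\<^sub>T
   ksign T (p * q) (tensor_inc K gg w \<otimes>\<^sub>T tensor_inc K gg v)" and vw: "v : grade gg p" "w : grade gg q"
  have c: "v el gg" "w el gg" "bracket gg v w el gg" using vw by (auto simp: bracket_closed)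
  have p: "pr n g = (if n = 2 then g else \<zero>\<^sub>T)" for n unfolding g using c pr_tensor_inc_mult
    addmap_ksign[OF T.M.ag T.M.ag pr(1)] by (simp add: T.M.minus_eq pr_add pr_uminus)
  have "env_ideal K gg +>\<^sub>T g = env_inc K gg (bracket gg v w)"
  proof -
   define y where "y = ksign U (p * q) (env_inc K gg w \<otimes>\<^sub>U env_inc K gg v)"
   have y: "y el U" using c by (simp add: y_def)
   have "env_ideal K gg +>\<^sub>T g = env_inc K gg v \<otimes>\<^sub>U env_inc K gg w \<oplus>\<^sub>U \<ominus>\<^sub>U y"
    unfolding g y_def using c
    by (simp add: T.M.minus_eq U.Iq.quo.cls_add[symmetric] U.Iq.quo.cls_uminus U.Iq.quo.cls_ksign cls_U env_inc_def)
   also have "... = (y \<oplus>\<^sub>U env_inc K gg (bracket gg v w)) \<oplus>\<^sub>U \<ominus>\<^sub>U y"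
    by (simp only: env_rel[OF vw] y_def)
   finally show ?thesis using y c U.pinc_closed[OF c(3)] by (simp add: U.P.M.a_ac U.P.M.r_neg1 U.P.M.r_neg2 U.P.M.r_neg)
  qed
  then show "g : shortening" using p c U.filt_pinc[OF grade_bracket[OF vw]] U.filt.zero
   by (auto simp: shortening_def U.Iq.quo.cls_zero) (simp add: g)
 next
  fix u assume g: "g = tensor_inc K gg u \<otimes>\<^sub>T tensor_inc K gg u" and u: "u : grade gg 1"
  have c: "u el gg" using u by auto
  define x where "x = env_inc K gg u \<otimes>\<^sub>U env_inc K gg u"
  define b where "b = env_inc K gg (bracket gg u u)"
  have xb: "x el U" "b el U" using c by (simp_all add: x_def b_def bracket_closed)
  have "x = ksign U 1 x \<oplus>\<^sub>U b" using env_rel[OF u u] by (simp add: x_def b_def)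
  then have "x \<oplus>\<^sub>U x = x \<oplus>\<^sub>U (\<ominus>\<^sub>U x \<oplus>\<^sub>U b)" by (simp add: U.P.M.ksign_1)
  then have xx: "x \<oplus>\<^sub>U x = b" using xb by (simp add: U.P.M.r_neg2)
  obtain h where h: "h el K" "(\<one>\<^sub>K \<oplus>\<^sub>K \<one>\<^sub>K) \<otimes>\<^sub>K h = \<one>\<^sub>K" by (rule half_obtain)
  have "x = act U (act U x (\<one>\<^sub>K \<oplus>\<^sub>K \<one>\<^sub>K)) h"
   using xb h by (simp add: U.P.act_act U.P.act_one)
  also have "... = act U b h" using xb h xx by (simp add: U.P.act_add_right U.P.act_one)
  finally have "x : U.filt 2" using U.filt_act[OF U.filt_pinc[OF grade_bracket[OF u u]] h(1)] by (simp add: b_def)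
  moreover have "env_ideal K gg +>\<^sub>T g = x" unfolding g x_def using c by (simp add: cls_U env_inc_def)
  ultimately show "g : shortening"
   using c U.filt.zero pr_tensor_inc_mult[OF c c] by (auto simp: shortening_def U.Iq.quo.cls_zero g)
 qed
qed

end

section \<open>The superalgebra of endomorphisms\<close>

context supermodule
begin

abbreviation "E \<equiv> End_alg K M"

lemma End_simps [simp]:
 "carrier E = Hom K M M" "f \<otimes>\<^sub>E g = compose (carrier M) f g" "\<one>\<^sub>E = (\<lambda>x\<in>carrier M. x)"
 "\<zero>\<^sub>E = (\<lambda>x\<in>carrier M. \<zero>\<^sub>M)" "f \<oplus>\<^sub>E g = (\<lambda>x\<in>carrier M. f x \<oplus>\<^sub>M g x)"
 "act E f ka = (\<lambda>x\<in>carrier M. f (lact K M ka x))"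
 "grade E p = {f : Hom K M M. ALL q. f ` grade M q \<subseteq> grade M (p + q)}" by (simp_all add: End_alg_def)

lemma HomD:
 assumes "f : Hom K M M"
 shows "addmap M M f" "x el M ==> f x el M"
  "[|x el M; ka el K|] ==> f (act M x ka) = act M (f x) ka" "x \<notin> carrier M ==> f x = undefined"
 using assms by (auto simp: Hom_def addmap_def)

lemma HomI:
 assumes "addmap M M f" "!!x ka. [|x el M; ka el K|] ==> f (act M x ka) = act M (f x) ka"
 shows "(\<lambda>x\<in>carrier M. f x) : Hom K M M" using assms by (auto simp: Hom_def addmap_def act_closed)

lemma End_eqI:
 "[|f : Hom K M M; g : Hom K M M; !!x. x el M ==> f x = g x|] ==> f = g"
 by (rule ext) (metis HomD(4))

lemma Hom_closed:
 "[|f : Hom K M M; g : Hom K M M|] ==> (\<lambda>x\<in>carrier M. f x \<oplus>\<^sub>M g x) : Hom K M M"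
 "[|f : Hom K M M; g : Hom K M M|] ==> compose (carrier M) f g : Hom K M M"
 "(\<lambda>x\<in>carrier M. x) : Hom K M M" "(\<lambda>x\<in>carrier M. \<zero>\<^sub>M) : Hom K M M"
 "f : Hom K M M ==> (\<lambda>x\<in>carrier M. \<ominus>\<^sub>M f x) : Hom K M M"
 "ka el K ==> (\<lambda>x\<in>carrier M. lact K M ka x) : Hom K M M"
proof -
 show "(\<lambda>x\<in>carrier M. f x \<oplus>\<^sub>M g x) : Hom K M M" if h: "f : Hom K M M" "g : Hom K M M"
  using HomD[OF h(1)] HomD[OF h(2)] by (intro HomI addmapI) (simp_all add: addmap_add M.add_4_swap act_add_left)
 show "compose (carrier M) f g : Hom K M M" if h: "f : Hom K M M" "g : Hom K M M"
  unfolding compose_def using HomD[OF h(1)] HomD[OF h(2)] by (intro HomI addmap_compose[of M M g M f]) simp_all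
 show "(\<lambda>x\<in>carrier M. \<ominus>\<^sub>M f x) : Hom K M M" if h: "f : Hom K M M"
  using HomD[OF h] addmap_minus[OF M.ag M.ag addmap_act]
  by (intro HomI addmapI) (simp_all add: addmap_add M.minus_add)
 show "(\<lambda>x\<in>carrier M. lact K M ka x) : Hom K M M" if "ka el K"
  using that by (intro HomI addmap_lact) (simp_all add: lact_act)
qed (auto intro!: HomI addmapI)

lemma ring_End: "ring E"
proof (rule ringI)
 show "abelian_group E"
 proof (rule abelian_groupI)
  fix f assume f: "f el E"
  show "EX g:carrier E. g \<oplus>\<^sub>E f = \<zero>\<^sub>E"
   by (rule bexI[of _ "\<lambda>x\<in>carrier M. \<ominus>\<^sub>M f x"])
    (use f HomD(2)[of f] Hom_closed(5) in \<open>auto simp: fun_eq_iff M.l_neg\<close>)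
  show "\<zero>\<^sub>E \<oplus>\<^sub>E f = f" using f HomD(2,4)[of f] by (auto simp: fun_eq_iff)
 next
  fix f g h assume "f el E" "g el E" "h el E"
  then show "f \<oplus>\<^sub>E g \<oplus>\<^sub>E h = f \<oplus>\<^sub>E (g \<oplus>\<^sub>E h)"
   using HomD(2)[of f] HomD(2)[of g] HomD(2)[of h] by (auto simp: fun_eq_iff M.a_assoc)
 next
  fix f g assume "f el E" "g el E"
  then show "f \<oplus>\<^sub>E g = g \<oplus>\<^sub>E f"
   using HomD(2)[of f] HomD(2)[of g] by (auto simp: fun_eq_iff M.a_comm)
 qed (simp_all add: Hom_closed)
 show "Group.monoid E"
 proof (rule monoidI)
  fix f g h assume "f el E" "g el E" "h el E"
  then show "f \<otimes>\<^sub>E g \<otimes>\<^sub>E h = f \<otimes>\<^sub>E (g \<otimes>\<^sub>E h)"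
   using HomD(2)[of h] by (auto simp: fun_eq_iff compose_def)
 next
  fix f assume "f el E"
  then show "\<one>\<^sub>E \<otimes>\<^sub>E f = f" "f \<otimes>\<^sub>E \<one>\<^sub>E = f"
   using HomD(2,4)[of f] by (auto simp: fun_eq_iff compose_def)
 qed (simp_all add: Hom_closed)
next
 fix f g h assume "f el E" "g el E" "h el E"
 then show "(f \<oplus>\<^sub>E g) \<otimes>\<^sub>E h = f \<otimes>\<^sub>E h \<oplus>\<^sub>E g \<otimes>\<^sub>E h" "h \<otimes>\<^sub>E (f \<oplus>\<^sub>E g) = h \<otimes>\<^sub>E f \<oplus>\<^sub>E h \<otimes>\<^sub>E g"
  using HomD(2)[of f] HomD(2)[of g] HomD(2)[of h] addmap_add[OF HomD(1)[of h]] by (auto simp: fun_eq_iff compose_def)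
qed

lemma End_ksign:
 assumes "f : Hom K M M" "x el M"
 shows "ksign E p f x = ksign M p (f x)"
proof -
 interpret E: ring E by (rule ring_End)
 have "\<ominus>\<^sub>E f = (\<lambda>x\<in>carrier M. \<ominus>\<^sub>M f x)"
  by (rule E.minus_equality)
   (use assms(1) HomD(2)[OF assms(1)] Hom_closed(5) in \<open>auto simp: fun_eq_iff M.l_neg\<close>)
 then show ?thesis using assms(2) by (simp add: ksign_def)
qed

end

section \<open>The operators attached to elements of the Lie superalgebra\<close>

context half_lie
begin

lemma adw_add:
 assumes "a : grade gg p" "b : grade gg p" "w : hwords gg"
 shows "adw p (a \<oplus>\<^sub>gg b) n w = adw p a n w \<oplus>\<^sub>gg adw p b n w"
 using assms(3)
proof (induction n arbitrary: w)
 case (Suc n)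
 have "br w p xw (adw p (a \<oplus>\<^sub>gg b) n) = br w p xw (%v. adw p a n v \<oplus>\<^sub>gg adw p b n v)"
  by (rule br_cong[OF refl Suc.IH Suc.prems])
 then show ?case using br_add_r[OF Suc.prems wf_xw wf_adw[OF assms(1)] wf_adw[OF assms(2)]] by simp
qed (use assms in \<open>auto simp: const_def\<close>)

lemma lact_ksign: "[|ka el K; x el gg|] ==> lact K gg ka (ksign gg p x) = ksign gg p (lact K gg ka x)"
 by (rule addmap_ksign[OF M.ag M.ag addmap_lact])

lemma bracket_lact:
 assumes "X : grade gg z" "Y el gg" "ka : grade K r"
 shows "bracket gg X (lact K gg ka Y) = ksign gg (r * z) (lact K gg ka (bracket gg X Y))"
 using assms(2)
proof (induction rule: M.grade_induct)
 case (homogeneous y Y)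
 have c: "X el gg" "Y el gg" "ka el K" using homogeneous assms by auto
 then show ?case
  by (simp add: lact_homogeneous[OF homogeneous assms(3)] lact_homogeneous[OF grade_bracket[OF assms(1) homogeneous] assms(3)]
    bracket_ksign bracket_act act_closed bracket_closed) (simp add: algebra_simps)
next
 case (add x y)
 have c: "X el gg" "ka el K" using assms by auto
 then show ?case using add by (simp add: lact_add_right bracket_add_right bracket_closed M.ksign_add)
qed

lemma adw_lact:
 assumes "a : grade gg p" "ka : grade K r" "w : hwords gg"
 shows "adw (r + p) (lact K gg ka a) n w = lact K gg ka (adw p a n w)"
proof -
 have al: "ka el K" using assms(2) by auto
 have wl: "wf (r + g) (%v. lact K gg ka (G v))" if "wf g G" for g G
  using lact_grade[OF wfD[OF that] assms(2)] by (simp add: wf_def add.assoc)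
 have br: "br w (r + g) xw (%v. lact K gg ka (G v)) = lact K gg ka (br w g xw G)"
  if "w : hwords gg" "wf g G" for w g G using that
 proof (induction w arbitrary: g G)
  case Nil
  then show ?case using al by (simp add: bracket_zero)
 next
  case (Cons Z w)
  then have Z: "snd Z : grade gg (fst Z)" "w : hwords gg" "snd Z el gg" by auto
  note G' = wf_shift[OF Cons.prems(2) Z(1)]
  have "br w (r + g + fst Z) xw (%v. lact K gg ka (G (Z # v))) = lact K gg ka (br w (g + fst Z) xw (%v. G (Z # v)))"
   using Cons.IH[OF Z(2) G'] by (simp add: add.assoc)
  then show ?case unfolding br_x_Cons[OF Cons.prems(1) wl[OF Cons.prems(2)]] br_x_Cons[OF Cons.prems]
   using al Z wf_closed[OF Cons.prems(2) Z(2)] br_closed[OF Z(2) wf_xw G']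
   by (simp add: bracket_lact[OF Z(1) _ assms(2)] lact_add_right lact_ksign bracket_closed) (simp add: algebra_simps)
 qed
 show ?thesis using assms(3)
 proof (induction n arbitrary: w)
  case 0
  then show ?case using al by (simp add: const_def)
 next
  case (Suc n)
  have "br w (r + p) xw (adw (r + p) (lact K gg ka a) n) = br w (r + p) xw (%v. lact K gg ka (adw p a n v))"
   by (rule br_cong[OF refl Suc.IH Suc.prems])
  then show ?case using br[OF Suc.prems wf_adw[OF assms(1)]] by simp
 qed
qed

definition "PF d p a = (SOME F. hh p F & (ALL w:hwords gg. F (sp w) = phw d p a w))"

lemma PF:
 assumes "!!n. K.rok (d n)" "a : grade gg p"
 shows "hh p (PF d p a)" "w : hwords gg ==> PF d p a (sp w) = phw d p a w"
 unfolding PF_def using someI_ex[OF phi_exists[of d a p, OF assms]] by blast+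

lemma dd_lact:
 assumes "hh f F" "s el S" "ka : grade K r"
 shows "dd f F (lact K S ka s) = ksign S (f * r) (lact K S ka (dd f F s))" using assms(2)
proof (induction rule: S.P.M.grade_induct)
 case (homogeneous q s)
 have c: "s el S" "ka el K" using homogeneous assms(3) by auto
 note D = dd_props[OF assms(1)]
 show ?case using c D(2) addmap_ksign[OF S.P.M.ag S.P.M.ag D(1)]
  by (simp add: S.P.lact_homogeneous[OF homogeneous assms(3)] S.P.act_closed D(3)
    S.P.lact_homogeneous[OF D(5)[OF homogeneous] assms(3)]) (simp add: algebra_simps)
next
 case (add x y)
 then show ?case using K.grade_carrier[OF assms(3)] dd_props(2)[OF assms(1)]
  by (simp add: S.P.lact_add_right addmap_add[OF dd_props(1)[OF assms(1)]] S.P.M.ksign_add)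
qed

lemma hh_lact_post:
 assumes "hh f F" "ka : grade K r"
 shows "hh (r + f) (%s. lact K gg ka (F s))" unfolding hh_def
proof (intro conjI ballI allI)
 note F = hhD[OF assms(1)] and al = K.grade_carrier[OF assms(2)]
 show "addmap S gg (%s. lact K gg ka (F s))" by (rule addmap_compose[OF F(1) addmap_lact[OF al]])
 show "lact K gg ka (F (act S s kb)) = act gg (lact K gg ka (F s)) kb" if "s el S" "kb el K" for s kb
  using that al F(2) by (simp add: F(3) lact_act)
 show "lact K gg ka (F s) : grade gg (q + (r + f))" if "s : grade S q" for s q
  using lact_grade[OF F(4)[OF that] assms(2)] by (simp add: add.left_commute)
qed

lemma dd_lact_post:
 assumes "hh f F" "ka : grade K r" "s el S"
 shows "dd (r + f) (%s. lact K gg ka (F s)) s = lact K S ka (dd f F s)"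
proof -
 have al: "ka el K" using assms(2) by auto
 have ml: "x \<otimes>\<^sub>S lact K S ka y = ksign S (r * z) (lact K S ka (x \<otimes>\<^sub>S y))"
  if x: "x : grade S z" and y: "y el S" for x y z
 proof -
  have "x el S" using x by auto
  then show ?thesis using y al S.P.M.ksign_closed
   by (simp add: S.P.act_mult[symmetric] S.P.lact_mult[symmetric] S.P.lact_homogeneous[OF x assms(2)]
     S.P.A.ring_ksign_l S.P.act_closed)
 qed
 have w: "dd (r + f) (%s. lact K gg ka (F s)) (sp w) = lact K S ka (dd f F (sp w))"
  if "hh f F" "w : hwords gg" for f F w using that
 proof (induction w arbitrary: f F)
  case Nil
  have "F \<one>\<^sub>S el gg" by (rule hhD(2)[OF Nil(1)]) simp
  then show ?case using dd_props(6)[OF hh_lact_post[OF Nil(1) assms(2)]] dd_props(6)[OF Nil(1)] al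
   by (simp add: S.pinc_lact)
 next
  case (Cons Z w)
  then have Z: "snd Z : grade gg (fst Z)" "w : hwords gg" by auto
  have s: "sp w el S" "inc (snd Z) : grade S (fst Z)" using Z S.pinc_grade by auto
  note F = Cons.prems(1) and FX = hh_shift[OF Cons.prems(1) Z(1)]
  have "inc (snd Z) \<otimes>\<^sub>S dd f F (sp w) el S" "dd (f + fst Z) (%s. F (inc (snd Z) \<otimes>\<^sub>S s)) (sp w) el S"
   using s dd_props(2)[OF F] dd_props(2)[OF FX] by auto
  then show ?case using Cons.IH[OF F Z(2)] Cons.IH[OF FX Z(2)] ml[OF s(2) dd_props(2)[OF F s(1)]] s al
    addmap_ksign[OF S.P.M.ag S.P.M.ag S.P.addmap_lact[OF al]]
   by (simp add: dd_Cons[OF F Z(1)] dd_Cons[OF hh_lact_post[OF F assms(2)] Z(1)] S.P.lact_add_right)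
    (simp add: algebra_simps)
 qed
 note D = dd_props[OF assms(1)] and D' = dd_props[OF hh_lact_post[OF assms(1,2)]]
 show ?thesis by (rule S.addmap_word_eq[OF D'(1) addmap_compose[OF D(1) S.P.addmap_lact[OF al]] assms(3)])
   (use w[OF assms(1)] al D(2) in \<open>simp add: D(3) D'(3) S.P.lact_act\<close>)
qed

text \<open>The operator \<Phi> with coefficients given by a rational sequence \<open>d\<close>.
  Splitting a into its even and odd part makes each summand a convolution operator with homogeneous
  symbol.\<close>

definition "Op d a s = dd 0 (PF d 0 (hcomp gg 0 a)) s \<oplus>\<^sub>S dd 1 (PF d 1 (hcomp gg 1 a)) s"

lemma Phi_op_Op:
 assumes "!!n. K.rok (d n)" "!!n. phi_coeff K N c n = rat_in K (d n)" "a el gg" "s el S"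
 shows "Phi_op K gg N c a s = Op d a s" unfolding Op_def
 by (rule Phi_op_eq[OF assms(3) PF PF assms(1,2,4)]) (use assms in auto)

context
 fixes d :: "nat => rat" assumes d: "!!n. K.rok (d n)"
begin

lemma dd_PF_eq:
 assumes "hh p G" "!!w. w : hwords gg ==> G (sp w) = phw d p a w" "a : grade gg p" "s el S"
 shows "dd p (PF d p a) s = dd p G s"
 by (rule dd_cong[OF PF(1)[of d, OF d assms(3)] assms(1) hh_word_eq[OF PF(1)[of d, OF d assms(3)] assms(1)] assms(4)])
  (simp_all add: PF(2)[of d, OF d assms(3)] assms(2))

lemma dd_PF_add:
 assumes "a : grade gg p" "b : grade gg p" "s el S"
 shows "dd p (PF d p (a \<oplus>\<^sub>gg b)) s = dd p (PF d p a) s \<oplus>\<^sub>S dd p (PF d p b) s"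
proof -
 note A = PF[of d, OF d assms(1)] and B = PF[of d, OF d assms(2)]
 have "dd p (PF d p (a \<oplus>\<^sub>gg b)) s = dd p (%s. PF d p a s \<oplus>\<^sub>gg PF d p b s) s"
  by (rule dd_PF_eq[OF hh_add[OF A(1) B(1)]])
   (use assms d wf_closed[OF wf_adw] in \<open>simp_all add: A(2) B(2) phw_def adw_add rs_add\<close>)
 then show ?thesis using dd_add[OF A(1) B(1) assms(3)] by simp
qed

lemma dd_PF_zero: "s el S ==> dd p (PF d p \<zero>\<^sub>gg) s = \<zero>\<^sub>S"
proof -
 assume s: "s el S"
 define x where "x = dd p (PF d p \<zero>\<^sub>gg) s"
 have x: "x el S" unfolding x_def by (rule dd_props(2)[OF PF(1)[of d, OF d]]) (simp_all add: s)
 have "x = x \<oplus>\<^sub>S x" using dd_PF_add[of "\<zero>\<^sub>gg" p "\<zero>\<^sub>gg" s] s by (simp add: x_def)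
 then show ?thesis using x by (metis x_def S.P.M.r_neg S.P.M.r_neg1 S.P.M.a_inv_closed S.P.M.a_comm S.P.M.r_neg2)
qed

lemma Op_homogeneous: "[|a : grade gg p; s el S|] ==> Op d a s = dd p (PF d p a) s"
 using dd_props(2)[OF PF(1)[of d, OF d], of a p s] by (cases p) (simp_all add: Op_def M.hcomp_homogeneous dd_PF_zero)

lemma Op_props:
 assumes "a el gg"
 shows "addmap S S (Op d a)" "s el S ==> Op d a s el S"
  "[|s el S; ka el K|] ==> Op d a (act S s ka) = act S (Op d a s) ka"
proof -
 have h: "hh p (PF d p (hcomp gg p a))" for p using PF(1)[of d, OF d] assms by simp
 note D0 = dd_props[OF h[of 0]] and D1 = dd_props[OF h[of 1]]
 show 1: "addmap S S (Op d a)"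
  by (rule addmapI) (simp_all add: Op_def D0(2) D1(2) addmap_add[OF D0(1)] addmap_add[OF D1(1)] S.P.M.add_4_swap)
 show "s el S ==> Op d a s el S" by (rule addmap_closed[OF 1])
 show "[|s el S; ka el K|] ==> Op d a (act S s ka) = act S (Op d a s) ka"
  by (simp add: Op_def D0(2,3) D1(2,3) S.P.act_add_left)
qed

lemma Op_grade: "[|a : grade gg p; s : grade S q|] ==> Op d a s : grade S (p + q)"
 using dd_props(5)[OF PF(1)[of d, OF d], of a p s q] by (simp add: Op_homogeneous add.commute)

lemma addmap_Op: "s el S ==> addmap gg S (%a. Op d a s)"
proof (rule addmapI)
 fix x y assume "s el S" "x el gg" "y el gg"
 then show "Op d (x \<oplus>\<^sub>gg y) s = Op d x s \<oplus>\<^sub>S Op d y s"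
  using dd_props(2)[OF PF(1)[of d, OF d]] by (simp add: Op_def M.hcomp_add dd_PF_add S.P.M.add_4_swap)
qed (simp add: Op_props)

text \<open>The two compatibilities with scalars demanded by the universal property of U(gg), where
  a scalar is represented by left multiplication on S(gg).\<close>

lemma Op_lact:
 assumes "a el gg" "ka el K" "s el S"
 shows "Op d (lact K gg ka a) s = lact K S ka (Op d a s) & Op d (act gg a ka) s = Op d a (lact K S ka s)"
 using assms(2)
proof (induction rule: K.grade_induct)
 case al: (homogeneous r ka)
 show ?case using assms(1)
 proof (induction rule: M.grade_induct)
  case (homogeneous p a)
  have c: "a el gg" "ka el K" using homogeneous al by auto
  note A = PF[of d, OF d homogeneous] and la = lact_grade[OF homogeneous al]
  have 1: "Op d (lact K gg ka a) s = lact K S ka (Op d a s)"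
  proof -
   have "dd (r + p) (PF d (r + p) (lact K gg ka a)) s = dd (r + p) (%s. lact K gg ka (PF d p a s)) s"
   proof (rule dd_PF_eq[OF hh_lact_post[OF A(1) al] _ la assms(3)])
    fix w assume w: "w : hwords gg"
    have "lact K gg ka (rs x y) = rs x (lact K gg ka y)" if "K.rok x" "y el gg" for x y
     using that c by (simp add: rs_def lact_act)
    then show "lact K gg ka (PF d p a (sp w)) = phw d (r + p) (lact K gg ka a) w"
     using d wf_closed[OF wf_adw[OF homogeneous] w] by (simp add: A(2)[OF w] phw_def adw_lact[OF homogeneous al w])
   qed
   then show ?thesis
    using dd_lact_post[OF A(1) al assms(3)] by (simp add: Op_homogeneous[OF la assms(3)] Op_homogeneous[OF homogeneous assms(3)])
  qed
  have "act gg a ka = ksign gg (p * r) (lact K gg ka a)"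
   using c by (simp add: lact_homogeneous[OF homogeneous al] act_closed mult.commute)
  then have "Op d (act gg a ka) s = ksign S (p * r) (Op d (lact K gg ka a) s)"
   using c addmap_ksign[OF M.ag S.P.M.ag addmap_Op[OF assms(3)]] by simp
  then show ?case using 1 c assms(3) dd_lact[OF A(1) assms(3) al] by (simp add: Op_homogeneous[OF homogeneous])
 next
  case (add x y)
  then show ?case using assms(3) K.grade_carrier[OF al] Op_props(2)
   by (simp add: lact_add_right act_add_left act_closed addmap_add[OF addmap_Op] S.P.lact_add_right)
 qed
next
 case (add x y)
 then show ?case using assms(1,3) Op_props(2)[of a]
  by (simp add: lact_add_left act_add_right act_closed addmap_add[OF addmap_Op] addmap_add[OF Op_props(1)] S.P.lact_add_left)
qed

end

lemma Op_coeff_add: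
 assumes c: "!!n. K.rok (c n)" and d: "!!n. K.rok (d n)" and a: "a el gg" and s: "s el S"
 shows "Op (%n. c n + d n) a s = Op c a s \<oplus>\<^sub>S Op d a s"
proof -
 have cd: "K.rok (c n + d n)" for n using c d by (simp add: K.rat_in_add(1))
 have "dd p (PF (%n. c n + d n) p b) s = dd p (PF c p b) s \<oplus>\<^sub>S dd p (PF d p b) s" if b: "b : grade gg p" for p b
 proof -
  note C = PF[of c, OF c b] and D = PF[of d, OF d b]
  have "dd p (PF (%n. c n + d n) p b) s = dd p (%s. PF c p b s \<oplus>\<^sub>gg PF d p b s) s"
   by (rule dd_PF_eq[OF cd hh_add[OF C(1) D(1)] _ b s])
    (use c d wf_closed[OF wf_adw[OF b]] in \<open>simp add: C(2) D(2) phw_def rs_add_rat\<close>)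
  then show ?thesis using dd_add[OF C(1) D(1) s] by simp
 qed
 moreover have "dd p (PF c p (hcomp gg p a)) s el S" "dd p (PF d p (hcomp gg p a)) s el S" for p
  using dd_props(2)[OF PF(1)[of c, OF c]] dd_props(2)[OF PF(1)[of d, OF d]] a s by simp_all
 ultimately show ?thesis using a by (simp add: Op_def S.P.M.add_4_swap)
qed

lemma Op_commutator:
 assumes c: "!!n. K.rok (c n)" and d: "!!n. K.rok (d n)" and e: "!!n. K.rok (e n)"
  and a: "a : grade gg p" and b: "b : grade gg q" and s: "s el S"
  and id: "!!w. w : hwords gg ==> (\<forall>i\<le>length w. br w q (adw p a i) (adw q b (length w - i)) = \<zero>\<^sub>gg) \<or>
   (\<forall>i\<le>length w.
    (\<Sum>n\<le>Suc (length w). c n * d (Suc (length w) - n) * (if i < n then of_nat (n choose i) else 0)) +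
    (\<Sum>n\<le>Suc (length w). d n * c (Suc (length w) - n) *
     (if length w - i < n then of_nat (n choose (length w - i)) else 0)) =
    - e (length w) * of_nat (length w choose i))"
 shows "Op c a (Op d b s) \<oplus>\<^sub>S ksign S (1 + p * q) (Op d b (Op c a s)) = Op e (bracket gg a b) s"
proof -
 note A = PF[of c, OF c a] and B = PF[of d, OF d b] and AB = PF[of e, OF e grade_bracket[OF a b]]
 have "dd p (PF c p a) (dd q (PF d q b) s) \<oplus>\<^sub>S ksign S (1 + p * q) (dd q (PF d q b) (dd p (PF c p a) s)) =
   dd (p + q) (PF e (p + q) (bracket gg a b)) s"
 proof (rule dd_commutator[OF A B AB(1) _ s])
  fix w assume w: "w : hwords gg"
  show "PF e (p + q) (bracket gg a b) (sp w) = cmp w q (phw c p a) (phw d q b) \<oplus>\<^sub>gg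
    ksign gg (1 + p * q) (cmp w p (phw d q b) (phw c p a))"
   unfolding AB(2)[OF w] by (rule phw_commutator[of c d e, OF c d e a b w id[OF w], symmetric])
 qed
 then show ?thesis using s dd_props(2)[OF A(1)] dd_props(2)[OF B(1)]
  by (simp add: Op_homogeneous[of c, OF c a] Op_homogeneous[of d, OF d b] Op_homogeneous[of e, OF e grade_bracket[OF a b]])
qed

end

section \<open>Right multiplication with signs\<close>

context superalg
begin

lemma addmap_mult_right: "w el A ==> addmap A A (mult_right A w)" "v el A ==> addmap A A (%w. mult_right A w v)"
proof -
 have c: "mult_right A w v el A" if "w el A" "v el A" for v w
  unfolding mult_right_def using that by (intro M.koszul_sum_closed) auto
 show "addmap A A (mult_right A w)" if "w el A"
 proof (rule addmapI)
  show "mult_right A w (x \<oplus>\<^sub>A y) = mult_right A w x \<oplus>\<^sub>A mult_right A w y" if "x el A" "y el A" for x y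
   unfolding mult_right_def using that \<open>w el A\<close>
   by (subst M.koszul_sum_add[symmetric]) (auto simp: M.hcomp_add A.l_distr)
 qed (use c that in auto)
 show "addmap A A (%w. mult_right A w v)" if "v el A"
 proof (rule addmapI)
  show "mult_right A (x \<oplus>\<^sub>A y) v = mult_right A x v \<oplus>\<^sub>A mult_right A y v" if "x el A" "y el A" for x y
   unfolding mult_right_def using that \<open>v el A\<close>
   by (subst M.koszul_sum_add[symmetric]) (auto simp: M.hcomp_add A.r_distr)
 qed (use c that in auto)
qed

lemma mult_right_homogeneous:
 assumes "w : grade A p" "v : grade A q"
 shows "mult_right A w v = ksign A (p * q) (v \<otimes>\<^sub>A w)"
proof -
 have c: "w el A" "v el A" using assms by auto
 have "mult_right A w v = ksign A (p * q) (hcomp A q v \<otimes>\<^sub>A hcomp A p w)" unfolding mult_right_def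
  by (rule M.koszul_sum_single[of "%p q. hcomp A q v \<otimes>\<^sub>A hcomp A p w"])
   (use assms c in \<open>auto simp: M.hcomp_homogeneous\<close>)
 then show ?thesis using assms by (simp add: M.hcomp_homogeneous)
qed

lemma mult_right_act:
 assumes "w : grade A p" "v el A" "ka el K"
 shows "mult_right A w (act A v ka) = act A (mult_right A w v) ka" using assms(3)
proof (induction rule: K.grade_induct)
 case al: (homogeneous r ka)
 show ?case using assms(2)
 proof (induction rule: M.grade_induct)
  case (homogeneous q v)
  have c: "w el A" "v el A" "ka el K" using assms(1) homogeneous al by auto
  then show ?case
   by (simp add: mult_right_homogeneous[OF assms(1) grade_act[OF homogeneous al]] mult_right_homogeneous[OF assms(1) homogeneous]
     act_mult lact_homogeneous[OF assms(1) al] A.ring_ksign_r act_closed mult_act act_ksign) (simp add: algebra_simps)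
 next
  case (add x y)
  then show ?case using assms(1) K.grade_carrier[OF al] addmap_closed[OF addmap_mult_right(1)]
   by (simp add: act_add_left addmap_add[OF addmap_mult_right(1)] act_closed)
 qed
next
 case (add x y)
 then show ?case using assms(1,2) addmap_closed[OF addmap_mult_right(1)]
  by (simp add: act_add_right addmap_add[OF addmap_mult_right(1)] act_closed)
qed

text \<open>By associativity left and right multiplications supercommute. On words a right
  multiplication is thus determined by its value at 1, and \<open>sig_right\<close> identifies it in
  this way.\<close>

lemma mult_right_mult:
 assumes "w : grade A p" "x : grade A z" "v el A"
 shows "mult_right A w (x \<otimes>\<^sub>A v) = ksign A (p * z) (x \<otimes>\<^sub>A mult_right A w v)"
 using assms(3)
proof (induction rule: M.grade_induct)
 case (homogeneous q v)
 have c: "w el A" "v el A" "x el A" using assms(1,2) homogeneous by auto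
 then show ?case by (simp add: mult_right_homogeneous[OF assms(1) grade_mult[OF assms(2) homogeneous]]
    mult_right_homogeneous[OF assms(1) homogeneous] A.ring_ksign_r A.m_assoc) (simp add: algebra_simps)
next
 case (add a b)
 have c: "w el A" "x el A" using assms(1,2) by auto
 then show ?case using add addmap_closed[OF addmap_mult_right(1)]
  by (simp add: A.r_distr addmap_add[OF addmap_mult_right(1)] M.ksign_add)
qed

end

text \<open>\<open>phi_coeff\<close> recognises \<phi>_0 by the test c = 0. If 1 = 0 in
  \<open>K\<close>, the cases c = 1 and c = -1 also fall under this test, and all coefficients agree
  because they are zero.\<close>

lemma (in comm_superring) trivial_ring: "[|\<one> = \<zero>; x el K|] ==> x = \<zero>"
 by (metis r_one r_null)

section \<open>The symbol map\<close>

locale symbol_setting = half_lie K gg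
 for K :: "('k, 'x) superring_scheme" and gg :: "('k, 'g, 'y) lie_superalgebra_scheme" +
 fixes N :: enat
 assumes units: "N = \<infinity> & (\<forall>n \<ge> 1. nat_unit K n) \<or>
  (\<exists>n \<ge> 2. N = enat n & nilpotent_lie gg n & (ALL k:{2..n}. nat_unit K k))"
begin

text \<open>Rational counterparts of \<open>phi_coeff\<close>, for c = 1 here and for c = 0 next.
  Coefficient identities are proved over the rationals and carried to \<open>K\<close> by
  \<open>rat_in\<close>.\<close>

definition c1 :: "nat => rat" where "c1 n = (if N \<le> enat n then 0 else bern n)"

definition c0 :: "nat => rat" where "c0 n = (if N \<le> enat n then 0 else if n = 1 then - 1 else 0)"

text \<open>The coefficients for c = -1: \<phi>_(-1) is the difference of \<phi>_0 and \<phi>_1,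
  which is how the operator for right multiplication acquires its name in the statement.\<close>

definition cr :: "nat => rat" where "cr n = c0 n - c1 n"

lemma rok_bern_N: "\<not> N \<le> enat n ==> K.rok (bern n)" by (rule K.rok_bern) (use units in auto)

lemma rok_c: "K.rok (c1 n)" "K.rok (c0 n)" "K.rok (cr n)"
proof -
 show 1: "K.rok (c1 n)" using rok_bern_N by (simp add: c1_def)
 show 2: "K.rok (c0 n)" using K.rok_uminus[of 1] by (simp add: c0_def)
 show "K.rok (cr n)" unfolding cr_def by (rule K.rok_diff[OF 2 1])
qed

lemma phi_coeff_0: "phi_coeff K N \<zero>\<^sub>K n = rat_in K (c0 n)"
 by (simp add: phi_coeff_def c0_def K.rat_in_uminus)

lemma phi_coeff_1: "phi_coeff K N \<one>\<^sub>K n = rat_in K (c1 n)"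
proof (cases "\<one>\<^sub>K = \<zero>\<^sub>K")
 case True
 have "phi_coeff K N \<one>\<^sub>K n el K" using True by (simp add: phi_coeff_def)
 then show ?thesis using K.trivial_ring[OF True] rok_c(1)[of n] by (metis K.rat_in_closed)
next
 case False
 then show ?thesis using rok_bern_N[of n] by (simp add: phi_coeff_def c1_def flip: bern_def)
qed

lemma minus_one_power: "(\<ominus>\<^sub>K \<one>\<^sub>K) [^]\<^sub>K n = rat_in K ((- 1) ^ n)" "K.rok ((- 1) ^ n)"
proof -
 show r: "K.rok ((- 1) ^ n)" for n using K.rok_int[of "(- 1) ^ n"] by simp
 show "(\<ominus>\<^sub>K \<one>\<^sub>K) [^]\<^sub>K n = rat_in K ((- 1) ^ n)"
 proof (induction n)
  case (Suc n)
  have "rat_in K ((- 1) ^ n * - 1) = rat_in K ((- 1) ^ n) \<otimes>\<^sub>K rat_in K (- 1)"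
   by (rule K.rat_in_mult(2)[OF r K.rok_uminus[OF K.rok_1]])
  then show ?case using Suc K.rat_in_uminus[of 1] by (simp add: mult.commute)
 qed simp
qed

lemma phi_coeff_minus: "phi_coeff K N (\<ominus>\<^sub>K \<one>\<^sub>K) n = rat_in K (cr n)"
proof (cases "\<one>\<^sub>K = \<zero>\<^sub>K")
 case True
 have "phi_coeff K N (\<ominus>\<^sub>K \<one>\<^sub>K) n el K" using True by (simp add: phi_coeff_def)
 then show ?thesis using K.trivial_ring[OF True] rok_c(3)[of n] by (metis K.rat_in_closed)
next
 case False
 then have nz: "\<ominus>\<^sub>K \<one>\<^sub>K \<noteq> \<zero>\<^sub>K" by (metis K.a_inv_zero K.minus_minus K.one_closed)
 have inv: "inv\<^bsub>K\<^esub> (\<ominus>\<^sub>K \<one>\<^sub>K) = \<ominus>\<^sub>K \<one>\<^sub>K"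
  by (rule K.inv_unique'[symmetric]) (simp_all add: K.l_minus K.r_minus)
 show ?thesis
 proof (cases "N \<le> enat n")
  case le: False
  \<comment> \<open>For c = -1 the factor c times the n-th power of 1/c is -1 times (-1)^n, and
    \<open>bern_parity\<close> evaluates the product with \<open>bern n\<close>.\<close>
  have "cr n = bern n * (- 1 * (- 1) ^ n)" using bern_parity[of n] le by (simp add: cr_def c0_def c1_def split: if_splits)
  moreover have "rat_in K (bern n * (- 1 * (- 1) ^ n)) =
    rat_in K (bern n) \<otimes>\<^sub>K (\<ominus>\<^sub>K \<one>\<^sub>K \<otimes>\<^sub>K (\<ominus>\<^sub>K \<one>\<^sub>K) [^]\<^sub>K n)"
   using K.rat_in_mult[OF K.rok_uminus[OF K.rok_1] minus_one_power(2)[of n]] K.rat_in_mult(2)[OF rok_bern_N[OF le]]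
    K.rat_in_uminus[of 1] by (simp only: minus_one_power(1)) simp
  ultimately show ?thesis using le nz by (simp add: phi_coeff_def inv flip: bern_def)
 qed (simp add: phi_coeff_def cr_def c0_def c1_def)
qed

text \<open>A word of length L involves coefficients up to index L + 1. If truncation reaches this
  index, then N <= L + 1 and nilpotency annihilates all the brackets; otherwise the coefficients are
  the untruncated ones.\<close>

lemma commutator_id:
 assumes "a : grade gg p" "b : grade gg q" "w : hwords gg"
  and "!!i. [|\<not> N \<le> enat (Suc (length w)); i \<le> length w|] ==> X i"
 shows "(\<forall>i\<le>length w. br w q (adw p a i) (adw q b (length w - i)) = \<zero>\<^sub>gg) \<or> (\<forall>i\<le>length w. X i)"
proof (cases "N \<le> enat (Suc (length w))")
 case True
 then obtain m where "N = enat m" "nilpotent_lie gg m" using units by auto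
 then show ?thesis using bra_nilpotent[OF _ assms(1-3)] True by simp
qed (use assms(4) in simp)

lemma c_below: "[|\<not> N \<le> enat L; n \<le> L|] ==> c1 n = bern n & c0 n = (if n = 1 then - 1 else 0)"
 unfolding c1_def c0_def by (metis enat_ord_simps(1) order_trans)

section \<open>Commutators of the operators for c = 1, 0 and -1\<close>

lemma Op_11:
 assumes "a : grade gg p" "b : grade gg q" "s el S"
 shows "Op c1 a (Op c1 b s) \<oplus>\<^sub>S ksign S (1 + p * q) (Op c1 b (Op c1 a s)) = Op c1 (bracket gg a b) s"
proof (rule Op_commutator[OF rok_c(1) rok_c(1) rok_c(1) assms commutator_id[OF assms(1,2)]])
 fix w :: "'g hw" and i assume h: "\<not> N \<le> enat (Suc (length w))" "i \<le> length w"
 let ?L = "length w"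
 note c = c_below[OF h(1), THEN conjunct1]
 have "(\<Sum>n\<le>Suc ?L. c1 n * c1 (Suc ?L - n) * (if i < n then of_nat (n choose i) else 0)) +
   (\<Sum>n\<le>Suc ?L. c1 n * c1 (Suc ?L - n) * (if ?L - i < n then of_nat (n choose (?L - i)) else 0)) =
   (\<Sum>n\<le>Suc ?L. bern n * bern (Suc ?L - n) *
    ((if i < n then of_nat (n choose i) else 0) + (if ?L - i < n then of_nat (n choose (?L - i)) else 0)))"
  unfolding sum.distrib[symmetric] by (rule sum.cong[OF refl]) (simp only: c atMost_iff diff_le_self distrib_left)
 also have "... = - c1 ?L * of_nat (?L choose i)" using bern_identity[of i "?L - i" ?L] h c[of ?L] by simp
 finally show "(\<Sum>n\<le>Suc ?L. c1 n * c1 (Suc ?L - n) * (if i < n then of_nat (n choose i) else 0)) +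
   (\<Sum>n\<le>Suc ?L. c1 n * c1 (Suc ?L - n) * (if ?L - i < n then of_nat (n choose (?L - i)) else 0)) =
   - c1 ?L * of_nat (?L choose i)" .
qed

text \<open>As \<phi>_0 has the single term -t, only n = 1 survives in the first sum and only n = L
  in the second, where L is the length of the word. They account for i = 0 and i > 0 respectively,
  and together give the binomial coefficient.\<close>

lemma Op_01:
 assumes "a : grade gg p" "b : grade gg q" "s el S"
 shows "Op c0 a (Op c1 b s) \<oplus>\<^sub>S ksign S (1 + p * q) (Op c1 b (Op c0 a s)) = Op c1 (bracket gg a b) s"
proof (rule Op_commutator[OF rok_c(2) rok_c(1) rok_c(1) assms commutator_id[OF assms(1,2)]])
 fix w :: "'g hw" and i assume h: "\<not> N \<le> enat (Suc (length w))" "i \<le> length w"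
 let ?L = "length w"
 note c = c_below[OF h(1)]
 have "(\<Sum>n\<le>Suc ?L. c0 n * c1 (Suc ?L - n) * (if i < n then of_nat (n choose i) else 0)) =
   (\<Sum>n\<le>Suc ?L. if n = 1 then - bern ?L * (if i = 0 then 1 else 0) else 0)"
  by (rule sum.cong[OF refl]) (use c in auto)
 also have "... = - bern ?L * (if i = 0 then 1 else 0)" by (subst sum.delta) auto
 finally have 1: "(\<Sum>n\<le>Suc ?L. c0 n * c1 (Suc ?L - n) * (if i < n then of_nat (n choose i) else 0)) =
   - bern ?L * (if i = 0 then 1 else 0)" .
 have "(\<Sum>n\<le>Suc ?L. c1 n * c0 (Suc ?L - n) * (if ?L - i < n then of_nat (n choose (?L - i)) else 0)) =
   (\<Sum>n\<le>Suc ?L. if n = ?L then - bern ?L * (if ?L - i < ?L then of_nat (?L choose (?L - i)) else 0) else 0)"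
 proof (rule sum.cong[OF refl])
  fix n assume "n : {..Suc ?L}"
  then have n: "n \<le> Suc ?L" "Suc ?L - n \<le> Suc ?L" "Suc ?L - n = 1 \<longleftrightarrow> n = ?L" by auto
  show "c1 n * c0 (Suc ?L - n) * (if ?L - i < n then of_nat (n choose (?L - i)) else 0) =
    (if n = ?L then - bern ?L * (if ?L - i < ?L then of_nat (?L choose (?L - i)) else 0) else 0)"
   unfolding c[OF n(1), THEN conjunct1] c[OF n(2), THEN conjunct2] n(3) by auto
 qed
 also have "... = - bern ?L * (if ?L - i < ?L then of_nat (?L choose (?L - i)) else 0)" by (subst sum.delta) auto
 finally have 2: "(\<Sum>n\<le>Suc ?L. c1 n * c0 (Suc ?L - n) * (if ?L - i < n then of_nat (n choose (?L - i)) else 0)) =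
   - bern ?L * (if ?L - i < ?L then of_nat (?L choose (?L - i)) else 0)" .
 have "(if i = 0 then 1 else 0) + (if ?L - i < ?L then of_nat (?L choose (?L - i)) else 0) = (of_nat (?L choose i) :: rat)"
  using h(2) binomial_symmetric[OF h(2)] by (cases "i = 0") auto
 then show "(\<Sum>n\<le>Suc ?L. c0 n * c1 (Suc ?L - n) * (if i < n then of_nat (n choose i) else 0)) +
   (\<Sum>n\<le>Suc ?L. c1 n * c0 (Suc ?L - n) * (if ?L - i < n then of_nat (n choose (?L - i)) else 0)) =
   - c1 ?L * of_nat (?L choose i)" unfolding 1 2 using c[of ?L] by (simp only: distrib_left[symmetric] le_SucI order_refl)
qed

lemmas O1 = Op_props[of c1, OF rok_c(1)]
lemmas Or = Op_props[of cr, OF rok_c(3)]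

lemma Op_0: "[|a el gg; s el S|] ==> Op c0 a s = Op c1 a s \<oplus>\<^sub>S Op cr a s"
 using Op_coeff_add[of c1 cr a s, OF rok_c(1) rok_c(3)] by (simp add: cr_def)

text \<open>\<open>Op_01\<close> and \<open>Op_11\<close> have the same right-hand side, so the
  difference of the operators for \<open>c0\<close> and \<open>c1\<close> supercommutes with every
  \<open>Op c1 b\<close>.\<close>

lemma Op_r1:
 assumes "a : grade gg p" "b : grade gg q" "s el S"
 shows "Op cr a (Op c1 b s) = ksign S (p * q) (Op c1 b (Op cr a s))"
proof -
 have c: "a el gg" "b el gg" using assms by auto
 define x y m n where d: "x = Op c1 a (Op c1 b s)" "y = ksign S (1 + p * q) (Op c1 b (Op c1 a s))"
  "m = Op cr a (Op c1 b s)" "n = ksign S (1 + p * q) (Op c1 b (Op cr a s))"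
 have cc: "x el S" "y el S" "m el S" "n el S"
  unfolding d using c assms(3) O1(2) Or(2) by auto
 have "(x \<oplus>\<^sub>S m) \<oplus>\<^sub>S (y \<oplus>\<^sub>S n) = x \<oplus>\<^sub>S y"
  using Op_01[OF assms] Op_11[OF assms] c assms(3) O1(2) Or(2) by (simp add: d Op_0 addmap_add[OF O1(1)] S.P.M.ksign_add)
 then have "(x \<oplus>\<^sub>S y) \<oplus>\<^sub>S (m \<oplus>\<^sub>S n) = x \<oplus>\<^sub>S y"
  using cc by (simp add: S.P.M.add_4_swap)
 then have "m \<oplus>\<^sub>S n = \<zero>\<^sub>S"
  using cc by (metis S.P.M.add.m_closed S.P.M.add.l_cancel_one)
 then have "m = \<ominus>\<^sub>S n" using cc by (simp add: S.P.M.minus_equality S.P.M.a_comm)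
 then show ?thesis using c assms(3) O1(2) Or(2) by (simp add: d S.P.M.uminus_ksign)
qed

lemma Op_one:
 assumes "!!n. K.rok (d n)" "a : grade gg p"
 shows "Op d a \<one>\<^sub>S = inc (rs (d 0) a)" "PF d p a \<one>\<^sub>S = rs (d 0) a"
proof -
 show 1: "PF d p a \<one>\<^sub>S = rs (d 0) a" using PF(2)[of d, OF assms, of "[]"] by (simp add: phw_def)
 then show "Op d a \<one>\<^sub>S = inc (rs (d 0) a)"
  using dd_props(6)[OF PF(1)[of d, OF assms]] by (simp add: Op_homogeneous[of d, OF assms])
qed

lemma c_zero: "c1 0 = 1" "cr 0 = - 1"
proof -
 have "\<not> N \<le> enat 0" using units by auto
 then show "c1 0 = 1" "cr 0 = - 1" using bern_rec[of 0] by (simp_all add: cr_def c1_def c0_def)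
qed

section \<open>The representation of the enveloping algebra\<close>

abbreviation "End \<equiv> End_alg K (sym_alg K gg)"

definition jj where "jj a = (\<lambda>s\<in>carrier S. Op c1 a s)"

definition kk where "kk ka = (\<lambda>s\<in>carrier S. lact K S ka s)"

lemma jj_Hom: "a el gg ==> jj a : Hom K S S" unfolding jj_def by (rule S.P.HomI[OF O1(1,3)])

lemma kk_Hom: "ka el K ==> kk ka : Hom K S S"
 unfolding kk_def by (rule S.P.Hom_closed(6))

lemma jj_Phi: "a el gg ==> Phi_op K gg N \<one>\<^sub>K a = jj a" unfolding jj_def
 by (rule extensionalityI[OF Phi_op_extensional restrict_extensional])
  (simp add: Phi_op_Op[of c1, OF rok_c(1) phi_coeff_1])

text \<open>A generator of the enveloping ideal is mapped to the supercommutator of two operators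
  minus the operator of the bracket, which is zero by \<open>Op_11\<close>.\<close>

lemma rep_exists:
 "EX h. h : ring_hom U End & (ALL X:carrier gg. h (env_inc K gg X) = jj X) &
  (ALL ka:carrier K. h (U.P.kap ka) = kk ka)"
proof (rule U.P_universal[OF S.P.ring_End _ _ _ _ env_ideal_eq env_gens_carrier])
 interpret End: ring End by (rule S.P.ring_End)
 show "kk : ring_hom K End" by (rule ring_hom_memI)
   (auto simp: kk_Hom, auto simp: kk_def fun_eq_iff compose_def S.P.lact_lact S.P.lact_add_left)
 show add: "addmap gg End jj"
  by (rule addmapI) (auto simp: jj_Hom, auto simp: jj_def fun_eq_iff addmap_add[OF addmap_Op[of c1, OF rok_c(1)]])
 fix X ka assume "X el gg" "ka el K"
 then show "jj (act gg X ka) = jj X \<otimes>\<^sub>End kk ka" "kk ka \<otimes>\<^sub>End jj X = jj (lact K gg ka X)"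
  using Op_lact[of c1, OF rok_c(1)] O1(2) by (auto simp: jj_def kk_def fun_eq_iff compose_def)
next
 interpret End: ring End by (rule S.P.ring_End)
 fix h g assume h: "h : ring_hom T End" "!!X. X el gg ==> h (tensor_inc K gg X) = jj X" and g: "g : env_gens"
 have add: "addmap T End h" by (rule addmapI[OF ring_hom_closed[OF h(1)] ring_hom_add[OF h(1)]])
 from g obtain a b p q where g: "g = (tensor_inc K gg a \<otimes>\<^sub>T tensor_inc K gg b) \<ominus>\<^sub>T
   ksign T (p * q) (tensor_inc K gg b \<otimes>\<^sub>T tensor_inc K gg a) \<ominus>\<^sub>T tensor_inc K gg (bracket gg a b)"
  and ab: "a : grade gg p" "b : grade gg q" unfolding env_gens_def by blast
 have c: "a el gg" "b el gg" "bracket gg a b el gg" using ab by (auto simp: bracket_closed)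
 define x y z where d: "x = jj a \<otimes>\<^sub>End jj b" "y = jj b \<otimes>\<^sub>End jj a" "z = jj (bracket gg a b)"
 have xyz: "x el End" "y el End" "z el End" unfolding d using jj_Hom c End.m_closed by auto
 have "x \<oplus>\<^sub>End ksign End (1 + p * q) y = z"
 proof (rule S.P.End_eqI)
  show "x \<oplus>\<^sub>End ksign End (1 + p * q) y : Hom K S S" "z : Hom K S S"
   using xyz End.a_closed[OF xyz(1) End.ksign_closed[OF xyz(2)]] by auto
  fix s assume s: "s el S"
  then show "(x \<oplus>\<^sub>End ksign End (1 + p * q) y) s = z s"
   using Op_11[OF ab s] c O1(2) S.P.End_ksign[of y s "1 + p * q"] xyz(2) by (simp add: d) (simp add: jj_def compose_def)
 qed
 moreover have "h g = x \<ominus>\<^sub>End ksign End (p * q) y \<ominus>\<^sub>End z"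
  unfolding g d using c by (simp only: T.M.minus_eq End.minus_eq addmap_add[OF add] ring_hom_mult[OF h(1)] h(2)
    addmap_minus[OF T.M.ag End.abelian_group_axioms add] tensor_inc_closed T.A.m_closed
    addmap_ksign[OF T.M.ag End.abelian_group_axioms add] T.M.ksign_closed T.M.a_inv_closed T.M.a_closed)
 moreover have "x \<ominus>\<^sub>End ksign End (p * q) y = x \<oplus>\<^sub>End ksign End (1 + p * q) y"
  using xyz by (simp only: End.minus_eq End.uminus_ksign End.ksign_closed End.ksign_ksign)
 ultimately show "h g = \<zero>\<^sub>End" using xyz by (simp only: End.minus_eq End.r_neg)
qed

text \<open>The universal property delivers a ring morphism only. Linearity over \<open>K\<close>
  follows from its values on scalars, and evenness is checked on words, where each letter acts with
  its own parity; after that the definite description is resolved by uniqueness on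
  generators.\<close>

lemma env_rep:
 "env_rep K gg N : superalg_hom K U End" "a el gg ==> env_rep K gg N (env_inc K gg a) = jj a"
proof -
 interpret End: ring End by (rule S.P.ring_End)
 obtain h where h: "h : ring_hom U End" "!!X. X el gg ==> h (env_inc K gg X) = jj X"
  "!!ka. ka el K ==> h (U.P.kap ka) = kk ka" using rep_exists by blast
 have hc: "h u : Hom K S S" if "u el U" for u using ring_hom_closed[OF h(1) that] by simp
 have act: "h (act U u ka) = (\<lambda>s\<in>carrier S. h u (lact K S ka s))" if "u el U" "ka el K" for u ka
  using that ring_hom_mult[OF h(1), of u "U.P.kap ka"] h(3) by (auto simp: U.P.act_kap kk_def compose_def fun_eq_iff)
 have gw: "h (U.psp (map snd w)) s : grade S (wpar w + q)" if "w : hwords gg" "s : grade S q" for w s q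
  using that
 proof (induction w)
  case Nil
  then show ?case using ring_hom_one[OF h(1)] by simp
 next
  case (Cons Z w)
  then have Z: "snd Z : grade gg (fst Z)" "snd Z el gg" "w : hwords gg" by auto
  have "h (U.psp (map snd w)) s : grade S (wpar w + q)" using Cons Z by simp
  from Op_grade[of c1, OF rok_c(1) Z(1) this] show ?case
   using Z Cons.prems(2) ring_hom_mult[OF h(1), of "env_inc K gg (snd Z)" "U.psp (map snd w)"] h(2)
    S.P.HomD(2)[OF hc[of "U.psp (map snd w)"], of s] by (simp add: compose_def jj_def add.assoc)
 qed
 have g: "h u s : grade S (p + q)" if "u : grade U p" "s : grade S q" for u s p q using that(1)
 proof (induction rule: U.grade_P_induct)
  case (word w ka)
  have "lact K S ka s : grade S (wpar w + p + q)" by (rule S.P.lact_grade[OF that(2) word(2)])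
  from gw[OF word(1) this] show ?case
   using act[of "U.psp (map snd w)" ka] word K.grade_carrier[OF word(2)] that(2) by (simp add: add.assoc)
 next
  case (diff x y)
  have "addmap U End h" by (rule addmapI[OF ring_hom_closed[OF h(1)] ring_hom_add[OF h(1)]])
  then have "h (x \<ominus>\<^sub>U y) = h x \<oplus>\<^sub>End ksign End 1 (h y)"
   using diff(1,2) addmap_add[of U End h x "\<ominus>\<^sub>U y"]
    addmap_minus[OF U.P.M.ag End.abelian_group_axioms, of h y]
   by (simp add: U.P.M.minus_eq End.ksign_1 del: S.P.End_simps)
  then show ?case using diff hc[of y] S.P.End_ksign[of "h y" s 1] that(2) by simp
 qed
 let ?P = "%F. F : superalg_hom K U End & (ALL a:carrier gg. F (env_inc K gg a) = Phi_op K gg N \<one>\<^sub>K a)"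
 have P: "?P (restrict h (carrier U))"
  using ring_hom_one[OF h(1)] ring_hom_mult[OF h(1)] ring_hom_add[OF h(1)] act g hc U.P.act_closed h(2) jj_Phi
  by (auto simp: superalg_hom_def Hom_def image_subset_iff)
 have "\<exists>!F. ?P F"
 proof (rule ex1I[of _ "restrict h (carrier U)"])
  show "?P (restrict h (carrier U))" by (rule P)
  fix F assume F: "?P F"
  show "F = restrict h (carrier U)"
  proof (rule U.superalg_hom_eq)
   show "F : superalg_hom K U End" "restrict h (carrier U) : superalg_hom K U End" using F P by blast+
   show "F (env_inc K gg X) = restrict h (carrier U) (env_inc K gg X)" if "X el gg" for X
    using F P that by simp
  qed
 qed
 then have "?P (env_rep K gg N)" unfolding env_rep_def by (rule theI')
 then show "env_rep K gg N : superalg_hom K U End" "a el gg ==> env_rep K gg N (env_inc K gg a) = jj a"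
  using jj_Phi by auto
qed

abbreviation "sig \<equiv> symbol_map K gg N"

lemma sig:
 "addmap U S sig" "sig \<one>\<^sub>U = \<one>\<^sub>S"
 "[|u el U; ka el K|] ==> sig (act U u ka) = act S (sig u) ka"
 "[|a el gg; u el U|] ==> sig (env_inc K gg a \<otimes>\<^sub>U u) = Op c1 a (sig u)"
proof -
 note E = env_rep(1)[unfolded superalg_hom_def Hom_def]
 have one: "\<one>\<^sub>S el S" by simp
 have c: "env_rep K gg N u : Hom K S S" if "u el U" for u using E that by auto
 show "addmap U S sig" unfolding symbol_map_def by (rule addmapI) (use E S.P.HomD(2)[OF c one] one in auto)
 show "sig \<one>\<^sub>U = \<one>\<^sub>S" unfolding symbol_map_def using E by simp
 show "sig (act U u ka) = act S (sig u) ka" if "u el U" "ka el K"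
 proof -
  have "sig (act U u ka) = env_rep K gg N u (lact K S ka \<one>\<^sub>S)"
   unfolding symbol_map_def using E that by simp
  also have "lact K S ka \<one>\<^sub>S = act S \<one>\<^sub>S ka"
   using that by (simp add: S.P.lact_kap S.P.act_kap)
  finally show ?thesis using that S.P.HomD(3)[OF c one] by (simp add: symbol_map_def)
 qed
 show "sig (env_inc K gg a \<otimes>\<^sub>U u) = Op c1 a (sig u)" if "a el gg" "u el U"
  unfolding symbol_map_def using E that env_rep(2)[OF that(1)] S.P.HomD(2)[OF c one] by (simp add: compose_def jj_def)
qed

lemma sig_closed [simp]: "u el U ==> sig u el S" by (rule addmap_closed[OF sig(1)])

section \<open>The symbol map is bijective\<close>

lemma dd_filt_word: "[|hh f F; w : hwords gg|] ==> dd f F (sp w) : S.filt (Suc (Suc (length w)))"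
proof (induction w arbitrary: f F)
 case Nil
 have "F \<one>\<^sub>S : grade gg f" using hhD(4)[OF Nil(1) S.P.one_even] by simp
 then show ?case using S.filt_pinc dd_props(6)[OF Nil(1)] by (simp add: numeral_2_eq_2)
next
 case (Cons Z w)
 then have Z: "snd Z : grade gg (fst Z)" "w : hwords gg" "sp w el S" by auto
 show ?case using dd_Cons[OF Cons.prems(1) Z(1,3)] S.filt_mult_pinc[OF Z(1) Cons.IH[OF Cons.prems(1) Z(2)]]
   S.filt_mono[OF Cons.IH[OF hh_shift[OF Cons.prems(1) Z(1)] Z(2)]] by (simp add: S.filt.add S.filt_ksign)
qed

lemma Op_filt: "[|a el gg; s : S.filt n|] ==> Op c1 a s : S.filt (Suc n)"
proof -
 assume a: "a el gg" and "s : S.filt n"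
 from this(2) show ?thesis
 proof (induction rule: S.filt.induct)
  case (word w ka)
  have h: "hh p (PF c1 p (hcomp gg p a))" for p using PF(1)[of c1, OF rok_c(1)] a by simp
  have "Op c1 a (sp w) : S.filt (Suc n)"
   unfolding Op_def using S.filt_mono[OF dd_filt_word[OF h word(1)]] word(3) by (simp add: S.filt.add)
  then show ?case using word a by (simp add: O1(3) S.filt_act)
 next
  case zero
  then show ?case
   using addmap_zero[OF S.P.M.ag S.P.M.ag O1(1)[OF a]] S.filt.zero by simp
 next
  case (add x y)
  then show ?case by (simp add: addmap_add[OF O1(1)[OF a]] S.filt_carrier S.filt.add)
 qed
qed

text \<open>The only term longer than w is the one in which F consumes nothing. Moving F(1) to the
  front past the letters undoes the signs of \<open>dd_Cons\<close>, by commutativity of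
  S(gg).\<close>

lemma dd_lead:
 "[|hh f F; w : hwords gg|] ==> EX r:S.filt (Suc (length w)). dd f F (sp w) = inc (F \<one>\<^sub>S) \<otimes>\<^sub>S sp w \<oplus>\<^sub>S r"
proof (induction w arbitrary: f F)
 case Nil
 have "F \<one>\<^sub>S el gg" by (rule hhD(2)[OF Nil(1)]) simp
 then show ?case using dd_props(6)[OF Nil(1)] S.filt.zero by (intro bexI[of _ "\<zero>\<^sub>S"]) auto
next
 case (Cons Z w)
 then have Z: "snd Z : grade gg (fst Z)" "w : hwords gg" "sp w el S" by auto
 let ?X = "inc (snd Z)" and ?Y = "inc (F \<one>\<^sub>S)"
 have F1: "F \<one>\<^sub>S : grade gg f" using hhD(4)[OF Cons.prems(1) S.P.one_even] by simp
 have c: "?X el S" "?Y el S" using Z F1 S.pinc_grade by auto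
 obtain r where r: "r : S.filt (Suc (length w))" "dd f F (sp w) = ?Y \<otimes>\<^sub>S sp w \<oplus>\<^sub>S r"
  using Cons.IH[OF Cons.prems(1) Z(2)] by blast
 define r' where "r' = dd (f + fst Z) (%s. F (?X \<otimes>\<^sub>S s)) (sp w)"
 have r': "r' : S.filt (Suc (Suc (length w)))"
  unfolding r'_def by (rule dd_filt_word[OF hh_shift[OF Cons.prems(1) Z(1)] Z(2)])
 note rc = S.filt_carrier[OF r(1)] and rc' = S.filt_carrier[OF r']
 have "ksign S (f * fst Z) (?X \<otimes>\<^sub>S (?Y \<otimes>\<^sub>S sp w)) = ?Y \<otimes>\<^sub>S (?X \<otimes>\<^sub>S sp w)"
  using sym_comm[OF Z(1) F1] c Z(3) by (simp add: S.P.A.m_assoc[symmetric] S.P.A.ring_ksign_l mult.commute)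
 then have "dd f F (sp (Z # w)) = ?Y \<otimes>\<^sub>S sp (Z # w) \<oplus>\<^sub>S (ksign S (f * fst Z) (?X \<otimes>\<^sub>S r) \<oplus>\<^sub>S r')"
  using dd_Cons[OF Cons.prems(1) Z(1,3)] c rc rc' Z(3)
  by (simp add: r(2) r'_def[symmetric] S.P.A.r_distr S.P.M.ksign_add S.P.M.a_assoc)
 moreover have "ksign S (f * fst Z) (?X \<otimes>\<^sub>S r) \<oplus>\<^sub>S r' : S.filt (Suc (length (Z # w)))"
  using S.filt_mult_pinc[OF Z(1) r(1)] r' by (simp add: S.filt.add S.filt_ksign)
 ultimately show ?case by blast
qed

lemma sig_lead: "w : hwords gg ==> EX r:S.filt (length w). sig (U.psp (map snd w)) = sp w \<oplus>\<^sub>S r"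
proof (induction w)
 case Nil
 then show ?case using S.filt.zero sig(2) by (intro bexI[of _ "\<zero>\<^sub>S"]) auto
next
 case (Cons Z w)
 then have Z: "snd Z : grade gg (fst Z)" "snd Z el gg" "w : hwords gg" "sp w el S" by auto
 obtain r where r: "r : S.filt (length w)" "sig (U.psp (map snd w)) = sp w \<oplus>\<^sub>S r"
  using Cons Z by blast
 note A = PF(1)[of c1, OF rok_c(1) Z(1)]
 obtain t where t: "t : S.filt (Suc (length w))"
  "dd (fst Z) (PF c1 (fst Z) (snd Z)) (sp w) = inc (PF c1 (fst Z) (snd Z) \<one>\<^sub>S) \<otimes>\<^sub>S sp w \<oplus>\<^sub>S t"
  using dd_lead[OF A Z(3)] by blast
 have "Op c1 (snd Z) (sp w) = inc (snd Z) \<otimes>\<^sub>S sp w \<oplus>\<^sub>S t"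
  using t(2) Z by (simp add: Op_homogeneous[of c1, OF rok_c(1) Z(1,4)] Op_one(2)[of c1, OF rok_c(1) Z(1)] c_zero)
 then have "sig (U.psp (map snd (Z # w))) = sp (Z # w) \<oplus>\<^sub>S (t \<oplus>\<^sub>S Op c1 (snd Z) r)"
  using Z r S.filt_carrier[OF r(1)] S.filt_carrier[OF t(1)] O1(2) by (simp add: sig(4) addmap_add[OF O1(1)] S.P.M.a_assoc)
 moreover have "t \<oplus>\<^sub>S Op c1 (snd Z) r : S.filt (length (Z # w))"
  using t(1) Op_filt[OF Z(2) r(1)] by (simp add: S.filt.add)
 ultimately show ?case by blast
qed

lemma sig_zero: "sig \<zero>\<^sub>U = \<zero>\<^sub>S"
 by (rule addmap_zero[OF U.P.M.ag S.P.M.ag sig(1)])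

lemma sig_filt: "u : U.filt n ==> sig u : S.filt n"
proof (induction rule: U.filt.induct)
 case (word w ka)
 obtain r where r: "r : S.filt (length w)" "sig (U.psp (map snd w)) = sp w \<oplus>\<^sub>S r"
  using sig_lead[OF word(1)] by blast
 have "r : S.filt n" using S.filt_mono[OF r(1)] word(3) by simp
 then show ?case using word r(2) by (simp add: sig(3) S.filt_act S.filt.add S.filt_word)
qed (simp_all add: sig_zero S.filt.zero addmap_add[OF sig(1)] U.filt_carrier S.filt.add)

text \<open>A single t of pure tensor degree n represents the top part of u in U(gg) and the top
  part of its symbol in S(gg). The two remainders are shorter words.\<close>

lemma sig_top:
 "u : U.filt (Suc n) ==> EX t:carrier T. EX u':U.filt n. EX r:S.filt n. pr n t = t &
  u = (env_ideal K gg +>\<^sub>T t) \<oplus>\<^sub>U u' & sig u = (sym_ideal K gg +>\<^sub>T t) \<oplus>\<^sub>S r"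
proof (induction rule: U.filt.induct)
 case (word w ka)
 have u: "map snd w : lists (carrier gg)" using M.hwords_lists[OF word(1)] .
 show ?case
 proof (cases "length w = n")
  case True
  obtain r where r: "r : S.filt n" "sig (U.psp (map snd w)) = sp w \<oplus>\<^sub>S r"
   using sig_lead[OF word(1)] True by blast
  have "sig (act U (U.psp (map snd w)) ka) = (sym_ideal K gg +>\<^sub>T tw (map snd w) ka) \<oplus>\<^sub>S act S r ka"
   using word r S.filt_carrier[OF r(1)] by (simp add: sig(3) S.P.act_add_left S.act_psp[OF u word(2)])
  moreover have "act U (U.psp (map snd w)) ka = (env_ideal K gg +>\<^sub>T tw (map snd w) ka) \<oplus>\<^sub>U \<zero>\<^sub>U"
   using word U.act_psp[OF u word(2)] U.P.act_closed[OF U.psp_hclosed[OF word(1)] word(2)] by simp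
  ultimately show ?thesis using True u word S.filt_act[OF r(1)] U.filt.zero
   by (intro bexI[of _ "tw (map snd w) ka"] bexI[of _ "\<zero>\<^sub>U"] bexI[of _ "act S r ka"]) (auto simp: pr(2))
 next
  case False
  then have f: "act U (U.psp (map snd w)) ka : U.filt n" using U.filt.word[OF word(1,2)] word(3) by simp
  then show ?thesis using sig_filt[OF f] U.filt_carrier[OF f] S.filt_carrier[OF sig_filt[OF f]]
   by (intro bexI[of _ "\<zero>\<^sub>T"] bexI[of _ "act U (U.psp (map snd w)) ka"] bexI[of _ "sig (act U (U.psp (map snd w)) ka)"])
    (auto simp: U.Iq.quo.cls_zero S.Iq.quo.cls_zero)
 qed
next
 case zero
 show ?case
  by (intro bexI[of _ "\<zero>\<^sub>T"] bexI[of _ "\<zero>\<^sub>U"] bexI[of _ "\<zero>\<^sub>S"])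
   (auto simp: U.Iq.quo.cls_zero S.Iq.quo.cls_zero sig_zero U.filt.zero S.filt.zero)
next
 case (add x y)
 then obtain t u r t' u' r' where h:
  "t el T" "u : U.filt n" "r : S.filt n" "pr n t = t" "x = (env_ideal K gg +>\<^sub>T t) \<oplus>\<^sub>U u"
  "sig x = (sym_ideal K gg +>\<^sub>T t) \<oplus>\<^sub>S r"
  "t' el T" "u' : U.filt n" "r' : S.filt n" "pr n t' = t'" "y = (env_ideal K gg +>\<^sub>T t') \<oplus>\<^sub>U u'"
  "sig y = (sym_ideal K gg +>\<^sub>T t') \<oplus>\<^sub>S r'" by blast
 note c = U.filt_carrier[OF h(2)] U.filt_carrier[OF h(8)] S.filt_carrier[OF h(3)] S.filt_carrier[OF h(9)]
 have "pr n (t \<oplus>\<^sub>T t') = t \<oplus>\<^sub>T t'" using h by (simp add: pr_add)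
 moreover have "x \<oplus>\<^sub>U y = (env_ideal K gg +>\<^sub>T (t \<oplus>\<^sub>T t')) \<oplus>\<^sub>U (u \<oplus>\<^sub>U u')"
  using h(1,7) c by (simp add: h(5,11) U.Iq.quo.cls_add[symmetric] U.P.M.add_4_swap)
 moreover have "sig (x \<oplus>\<^sub>U y) = (sym_ideal K gg +>\<^sub>T (t \<oplus>\<^sub>T t')) \<oplus>\<^sub>S (r \<oplus>\<^sub>S r')"
  using h(1,7) c addmap_add[OF sig(1) U.filt_carrier[OF add(1)] U.filt_carrier[OF add(2)]]
  by (simp add: h(6,12) S.Iq.quo.cls_add[symmetric] S.P.M.add_4_swap)
 ultimately show ?case using h T.M.a_closed[OF h(1,7)] U.filt.add[OF h(2,8)] S.filt.add[OF h(3,9)] by blast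
qed

text \<open>If the symbol of u vanishes, the class of t in S(gg) has a representative t' without
  degree n part, so t - t' lies in the symmetric ideal. Its degree n part is t, and
  \<open>sym_ideal_shortening\<close> makes the class of t in U(gg) shorter. Hence u drops one
  filtration step, down to zero.\<close>

lemma sig_kernel: "[|u : U.filt n; sig u = \<zero>\<^sub>S |] ==> u = \<zero>\<^sub>U"
proof (induction n)
 case 0
 then show ?case using U.filt_0 by simp
next
 case (Suc n)
 obtain t u' r where h: "t el T" "u' : U.filt n" "r : S.filt n" "pr n t = t"
  "u = (env_ideal K gg +>\<^sub>T t) \<oplus>\<^sub>U u'" "sig u = (sym_ideal K gg +>\<^sub>T t) \<oplus>\<^sub>S r"
  using sig_top[OF Suc.prems(1)] by blast
 have tc: "sym_ideal K gg +>\<^sub>T t el S" using S.Iq.quo.cls_closed[OF h(1)] by simp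
 have "sym_ideal K gg +>\<^sub>T t = \<ominus>\<^sub>S r"
  using h(6) Suc.prems(2) tc S.filt_carrier[OF h(3)] by (simp add: S.P.M.minus_equality)
 moreover obtain t' where t': "t' el T" "sym_ideal K gg +>\<^sub>T t' = \<ominus>\<^sub>S r" "pr n t' = \<zero>\<^sub>T"
  using S.filt_lift[OF S.filt_uminus[OF h(3)]] by blast
 ultimately have "t \<ominus>\<^sub>T t' : sym_ideal K gg" using S.Iq.quo.cls_eq_iff[OF h(1) t'(1)] by simp
 then have "env_ideal K gg +>\<^sub>T pr n (t \<ominus>\<^sub>T t') : U.filt n"
  using sym_ideal_shortening by (auto simp: shortening_def)
 moreover have "pr n (t \<ominus>\<^sub>T t') = t" using h(1,4) t' by (simp add: T.M.minus_eq pr_add pr_uminus)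
 ultimately have "u : U.filt n" using h(2,5) by (simp add: U.filt.add)
 then show ?case using Suc by blast
qed

text \<open>A product in S(gg) is the symbol of the corresponding product in U(gg) up to a shorter
  remainder, and the remainder is a symbol by induction.\<close>

lemma sig_surj: "S.filt n \<subseteq> sig ` carrier U"
proof (induction n)
 case 0
 then show ?case using S.filt_0 sig_zero U.P.M.zero_closed by (metis imageI subsetI)
next
 case (Suc n)
 have add: "x \<oplus>\<^sub>S y : sig ` carrier U" if "x : sig ` carrier U" "y : sig ` carrier U" for x y
  using that by (auto simp: addmap_add[OF sig(1), symmetric])
 show ?case
 proof
  fix s assume "s : S.filt (Suc n)"
  then show "s : sig ` carrier U"
  proof (induction rule: S.filt.induct)
   case (word w ka)
   obtain r where r: "r : S.filt (length w)" "sig (U.psp (map snd w)) = sp w \<oplus>\<^sub>S r"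
    using sig_lead[OF word(1)] by blast
   have rc: "r el S" using S.filt_carrier[OF r(1)] .
   have "\<ominus>\<^sub>S r : S.filt n" using S.filt_uminus[OF S.filt_mono[OF r(1)]] word(3) by simp
   then have "\<ominus>\<^sub>S r : sig ` carrier U" using Suc by blast
   moreover have "sp w \<oplus>\<^sub>S r : sig ` carrier U" unfolding r(2)[symmetric] using word(1) by simp
   ultimately have "(sp w \<oplus>\<^sub>S r) \<oplus>\<^sub>S \<ominus>\<^sub>S r : sig ` carrier U" by (rule add[rotated])
   then have "sp w : sig ` carrier U" using rc word(1) by (simp add: S.P.M.a_assoc S.P.M.r_neg)
   then show ?case using word(2) U.P.act_closed by (auto simp: sig(3)[symmetric])
  next
   case zero
   then show ?case using sig_zero U.P.M.zero_closed by (metis imageI)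
  qed (rule add)
 qed
qed

lemma sig_bij: "bij_betw sig (carrier U) (carrier S)" unfolding bij_betw_def
proof
 show "inj_on sig (carrier U)"
 proof (rule inj_onI)
  fix x y assume xy: "x el U" "y el U" "sig x = sig y"
  then have "sig (x \<ominus>\<^sub>U y) = \<zero>\<^sub>S"
   by (simp add: U.P.M.minus_eq addmap_add[OF sig(1)] S.P.M.r_neg
     addmap_minus[OF U.P.M.ag S.P.M.ag sig(1)])
  moreover obtain n where "x \<ominus>\<^sub>U y : U.filt n" using U.filt_all[of "x \<ominus>\<^sub>U y"] xy by auto
  ultimately have "x \<ominus>\<^sub>U y = \<zero>\<^sub>U" by (rule sig_kernel[rotated])
  then show "x = y" using xy by (simp add: U.P.M.minus_eq_zero_iff)
 qed
 show "sig ` carrier U = carrier S" using sig_surj S.filt_all by fastforce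
qed

text \<open>Both sides are determined by their value at 1 and by supercommuting with left
  multiplication by a letter: by associativity in U(gg), by \<open>Op_r1\<close> in S(gg). At 1 they
  agree because the constant coefficient \<open>cr 0\<close> is -1.\<close>

lemma sig_right:
 assumes "a el gg" "u el U"
 shows "sig (mult_right U (env_inc K gg a) u) = \<ominus>\<^sub>S Op cr a (sig u)" using assms(1)
proof (induction rule: M.grade_induct)
 case (homogeneous p a)
 have a: "a el gg" "env_inc K gg a el U" "env_inc K gg a : grade U p"
  using homogeneous U.pinc_grade by auto
 let ?r = "mult_right U (env_inc K gg a)"
 note r = U.P.addmap_mult_right(1)[OF a(2)]
 have m: "addmap S S (%s. \<ominus>\<^sub>S Op cr a s)"
  using a(1) by (intro addmapI) (simp_all add: Or(2) addmap_add[OF Or(1)] S.P.M.minus_add)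
 have w: "sig (?r (U.psp (map snd w))) = \<ominus>\<^sub>S Op cr a (sig (U.psp (map snd w)))" if "w : hwords gg" for w
  using that
 proof (induction w)
  case Nil
  have "sig (env_inc K gg a) = inc a"
   using sig(4)[of a "\<one>\<^sub>U"] a sig(2) Op_one(1)[of c1, OF rok_c(1) homogeneous] by (simp add: c_zero)
  moreover have "Op cr a \<one>\<^sub>S = \<ominus>\<^sub>S inc a"
   using Op_one(1)[of cr, OF rok_c(3) homogeneous] a rs_uminus[of 1 a]
    addmap_minus[OF M.ag S.P.M.ag S.addmap_pinc a(1)] by (simp add: c_zero)
  ultimately show ?case using a sig(2) U.P.mult_right_homogeneous[OF a(3) U.P.one_even] by simp
 next
  case (Cons Z w)
  then have Z: "snd Z : grade gg (fst Z)" "snd Z el gg" "w : hwords gg" by auto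
  define u where "u = U.psp (map snd w)"
  have u: "u el U" "?r u el U" using Z(3) addmap_closed[OF r] by (auto simp: u_def)
  have IH: "sig (?r u) = \<ominus>\<^sub>S Op cr a (sig u)" using Cons Z by (simp add: u_def)
  have c: "Op cr a (sig u) el S" "Op c1 (snd Z) (Op cr a (sig u)) el S"
   using a(1) u(1) Z(2) Or(2) O1(2) by simp_all
  have "sig (?r (env_inc K gg (snd Z) \<otimes>\<^sub>U u)) = ksign S (p * fst Z) (Op c1 (snd Z) (\<ominus>\<^sub>S Op cr a (sig u)))"
   using Z u addmap_ksign[OF U.P.M.ag S.P.M.ag sig(1)]
   by (simp add: U.P.mult_right_mult[OF a(3) U.pinc_grade[OF Z(1)]] sig(4) IH)
  also have "... = \<ominus>\<^sub>S ksign S (p * fst Z) (Op c1 (snd Z) (Op cr a (sig u)))"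
   using c addmap_minus[OF S.P.M.ag S.P.M.ag O1(1)[OF Z(2)] c(1)]
   by (simp add: S.P.M.ksign_uminus)
  also have "... = \<ominus>\<^sub>S Op cr a (sig (env_inc K gg (snd Z) \<otimes>\<^sub>U u))"
   using u Z(2) by (simp add: sig(4) Op_r1[OF homogeneous Z(1)])
  finally show ?case by (simp add: u_def)
 qed
 show ?case
 proof (rule U.addmap_word_eq[OF addmap_compose[OF r sig(1)] addmap_compose[OF sig(1) m] assms(2)])
  fix w ka assume h: "w : hwords gg" "ka el K"
  then have c: "U.psp (map snd w) el U" by simp
  then show "sig (?r (act U (U.psp (map snd w)) ka)) = \<ominus>\<^sub>S Op cr a (sig (act U (U.psp (map snd w)) ka))"
   using h(2) w[OF h(1)] a(1) addmap_closed[OF r c] Or(2)[OF a(1) sig_closed[OF c]]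
    addmap_minus[OF S.P.M.ag S.P.M.ag S.P.addmap_act[OF h(2)]]
   by (simp add: U.P.mult_right_act[OF a(3) c] sig(3) Or(3))
 qed
next
 case (add x y)
 then show ?case using assms(2) addmap_closed[OF U.P.addmap_mult_right(2)[OF assms(2)]] Or(2)
   addmap_add[OF U.P.addmap_mult_right(2)[OF assms(2)]]
   addmap_add[OF addmap_Op[of cr, OF rok_c(3)]] by (simp add: U.pinc_add addmap_add[OF sig(1)] S.P.M.minus_add)
qed

text \<open>The statement inverts \<beta>, itself defined as an inverse of the symbol map. By
  bijectivity the double inverse is the symbol map on U(gg).\<close>

lemma symbol_of_beta: "y el U ==> inv_into (carrier S) (symmetrization K gg N) y = sig y"
 unfolding symmetrization_def by (rule inv_into_inv_into_eq[OF sig_bij])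

lemma conjugation_formulas:
 assumes "a el gg" "x el S"
 defines "kb \<equiv> symmetrization K gg N"
 shows "inv_into (carrier S) kb (ad_alg U (env_inc K gg a) (kb x)) = Phi_op K gg N \<zero>\<^sub>K a x"
  "inv_into (carrier S) kb (mult_left U (env_inc K gg a) (kb x)) = Phi_op K gg N \<one>\<^sub>K a x"
  "inv_into (carrier S) kb (mult_right U (env_inc K gg a) (kb x)) = \<ominus>\<^sub>S Phi_op K gg N (\<ominus>\<^sub>K \<one>\<^sub>K) a x"
proof -
 have b: "kb x el U" "sig (kb x) = x"
  using assms(2) sig_bij inv_into_into[of x sig "carrier U"] f_inv_into_f[of x sig "carrier U"]
  by (simp_all add: kb_def symmetrization_def bij_betw_def)
 have j: "env_inc K gg a el U" using assms(1) by simp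
 note r = addmap_closed[OF U.P.addmap_mult_right(1)[OF j] b(1)]
 have P: "Phi_op K gg N \<zero>\<^sub>K a x = Op c0 a x" "Phi_op K gg N \<one>\<^sub>K a x = Op c1 a x"
  "Phi_op K gg N (\<ominus>\<^sub>K \<one>\<^sub>K) a x = Op cr a x"
  by (rule Phi_op_Op[OF rok_c(2) phi_coeff_0 assms(1,2)] Phi_op_Op[OF rok_c(1) phi_coeff_1 assms(1,2)]
    Phi_op_Op[OF rok_c(3) phi_coeff_minus assms(1,2)])+
 have L: "sig (mult_left U (env_inc K gg a) (kb x)) = Op c1 a x"
  using sig(4)[OF assms(1) b(1)] b(2) by (simp add: mult_left_def)
 have R: "sig (mult_right U (env_inc K gg a) (kb x)) = \<ominus>\<^sub>S Op cr a x"
  using sig_right[OF assms(1) b(1)] b(2) by simp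
 have l: "mult_left U (env_inc K gg a) (kb x) el U" using j b(1) by (simp add: mult_left_def)
 \<comment> \<open>The adjoint action is left minus right multiplication, with symbols
   \<open>Op c1\<close> and minus \<open>Op cr\<close>; their difference is \<open>Op c0\<close> by
   \<open>Op_0\<close>.\<close>
 have A: "sig (ad_alg U (env_inc K gg a) (kb x)) = Op c0 a x" unfolding ad_alg_def using l r assms(1,2) Or(2)
  by (simp add: U.P.M.minus_eq addmap_add[OF sig(1)] L R Op_0
    addmap_minus[OF U.P.M.ag S.P.M.ag sig(1)])
 have ad: "ad_alg U (env_inc K gg a) (kb x) el U" unfolding ad_alg_def using l r by simp
 show "inv_into (carrier S) kb (ad_alg U (env_inc K gg a) (kb x)) = Phi_op K gg N \<zero>\<^sub>K a x"
  "inv_into (carrier S) kb (mult_left U (env_inc K gg a) (kb x)) = Phi_op K gg N \<one>\<^sub>K a x"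
  "inv_into (carrier S) kb (mult_right U (env_inc K gg a) (kb x)) = \<ominus>\<^sub>S Phi_op K gg N (\<ominus>\<^sub>K \<one>\<^sub>K) a x"
  using symbol_of_beta[OF ad] symbol_of_beta[OF l] symbol_of_beta[OF r] by (simp_all add: kb_def[symmetric] A L R P)
qed

end

theorem theorem8p3:
  fixes K :: "'k superring" and \<gg> :: "('k, 'g) lie_superalgebra" and N :: enat and a :: 'g
  assumes "lie_superalgebra K \<gg>"
    and "nat_unit K 2 \<or> grade K 0 = carrier K \<and> grade \<gg> 0 = carrier \<gg>"
    and "N = \<infinity> \<and> (\<forall>n \<ge> 1. nat_unit K n) \<or>
      (\<exists>n \<ge> 2. N = enat n \<and> nilpotent_lie \<gg> n \<and> (\<forall>k \<in> {2..n}. nat_unit K k))"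
    and "a \<in> carrier \<gg>"
  shows "(\<forall>x \<in> carrier (sym_alg K \<gg>).
      inv_into (carrier (sym_alg K \<gg>)) (symmetrization K \<gg> N)
        (ad_alg (env_alg K \<gg>) (env_inc K \<gg> a) (symmetrization K \<gg> N x)) =
      Phi_op K \<gg> N \<zero>\<^bsub>K\<^esub> a x) \<and>
    (\<forall>x \<in> carrier (sym_alg K \<gg>).
      inv_into (carrier (sym_alg K \<gg>)) (symmetrization K \<gg> N)
        (mult_left (env_alg K \<gg>) (env_inc K \<gg> a) (symmetrization K \<gg> N x)) =
      Phi_op K \<gg> N \<one>\<^bsub>K\<^esub> a x) \<and>
    (\<forall>x \<in> carrier (sym_alg K \<gg>).
      inv_into (carrier (sym_alg K \<gg>)) (symmetrization K \<gg> N)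
        (mult_right (env_alg K \<gg>) (env_inc K \<gg> a) (symmetrization K \<gg> N x)) =
      \<ominus>\<^bsub>sym_alg K \<gg>\<^esub> Phi_op K \<gg> N (\<ominus>\<^bsub>K\<^esub> \<one>\<^bsub>K\<^esub>) a x)"
proof -
  \<comment> \<open>Either alternative for N provides this unit: in the nilpotent case 2 belongs to
    \<open>{2..n}\<close> because n >= 2.\<close>
  have "nat_unit K 2" using assms(3) by auto
  then interpret symbol_setting K \<gg> N
    by (intro symbol_setting.intro half_lie.intro half_lie_axioms.intro symbol_setting_axioms.intro assms(1,3))
  show ?thesis
    using conjugation_formulas[OF assms(4)] by simp
qed

end
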